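(* Let $X$ be a cocompact proper CAT(0) space, and let $d$ be the integer such that $H_c^d(X)$ is non-trivial while $H_c^i(X)$ is trivial for all $i>d$ (such a $d$ exists). Then the boundary $\partial_\infty X$ has non-trivial reduced integral Čech cohomology in dimension $d-1$ and trivial integral Čech cohomology in all dimensions greater than $d-1$.
   Context: A CAT(0) space is a (non-empty) geodesic metric space whose geodesic triangles are no fatter than the corresponding comparison triangles in the Euclidean plane. A metric space is proper if all its closed balls are compact. A metric space $X$ is cocompact if there is a compact set $C\subset X$ such that the sets $h(C)$, with $h$ ranging over all isometries of $X$ onto itself, cover $X$. $H_c^*(X)$ denotes the integral cohomology of $X$ with compact supports. The boundary $\partial_\infty X$ is the set of asymptoty classes of geodesic rays in $X$ with the cone topology; equivalently, for a base point $p\in X$, it is the set of geodesic rays starting at $p$ with the compact-open topology. It is compact. If $X$ is compact then $\partial_\infty X=\emptyset$ and $d=0$; by the usual convention the reduced cohomology of the empty space is $\mathbb{Z}$ in dimension $-1$ and $0$ otherwise. *)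

theory Defs
  imports "HOL-Analysis.Analysis" "HOL-Homology.Homology"
begin

section \<open>CAT(0) spaces\<close>

context Metric_space
begin

definition geodesic_segment :: "'a set \<Rightarrow> 'a \<Rightarrow> 'a \<Rightarrow> bool" where
  "geodesic_segment S x y \<longleftrightarrow>
     (\<exists>c. c \<in> {0..d x y} \<rightarrow> M \<and> c 0 = x \<and> c (d x y) = y \<and>
          (\<forall>s\<in>{0..d x y}. \<forall>t\<in>{0..d x y}. d (c s) (c t) = \<bar>s - t\<bar>) \<and>
          S = c ` {0..d x y})"

definition geodesic_space :: bool where
  "geodesic_space \<longleftrightarrow> (\<forall>x\<in>M. \<forall>y\<in>M. \<exists>S. geodesic_segment S x y)"

definition comparison_triangle ::
  "'a \<Rightarrow> 'a \<Rightarrow> 'a \<Rightarrow> real^2 \<Rightarrow> real^2 \<Rightarrow> real^2 \<Rightarrow> bool" where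
  "comparison_triangle x y z x' y' z' \<longleftrightarrow>
     dist x' y' = d x y \<and> dist y' z' = d y z \<and> dist z' x' = d z x"

text \<open>
  Any two distinct sides of a triangle share a vertex, here called \<open>x\<close>; since the vertices are
  universally quantified, comparing points on the sides \<open>S\<close> from \<open>x\<close> to \<open>y\<close> and \<open>T\<close> from \<open>x\<close> to
  \<open>z\<close> covers every pair of sides. Points on a common side satisfy the inequality trivially.
\<close>

definition cat0_inequality :: bool where
  "cat0_inequality \<longleftrightarrow>
     (\<forall>x\<in>M. \<forall>y\<in>M. \<forall>z\<in>M. \<forall>S T R x' y' z'.
        geodesic_segment S x y \<and> geodesic_segment T x z \<and> geodesic_segment R y z \<and>
        comparison_triangle x y z x' y' z' \<longrightarrow>
        (\<forall>p\<in>S. \<forall>q\<in>T. \<forall>p'\<in>closed_segment x' y'. \<forall>q'\<in>closed_segment x' z'.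
           dist x' p' = d x p \<and> dist x' q' = d x q \<longrightarrow> d p q \<le> dist p' q'))"

definition proper_space :: bool where
  "proper_space \<longleftrightarrow> (\<forall>x\<in>M. \<forall>r. compactin mtopology (mcball x r))"

definition self_isometry :: "('a \<Rightarrow> 'a) \<Rightarrow> bool" where
  "self_isometry h \<longleftrightarrow> h ` M = M \<and> (\<forall>x\<in>M. \<forall>y\<in>M. d (h x) (h y) = d x y)"

definition cocompact_space :: bool where
  "cocompact_space \<longleftrightarrow>
     (\<exists>C. compactin mtopology C \<and> M \<subseteq> (\<Union>h\<in>Collect self_isometry. h ` C))"

end

locale CAT0_space = Metric_space +
  assumes nonempty: "M \<noteq> {}"
    and geodesic: "geodesic_space"
    and cat0: "cat0_inequality"


section \<open>The boundary at infinity\<close>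

context Metric_space
begin

definition geodesic_ray :: "(real \<Rightarrow> 'a) \<Rightarrow> bool" where
  "geodesic_ray c \<longleftrightarrow> c \<in> {0..} \<rightarrow> M \<and> (\<forall>s\<ge>0. \<forall>t\<ge>0. d (c s) (c t) = \<bar>s - t\<bar>)"

definition asymptotic :: "((real \<Rightarrow> 'a) \<times> (real \<Rightarrow> 'a)) set" where
  "asymptotic =
     {(c, c'). geodesic_ray c \<and> geodesic_ray c' \<and> (\<exists>K. \<forall>t\<ge>0. d (c t) (c' t) \<le> K)}"

definition boundary_points :: "(real \<Rightarrow> 'a) set set" where
  "boundary_points = Collect geodesic_ray // asymptotic"

text \<open>
  The sets \<open>cone_nhd c r e\<close> with \<open>c\<close> issuing from a fixed base point \<open>p\<close> form the neighbourhood
  bases of the cone topology, which is that of uniform convergence on compact sets for the rays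
  from \<open>p\<close>. In a complete CAT(0) space this topology does not depend on \<open>p\<close>, so that letting \<open>c\<close>
  range over all rays generates the same topology.
\<close>

definition cone_nhd :: "(real \<Rightarrow> 'a) \<Rightarrow> real \<Rightarrow> real \<Rightarrow> (real \<Rightarrow> 'a) set set" where
  "cone_nhd c r e = {\<xi> \<in> boundary_points. \<exists>c'\<in>\<xi>. c' 0 = c 0 \<and> d (c' r) (c r) < e}"

definition boundary :: "(real \<Rightarrow> 'a) set topology" where
  "boundary = topology_generated_by {cone_nhd c r e | c r e. geodesic_ray c \<and> 0 < r \<and> 0 < e}"

end


section \<open>Cohomology of integral cochain complexes\<close>

text \<open>Integer-valued functions on \<open>S\<close>, represented as functions vanishing outside \<open>S\<close>.\<close>

definition cochain_group :: "'b set \<Rightarrow> ('b \<Rightarrow> int) monoid" where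
  "cochain_group S =
     \<lparr>carrier = {f. \<forall>x. x \<notin> S \<longrightarrow> f x = 0}, monoid.mult = (\<lambda>f g x. f x + g x), one = (\<lambda>x. 0)\<rparr>"

definition cocycles :: "(int \<Rightarrow> 'c monoid) \<Rightarrow> (int \<Rightarrow> 'c \<Rightarrow> 'c) \<Rightarrow> int \<Rightarrow> 'c set" where
  "cocycles C \<delta> n = kernel (C n) (C (n + 1)) (\<delta> n)"

definition coboundaries :: "(int \<Rightarrow> 'c monoid) \<Rightarrow> (int \<Rightarrow> 'c \<Rightarrow> 'c) \<Rightarrow> int \<Rightarrow> 'c set" where
  "coboundaries C \<delta> n = \<delta> (n - 1) ` carrier (C (n - 1))"

definition cohomology_group ::
  "(int \<Rightarrow> 'c monoid) \<Rightarrow> (int \<Rightarrow> 'c \<Rightarrow> 'c) \<Rightarrow> int \<Rightarrow> 'c set monoid" where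
  "cohomology_group C \<delta> n =
     subgroup_generated (C n) (cocycles C \<delta> n) Mod coboundaries C \<delta> n"


section \<open>Singular cohomology with compact supports\<close>

definition singular_simplices :: "'a topology \<Rightarrow> int \<Rightarrow> ((nat \<Rightarrow> real) \<Rightarrow> 'a) set" where
  "singular_simplices X n = (if n < 0 then {} else singular_simplex_set (nat n) X)"

definition singular_coboundary ::
  "'a topology \<Rightarrow> int \<Rightarrow> (((nat \<Rightarrow> real) \<Rightarrow> 'a) \<Rightarrow> int) \<Rightarrow> ((nat \<Rightarrow> real) \<Rightarrow> 'a) \<Rightarrow> int" where
  "singular_coboundary X n f =
     (\<lambda>\<sigma>. if \<sigma> \<in> singular_simplices X (n + 1)
          then \<Sum>k\<le>nat (n + 1). (-1) ^ k * f (singular_face (nat (n + 1)) k \<sigma>) else 0)"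

definition compact_support_cochain_group ::
  "'a topology \<Rightarrow> int \<Rightarrow> (((nat \<Rightarrow> real) \<Rightarrow> 'a) \<Rightarrow> int) monoid" where
  "compact_support_cochain_group X n =
     (cochain_group (singular_simplices X n))
       \<lparr>carrier := {f \<in> carrier (cochain_group (singular_simplices X n)).
          \<exists>K. compactin X K \<and>
              (\<forall>\<sigma>\<in>singular_simplices (subtopology X (topspace X - K)) n. f \<sigma> = 0)}\<rparr>"

definition compact_support_cohomology ::
  "'a topology \<Rightarrow> int \<Rightarrow> (((nat \<Rightarrow> real) \<Rightarrow> 'a) \<Rightarrow> int) set monoid" where
  "compact_support_cohomology X =
     cohomology_group (compact_support_cochain_group X) (singular_coboundary X)"


section \<open>Direct limits of groups\<close>

definition summand :: "'i set \<Rightarrow> ('i \<Rightarrow> 'g monoid) \<Rightarrow> 'i \<Rightarrow> 'g \<Rightarrow> 'i \<Rightarrow> 'g" where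
  "summand I G i x = (\<lambda>j\<in>I. if j = i then x else \<one>\<^bsub>G j\<^esub>)"

text \<open>
  The direct limit of abelian groups, as a quotient of their direct sum. The transition
  homomorphisms are given by the union \<open>T\<close> of their graphs: \<open>((i, x), (j, y)) \<in> T\<close> means that
  \<open>x\<close> in \<open>G i\<close> is mapped to \<open>y\<close> in \<open>G j\<close>.
\<close>

definition direct_limit ::
  "'i set \<Rightarrow> ('i \<Rightarrow> 'g monoid) \<Rightarrow> (('i \<times> 'g) \<times> ('i \<times> 'g)) set \<Rightarrow> ('i \<Rightarrow> 'g) set monoid" where
  "direct_limit I G T =
     sum_group I G Mod
       generate (sum_group I G)
         {summand I G i x \<otimes>\<^bsub>sum_group I G\<^esub> inv\<^bsub>sum_group I G\<^esub> summand I G j y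
          | i x j y. ((i, x), (j, y)) \<in> T}"


section \<open>Cech cohomology\<close>

text \<open>
  The ordered simplices of the nerve of \<open>U\<close>. In the augmented case there is in addition one
  simplex of dimension \<open>-1\<close>, the empty list, also when the nerve is empty; hence the reduced
  cohomology of the empty space is that of the complex with a single copy of the integers, in
  dimension \<open>-1\<close>.
\<close>

definition nerve_simplices :: "bool \<Rightarrow> 'a set set \<Rightarrow> int \<Rightarrow> 'a set list set" where
  "nerve_simplices augmented U n =
     {us. int (length us) = n + 1 \<and> set us \<subseteq> U \<and>
          (if us = [] then augmented else \<Inter> (set us) \<noteq> {})}"

definition nerve_cochain_group ::
  "bool \<Rightarrow> 'a set set \<Rightarrow> int \<Rightarrow> ('a set list \<Rightarrow> int) monoid" where
  "nerve_cochain_group augmented U n = cochain_group (nerve_simplices augmented U n)"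

definition nerve_coboundary ::
  "bool \<Rightarrow> 'a set set \<Rightarrow> int \<Rightarrow> ('a set list \<Rightarrow> int) \<Rightarrow> 'a set list \<Rightarrow> int" where
  "nerve_coboundary augmented U n f =
     (\<lambda>us. if us \<in> nerve_simplices augmented U (n + 1)
           then \<Sum>k<length us. (-1) ^ k * f (take k us @ drop (Suc k) us) else 0)"

definition nerve_cohomology ::
  "bool \<Rightarrow> 'a set set \<Rightarrow> int \<Rightarrow> ('a set list \<Rightarrow> int) set monoid" where
  "nerve_cohomology augmented U =
     cohomology_group (nerve_cochain_group augmented U) (nerve_coboundary augmented U)"

definition nerve_class ::
  "bool \<Rightarrow> 'a set set \<Rightarrow> int \<Rightarrow> ('a set list \<Rightarrow> int) \<Rightarrow> ('a set list \<Rightarrow> int) set" where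
  "nerve_class augmented U n z =
     coboundaries (nerve_cochain_group augmented U) (nerve_coboundary augmented U) n
       #>\<^bsub>nerve_cochain_group augmented U n\<^esub> z"

definition nerve_pullback ::
  "bool \<Rightarrow> 'a set set \<Rightarrow> int \<Rightarrow> ('a set \<Rightarrow> 'a set) \<Rightarrow> ('a set list \<Rightarrow> int) \<Rightarrow> 'a set list \<Rightarrow> int" where
  "nerve_pullback augmented V n \<tau> f =
     (\<lambda>vs. if vs \<in> nerve_simplices augmented V n then f (map \<tau> vs) else 0)"

definition open_covers :: "'a topology \<Rightarrow> 'a set set set" where
  "open_covers X = {U. (\<forall>u\<in>U. openin X u) \<and> \<Union> U = topspace X}"

definition refinement_map :: "'a set set \<Rightarrow> 'a set set \<Rightarrow> ('a set \<Rightarrow> 'a set) \<Rightarrow> bool" where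
  "refinement_map V U \<tau> \<longleftrightarrow> \<tau> ` V \<subseteq> U \<and> (\<forall>v\<in>V. v \<subseteq> \<tau> v)"

text \<open>All refinement maps between two covers induce the same map of cohomology groups.\<close>

definition refinement_transitions ::
  "bool \<Rightarrow> 'a topology \<Rightarrow> int \<Rightarrow>
     (('a set set \<times> ('a set list \<Rightarrow> int) set) \<times> ('a set set \<times> ('a set list \<Rightarrow> int) set)) set" where
  "refinement_transitions augmented X n =
     {((U, nerve_class augmented U n z), (V, nerve_class augmented V n (nerve_pullback augmented V n \<tau> z)))
      | U V \<tau> z. U \<in> open_covers X \<and> V \<in> open_covers X \<and> refinement_map V U \<tau> \<and>
          z \<in> cocycles (nerve_cochain_group augmented U) (nerve_coboundary augmented U) n}"

definition nerve_limit ::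
  "bool \<Rightarrow> 'a topology \<Rightarrow> int \<Rightarrow> ('a set set \<Rightarrow> ('a set list \<Rightarrow> int) set) set monoid" where
  "nerve_limit augmented X n =
     direct_limit (open_covers X) (\<lambda>U. nerve_cohomology augmented U n)
       (refinement_transitions augmented X n)"

definition cech_cohomology ::
  "'a topology \<Rightarrow> int \<Rightarrow> ('a set set \<Rightarrow> ('a set list \<Rightarrow> int) set) set monoid" where
  "cech_cohomology = nerve_limit False"

definition reduced_cech_cohomology ::
  "'a topology \<Rightarrow> int \<Rightarrow> ('a set set \<Rightarrow> ('a set list \<Rightarrow> int) set) set monoid" where
  "reduced_cech_cohomology = nerve_limit True"

end

(*
  Cohomology with compact supports is compared with the boundary through the complements of large
  balls about a base point p: since X is contractible, H_c^i(X) is the direct limit of the reduced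
  groups H^(i-1)(X - B(p,r)). By compactness, geodesics from p to far away points stay close to rays
  for a long time, which gives chain maps in both directions between the singular complexes of these
  complements and the nerves of covers of the boundary. The carriers of all chains involved are
  convex sets, radial preimages of convex sets, or full simplices, so that acyclic carriers yield
  the homotopies showing that the two systems are equivalent. Hence H_c^i(X) vanishes if and only
  if the reduced Cech group of the boundary in dimension i - 1 does.

  Cocompactness makes the singular complex a homotopy retract, with control on distances, of the
  chains of a finite-dimensional, locally finite Rips complex of a net; so H_c^i(X) = 0 for large i.
  Suppose that all H_c^i(X) were trivial. The cochains of the Rips complex with support in a given
  ball are finitely generated, and isometries move balls around; hence cocycles with support in a
  ball of radius r bound in a concentric ball of radius R(r), independently of the centre.
  Descending induction on the dimension then gives a local contraction of the cochains of the Rips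
  complex. Being local, it applies to the constant cochain 1, which is impossible, as there are no
  non-zero cochains with compact support in dimension -1.
*)

theory Submission
  imports Defs "HOL-Library.Diagonal_Subsequence"
begin

section \<open>Chains, cochains and acyclic carriers\<close>

text \<open>All complexes are augmented: the empty simplex sits in dimension -1, and degrees are
  shifted by one. The empty simplex lies off every compact set, so a compactly supported cochain of
  degree 0 is zero. Hence compact supports do not see the augmentation, and a compact
  \<open>X\<close>, with its empty boundary, is covered by the same comparison.

  Three obstacles shape the second half. Isometries need not preserve the net, so a bound
  independent of the centre is found for singular cochains, on which isometries act, and only then
  carried over to the Rips complex. The radius \<open>R(r)\<close> for one centre comes from the
  ascending chain condition: the cocycles that bound within radius \<open>n\<close> give an
  increasing sequence of subgroups of a finitely generated free abelian group, which stops. Finally,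
  the Rips complex at a fixed scale need not be contractible; only its endomorphism
  \<open>e\<close>, which passes through singular chains, can be controlled. Each step down in
  dimension costs one factor \<open>e\<close>, so what is contracted is a power of \<open>e\<close>
  and not the identity. This still suffices for the contradiction, because powers of
  \<open>e\<close> preserve the augmentation.\<close>

abbreviation supp :: "('b \<Rightarrow>\<^sub>0 int) \<Rightarrow> 'b set" where "supp \<equiv> Poly_Mapping.keys"

section \<open>The pairing of cochains with finite chains\<close>

definition pair :: "('b \<Rightarrow> int) \<Rightarrow> ('b \<Rightarrow>\<^sub>0 int) \<Rightarrow> int" where
  "pair f c = (\<Sum>x\<in>supp c. Poly_Mapping.lookup c x * f x)"

lemma pair_superset:
  assumes "finite A" "supp c \<subseteq> A"
  shows "pair f c = (\<Sum>x\<in>A. Poly_Mapping.lookup c x * f x)"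
  unfolding pair_def using assms by (intro sum.mono_neutral_left) (auto simp: in_keys_iff)

lemma pair_0 [simp]: "pair f 0 = 0" "pair (\<lambda>x. 0) c = 0"
  by (simp_all add: pair_def)

lemma pair_of [simp]: "pair f (frag_of x) = f x"
  by (simp add: pair_def)

lemma pair_add: "pair f (a + b) = pair f a + pair f b"
proof -
  have "finite (supp a \<union> supp b)" by simp
  note * = pair_superset [OF this]
  show ?thesis
    by (simp add: * keys_add lookup_add algebra_simps sum.distrib)
qed

lemma pair_cmul: "pair f (frag_cmul k a) = k * pair f a"
  by (subst (1 2) pair_superset [of "supp a"])
    (auto simp: keys_cmul sum_distrib_left mult.assoc)

lemma pair_minus: "pair f (- a) = - pair f a"
  by (metis frag_cmul_minus_one pair_cmul mult_minus1)

lemma pair_diff: "pair f (a - b) = pair f a - pair f b"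
  using pair_add [of f a "- b"] by (simp add: pair_minus)

lemma pair_sum: "pair f (sum g I) = (\<Sum>i\<in>I. pair f (g i))"
  by (induction I rule: infinite_finite_induct) (simp_all add: pair_add)

lemma pair_cong: "(\<And>x. x \<in> supp c \<Longrightarrow> f x = g x) \<Longrightarrow> pair f c = pair g c"
  by (simp add: pair_def)

lemma pair_add_fun: "pair (\<lambda>x. f x + g x) c = pair f c + pair g c"
  by (simp add: pair_def sum.distrib algebra_simps)

lemma pair_diff_fun: "pair (\<lambda>x. f x - g x) c = pair f c - pair g c"
  by (simp add: pair_def sum_subtractf algebra_simps)

lemma pair_cmul_fun: "pair (\<lambda>x. k * f x) c = k * pair f c"
  by (simp add: pair_def sum_distrib_left algebra_simps)

lemma pair_sum_fun: "pair (\<lambda>x. \<Sum>i\<in>I. g i x) c = (\<Sum>i\<in>I. pair (g i) c)"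
  unfolding pair_def by (simp add: sum_distrib_left) (rule sum.swap)

text \<open>\<open>frag_extend F\<close> is the linear map of chains with values \<open>F\<close> on
  simplices, so this identity computes its transpose. Coboundaries, pull-backs and dual homotopies
  are all instances.\<close>

lemma pair_extend: "pair f (frag_extend F c) = pair (\<lambda>x. pair f (F x)) c"
  by (simp add: frag_extend_def pair_sum pair_cmul) (simp add: pair_def)

lemma pair_eq_0: "(\<And>x. x \<in> supp c \<Longrightarrow> f x = 0) \<Longrightarrow> pair f c = 0"
  by (simp add: pair_def)

lemma frag_extend_closed:
  assumes "\<And>x. x \<in> supp c \<Longrightarrow> supp (F x) \<subseteq> A"
  shows "supp (frag_extend F c) \<subseteq> A"
  using keys_frag_extend [of F c] assms by blast

lemma frag_extend_frag_extend:
  "frag_extend F (frag_extend G c) = frag_extend (\<lambda>x. frag_extend F (G x)) c"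
  using subset_UNIV by (induction c rule: frag_induction) (simp_all add: frag_extend_diff)

lemma frag_extend_diff_fun:
  "frag_extend (\<lambda>x. F x - G x) c = frag_extend F c - frag_extend G c"
  using subset_UNIV by (induction c rule: frag_induction) (simp_all add: frag_extend_diff)

lemma frag_extend_add_fun:
  "frag_extend (\<lambda>x. F x + G x) c = frag_extend F c + frag_extend G c"
  using subset_UNIV by (induction c rule: frag_induction) (simp_all add: frag_extend_diff)

lemma frag_extend_zero_fun [simp]: "frag_extend (\<lambda>x. 0) c = 0"
  by (simp add: frag_extend_def)

lemma frag_extend_id [simp]: "frag_extend frag_of c = c"
  by (rule frag_expansion [symmetric])

section \<open>Augmented chain complexes, chain maps and carriers\<close>

text \<open>
  Degrees are shifted by one: \<open>G (Suc n)\<close> are the \<open>n\<close>-simplices, and \<open>G 0\<close> contains the simplices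
  of dimension \<open>-1\<close> of the augmented complex. The boundary \<open>b m\<close> leads from degree \<open>Suc m\<close> to
  degree \<open>m\<close>.
\<close>

definition cpx :: "(nat \<Rightarrow> 'b set) \<Rightarrow> (nat \<Rightarrow> 'b \<Rightarrow> 'b \<Rightarrow>\<^sub>0 int) \<Rightarrow> bool" where
  "cpx G b \<longleftrightarrow> (\<forall>m. \<forall>s\<in>G (Suc m). supp (b m s) \<subseteq> G m) \<and>
     (\<forall>m. \<forall>s\<in>G (Suc (Suc m)). frag_extend (b m) (b (Suc m) s) = 0)"

lemma cpx_supp: "cpx G b \<Longrightarrow> s \<in> G (Suc m) \<Longrightarrow> supp (b m s) \<subseteq> G m"
  by (simp add: cpx_def)

lemma cpx_bb: "cpx G b \<Longrightarrow> s \<in> G (Suc (Suc m)) \<Longrightarrow> frag_extend (b m) (b (Suc m) s) = 0"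
  by (simp add: cpx_def)

lemma cpx_supp_extend: "cpx G b \<Longrightarrow> supp c \<subseteq> G (Suc m) \<Longrightarrow> supp (frag_extend (b m) c) \<subseteq> G m"
  by (meson cpx_supp frag_extend_closed subsetD)

lemma cpx_bb_extend:
  assumes "cpx G b" "supp c \<subseteq> G (Suc (Suc m))"
  shows "frag_extend (b m) (frag_extend (b (Suc m)) c) = 0"
proof -
  have "frag_extend (b m) (frag_extend (b (Suc m)) c) = frag_extend (\<lambda>x. 0) c"
    unfolding frag_extend_frag_extend
    by (intro frag_extend_eq) (use assms in \<open>auto simp: cpx_bb subset_iff\<close>)
  then show ?thesis by simp
qed

text \<open>No boundary leaves degree 0, so every chain of that degree is a cycle. Exactness in
  degree 0 therefore says that the augmentation is onto, which excludes an empty vertex set as soon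
  as the empty simplex is present.\<close>

definition is_cycle :: "(nat \<Rightarrow> 'b \<Rightarrow> 'b \<Rightarrow>\<^sub>0 int) \<Rightarrow> nat \<Rightarrow> ('b \<Rightarrow>\<^sub>0 int) \<Rightarrow> bool" where
  "is_cycle b m c \<longleftrightarrow> (case m of 0 \<Rightarrow> True | Suc j \<Rightarrow> frag_extend (b j) c = 0)"

lemma is_cycle_simps [simp]: "is_cycle b 0 c" "is_cycle b (Suc j) c \<longleftrightarrow> frag_extend (b j) c = 0"
  by (simp_all add: is_cycle_def)

definition exact_on :: "(nat \<Rightarrow> 'b \<Rightarrow> 'b \<Rightarrow>\<^sub>0 int) \<Rightarrow> (nat \<Rightarrow> 'b set) \<Rightarrow> bool" where
  "exact_on b A \<longleftrightarrow>
     (\<forall>m c. supp c \<subseteq> A m \<longrightarrow> is_cycle b m c \<longrightarrow> (\<exists>c'. supp c' \<subseteq> A (Suc m) \<and> frag_extend (b m) c' = c))"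

definition chmap :: "(nat \<Rightarrow> 'b set) \<Rightarrow> (nat \<Rightarrow> 'b \<Rightarrow> 'b \<Rightarrow>\<^sub>0 int) \<Rightarrow>
    (nat \<Rightarrow> 'c set) \<Rightarrow> (nat \<Rightarrow> 'c \<Rightarrow> 'c \<Rightarrow>\<^sub>0 int) \<Rightarrow> (nat \<Rightarrow> 'b \<Rightarrow> 'c \<Rightarrow>\<^sub>0 int) \<Rightarrow> bool" where
  "chmap G b H b' F \<longleftrightarrow> (\<forall>m. \<forall>s\<in>G m. supp (F m s) \<subseteq> H m) \<and>
     (\<forall>m. \<forall>s\<in>G (Suc m). frag_extend (b' m) (F (Suc m) s) = frag_extend (F m) (b m s))"

lemma chmap_supp: "chmap G b H b' F \<Longrightarrow> s \<in> G m \<Longrightarrow> supp (F m s) \<subseteq> H m"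
  by (simp add: chmap_def)

lemma chmap_b: "chmap G b H b' F \<Longrightarrow> s \<in> G (Suc m) \<Longrightarrow>
    frag_extend (b' m) (F (Suc m) s) = frag_extend (F m) (b m s)"
  by (simp add: chmap_def)

lemma chmap_b_extend:
  assumes "chmap G b H b' F" "supp c \<subseteq> G (Suc m)"
  shows "frag_extend (b' m) (frag_extend (F (Suc m)) c) = frag_extend (F m) (frag_extend (b m) c)"
  unfolding frag_extend_frag_extend
  by (intro frag_extend_eq) (use assms in \<open>auto simp: chmap_b subset_iff\<close>)

lemma chmap_of: "(\<And>m. G m \<subseteq> H m) \<Longrightarrow> chmap G b H b (\<lambda>m. frag_of)"
  by (auto simp: chmap_def subset_iff)

definition comp_ch :: "(nat \<Rightarrow> 'c \<Rightarrow> 'd \<Rightarrow>\<^sub>0 int) \<Rightarrow> (nat \<Rightarrow> 'b \<Rightarrow> 'c \<Rightarrow>\<^sub>0 int) \<Rightarrow> nat \<Rightarrow> 'b \<Rightarrow> 'd \<Rightarrow>\<^sub>0 int"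
  where "comp_ch F' F = (\<lambda>m s. frag_extend (F' m) (F m s))"

lemma chmap_comp:
  assumes F: "chmap G b H b' F" and F': "chmap H b' K b'' F'"
  shows "chmap G b K b'' (comp_ch F' F)"
  unfolding chmap_def comp_ch_def
proof (intro conjI allI ballI)
  show "supp (frag_extend (F' m) (F m s)) \<subseteq> K m" if "s \<in> G m" for m s
    using chmap_supp [OF F that] chmap_supp [OF F'] by (intro frag_extend_closed) auto
  show "frag_extend (b'' m) (frag_extend (F' (Suc m)) (F (Suc m) s)) =
      frag_extend (\<lambda>s. frag_extend (F' m) (F m s)) (b m s)" if "s \<in> G (Suc m)" for m s
    using chmap_b_extend [OF F' chmap_supp [OF F that]] chmap_b [OF F that]
    by (simp add: frag_extend_frag_extend)
qed

text \<open>Exactness is demanded from degree 1 on. The carrier of a simplex of degree 0 typically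
  is the complex of the empty set, which is not exact; the value there is prescribed by hand
  instead.\<close>

definition carrier_ok :: "(nat \<Rightarrow> 'b set) \<Rightarrow> (nat \<Rightarrow> 'b \<Rightarrow> 'b \<Rightarrow>\<^sub>0 int) \<Rightarrow>
    (nat \<Rightarrow> 'c \<Rightarrow> 'c \<Rightarrow>\<^sub>0 int) \<Rightarrow> (nat \<Rightarrow> 'b \<Rightarrow> nat \<Rightarrow> 'c set) \<Rightarrow> bool" where
  "carrier_ok G b b' P \<longleftrightarrow>
     (\<forall>m. \<forall>s\<in>G (Suc m). (\<forall>s'\<in>supp (b m s). \<forall>n. P m s' n \<subseteq> P (Suc m) s n) \<and> exact_on b' (P (Suc m) s))"

lemma carrier_ok_mono:
  "carrier_ok G b b' P \<Longrightarrow> s \<in> G (Suc m) \<Longrightarrow> s' \<in> supp (b m s) \<Longrightarrow> P m s' n \<subseteq> P (Suc m) s n"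
  by (simp add: carrier_ok_def)

lemma carrier_ok_exact:
  "carrier_ok G b b' P \<Longrightarrow> s \<in> G (Suc m) \<Longrightarrow> exact_on b' (P (Suc m) s)"
  by (simp add: carrier_ok_def)

lemma exact_onD:
  "exact_on b A \<Longrightarrow> supp c \<subseteq> A m \<Longrightarrow> is_cycle b m c \<Longrightarrow> \<exists>c'. supp c' \<subseteq> A (Suc m) \<and> frag_extend (b m) c' = c"
  by (simp add: exact_on_def)

text \<open>Induction on the degree: the boundary of \<open>s\<close> has been mapped into the
  carriers of the faces, hence into that of \<open>s\<close>, where its image is a cycle and can be
  filled.\<close>

theorem acyclic_carrier_chmap:
  assumes G: "cpx G b" and P: "carrier_ok G b b' P"
    and PH: "\<And>m s n. s \<in> G m \<Longrightarrow> P m s n \<subseteq> H n"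
    and Fz: "\<And>s. s \<in> G 0 \<Longrightarrow> supp (Fz s) \<subseteq> P 0 s 0"
  obtains F where "chmap G b H b' F" "\<And>m s. s \<in> G m \<Longrightarrow> supp (F m s) \<subseteq> P m s m"
    "\<And>s. s \<in> G 0 \<Longrightarrow> F 0 s = Fz s"
proof -
  \<comment> \<open>The middle clause says that images of boundaries are cycles, so that the next
    extension exists. With it in the invariant, dependent choice has to remember the current degree
    only.\<close>
  define Q where "Q \<equiv> \<lambda>m F. (\<forall>s\<in>G m. supp (F s) \<subseteq> P m s m) \<and>
    (\<forall>s\<in>G (Suc m). is_cycle b' m (frag_extend F (b m s))) \<and> (m = 0 \<longrightarrow> F = Fz)"
  define R where "R \<equiv> \<lambda>m F F'. \<forall>s\<in>G (Suc m). frag_extend (b' m) (F' s) = frag_extend F (b m s)"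
  have "\<exists>F. \<forall>m. Q m (F m) \<and> R m (F m) (F (Suc m))"
  proof (rule dependent_nat_choice)
    show "\<exists>F. Q 0 F"
      using Fz by (auto simp: Q_def)
  next
    fix F m assume Q: "Q m F"
    have "\<exists>c. supp c \<subseteq> P (Suc m) s (Suc m) \<and> frag_extend (b' m) c = frag_extend F (b m s)"
      if s: "s \<in> G (Suc m)" for s
    proof (rule exact_onD [where A = "P (Suc m) s"])
      show "exact_on b' (P (Suc m) s)"
        by (rule carrier_ok_exact [OF P s])
      have "supp (b m s) \<subseteq> G m"
        by (rule cpx_supp [OF G s])
      then show "supp (frag_extend F (b m s)) \<subseteq> P (Suc m) s m"
        using Q carrier_ok_mono [OF P s] unfolding Q_def by (intro frag_extend_closed) (meson subset_iff)
      show "is_cycle b' m (frag_extend F (b m s))"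
        using Q s by (auto simp: Q_def)
    qed
    then obtain F' where F': "\<And>s. s \<in> G (Suc m) \<Longrightarrow>
        supp (F' s) \<subseteq> P (Suc m) s (Suc m) \<and> frag_extend (b' m) (F' s) = frag_extend F (b m s)"
      by metis
    have "frag_extend (b' m) (frag_extend F' (b (Suc m) s)) = 0" if s: "s \<in> G (Suc (Suc m))" for s
    proof -
      have "frag_extend (b' m) (frag_extend F' (b (Suc m) s)) = frag_extend F (frag_extend (b m) (b (Suc m) s))"
        unfolding frag_extend_frag_extend
        by (intro frag_extend_eq) (use F' cpx_supp [OF G s] in auto)
      then show ?thesis
        using cpx_bb [OF G s] by simp
    qed
    with F' show "\<exists>F'. Q (Suc m) F' \<and> R m F F'"
      by (auto simp: Q_def R_def)
  qed
  then obtain F where F: "\<And>m. Q m (F m)" "\<And>m. R m (F m) (F (Suc m))" by blast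
  show thesis
  proof
    show "supp (F m s) \<subseteq> P m s m" if "s \<in> G m" for m s
      using F(1) [of m] that by (auto simp: Q_def)
    then show "chmap G b H b' F"
      using F(2) PH unfolding R_def chmap_def by blast
    show "F 0 s = Fz s" if "s \<in> G 0" for s
      using F(1) [of 0] by (auto simp: Q_def)
  qed
qed

text \<open>The same induction, now filling \<open>E - E' - h b\<close>, which the homotopy equation
  one degree lower makes a cycle. The start \<open>hz\<close> in degree 0 has to be
  supplied.\<close>

theorem acyclic_carrier_homotopy:
  assumes G: "cpx G b" and P: "carrier_ok G b b' P"
    and E: "chmap G b H b' E" "chmap G b H b' E'"
    and EP: "\<And>m s. s \<in> G m \<Longrightarrow> supp (E m s) \<subseteq> P m s m" "\<And>m s. s \<in> G m \<Longrightarrow> supp (E' m s) \<subseteq> P m s m"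
    and hz: "\<And>s. s \<in> G 0 \<Longrightarrow> supp (hz s) \<subseteq> P 0 s 1 \<and> frag_extend (b' 0) (hz s) = E 0 s - E' 0 s"
  obtains h where "\<And>m s. s \<in> G m \<Longrightarrow> supp (h m s) \<subseteq> P m s (Suc m)"
    "\<And>m s. s \<in> G (Suc m) \<Longrightarrow> frag_extend (b' (Suc m)) (h (Suc m) s) =
       E (Suc m) s - E' (Suc m) s - frag_extend (h m) (b m s)"
    "\<And>s. s \<in> G 0 \<Longrightarrow> h 0 s = hz s"
proof -
  define r where "r \<equiv> \<lambda>m s. E m s - E' m s"
  have rP: "supp (r m s) \<subseteq> P m s m" if "s \<in> G m" for m s
    unfolding r_def using EP [OF that] keys_diff [of "E m s" "E' m s"] by blast
  have rb: "frag_extend (b' m) (r (Suc m) s) = frag_extend (r m) (b m s)" if "s \<in> G (Suc m)" for m s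
    using E that by (simp add: r_def frag_extend_diff chmap_b frag_extend_diff_fun)
  define Q where "Q \<equiv> \<lambda>m h. (\<forall>s\<in>G m. supp (h s) \<subseteq> P m s (Suc m)) \<and>
    (\<forall>s\<in>G (Suc m). frag_extend (b' m) (r (Suc m) s - frag_extend h (b m s)) = 0) \<and> (m = 0 \<longrightarrow> h = hz)"
  define R where "R \<equiv> \<lambda>m h h'. \<forall>s\<in>G (Suc m).
    frag_extend (b' (Suc m)) (h' s) = r (Suc m) s - frag_extend h (b m s)"
  have "\<exists>h. \<forall>m. Q m (h m) \<and> R m (h m) (h (Suc m))"
  proof (rule dependent_nat_choice)
    have "frag_extend (b' 0) (r (Suc 0) s - frag_extend hz (b 0 s)) = 0" if s: "s \<in> G (Suc 0)" for s
    proof -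
      have "frag_extend (b' 0) (frag_extend hz (b 0 s)) = frag_extend (r 0) (b 0 s)"
        unfolding frag_extend_frag_extend
        by (intro frag_extend_eq) (use hz cpx_supp [OF G s] in \<open>auto simp: r_def\<close>)
      then show ?thesis
        using rb [OF s] by (simp add: frag_extend_diff)
    qed
    then show "\<exists>h. Q 0 h"
      using hz by (auto simp: Q_def)
  next
    fix h m assume Q: "Q m h"
    have "\<exists>c. supp c \<subseteq> P (Suc m) s (Suc (Suc m)) \<and>
        frag_extend (b' (Suc m)) c = r (Suc m) s - frag_extend h (b m s)"
      if s: "s \<in> G (Suc m)" for s
    proof (rule exact_onD [where A = "P (Suc m) s"])
      show "exact_on b' (P (Suc m) s)"
        by (rule carrier_ok_exact [OF P s])
      have "supp (b m s) \<subseteq> G m"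
        by (rule cpx_supp [OF G s])
      then have "supp (frag_extend h (b m s)) \<subseteq> P (Suc m) s (Suc m)"
        using Q carrier_ok_mono [OF P s] unfolding Q_def by (intro frag_extend_closed) (meson subset_iff)
      then show "supp (r (Suc m) s - frag_extend h (b m s)) \<subseteq> P (Suc m) s (Suc m)"
        using rP [OF s] keys_diff [of "r (Suc m) s" "frag_extend h (b m s)"] by (meson Un_least order_trans)
      show "is_cycle b' (Suc m) (r (Suc m) s - frag_extend h (b m s))"
        using Q s by (auto simp: Q_def)
    qed
    then obtain h' where h': "\<And>s. s \<in> G (Suc m) \<Longrightarrow> supp (h' s) \<subseteq> P (Suc m) s (Suc (Suc m)) \<and>
        frag_extend (b' (Suc m)) (h' s) = r (Suc m) s - frag_extend h (b m s)"
      by metis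
    have "frag_extend (b' (Suc m)) (r (Suc (Suc m)) s - frag_extend h' (b (Suc m) s)) = 0"
      if s: "s \<in> G (Suc (Suc m))" for s
    proof -
      have "frag_extend (b' (Suc m)) (frag_extend h' (b (Suc m) s)) =
          frag_extend (\<lambda>s. r (Suc m) s - frag_extend h (b m s)) (b (Suc m) s)"
        unfolding frag_extend_frag_extend
        by (intro frag_extend_eq) (use h' cpx_supp [OF G s] in auto)
      also have "\<dots> = frag_extend (r (Suc m)) (b (Suc m) s) - frag_extend h (frag_extend (b m) (b (Suc m) s))"
        by (simp add: frag_extend_diff_fun frag_extend_frag_extend)
      also have "\<dots> = frag_extend (r (Suc m)) (b (Suc m) s)"
        using cpx_bb [OF G s] by simp
      finally show ?thesis
        using rb [OF s] by (simp add: frag_extend_diff)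
    qed
    with h' show "\<exists>h'. Q (Suc m) h' \<and> R m h h'"
      by (auto simp: Q_def R_def)
  qed
  then obtain h where h: "\<And>m. Q m (h m)" "\<And>m. R m (h m) (h (Suc m))" by blast
  show thesis
  proof
    show "supp (h m s) \<subseteq> P m s (Suc m)" if "s \<in> G m" for m s
      using h(1) [of m] that by (auto simp: Q_def)
    show "frag_extend (b' (Suc m)) (h (Suc m) s) =
       E (Suc m) s - E' (Suc m) s - frag_extend (h m) (b m s)" if "s \<in> G (Suc m)" for m s
      using h(2) [of m] that by (auto simp: R_def r_def)
    show "h 0 s = hz s" if "s \<in> G 0" for s
      using h(1) [of 0] by (auto simp: Q_def)
  qed
qed

section \<open>Cochains, pull-backs and dual homotopies\<close>

definition cocycle :: "(nat \<Rightarrow> 'b set) \<Rightarrow> (nat \<Rightarrow> 'b \<Rightarrow> 'b \<Rightarrow>\<^sub>0 int) \<Rightarrow> nat \<Rightarrow> ('b \<Rightarrow> int) \<Rightarrow> bool" where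
  "cocycle G b m f \<longleftrightarrow> (\<forall>s\<in>G (Suc m). pair f (b m s) = 0)"

text \<open>A cochain is given by any function on simplices; two functions that agree on
  \<open>G\<close> represent the same one. Nothing lies below degree 0, where the only coboundary is
  zero.\<close>

definition coboundary :: "(nat \<Rightarrow> 'b set) \<Rightarrow> (nat \<Rightarrow> 'b \<Rightarrow> 'b \<Rightarrow>\<^sub>0 int) \<Rightarrow> nat \<Rightarrow> ('b \<Rightarrow> int) \<Rightarrow> bool" where
  "coboundary G b m f \<longleftrightarrow>
     (case m of 0 \<Rightarrow> \<forall>s\<in>G 0. f s = 0 | Suc j \<Rightarrow> \<exists>g. \<forall>s\<in>G (Suc j). f s = pair g (b j s))"

definition pull :: "(nat \<Rightarrow> 'b \<Rightarrow> 'c \<Rightarrow>\<^sub>0 int) \<Rightarrow> nat \<Rightarrow> ('c \<Rightarrow> int) \<Rightarrow> 'b \<Rightarrow> int" where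
  "pull F m f = (\<lambda>s. pair f (F m s))"

lemma pull_comp: "pull (comp_ch F' F) m f = pull F m (pull F' m f)"
  by (simp add: pull_def comp_ch_def pair_extend)

lemma pair_pull:
  assumes "chmap G b H b' F" "s \<in> G (Suc m)"
  shows "pair (pull F m f) (b m s) = pair (\<lambda>t. pair f (b' m t)) (F (Suc m) s)"
  using chmap_b [OF assms] by (simp add: pull_def flip: pair_extend)

lemma cocycle_pull:
  assumes F: "chmap G b H b' F" and f: "cocycle H b' m f"
  shows "cocycle G b m (pull F m f)"
  unfolding cocycle_def
proof
  fix s assume s: "s \<in> G (Suc m)"
  show "pair (pull F m f) (b m s) = 0"
    unfolding pair_pull [OF F s]
    by (rule pair_eq_0) (use f chmap_supp [OF F s] in \<open>auto simp: cocycle_def\<close>)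
qed

lemma pull_coboundary_eq:
  assumes F: "chmap G b H b' F" and f: "\<And>t. t \<in> H (Suc m) \<Longrightarrow> f t = pair g (b' m t)" and s: "s \<in> G (Suc m)"
  shows "pull F (Suc m) f s = pair (pull F m g) (b m s)"
  unfolding pair_pull [OF F s]
  unfolding pull_def by (intro pair_cong) (use f chmap_supp [OF F s] in auto)

lemma coboundary_pull:
  assumes F: "chmap G b H b' F" and f: "coboundary H b' m f"
  shows "coboundary G b m (pull F m f)"
proof (cases m)
  case 0
  then show ?thesis
    using f chmap_supp [OF F] by (auto simp: coboundary_def pull_def subset_iff intro!: pair_eq_0)
next
  case (Suc j)
  then obtain g where "\<And>t. t \<in> H (Suc j) \<Longrightarrow> f t = pair g (b' j t)"
    using f by (auto simp: coboundary_def)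
  then show ?thesis
    using pull_coboundary_eq [OF F] Suc by (auto simp: coboundary_def)
qed

text \<open>Pairing the homotopy equation with a cocycle removes the term with the boundary of
  \<open>h\<close>. The primitive \<open>pull h m f\<close> is kept explicit, because its support
  has to be estimated later.\<close>

lemma homotopy_pull:
  assumes f: "cocycle H b' (Suc m) f"
    and hH: "supp (h (Suc m) s) \<subseteq> H (Suc (Suc m))"
    and h: "frag_extend (b' (Suc m)) (h (Suc m) s) = E (Suc m) s - E' (Suc m) s - frag_extend (h m) (b m s)"
  shows "pull E (Suc m) f s - pull E' (Suc m) f s = pair (pull h m f) (b m s)"
proof -
  have "pair f (frag_extend (b' (Suc m)) (h (Suc m) s)) = 0"
    unfolding pair_extend using f hH by (intro pair_eq_0 [where c = "h (Suc m) s"]) (auto simp: cocycle_def)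
  then show ?thesis
    by (simp add: h pair_diff pull_def pair_extend)
qed

text \<open>In degree 0 a coboundary has to vanish, so there the two maps must agree instead of
  being homotopic.\<close>

lemma coboundary_diff_homotopy:
  assumes f: "cocycle H b' m f"
    and hH: "\<And>m s. s \<in> G m \<Longrightarrow> supp (h m s) \<subseteq> H (Suc m)"
    and h: "\<And>m s. s \<in> G (Suc m) \<Longrightarrow> frag_extend (b' (Suc m)) (h (Suc m) s) =
       E (Suc m) s - E' (Suc m) s - frag_extend (h m) (b m s)"
    and 0: "\<And>s. s \<in> G 0 \<Longrightarrow> E 0 s = E' 0 s"
  shows "coboundary G b m (\<lambda>s. pull E m f s - pull E' m f s)"
proof (cases m)
  case 0
  then show ?thesis
    using assms(4) by (simp add: coboundary_def pull_def)
next
  case (Suc j)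
  then show ?thesis
    using homotopy_pull [where m = j and h = h] f h hH unfolding coboundary_def by force
qed

lemma coboundary_add:
  assumes "coboundary G b m f" "coboundary G b m g"
  shows "coboundary G b m (\<lambda>s. f s + g s)"
proof (cases m)
  case 0
  then show ?thesis using assms by (simp add: coboundary_def)
next
  case (Suc j)
  with assms obtain u v where "\<And>s. s \<in> G (Suc j) \<Longrightarrow> f s = pair u (b j s)"
    "\<And>s. s \<in> G (Suc j) \<Longrightarrow> g s = pair v (b j s)"
    by (auto simp: coboundary_def)
  then have "\<forall>s\<in>G (Suc j). f s + g s = pair (\<lambda>x. u x + v x) (b j s)"
    by (simp add: pair_add_fun)
  then show ?thesis
    unfolding coboundary_def Suc by auto
qed

lemma coboundary_cong:
  "(\<And>s. s \<in> G m \<Longrightarrow> f s = g s) \<Longrightarrow> coboundary G b m f \<longleftrightarrow> coboundary G b m g"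
  by (cases m) (auto simp: coboundary_def)

lemma cocycle_coboundary:
  assumes "cpx G b" "coboundary G b m f"
  shows "cocycle G b m f"
proof (cases m)
  case 0
  then show ?thesis
    using assms cpx_supp [OF assms(1)] by (auto simp: coboundary_def cocycle_def subset_iff intro!: pair_eq_0)
next
  case (Suc j)
  with assms obtain u where u: "\<And>s. s \<in> G (Suc j) \<Longrightarrow> f s = pair u (b j s)"
    by (auto simp: coboundary_def)
  show ?thesis unfolding cocycle_def Suc
  proof
    fix s assume s: "s \<in> G (Suc (Suc j))"
    have "pair f (b (Suc j) s) = pair (\<lambda>s. pair u (b j s)) (b (Suc j) s)"
      by (intro pair_cong) (use u cpx_supp [OF assms(1) s] in auto)
    also have "\<dots> = 0"
      using cpx_bb [OF assms(1) s] by (simp flip: pair_extend)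
    finally show "pair f (b (Suc j) s) = 0" .
  qed
qed

section \<open>The augmented singular complex\<close>

text \<open>
  The simplex of dimension \<open>-1\<close> is the only function that is extensional on the empty set.
\<close>

definition sing :: "'a topology \<Rightarrow> nat \<Rightarrow> ((nat \<Rightarrow> real) \<Rightarrow> 'a) set" where
  "sing X m = (case m of 0 \<Rightarrow> {\<lambda>_. undefined} | Suc p \<Rightarrow> singular_simplex_set p X)"

definition sbd :: "nat \<Rightarrow> ((nat \<Rightarrow> real) \<Rightarrow> 'a) \<Rightarrow> 'a chain" where
  "sbd m s = (case m of 0 \<Rightarrow> frag_of (\<lambda>_. undefined) | Suc p \<Rightarrow> chain_boundary (Suc p) (frag_of s))"

definition im :: "nat \<Rightarrow> ((nat \<Rightarrow> real) \<Rightarrow> 'a) \<Rightarrow> 'a set" where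
  "im m s = (case m of 0 \<Rightarrow> {} | Suc p \<Rightarrow> s ` standard_simplex p)"

text \<open>The exception for degree 0 keeps the empty simplex in the complex even if
  \<open>W\<close> is empty.\<close>

definition sing_small :: "'a topology \<Rightarrow> 'a set set \<Rightarrow> nat \<Rightarrow> ((nat \<Rightarrow> real) \<Rightarrow> 'a) set" where
  "sing_small X W m = {s \<in> sing X m. m = 0 \<or> (\<exists>w\<in>W. im m s \<subseteq> w)}"

lemma sing_simps [simp]: "sing X 0 = {\<lambda>_. undefined}" "sing X (Suc p) = singular_simplex_set p X"
  by (simp_all add: sing_def)

lemma im_simps [simp]: "im 0 s = {}" "im (Suc p) s = s ` standard_simplex p"
  by (simp_all add: im_def)

lemma sbd_0 [simp]: "sbd 0 = (\<lambda>s. frag_of (\<lambda>_. undefined))"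
  by (simp add: sbd_def fun_eq_iff)

lemma frag_extend_sbd: "frag_extend (sbd (Suc p)) c = chain_boundary (Suc p) c"
  unfolding chain_boundary_def sbd_def by (simp del: sum.atMost_Suc)

lemma sbd_Suc: "sbd (Suc p) s = (\<Sum>k\<le>Suc p. frag_cmul ((-1) ^ k) (frag_of (singular_face (Suc p) k s)))"
  by (simp add: sbd_def chain_boundary_of)

lemma sing_subtopology: "sing (subtopology X A) m = {s \<in> sing X m. im m s \<subseteq> A}"
  by (cases m) (auto simp: singular_simplex_subtopology image_subset_iff)

lemma sing_small_subset: "sing_small X W m \<subseteq> sing X m"
  by (auto simp: sing_small_def)

lemma im_subset_topspace: "s \<in> sing X m \<Longrightarrow> im m s \<subseteq> topspace X"
  by (cases m) (auto simp: singular_simplex_def continuous_map_def)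

lemma im_nonempty: "im (Suc p) s \<noteq> {}"
  by (simp add: nonempty_standard_simplex)

lemma supp_sbd: "supp (sbd (Suc p) s) \<subseteq> (\<lambda>k. singular_face (Suc p) k s) ` {..Suc p}"
proof -
  have "supp (sbd (Suc p) s) \<subseteq> (\<Union>k\<le>Suc p. supp (frag_cmul ((-1) ^ k) (frag_of (singular_face (Suc p) k s))))"
    unfolding sbd_Suc by (rule keys_sum)
  also have "\<dots> \<subseteq> (\<lambda>k. singular_face (Suc p) k s) ` {..Suc p}"
    using keys_cmul by (force simp: subset_iff)
  finally show ?thesis .
qed

lemma im_face:
  assumes "s' \<in> supp (sbd m s)"
  shows "im m s' \<subseteq> im (Suc m) s"
proof (cases m)
  case (Suc p)
  then obtain k where k: "k \<le> Suc p" "s' = singular_face (Suc p) k s"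
    using assms supp_sbd [of p s] by auto
  have "simplical_face k x \<in> standard_simplex (Suc p)" if "x \<in> standard_simplex p" for x
    using simplical_face_in_standard_simplex [of "Suc p" k x] k that by simp
  then show ?thesis
    unfolding k(2) Suc by (auto simp: singular_face_def)
qed simp

lemma cpx_sing: "cpx (sing X) sbd"
  unfolding cpx_def
proof (intro conjI allI ballI)
  fix m and s :: "(nat \<Rightarrow> real) \<Rightarrow> 'a" assume s: "s \<in> sing X (Suc m)"
  show "supp (sbd m s) \<subseteq> sing X m"
  proof (cases m)
    case (Suc p)
    then have "singular_chain (Suc p) X (frag_of s)"
      using s by (simp add: singular_chain_of)
    from singular_chain_boundary [OF this] show ?thesis
      by (simp add: Suc sbd_def singular_chain_def)
  qed simp
next
  fix m and s :: "(nat \<Rightarrow> real) \<Rightarrow> 'a" assume s: "s \<in> sing X (Suc (Suc m))"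
  show "frag_extend (sbd m) (sbd (Suc m) s) = 0"
  proof (cases m)
    case 0
    then show ?thesis
      by (simp add: sbd_Suc frag_extend_diff)
  next
    case (Suc p)
    then have "singular_chain (Suc (Suc p)) X (frag_of s)"
      using s by (simp add: singular_chain_of)
    from chain_boundary_boundary [OF this] show ?thesis
      unfolding Suc frag_extend_sbd by (simp add: sbd_def)
  qed
qed

lemma cpx_sing_small: "cpx (sing_small X W) sbd"
  unfolding cpx_def
proof (intro conjI allI ballI)
  fix m and s :: "(nat \<Rightarrow> real) \<Rightarrow> 'a" assume s: "s \<in> sing_small X W (Suc m)"
  then have sX: "s \<in> sing X (Suc m)" by (simp add: sing_small_def)
  show "supp (sbd m s) \<subseteq> sing_small X W m"
    using cpx_supp [OF cpx_sing sX] im_face [of _ m s] s unfolding sing_small_def by fastforce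
next
  fix m and s :: "(nat \<Rightarrow> real) \<Rightarrow> 'a" assume "s \<in> sing_small X W (Suc (Suc m))"
  then show "frag_extend (sbd m) (sbd (Suc m) s) = 0"
    using cpx_bb [OF cpx_sing] sing_small_subset by blast
qed

text \<open>A contraction gives a chain homotopy from the identity to a constant map. In positive
  dimension the constant map factors through a point, where cycles bound; in dimension 0 the
  augmentation is used, and in dimension -1 a point is needed.\<close>

lemma exact_on_contractible:
  assumes Y: "contractible_space Y" "topspace Y \<noteq> {}"
  shows "exact_on sbd (sing Y)"
  unfolding exact_on_def
proof (intro allI impI)
  fix m and c :: "'a chain" assume c: "supp c \<subseteq> sing Y m" and cyc: "is_cycle sbd m c"
  obtain a where hom: "homotopic_with (\<lambda>x. True) Y Y id (\<lambda>x. a)"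
    using Y(1) by (auto simp: contractible_space_def)
  then have a: "a \<in> topspace Y"
    using Y(2) homotopic_with_imp_continuous_maps [OF hom] by (auto simp: continuous_map_def)
  define pt where "pt \<equiv> \<lambda>p. restrict (\<lambda>x::nat\<Rightarrow>real. a) (standard_simplex p)"
  have pt: "singular_simplex p Y (pt p)" for p
    using a by (auto simp: singular_simplex_def pt_def continuous_map_const continuous_map_eq)
  show "\<exists>c'. supp c' \<subseteq> sing Y (Suc m) \<and> frag_extend (sbd m) c' = c"
  proof (cases m)
    case 0
    define c' where "c' \<equiv> frag_extend (\<lambda>_. frag_of (pt 0)) c"
    have "frag_extend (sbd 0) c' = frag_extend frag_of c"
      unfolding c'_def frag_extend_frag_extend
      by (intro frag_extend_eq) (use c 0 in \<open>auto simp: sbd_def\<close>)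
    moreover have "supp c' \<subseteq> sing Y (Suc 0)"
      unfolding c'_def using pt by (intro frag_extend_closed) auto
    ultimately show ?thesis using 0 by auto
  next
    case (Suc p)
    have sc: "singular_chain p Y c"
      using c Suc by (simp add: singular_chain_def)
    have cb: "chain_boundary p c = 0"
      using cyc Suc by (cases p) (auto simp: frag_extend_sbd, simp add: chain_boundary_def)
    then have rc: "singular_relcycle p Y {} c"
      using sc by (simp add: singular_cycle)
    have "homotopic_with (\<lambda>h. h \<in> {} \<rightarrow> {}) Y Y id (\<lambda>x. a)"
      using hom by (simp add: Pi_def)
    from homotopic_imp_homologous_rel_chain_maps [OF this rc]
    have 1: "homologous_rel p Y {} c (chain_map p (\<lambda>x. a) c)"
      using chain_map_id_gen [OF sc, of id] by simp
    have 2: "singular_relboundary p Y {} (chain_map p (\<lambda>x. a) c)"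
    proof (cases p)
      case 0
      have "frag_extend (sbd 0) c = 0"
        using cyc Suc 0 by simp
      then have "frag_extend (\<lambda>_. frag_of (\<lambda>_. undefined)) c = (0 :: 'a chain)"
        by (simp add: sbd_def)
      \<comment> \<open>The coefficient sum of the cycle \<open>c\<close> is zero, so its image
        under the constant map, a multiple of one simplex, vanishes.\<close>
      then have "frag_extend (\<lambda>_. frag_of (pt 0)) (frag_extend (\<lambda>_. frag_of (\<lambda>_. undefined)) c :: 'a chain) = 0"
        by simp
      then have "frag_extend (\<lambda>_. frag_of (pt 0)) c = 0"
        by (simp add: frag_extend_frag_extend)
      moreover have "chain_map p (\<lambda>x. a) c = frag_extend (\<lambda>_. frag_of (pt 0)) c"
        unfolding chain_map_def by (intro frag_extend_eq) (auto simp: simplex_map_def pt_def 0 o_def)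
      ultimately show ?thesis by simp
    next
      case (Suc q)
      define Z where "Z = subtopology Y {a}"
      have Z: "topspace Z = {a}" using a by (auto simp: Z_def)
      have "continuous_map Y Z (\<lambda>x. a)"
        using a by (auto simp: Z_def continuous_map_in_subtopology)
      then have "singular_relcycle p Z {} (chain_map p (\<lambda>x. a) c)"
        using rc by (intro singular_relcycle_chain_map) auto
      then have "singular_relboundary p Z {} (chain_map p (\<lambda>x. a) c)"
        using singular_boundary_eq_cycle_singleton [OF Z, of p] Suc by simp
      then show ?thesis
        unfolding Z_def using singular_boundary_mono [of "{a}" UNIV p Y] by simp
    qed
    have "singular_relboundary p Y {} c"
      using singular_relboundary_add [OF _ 2] 1 unfolding homologous_rel_def by force
    then obtain d where "singular_chain (Suc p) Y d" "chain_boundary (Suc p) d = c"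
      by (auto simp: singular_boundary)
    then show ?thesis
      using Suc by (auto simp: singular_chain_def frag_extend_sbd)
  qed
qed

lemma additive_frag_extend:
  assumes "\<And>a b. h (a - b) = h a - h b"
  shows "h c = frag_extend (\<lambda>x. h (frag_of x)) c"
proof -
  have "h 0 = 0" using assms [of 0 0] by simp
  with subset_UNIV [of "supp c"] show ?thesis
    by (induction c rule: frag_induction) (simp_all add: assms frag_extend_diff)
qed

text \<open>
  The number of subdivisions depends on the simplex; the homotopy \<open>D\<close> subdivides every simplex
  as often as needed, and \<open>\<rho>\<close> is what is left of the identity.
\<close>

theorem small_simplices:
  fixes X :: "'a topology"
  assumes W: "\<And>w. w \<in> W \<Longrightarrow> openin X w" and WX: "topspace X \<subseteq> \<Union> W"
  obtains \<rho> D where "chmap (sing X) sbd (sing_small X W) sbd \<rho>"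
    "\<And>m s. s \<in> sing X (Suc m) \<Longrightarrow> frag_extend (sbd (Suc m)) (D (Suc m) s) =
       frag_of s - \<rho> (Suc m) s - frag_extend (D m) (sbd m s)"
    "\<And>s. \<rho> 0 s = frag_of s" "\<And>s. D 0 s = 0"
    "\<And>m s. s \<in> sing X m \<Longrightarrow> supp (\<rho> m s) \<subseteq> sing (subtopology X (im m s)) m"
    "\<And>m s. s \<in> sing X m \<Longrightarrow> supp (D m s) \<subseteq> sing (subtopology X (im m s)) (Suc m)"
proof -
  let ?sd = "singular_subdivision :: nat \<Rightarrow> 'a chain \<Rightarrow> 'a chain"
  obtain h where h0: "\<And>p. h p 0 = (0 :: 'a chain)"
    and hdiff: "\<And>p c1 c2. h p (c1 - c2) = h p c1 - h p c2"
    and hX: "\<And>p X (c :: 'a chain). singular_chain p X c \<Longrightarrow> singular_chain (Suc p) X (h p c)"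
    and hb: "\<And>p X (c :: 'a chain). singular_chain p X c
          \<Longrightarrow> chain_boundary (Suc p) (h p c) + h (p - Suc 0) (chain_boundary p c) = ?sd p c - c"
    by (rule chain_homotopic_singular_subdivision) blast
  \<comment> \<open>Summing the homotopies between successive subdivisions gives a homotopy from the
    identity to the n-th iterate.\<close>
  define H where "H \<equiv> \<lambda>n p c. \<Sum>i<n. h p ((?sd p ^^ i) c)"
  have sdX: "singular_chain p Y ((?sd p ^^ i) c)" if "singular_chain p Y c" for p i c Y
    using that by (induction i) (auto intro: singular_chain_singular_subdivision)
  have HX: "singular_chain (Suc p) Y (H n p c)" if "singular_chain p Y c" for p n c Y
    unfolding H_def using that by (intro singular_chain_sum hX sdX)
  have sdb: "chain_boundary p ((?sd p ^^ i) c) = (?sd (p - Suc 0) ^^ i) (chain_boundary p c)"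
    if "singular_chain p Y c" for p i c Y
  proof (induction i)
    case (Suc i)
    then show ?case
      using chain_boundary_singular_subdivision [OF sdX [OF that]] by simp
  qed simp
  have Hb: "chain_boundary (Suc p) (H n p c) + H n (p - Suc 0) (chain_boundary p c) = (?sd p ^^ n) c - c"
    if c: "singular_chain p Y c" for p n c Y
  proof (induction n)
    case 0
    then show ?case by (simp add: H_def)
  next
    case (Suc n)
    have "chain_boundary (Suc p) (h p ((?sd p ^^ n) c)) + h (p - Suc 0) ((?sd (p - Suc 0) ^^ n) (chain_boundary p c))
        = (?sd p ^^ Suc n) c - (?sd p ^^ n) c"
      using hb [OF sdX [OF c], of n] by (simp add: sdb [OF c])
    moreover have "chain_boundary (Suc p) (H (Suc n) p c) + H (Suc n) (p - Suc 0) (chain_boundary p c) =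
        (chain_boundary (Suc p) (H n p c) + H n (p - Suc 0) (chain_boundary p c)) +
        (chain_boundary (Suc p) (h p ((?sd p ^^ n) c)) + h (p - Suc 0) ((?sd (p - Suc 0) ^^ n) (chain_boundary p c)))"
      by (simp add: H_def chain_boundary_add)
    ultimately show ?case
      using Suc by simp
  qed
  have Hdiff: "H n p (a - b) = H n p a - H n p b" for n p a b
    by (simp add: H_def singular_subdivision_power_diff hdiff sum_subtractf)
  define small where "small \<equiv> \<lambda>p. {s. singular_simplex p X s \<and> (\<exists>w\<in>W. s ` standard_simplex p \<subseteq> w)}"
  \<comment> \<open>The same \<open>h\<close> satisfies \<open>hX\<close> for every space, in
    particular for the subspace \<open>w\<close> that contains the given simplex.\<close>
  have small_h: "supp (h p c) \<subseteq> small (Suc p)" if "supp c \<subseteq> small p" for p c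
    using that
  proof (induction rule: frag_induction)
    case zero
    then show ?case by (simp add: h0)
  next
    case (one s)
    then obtain w where w: "w \<in> W" "singular_simplex p (subtopology X w) s"
      by (auto simp: small_def singular_simplex_subtopology)
    then have "singular_chain (Suc p) (subtopology X w) (h p (frag_of s))"
      by (intro hX) (simp add: singular_chain_of)
    then show ?case
      using w(1) unfolding singular_chain_def small_def subset_iff mem_Collect_eq singular_simplex_subtopology
      by blast
  next
    case (diff a b)
    then show ?case
      using keys_diff [of "h p a" "h p b"] by (simp add: hdiff) blast
  qed
  have "\<exists>n. \<forall>m\<ge>n. supp ((?sd p ^^ m) (frag_of s)) \<subseteq> small p" if "singular_simplex p X s" for p s
  proof -
    have sc: "singular_chain p X (frag_of s)" using that by (simp add: singular_chain_of)
    obtain n where n: "\<And>m f. \<lbrakk>n \<le> m; f \<in> supp ((?sd p ^^ m) (frag_of s))\<rbrakk>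
                      \<Longrightarrow> \<exists>V \<in> W. f \<in> (standard_simplex p) \<rightarrow> V"
      using sufficient_iterated_singular_subdivision_exists [OF W WX sc] by metis
    have "supp ((?sd p ^^ m) (frag_of s)) \<subseteq> small p" if "n \<le> m" for m
    proof
      fix f assume f: "f \<in> supp ((?sd p ^^ m) (frag_of s))"
      then have "singular_simplex p X f"
        using sdX [OF sc, of m] by (auto simp: singular_chain_def)
      then show "f \<in> small p"
        using n [OF that f] by (auto simp: small_def)
    qed
    then show ?thesis by blast
  qed
  then obtain n0 where n0: "\<And>p s m. singular_simplex p X s \<Longrightarrow> n0 p s \<le> m \<Longrightarrow>
      supp ((?sd p ^^ m) (frag_of s)) \<subseteq> small p"
    by metis
  \<comment> \<open>\<open>N p s\<close> subdivisions make \<open>s\<close> small, and the recursive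
    maximum ensures that no face of \<open>s\<close> is subdivided more often than
    \<open>s\<close>.\<close>
  define N where "N \<equiv> rec_nat (n0 0) (\<lambda>p Np s. Max (insert (n0 (Suc p) s)
       (Np ` supp (chain_boundary (Suc p) (frag_of s)))))"
  have N_Suc: "N (Suc p) s = Max (insert (n0 (Suc p) s) (N p ` supp (chain_boundary (Suc p) (frag_of s))))" for p s
    by (simp add: N_def)
  have N_n0: "n0 p s \<le> N p s" for p s
    by (cases p) (simp add: N_def, simp add: N_Suc)
  have N_face: "N p s' \<le> N (Suc p) s" if "s' \<in> supp (chain_boundary (Suc p) (frag_of s))" for p s s'
    unfolding N_Suc using that by (intro Max_ge) auto
  define D where "D \<equiv> \<lambda>m s. case m of 0 \<Rightarrow> 0 | Suc p \<Rightarrow> - H (N p s) p (frag_of s)"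
  \<comment> \<open>As the remainder of the homotopy formula, \<open>\<rho>\<close> is homotopic to
    the identity by construction; the real issue is that its values are small.\<close>
  define \<rho> where "\<rho> \<equiv> \<lambda>m s. case m of 0 \<Rightarrow> frag_of s
    | Suc p \<Rightarrow> frag_of s - frag_extend (sbd (Suc p)) (D (Suc p) s) - frag_extend (D p) (sbd p s)"
  have \<rho>_Suc: "\<rho> (Suc m) s = frag_of s - frag_extend (sbd (Suc m)) (D (Suc m) s) - frag_extend (D m) (sbd m s)" for m s
    by (simp add: \<rho>_def)
  have \<rho>_0: "\<rho> 0 s = frag_of s" and D_0: "D 0 s = 0" for s
    by (simp_all add: \<rho>_def D_def)
  have suppD: "supp (D m s) \<subseteq> sing (subtopology X (im m s)) (Suc m)" if "s \<in> sing X m" for m s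
  proof (cases m)
    case (Suc p)
    then have "singular_chain p (subtopology X (im m s)) (frag_of s)"
      using that by (auto simp: singular_chain_of singular_simplex_subtopology)
    from HX [OF this, of "N p s"] show ?thesis
      by (simp add: D_def Suc singular_chain_def)
  qed (simp add: D_0)
  have suppD': "supp (D m s) \<subseteq> sing X (Suc m)" if "s \<in> sing X m" for m s
    using suppD [OF that] unfolding sing_subtopology by blast
  have \<rho>_sub: "supp (\<rho> m s) \<subseteq> sing (subtopology X (im m s)) m" if s: "s \<in> sing X m" for m s
  proof (cases m)
    case (Suc p)
    let ?Y = "subtopology X (im m s)"
    have sY: "s \<in> sing ?Y m" using s by (simp add: sing_subtopology)
    have 1: "supp (frag_extend (sbd (Suc p)) (D (Suc p) s)) \<subseteq> sing ?Y m"
      using cpx_supp_extend [OF cpx_sing suppD [OF s]] Suc by simp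
    have "supp (D p s') \<subseteq> sing ?Y m" if "s' \<in> supp (sbd p s)" for s'
    proof -
      have "s' \<in> sing X p" using cpx_supp [OF cpx_sing, of s X p] s Suc that by blast
      then show ?thesis
        using suppD [of s' p] im_face [OF that] unfolding Suc sing_subtopology by blast
    qed
    then have 2: "supp (frag_extend (D p) (sbd p s)) \<subseteq> sing ?Y m"
      by (intro frag_extend_closed)
    have 3: "supp (frag_of s) \<subseteq> sing ?Y m"
      using sY by simp
    have *: "supp (a - b - c) \<subseteq> S" if "supp a \<subseteq> S" "supp b \<subseteq> S" "supp c \<subseteq> S"
      for a b c :: "'a chain" and S
      using that keys_diff [of "a - b" c] keys_diff [of a b] by blast
    show ?thesis
      using * [OF 3 1 2] by (simp add: \<rho>_Suc Suc)
  qed (use s in \<open>simp add: \<rho>_0\<close>)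
  have \<rho>_b: "frag_extend (sbd m) (\<rho> (Suc m) s) = frag_extend (\<rho> m) (sbd m s)" if s: "s \<in> sing X (Suc m)" for m s
  proof -
    have a: "frag_extend (sbd m) (frag_extend (sbd (Suc m)) (D (Suc m) s)) = 0"
      using cpx_bb_extend [OF cpx_sing suppD' [OF s]] .
    have sup: "supp (sbd m s) \<subseteq> sing X m"
      using cpx_supp [OF cpx_sing s] .
    show ?thesis
    proof (cases m)
      case 0
      have "frag_extend (D 0) (sbd 0 s) = 0" "frag_extend (\<rho> 0) (sbd 0 s) = sbd 0 s"
        by (simp_all add: D_0 \<rho>_0)
      then show ?thesis
        using a by (simp add: \<rho>_Suc 0 frag_extend_diff)
    next
      case (Suc q)
      have "frag_extend (\<rho> m) (sbd m s) =
          frag_extend frag_of (sbd m s) - frag_extend (sbd m) (frag_extend (D m) (sbd m s))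
          - frag_extend (D q) (frag_extend (sbd q) (sbd m s))"
        using ext [of "\<rho> (Suc q)", OF \<rho>_Suc] by (simp only: Suc frag_extend_diff_fun frag_extend_frag_extend)
      also have "frag_extend (sbd q) (sbd m s) = 0"
        using cpx_bb [OF cpx_sing, of s X q] s Suc by simp
      finally show ?thesis
        using a by (simp add: \<rho>_Suc frag_extend_diff)
    qed
  qed
  have \<rho>_small: "supp (\<rho> (Suc p) s) \<subseteq> small p" if s: "singular_simplex p X s" for p s
  proof -
    have sc: "singular_chain p X (frag_of s)" using s by (simp add: singular_chain_of)
    define n where "n = N p s"
    have sdn: "supp ((?sd p ^^ n) (frag_of s)) \<subseteq> small p"
      using n0 [OF s N_n0] by (simp add: n_def)
    have D: "frag_extend (sbd (Suc p)) (D (Suc p) s) = - chain_boundary (Suc p) (H n p (frag_of s))"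
      by (simp add: D_def n_def frag_extend_minus frag_extend_sbd)
    show ?thesis
    proof (cases p)
      case 0
      have "H n 0 (0 :: 'a chain) = 0" by (simp add: H_def h0)
      moreover have "chain_boundary 0 c = 0" for c :: "'a chain" by (simp add: chain_boundary_def)
      ultimately have "chain_boundary (Suc p) (H n p (frag_of s)) = (?sd p ^^ n) (frag_of s) - frag_of s"
        using Hb [OF sc, of n] 0 by simp
      moreover have "frag_extend (D p) (sbd p s) = 0"
        by (simp add: 0 D_0)
      ultimately have "\<rho> (Suc p) s = (?sd p ^^ n) (frag_of s)"
        unfolding \<rho>_Suc D by simp
      then show ?thesis using sdn by simp
    next
      case (Suc q)
      let ?d = "chain_boundary p (frag_of s)"
      have d: "sbd p s = ?d" by (simp add: Suc sbd_def)
      have "H n q ?d = frag_extend (\<lambda>t. H n q (frag_of t)) ?d"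
        by (rule additive_frag_extend) (rule Hdiff)
      moreover have "frag_extend (D p) ?d = frag_extend (\<lambda>t. - H (N q t) q (frag_of t)) ?d"
        by (simp add: D_def Suc)
      moreover have "chain_boundary (Suc p) (H n p (frag_of s)) = (?sd p ^^ n) (frag_of s) - frag_of s - H n q ?d"
        using Hb [OF sc, of n] Suc by (simp add: eq_diff_eq)
      ultimately have "\<rho> (Suc p) s = (?sd p ^^ n) (frag_of s) -
          (frag_extend (\<lambda>t. H n q (frag_of t)) ?d + frag_extend (\<lambda>t. - H (N q t) q (frag_of t)) ?d)"
        unfolding \<rho>_Suc D d by simp
      also have "frag_extend (\<lambda>t. H n q (frag_of t)) ?d + frag_extend (\<lambda>t. - H (N q t) q (frag_of t)) ?d
          = frag_extend (\<lambda>t. H n q (frag_of t) + - H (N q t) q (frag_of t)) ?d"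
        by (simp only: frag_extend_add_fun)
      finally have \<rho>: "\<rho> (Suc p) s = (?sd p ^^ n) (frag_of s) -
          frag_extend (\<lambda>t. H n q (frag_of t) + - H (N q t) q (frag_of t)) ?d" .
      \<comment> \<open>The homotopy of \<open>s\<close> uses \<open>n\<close> subdivisions on the
        face \<open>t\<close>, that of \<open>t\<close> itself only \<open>N q t\<close>. The
        difference consists of the homotopies of the later iterates, whose simplices are small
        already.\<close>
      have "supp (H n q (frag_of t) + - H (N q t) q (frag_of t)) \<subseteq> small p" if t: "t \<in> supp ?d" for t
      proof -
        have tX: "singular_simplex q X t"
          using singular_chain_boundary [OF sc] t Suc by (auto simp: singular_chain_def)
        have Nn: "N q t \<le> n"
          using N_face t Suc by (simp add: n_def)
        then have "{..<n} = {..<N q t} \<union> {N q t..<n}" by auto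
        then have "H n q (frag_of t) = H (N q t) q (frag_of t) + (\<Sum>i\<in>{N q t..<n}. h q ((?sd q ^^ i) (frag_of t)))"
          unfolding H_def by (simp only: \<open>{..<n} = {..<N q t} \<union> {N q t..<n}\<close>) (rule sum.union_disjoint, auto)
        then have "H n q (frag_of t) + - H (N q t) q (frag_of t) = (\<Sum>i\<in>{N q t..<n}. h q ((?sd q ^^ i) (frag_of t)))"
          by simp
        also have "supp \<dots> \<subseteq> (\<Union>i\<in>{N q t..<n}. supp (h q ((?sd q ^^ i) (frag_of t))))"
          by (rule keys_sum)
        also have "\<dots> \<subseteq> small p"
        proof (rule UN_least)
          fix i assume "i \<in> {N q t..<n}"
          then have "n0 q t \<le> i" using N_n0 [of q t] by (meson atLeastLessThan_iff order_trans)
          then show "supp (h q ((?sd q ^^ i) (frag_of t))) \<subseteq> small p"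
            unfolding Suc by (intro small_h n0 tX)
        qed
        finally show ?thesis .
      qed
      then have "supp (frag_extend (\<lambda>t. H n q (frag_of t) + - H (N q t) q (frag_of t)) ?d) \<subseteq> small p"
        by (intro frag_extend_closed)
      then show ?thesis
        unfolding \<rho> using sdn by (meson Un_least keys_diff order_trans)
    qed
  qed
  have "supp (\<rho> m s) \<subseteq> sing_small X W m" if s: "s \<in> sing X m" for m s
  proof (cases m)
    case 0
    then show ?thesis using s by (simp add: \<rho>_0 sing_small_def)
  next
    case (Suc p)
    then show ?thesis using \<rho>_small [of p s] s by (auto simp: sing_small_def small_def)
  qed
  then have "chmap (sing X) sbd (sing_small X W) sbd \<rho>"
    using \<rho>_b by (auto simp: chmap_def)
  with \<rho>_Suc \<rho>_0 D_0 \<rho>_sub suppD show thesis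
    by (intro that [of \<rho> D]) auto
qed

section \<open>Geodesics and convexity in CAT(0) spaces\<close>

text \<open>The CAT(0) inequality quantifies over given comparison triangles, so one has to be
  produced before it says anything.\<close>

lemma planar_triangle_exists:
  fixes a b c :: real
  assumes "0 \<le> a" "0 \<le> b" "0 \<le> c" "a \<le> b + c" "b \<le> a + c" "c \<le> a + b"
  obtains x y z :: "real^2" where "dist x y = a" "dist y z = c" "dist z x = b"
proof -
  have norm2: "norm (vector [u, v] :: real^2) = sqrt (u\<^sup>2 + v\<^sup>2)" for u v :: real
    by (simp add: norm_eq_sqrt_inner inner_vec_def sum_2 power2_eq_square)
  have diff2: "(vector [u, v] :: real^2) - vector [u', v'] = vector [u - u', v - v']" for u v u' v' :: real
    by (simp add: vec_eq_iff forall_2)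
  \<comment> \<open>By the law of cosines, the foot of the altitude from \<open>z\<close>. If
    \<open>a = 0\<close> then \<open>b = c\<close>, and \<open>z\<close> is put on the axis at
    distance \<open>b\<close>.\<close>
  define u where "u = (if a = 0 then b else (a\<^sup>2 + b\<^sup>2 - c\<^sup>2) / (2 * a))"
  have ub: "u\<^sup>2 \<le> b\<^sup>2" and uc: "(a - u)\<^sup>2 + (b\<^sup>2 - u\<^sup>2) = c\<^sup>2"
  proof -
    show "u\<^sup>2 \<le> b\<^sup>2"
    proof (cases "a = 0")
      case False
      have "(a - b)\<^sup>2 \<le> c\<^sup>2"
        using assms abs_le_square_iff [of "a - b" c] by auto
      moreover have "c\<^sup>2 \<le> (a + b)\<^sup>2"
        using assms by (intro power_mono) auto
      ultimately have "\<bar>a\<^sup>2 + b\<^sup>2 - c\<^sup>2\<bar> \<le> 2 * a * b"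
        by (simp add: power2_eq_square algebra_simps abs_le_iff)
      then have "\<bar>u\<bar> \<le> b"
        using False assms by (simp add: u_def divide_simps abs_mult) (simp add: algebra_simps)
      then show ?thesis
        by (metis abs_le_square_iff abs_of_nonneg assms(2))
    qed (simp add: u_def)
    show "(a - u)\<^sup>2 + (b\<^sup>2 - u\<^sup>2) = c\<^sup>2"
    proof (cases "a = 0")
      case True
      then show ?thesis using assms by (simp add: u_def)
    next
      case False
      then have "2 * a * u = a\<^sup>2 + b\<^sup>2 - c\<^sup>2" by (simp add: u_def)
      then show ?thesis by (simp add: power2_eq_square algebra_simps)
    qed
  qed
  define v where "v = sqrt (b\<^sup>2 - u\<^sup>2)"
  have v2: "v\<^sup>2 = b\<^sup>2 - u\<^sup>2" using ub by (simp add: v_def)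
  show thesis
  proof (rule that [of "vector [0, 0]" "vector [a, 0]" "vector [u, v]"])
    show "dist (vector [0, 0] :: real^2) (vector [a, 0]) = a"
      using assms by (simp add: dist_norm diff2 norm2)
    show "dist (vector [a, 0] :: real^2) (vector [u, v]) = c"
      using assms uc v2 by (simp add: dist_norm diff2 norm2)
    show "dist (vector [u, v] :: real^2) (vector [0, 0]) = b"
      using assms v2 by (simp add: dist_norm diff2 norm2)
  qed
qed

context CAT0_space
begin

definition geodesic_path :: "(real \<Rightarrow> 'a) \<Rightarrow> 'a \<Rightarrow> 'a \<Rightarrow> bool" where
  "geodesic_path c x y \<longleftrightarrow> c \<in> {0..d x y} \<rightarrow> M \<and> c 0 = x \<and> c (d x y) = y \<and>
          (\<forall>s\<in>{0..d x y}. \<forall>t\<in>{0..d x y}. d (c s) (c t) = \<bar>s - t\<bar>)"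

lemma geodesic_path_segment: "geodesic_path c x y \<Longrightarrow> geodesic_segment (c ` {0..d x y}) x y"
  by (auto simp: geodesic_path_def geodesic_segment_def)

lemma geodesic_path_exists: "x \<in> M \<Longrightarrow> y \<in> M \<Longrightarrow> \<exists>c. geodesic_path c x y"
  using geodesic unfolding geodesic_space_def geodesic_segment_def geodesic_path_def by blast

text \<open>In the comparison triangle, the points with the same parameter \<open>t\<close> on two
  sides are at distance \<open>t\<close> times the third side, by Thales' theorem.\<close>

lemma geodesic_path_thales:
  assumes c: "geodesic_path c x y" and e: "geodesic_path e x z" and xyz: "x \<in> M" "y \<in> M" "z \<in> M"
    and t: "0 \<le> t" "t \<le> 1"
  shows "d (c (t * d x y)) (e (t * d x z)) \<le> t * d y z"
proof -
  have tri: "d x y \<le> d x z + d y z" "d x z \<le> d x y + d y z" "d y z \<le> d x y + d x z"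
    using triangle xyz commute by metis+
  obtain x' y' z' :: "real^2" where x': "dist x' y' = d x y" "dist y' z' = d y z" "dist z' x' = d x z"
    using planar_triangle_exists [of "d x y" "d x z" "d y z"] tri by auto
  obtain r where r: "geodesic_path r y z" using geodesic_path_exists xyz by blast
  define p q where "p = c (t * d x y)" and "q = e (t * d x z)"
  define p' q' where "p' = (1 - t) *\<^sub>R x' + t *\<^sub>R y'" and "q' = (1 - t) *\<^sub>R x' + t *\<^sub>R z'"
  have tle: "t * d x y \<in> {0..d x y}" "t * d x z \<in> {0..d x z}"
    using t by (auto intro: mult_left_le_one_le)
  have zin: "0 \<in> {0..d x y}" "0 \<in> {0..d x z}" by auto
  have px: "d x p = t * d x y" "d x q = t * d x z"
    using c e tle zin t unfolding geodesic_path_def p_def q_def by (metis abs_minus_commute abs_of_nonneg diff_zero mult_nonneg_nonneg nonneg)+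
  have p'seg: "p' \<in> closed_segment x' y'" "q' \<in> closed_segment x' z'"
    unfolding p'_def q'_def closed_segment_def using t by blast+
  have "x' - p' = t *\<^sub>R (x' - y')" "x' - q' = t *\<^sub>R (x' - z')" "p' - q' = t *\<^sub>R (y' - z')"
    by (simp_all add: p'_def q'_def algebra_simps)
  then have dist': "dist x' p' = t * d x y" "dist x' q' = t * d x z" "dist p' q' = t * d y z"
    using t x' by (simp_all add: dist_norm norm_minus_commute)
  have "d p q \<le> dist p' q'"
    using cat0 [unfolded cat0_inequality_def comparison_triangle_def, rule_format, OF xyz,
        of "c ` {0..d x y}" "e ` {0..d x z}" "r ` {0..d y z}" x' y' z' p q p' q']
      geodesic_path_segment [OF c] geodesic_path_segment [OF e] geodesic_path_segment [OF r]
      x' px p'seg dist' tle commute p_def q_def by auto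
  then show ?thesis
    by (simp add: dist' p_def q_def)
qed

text \<open>Rescaling to the unit interval allows geodesics of different lengths to be compared at
  equal parameters. By \<open>geo_unique\<close> the value does not depend on the geodesic
  chosen.\<close>

definition geo :: "'a \<Rightarrow> 'a \<Rightarrow> real \<Rightarrow> 'a" where
  "geo x y t = (SOME c. geodesic_path c x y) (t * d x y)"

lemma geodesic_path_some: "x \<in> M \<Longrightarrow> y \<in> M \<Longrightarrow> geodesic_path (SOME c. geodesic_path c x y) x y"
  using geodesic_path_exists by (rule someI_ex)

text \<open>Thales' inequality for a degenerate triangle, whose two sides from \<open>x\<close> have
  the same end point.\<close>

lemma geo_unique:
  assumes "geodesic_path c x y" "x \<in> M" "y \<in> M" "0 \<le> t" "t \<le> 1"
  shows "c (t * d x y) = geo x y t"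
proof -
  have le: "d (c (t * d x y)) (geo x y t) \<le> t * d y y"
    unfolding geo_def using assms by (intro geodesic_path_thales geodesic_path_some)
  have "t * d x y \<in> {0..d x y}" using assms by (auto intro: mult_left_le_one_le)
  then have "c (t * d x y) \<in> M" "geo x y t \<in> M"
    using assms geodesic_path_some [of x y] unfolding geodesic_path_def geo_def by auto
  moreover have "d (c (t * d x y)) (geo x y t) = 0"
    using le assms by (metis antisym mult_zero_right nonneg mdist_zero)
  ultimately show ?thesis by (metis zero)
qed

lemma geo_closed [simp]:
  assumes "x \<in> M" "y \<in> M" "0 \<le> t" "t \<le> 1"
  shows "geo x y t \<in> M"
proof -
  have "t * d x y \<in> {0..d x y}" using assms by (auto intro: mult_left_le_one_le)
  then show ?thesis
    using geodesic_path_some [of x y] assms unfolding geodesic_path_def geo_def by auto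
qed

lemma geo_0 [simp]: "x \<in> M \<Longrightarrow> y \<in> M \<Longrightarrow> geo x y 0 = x"
  and geo_1 [simp]: "x \<in> M \<Longrightarrow> y \<in> M \<Longrightarrow> geo x y 1 = y"
  using geodesic_path_some [of x y] by (auto simp: geodesic_path_def geo_def)

lemma geo_dist:
  assumes "x \<in> M" "y \<in> M" "0 \<le> s" "s \<le> 1" "0 \<le> t" "t \<le> 1"
  shows "d (geo x y s) (geo x y t) = \<bar>s - t\<bar> * d x y"
proof -
  have "s * d x y \<in> {0..d x y}" "t * d x y \<in> {0..d x y}"
    using assms by (auto intro: mult_left_le_one_le)
  then have "d (geo x y s) (geo x y t) = \<bar>s * d x y - t * d x y\<bar>"
    using geodesic_path_some [of x y] assms unfolding geodesic_path_def geo_def by auto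
  also have "\<dots> = \<bar>s - t\<bar> * d x y"
    by (simp add: abs_mult flip: left_diff_distrib)
  finally show ?thesis .
qed

lemma geo_dist_left: "x \<in> M \<Longrightarrow> y \<in> M \<Longrightarrow> 0 \<le> t \<Longrightarrow> t \<le> 1 \<Longrightarrow> d x (geo x y t) = t * d x y"
  using geo_dist [of x y 0 t] by simp

lemma geo_thales:
  assumes "x \<in> M" "y \<in> M" "z \<in> M" "0 \<le> t" "t \<le> 1"
  shows "d (geo x y t) (geo x z t) \<le> t * d y z"
  unfolding geo_def using assms by (intro geodesic_path_thales geodesic_path_some)

lemma geo_rev:
  assumes xy: "x \<in> M" "y \<in> M" and t: "0 \<le> t" "t \<le> 1"
  shows "geo y x t = geo x y (1 - t)"
proof -
  define c where "c s = geo x y (1 - s / d x y)" for s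
  show ?thesis
  proof (cases "d x y = 0")
    case True
    then have "d (geo y x t) (geo x y (1 - t)) \<le> 0"
      using xy t triangle [of "geo y x t" y "geo x y (1 - t)"] triangle [of y x "geo x y (1 - t)"]
        geo_dist_left [of x y "1 - t"] geo_dist_left [of y x t] commute by auto
    then show ?thesis
      using xy t geo_closed by (metis antisym_conv diff_ge_0_iff_ge diff_le_eq le_add_same_cancel1 nonneg zero)
  next
    case False
    then have pos: "0 < d x y" by (metis nonneg less_le)
    have "geodesic_path c y x"
      unfolding geodesic_path_def c_def commute [of y x]
    proof (intro conjI ballI)
      show "(\<lambda>s. geo x y (1 - s / d x y)) \<in> {0..d x y} \<rightarrow> M"
        using xy pos by auto
      fix s u assume "s \<in> {0..d x y}" "u \<in> {0..d x y}"
      then have "d (geo x y (1 - s / d x y)) (geo x y (1 - u / d x y)) =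
          \<bar>(1 - s / d x y) - (1 - u / d x y)\<bar> * d x y"
        using xy pos by (intro geo_dist) auto
      also have "\<dots> = \<bar>((1 - s / d x y) - (1 - u / d x y)) * d x y\<bar>"
        using pos by (simp add: abs_mult)
      also have "((1 - s / d x y) - (1 - u / d x y)) * d x y = u - s"
        using pos by (simp add: left_diff_distrib)
      also have "\<bar>u - s\<bar> = \<bar>s - u\<bar>" by simp
      finally show "d (geo x y (1 - s / d x y)) (geo x y (1 - u / d x y)) = \<bar>s - u\<bar>" .
    qed (use xy pos in auto)
    from geo_unique [OF this _ _ t] show ?thesis
      using xy pos by (simp add: c_def commute [of y x])
  qed
qed

lemma geo_geo:
  assumes xy: "x \<in> M" "y \<in> M" and s: "0 \<le> s" "s \<le> 1" and t: "0 \<le> t" "t \<le> 1"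
  shows "geo x (geo x y s) t = geo x y (s * t)"
proof -
  define c where "c = (SOME c. geodesic_path c x y)"
  have c: "geodesic_path c x y"
    unfolding c_def using geodesic_path_some xy by blast
  have gy: "geo x y s = c (s * d x y)" by (simp add: geo_def c_def)
  have dxs: "d x (geo x y s) = s * d x y"
    using geo_dist_left xy s by blast
  have sle: "s * d x y \<le> d x y" using s by (auto intro: mult_left_le_one_le)
  have "geodesic_path c x (geo x y s)"
    unfolding geodesic_path_def dxs
    using c sle gy unfolding geodesic_path_def by auto
  from geo_unique [OF this _ _ t] have "geo x (geo x y s) t = c (t * (s * d x y))"
    using xy s dxs by simp
  then show ?thesis
    by (simp add: geo_def c_def mult.assoc mult.left_commute)
qed

text \<open>The diagonal from \<open>x\<close> to \<open>y'\<close> divides the quadrangle into two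
  triangles, to each of which Thales' inequality applies.\<close>

lemma geo_convex:
  assumes "x \<in> M" "y \<in> M" "x' \<in> M" "y' \<in> M" "0 \<le> t" "t \<le> 1"
  shows "d (geo x y t) (geo x' y' t) \<le> (1 - t) * d x x' + t * d y y'"
proof -
  have "d (geo x y t) (geo x' y' t) \<le> d (geo x y t) (geo x y' t) + d (geo x y' t) (geo x' y' t)"
    using assms by (intro triangle) auto
  moreover have "d (geo x y t) (geo x y' t) \<le> t * d y y'"
    using assms by (intro geo_thales)
  moreover have "d (geo x y' t) (geo x' y' t) \<le> (1 - t) * d x x'"
    using assms geo_rev [of y' x t] geo_rev [of y' x' t] geo_thales [of y' x x' "1 - t"] by simp
  ultimately show ?thesis by simp
qed

lemma geo_refl [simp]: "x \<in> M \<Longrightarrow> 0 \<le> t \<Longrightarrow> t \<le> 1 \<Longrightarrow> geo x x t = x"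
  using geo_dist_left [of x x t] geo_closed [of x x t] by (metis mdist_zero mult_zero_right zero)

section \<open>Convex sets and homotopies along geodesics\<close>

definition cvx :: "'a set \<Rightarrow> bool" where
  "cvx S \<longleftrightarrow> S \<subseteq> M \<and> (\<forall>x\<in>S. \<forall>y\<in>S. \<forall>t. 0 \<le> t \<and> t \<le> 1 \<longrightarrow> geo x y t \<in> S)"

lemma cvx_geo: "cvx S \<Longrightarrow> x \<in> S \<Longrightarrow> y \<in> S \<Longrightarrow> 0 \<le> t \<Longrightarrow> t \<le> 1 \<Longrightarrow> geo x y t \<in> S"
  by (simp add: cvx_def)

lemma dist_geo_le_max:
  assumes "x \<in> M" "y \<in> M" "z \<in> M" "0 \<le> t" "t \<le> 1"
  shows "d z (geo x y t) \<le> max (d z x) (d z y)"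
proof -
  have "d z (geo x y t) \<le> (1 - t) * d z x + t * d z y"
    using geo_convex [of z z x y t] assms by simp
  also have "\<dots> \<le> (1 - t) * max (d z x) (d z y) + t * max (d z x) (d z y)"
    using assms by (intro add_mono mult_left_mono) auto
  finally show ?thesis by (simp add: algebra_simps)
qed

lemma cvx_M: "cvx M"
  by (simp add: cvx_def)

lemma cvx_mball: "cvx (mball z r)"
  unfolding cvx_def using dist_geo_le_max [of _ _ z] by (fastforce simp: max_def split: if_splits)

lemma cvx_mcball: "cvx (mcball z r)"
  unfolding cvx_def using dist_geo_le_max [of _ _ z] by (fastforce simp: max_def split: if_splits)

definition chull :: "'a set \<Rightarrow> 'a set" where
  "chull S = \<Inter> {T. cvx T \<and> S \<subseteq> T}"

lemma cvx_chull: "S \<subseteq> M \<Longrightarrow> cvx (chull S)"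
  unfolding chull_def cvx_def using cvx_M by (auto simp: cvx_def)

lemma chull_minimal: "cvx T \<Longrightarrow> S \<subseteq> T \<Longrightarrow> chull S \<subseteq> T"
  unfolding chull_def by blast

lemma chull_superset: "S \<subseteq> chull S"
  unfolding chull_def by blast

lemma chull_mono: "S \<subseteq> T \<Longrightarrow> chull S \<subseteq> chull T"
  unfolding chull_def by blast

text \<open>Points are moved along geodesics, which by \<open>geo_convex\<close> depend continuously
  on both end points.\<close>

lemma geodesic_homotopy:
  assumes S: "S \<subseteq> M"
    and f: "continuous_map (subtopology mtopology S) (subtopology mtopology S) f"
    and g: "continuous_map (subtopology mtopology S) (subtopology mtopology S) g"
    and fg: "\<And>x t. x \<in> S \<Longrightarrow> 0 \<le> t \<Longrightarrow> t \<le> 1 \<Longrightarrow> geo (f x) (g x) t \<in> S"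
  shows "homotopic_with (\<lambda>x. True) (subtopology mtopology S) (subtopology mtopology S) f g"
proof -
  let ?S = "subtopology mtopology S"
  have topS: "topspace ?S = S" using S by auto
  have fS: "f x \<in> S" "g x \<in> S" "f x \<in> M" "g x \<in> M" if "x \<in> S" for x
    using f g that S by (auto simp: continuous_map_def topS)
  define h where "h = (\<lambda>(t, x). geo (f x) (g x) t)"
  let ?P = "prod_topology (top_of_set {0..1::real}) ?S"
  have "continuous_map ?P mtopology h"
    unfolding continuous_map_to_metric
  proof (intro ballI allI impI)
    fix tx and e :: real assume "tx \<in> topspace ?P" and e: "0 < e"
    then obtain t x where tx: "tx = (t, x)" "0 \<le> t" "t \<le> 1" "x \<in> S"
      using topS by auto
    \<comment> \<open>The summand 1 keeps \<open>D\<close> positive when the two images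
      coincide.\<close>
    define D where "D = d (f x) (g x) + 1"
    have D: "0 < D" "d (f x) (g x) \<le> D" by (simp_all add: D_def add_nonneg_pos)
    define U where "U = {s \<in> {0..1}. \<bar>t - s\<bar> < e / (2 * D)}"
    define V where "V = {y \<in> S. f y \<in> mball (f x) (e/2)} \<inter> {y \<in> S. g y \<in> mball (g x) (e/2)}"
    have "U = {0..1} \<inter> ball t (e / (2 * D))"
      by (auto simp: U_def dist_real_def)
    then have "openin (top_of_set {0..1}) U"
      by (simp add: openin_open_Int)
    moreover have "openin ?S V"
    proof -
      have "continuous_map ?S mtopology f" "continuous_map ?S mtopology g"
        using f g by (auto simp: continuous_map_in_subtopology)
      then show ?thesis
        unfolding V_def using openin_continuous_map_preimage [of ?S mtopology _ "mball _ (e/2)", OF _ openin_mball, unfolded topS]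
        by (intro openin_Int) blast+
    qed
    ultimately have "openin ?P (U \<times> V)"
      by (simp add: openin_prod_Times_iff)
    moreover have "tx \<in> U \<times> V"
      using tx e D fS by (auto simp: U_def V_def)
    moreover have "h sy \<in> mball (h tx) e" if sy': "sy \<in> U \<times> V" for sy
    proof -
      obtain s y where sy: "sy = (s, y)" "0 \<le> s" "s \<le> 1" "\<bar>t - s\<bar> < e / (2 * D)" "y \<in> S"
        "d (f x) (f y) < e/2" "d (g x) (g y) < e/2"
        using sy' by (cases sy) (auto simp: U_def V_def)
      note M = fS [OF \<open>x \<in> S\<close>] fS [OF \<open>y \<in> S\<close>]
      have "d (geo (f x) (g x) t) (geo (f y) (g y) s) \<le>
          d (geo (f x) (g x) t) (geo (f x) (g x) s) + d (geo (f x) (g x) s) (geo (f y) (g y) s)"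
        using M sy tx by (intro triangle) auto
      also have "d (geo (f x) (g x) t) (geo (f x) (g x) s) = \<bar>t - s\<bar> * d (f x) (g x)"
        using M sy tx by (intro geo_dist) auto
      also have "\<dots> \<le> \<bar>t - s\<bar> * D"
        using D by (intro mult_left_mono) auto
      also have "\<dots> < e / 2"
        using sy(4) D by (simp add: field_simps)
      also have "d (geo (f x) (g x) s) (geo (f y) (g y) s) \<le> (1 - s) * d (f x) (f y) + s * d (g x) (g y)"
        using M sy by (intro geo_convex) auto
      also have "\<dots> \<le> (1 - s) * (e/2) + s * (e/2)"
        using sy by (intro add_mono mult_left_mono) auto
      also have "\<dots> = e / 2" by (simp flip: distrib_right)
      finally show ?thesis
        using M sy tx by (simp add: h_def)
    qed
    ultimately show "\<exists>U. openin ?P U \<and> tx \<in> U \<and> (\<forall>y\<in>U. h y \<in> mball (h tx) e)"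
      by blast
  qed
  then have "continuous_map ?P ?S h"
    using fg topS by (auto simp: continuous_map_in_subtopology h_def)
  then show ?thesis
    using fS by (subst homotopic_with) (auto simp: topS h_def intro!: exI [of _ h])
qed

lemma contractible_cvx:
  assumes "cvx S"
  shows "contractible_space (subtopology mtopology S)"
proof (cases "S = {}")
  case False
  then obtain a where a: "a \<in> S" by blast
  have S: "S \<subseteq> M" using assms by (simp add: cvx_def)
  have "homotopic_with (\<lambda>x. True) (subtopology mtopology S) (subtopology mtopology S) id (\<lambda>x. a)"
    using assms a S by (intro geodesic_homotopy) (auto intro: cvx_geo)
  then show ?thesis by (auto simp: contractible_space_def)
qed (simp add: contractible_space_empty)

lemma exact_on_cvx: "cvx S \<Longrightarrow> S \<noteq> {} \<Longrightarrow> exact_on sbd (sing (subtopology mtopology S))"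
  by (intro exact_on_contractible contractible_cvx) (auto simp: cvx_def)

section \<open>Radial projection onto a ball\<close>

definition proj :: "'a \<Rightarrow> real \<Rightarrow> 'a \<Rightarrow> 'a" where
  "proj p r x = geo p x (min 1 (r / d p x))"

context
  fixes p :: 'a and r :: real
  assumes p: "p \<in> M" and r: "0 \<le> r"
begin

lemma proj_param: "0 \<le> min 1 (r / d p x)" "min 1 (r / d p x) \<le> 1"
  using r by auto

lemma proj_closed [simp]: "x \<in> M \<Longrightarrow> proj p r x \<in> M"
  unfolding proj_def by (intro geo_closed p proj_param)

text \<open>Within the ball the parameter is cut off at 1. For \<open>x = p\<close> the quotient is
  a division by zero with value 0, which gives \<open>p\<close> all the same.\<close>

lemma proj_eq: "x \<in> M \<Longrightarrow> d p x \<le> r \<Longrightarrow> proj p r x = x"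
  using p r by (cases "d p x = 0") (auto simp: proj_def min_def divide_simps)

lemma dist_proj: "x \<in> M \<Longrightarrow> d p (proj p r x) = min (d p x) r"
proof -
  assume x: "x \<in> M"
  have "d p (proj p r x) = min 1 (r / d p x) * d p x"
    unfolding proj_def using p x proj_param by (intro geo_dist_left)
  also have "\<dots> = min (d p x) r"
  proof (cases "d p x = 0")
    case False
    then have "0 < d p x" by (metis nonneg less_le)
    then show ?thesis by (auto simp: min_def divide_simps)
  qed (use r in simp)
  finally show ?thesis .
qed

text \<open>If \<open>x\<close> is the farther point, contract both points by the parameter of
  \<open>x\<close>, which does not increase their distance, and then slide along the geodesic to
  \<open>y\<close> by at most \<open>d p x - d p y\<close>. The constant 2 is not optimal, but the
  later estimates allow for it.\<close>

lemma proj_lipschitz: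
  assumes x: "x \<in> M" and y: "y \<in> M"
  shows "d (proj p r x) (proj p r y) \<le> 2 * d x y"
proof -
  have *: "d (proj p r x) (proj p r y) \<le> 2 * d x y" if xy: "x \<in> M" "y \<in> M" and le: "d p y \<le> d p x" for x y
  proof -
    define s t where "s = min 1 (r / d p x)" and "t = min 1 (r / d p y)"
    have st: "0 \<le> s" "s \<le> 1" "0 \<le> t" "t \<le> 1" using r by (auto simp: s_def t_def)
    have "d (geo p x s) (geo p y t) \<le> d (geo p x s) (geo p y s) + d (geo p y s) (geo p y t)"
      using st p xy by (intro triangle) auto
    moreover have "d (geo p x s) (geo p y s) \<le> s * d x y"
      using st p xy by (intro geo_thales)
    moreover have "s * d x y \<le> 1 * d x y"
      using st by (intro mult_right_mono) auto
    moreover have "d (geo p y s) (geo p y t) = \<bar>s - t\<bar> * d p y"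
      using st p xy by (intro geo_dist)
    moreover have "\<bar>s - t\<bar> * d p y \<le> d p x - d p y"
    proof (cases "d p y = 0")
      case False
      then have b: "0 < d p y" by (metis nonneg less_le)
      then have a: "0 < d p x" using le by simp
      consider "d p x \<le> r" | "r < d p x" "d p y \<le> r" | "r < d p y" by linarith
      then show ?thesis
      proof cases
        case 1
        then have "s = 1" "t = 1" using a b le by (auto simp: s_def t_def)
        then show ?thesis using le by simp
      next
        case 2
        then have st': "s = r / d p x" "t = 1" using a b le by (auto simp: s_def t_def)
        then have "\<bar>s - t\<bar> * d p y = (1 - r / d p x) * d p y"
          using st by simp
        also have "\<dots> \<le> (1 - d p y / d p x) * d p y"
          using 2 a b by (intro mult_right_mono diff_left_mono divide_right_mono) auto
        also have "\<dots> = (d p x - d p y) * (d p y / d p x)"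
          using a by (simp add: field_simps)
        also have "\<dots> \<le> (d p x - d p y) * 1"
          using a b le by (intro mult_left_mono) auto
        finally show ?thesis by simp
      next
        case 3
        then have st': "s = r / d p x" "t = r / d p y" using a b le by (auto simp: s_def t_def)
        have "s \<le> t" unfolding st' using a b le r by (intro divide_left_mono) auto
        then have "\<bar>s - t\<bar> * d p y = (r / d p y - r / d p x) * d p y"
          using st' by simp
        also have "\<dots> = (d p x - d p y) * (r / d p x)"
          using a b by (simp add: field_simps)
        also have "\<dots> \<le> (d p x - d p y) * 1"
          using a b le 3 by (intro mult_left_mono) auto
        finally show ?thesis by simp
      qed
    qed (use le in simp)
    moreover have "d p x \<le> d p y + d x y"
      using triangle [of p y x] p xy commute by simp
    ultimately show ?thesis
      unfolding proj_def s_def t_def by linarith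
  qed
  show ?thesis
  proof (cases "d p y \<le> d p x")
    case True
    then show ?thesis using * x y by blast
  next
    case False
    then show ?thesis using * [of y x] x y by (simp add: commute)
  qed
qed

lemma proj_geo:
  assumes x: "x \<in> M" and s: "0 \<le> s" "s \<le> 1" "r \<le> s * d p x"
  shows "proj p r (geo p x s) = proj p r x"
proof (cases "s * d p x = 0")
  case True
  then have "r = 0" using s(3) r by linarith
  then show ?thesis using p x s by (simp add: proj_def)
next
  case False
  then have pos: "0 < s" "0 < d p x" using s nonneg [of p x] by (auto simp: less_le)
  have ds: "d p (geo p x s) = s * d p x" using p x s by (intro geo_dist_left)
  have le1: "r / (s * d p x) \<le> 1" using pos s by simp
  have "s * d p x \<le> 1 * d p x" using s pos by (intro mult_right_mono) auto
  then have "r \<le> d p x" using s(3) by linarith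
  then have le2: "r / d p x \<le> 1" using pos by simp
  have "proj p r (geo p x s) = geo p (geo p x s) (r / (s * d p x))"
    using le1 by (simp add: proj_def ds)
  also have "\<dots> = geo p x (s * (r / (s * d p x)))"
    using p x s le1 r pos by (intro geo_geo) auto
  also have "\<dots> = proj p r x"
    using le2 pos by (simp add: proj_def)
  finally show ?thesis .
qed

lemma proj_proj:
  assumes x: "x \<in> M" and R: "r \<le> R"
  shows "proj p r (proj p R x) = proj p r x"
proof (cases "d p x \<le> R")
  case True
  then show ?thesis
    using x p r R by (cases "d p x = 0") (auto simp: proj_def min_def divide_simps)
next
  case False
  then have pos: "0 < d p x" using R r by linarith
  have "proj p R x = geo p x (R / d p x)" using False pos by (auto simp: proj_def)
  then show ?thesis
    using proj_geo [OF x, of "R / d p x"] False pos r R by simp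
qed

text \<open>For \<open>x\<close> outside the ball, the geodesic to its projection is the outer part
  of the geodesic from \<open>p\<close> to \<open>x\<close>, all of whose points project to the same
  point.\<close>

lemma proj_homotopy_path:
  assumes x: "x \<in> M" and t: "0 \<le> t" "t \<le> 1"
  shows "proj p r (geo x (proj p r x) t) = proj p r x"
proof (cases "d p x \<le> r")
  case True
  then show ?thesis using x t proj_eq by simp
next
  case False
  then have pos: "0 < d p x" using r by linarith
  define s where "s = r / d p x"
  have s: "0 \<le> s" "s \<le> 1" "s * d p x = r" using False pos r by (auto simp: s_def)
  have px: "proj p r x = geo p x s" using False pos s by (auto simp: proj_def s_def)
  have "geo x (geo p x s) t = geo x (geo x p (1 - s)) t"
    using geo_rev [of x p s] p x s by simp
  also have "\<dots> = geo x p ((1 - s) * t)"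
    using p x s t by (intro geo_geo) auto
  also have "\<dots> = geo p x (1 - (1 - s) * t)"
    using p x s t by (intro geo_rev) (auto simp: mult_le_one)
  finally have *: "geo x (geo p x s) t = geo p x (1 - (1 - s) * t)" .
  have "(1 - s) * t \<le> 1 - s" using s t by (simp add: mult_left_le)
  then have "s \<le> 1 - (1 - s) * t" by simp
  then have "r \<le> (1 - (1 - s) * t) * d p x"
    using mult_right_mono [of s "1 - (1 - s) * t" "d p x"] s pos by simp
  moreover have "0 \<le> 1 - (1 - s) * t" "1 - (1 - s) * t \<le> 1"
    using s t by (auto simp: mult_le_one)
  ultimately show ?thesis
    unfolding px * using proj_geo x px by simp
qed

lemma continuous_map_proj: "continuous_map mtopology mtopology (proj p r)"
  unfolding continuous_map_to_metric
proof (intro ballI allI impI)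
  fix x and e :: real assume x: "x \<in> topspace mtopology" and e: "0 < e"
  have "proj p r y \<in> mball (proj p r x) e" if "y \<in> mball x (e/2)" for y
    using proj_lipschitz [of x y] that by auto
  then show "\<exists>U. openin mtopology U \<and> x \<in> U \<and> (\<forall>y\<in>U. proj p r y \<in> mball (proj p r x) e)"
    using x e by (intro exI [of _ "mball x (e/2)"]) auto
qed

text \<open>Sliding inwards towards \<open>p\<close> retracts the preimage onto \<open>H\<close>
  without changing projections; then the convex set \<open>H\<close> is contracted along its
  geodesics.\<close>

lemma contractible_proj_vimage:
  assumes H: "cvx H" "H \<subseteq> mcball p r" "H \<noteq> {}"
  shows "contractible_space (subtopology mtopology {x \<in> M. proj p r x \<in> H})"
proof -
  let ?T = "{x \<in> M. proj p r x \<in> H}"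
  let ?X = "subtopology mtopology ?T"
  obtain a where a: "a \<in> H" using H by blast
  have HT: "H \<subseteq> ?T"
    using H proj_eq by auto
  then have aM: "a \<in> ?T" using a by auto
  have "proj p r (proj p r x) = proj p r x" if "x \<in> ?T" for x
    using that HT proj_proj by auto
  then have pc: "continuous_map ?X ?X (proj p r)"
    using continuous_map_from_subtopology [OF continuous_map_proj] by (auto simp: continuous_map_in_subtopology)
  have "homotopic_with (\<lambda>x. True) ?X ?X id (proj p r)"
    using pc by (intro geodesic_homotopy) (auto simp: proj_homotopy_path proj_param)
  moreover have "homotopic_with (\<lambda>x. True) ?X ?X (proj p r) (\<lambda>x. a)"
    using pc aM HT a H by (intro geodesic_homotopy) (auto intro: cvx_geo subsetD [OF HT])
  ultimately have "homotopic_with (\<lambda>x. True) ?X ?X id (\<lambda>x. a)"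
    by (rule homotopic_with_trans)
  then show ?thesis by (auto simp: contractible_space_def)
qed

end

end

section \<open>Rays and the cone topology\<close>

locale proper_CAT0_space = CAT0_space +
  assumes proper: proper_space
begin

lemma dist_proj_proj:
  assumes "p \<in> M" "x \<in> M" "0 \<le> s" "s \<le> d p x" "0 \<le> t" "t \<le> d p x"
  shows "d (proj p s x) (proj p t x) = \<bar>s - t\<bar>"
proof (cases "d p x = 0")
  case True
  then have "s = 0" "t = 0" using assms by auto
  then show ?thesis using assms by simp
next
  case False
  then have pos: "0 < d p x" by (metis nonneg less_le)
  have "d (proj p s x) (proj p t x) = \<bar>s / d p x - t / d p x\<bar> * d p x"
    using assms pos by (simp add: proj_def geo_dist)
  also have "\<dots> = \<bar>(s / d p x - t / d p x) * d p x\<bar>"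
    using pos by (simp add: abs_mult)
  also have "\<dots> = \<bar>s - t\<bar>" using pos by (simp add: left_diff_distrib)
  finally show ?thesis .
qed

text \<open>An Arzela-Ascoli argument: by properness the projections to each integer radius
  subconverge, and a diagonal subsequence serves all radii. The points leave every ball, so the
  limit has unit speed at all times.\<close>

lemma proj_limit:
  assumes p: "p \<in> M" and x: "\<And>n. x n \<in> M" "\<And>n::nat. real n \<le> d p (x n)"
  obtains r :: "nat \<Rightarrow> nat" and c where "strict_mono r" "geodesic_ray c" "c 0 = p"
    "\<And>s. 0 \<le> s \<Longrightarrow> limitin mtopology (\<lambda>n. proj p s (x (r n))) (c s) sequentially"
proof -
  define P where "P \<equiv> \<lambda>k (r :: nat \<Rightarrow> nat). \<exists>l. limitin mtopology (\<lambda>n. proj p (real k) (x (r n))) l sequentially"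
  interpret subseqs P
  proof
    fix k and s :: "nat \<Rightarrow> nat" assume "strict_mono s"
    define y where "y n = proj p (real k) (x (s n))" for n
    have "range y \<subseteq> mcball p (real k)"
      using p x dist_proj [OF p, of "real k"] by (auto simp: y_def)
    moreover have "compactin mtopology (mcball p (real k))"
      using proper p by (simp add: proper_space_def)
    ultimately obtain l r where "strict_mono r" "limitin mtopology (y \<circ> r) l sequentially"
      unfolding compactin_sequentially by blast
    then show "\<exists>r'. strict_mono r' \<and> P k (s \<circ> r')"
      by (auto simp: P_def y_def o_def)
  qed
  define r where "r = diagseq"
  have r: "strict_mono r" by (simp add: r_def subseq_diagseq)
  have "P k (diagseq \<circ> (+) (Suc k))" for k
  proof (rule diagseq_holds)
    fix k and r s :: "nat \<Rightarrow> nat" assume r: "strict_mono r" and "P k s"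
    then obtain l where "limitin mtopology (\<lambda>n. proj p (real k) (x (s n))) l sequentially"
      by (auto simp: P_def)
    from limitin_subsequence [OF r this] show "P k (s \<circ> r)"
      by (auto simp: P_def o_def)
  qed
  then have "\<exists>l. limitin mtopology (\<lambda>n. proj p (real k) (x (r (Suc k + n)))) l sequentially" for k
    by (simp add: P_def r_def o_def)
  then obtain l where l: "\<And>k. limitin mtopology (\<lambda>n. proj p (real k) (x (r (Suc k + n)))) (l k) sequentially"
    by metis
  have lim: "\<exists>N. \<forall>n\<ge>N. d (proj p (real k) (x (r n))) (l k) < e" if "0 < e" for k e
  proof -
    obtain N where N: "\<And>n. n \<ge> N \<Longrightarrow> d (proj p (real k) (x (r (Suc k + n)))) (l k) < e"
      using l [of k] \<open>0 < e\<close> unfolding limitin_metric eventually_sequentially by blast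
    have "d (proj p (real k) (x (r n))) (l k) < e" if "n \<ge> Suc k + N" for n
      using N [of "n - Suc k"] that by simp
    then show ?thesis by blast
  qed
  have lM: "l k \<in> M" for k using l [of k] by (simp add: limitin_metric)
  \<comment> \<open>Other radii are reached by projecting the limit at the next integer
    radius.\<close>
  define c where "c s = proj p s (l (nat \<lceil>s\<rceil>))" for s
  have clim: "\<exists>N. \<forall>n\<ge>N. d (proj p s (x (r n))) (c s) < e" if s: "0 \<le> s" and e: "0 < e" for s e
  proof -
    define k where "k = nat \<lceil>s\<rceil>"
    have sk: "s \<le> real k" by (simp add: k_def real_nat_ceiling_ge)
    obtain N where N: "\<And>n. n \<ge> N \<Longrightarrow> d (proj p (real k) (x (r n))) (l k) < e / 2"
      using lim [of "e/2" k] e by auto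
    have "d (proj p s (x (r n))) (c s) < e" if "n \<ge> N" for n
    proof -
      have "d (proj p s (proj p (real k) (x (r n)))) (proj p s (l k)) \<le> 2 * d (proj p (real k) (x (r n))) (l k)"
        using p s lM x by (intro proj_lipschitz) auto
      also have "proj p s (proj p (real k) (x (r n))) = proj p s (x (r n))"
        using p s sk x by (intro proj_proj) auto
      finally show ?thesis
        using N [OF that] by (simp add: c_def k_def)
    qed
    then show ?thesis by blast
  qed
  have cM: "c s \<in> M" if "0 \<le> s" for s
    using p that lM by (simp add: c_def)
  have rn: "n \<le> r n" for n
    using r by (rule seq_suble)
  have iso: "d (c s) (c t) = \<bar>s - t\<bar>" if s: "0 \<le> s" and t: "0 \<le> t" for s t
  proof -
    have "\<bar>d (c s) (c t) - \<bar>s - t\<bar>\<bar> \<le> e" if e: "0 < e" for e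
    proof -
      obtain N1 N2 where N: "\<forall>n\<ge>N1. d (proj p s (x (r n))) (c s) < e / 2"
        "\<forall>n\<ge>N2. d (proj p t (x (r n))) (c t) < e / 2"
        using clim [OF s, of "e/2"] clim [OF t, of "e/2"] e by auto
      define n where "n = max (max N1 N2) (nat \<lceil>max s t\<rceil>)"
      have "max s t \<le> real n"
        using real_nat_ceiling_ge [of "max s t"] by (auto simp: n_def of_nat_max le_max_iff_disj)
      also have "\<dots> \<le> real (r n)" using rn by simp
      also have "\<dots> \<le> d p (x (r n))" by (rule x)
      finally have st: "d (proj p s (x (r n))) (proj p t (x (r n))) = \<bar>s - t\<bar>"
        using s t p x by (intro dist_proj_proj) auto
      define a b where "a = proj p s (x (r n))" and "b = proj p t (x (r n))"
      have ab: "a \<in> M" "b \<in> M" "c s \<in> M" "c t \<in> M" using p x s t cM by (auto simp: a_def b_def)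
      have "d a (c s) < e/2" "d b (c t) < e/2" using N by (auto simp: a_def b_def n_def)
      moreover have "d a b \<le> d a (c s) + d (c s) (c t) + d b (c t)"
        using triangle [of a "c s" b] triangle [of "c s" "c t" b] ab commute by auto
      moreover have "d (c s) (c t) \<le> d a (c s) + d a b + d b (c t)"
        using triangle [of "c s" a "c t"] triangle [of a b "c t"] ab commute by auto
      ultimately show ?thesis using st unfolding a_def b_def by linarith
    qed
    then have "\<bar>d (c s) (c t) - \<bar>s - t\<bar>\<bar> \<le> 0"
      by (meson field_le_epsilon add_0 le_add_same_cancel1 order_trans dense_le_bounded linorder_not_le dense)
    then show ?thesis by simp
  qed
  show thesis
  proof (rule that [OF r])
    show "geodesic_ray c" using cM iso by (auto simp: geodesic_ray_def)
    show "c 0 = p"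
      using p lM by (simp add: c_def proj_def)
    show "limitin mtopology (\<lambda>n. proj p s (x (r n))) (c s) sequentially" if "0 \<le> s" for s
      unfolding limitin_metric eventually_sequentially using clim [OF that] cM [OF that] p x that by auto
  qed
qed

lemma ray_closed: "geodesic_ray c \<Longrightarrow> 0 \<le> t \<Longrightarrow> c t \<in> M"
  by (auto simp: geodesic_ray_def)

lemma ray_dist: "geodesic_ray c \<Longrightarrow> 0 \<le> s \<Longrightarrow> 0 \<le> t \<Longrightarrow> d (c s) (c t) = \<bar>s - t\<bar>"
  by (auto simp: geodesic_ray_def)

lemma ray_geo:
  assumes c: "geodesic_ray c" and u: "0 \<le> u" "u \<le> 1" and t: "0 \<le> t"
  shows "geo (c 0) (c t) u = c (u * t)"
proof -
  have dt: "d (c 0) (c t) = t" using ray_dist [OF c, of 0 t] t by simp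
  have "geodesic_path c (c 0) (c t)"
    using c t unfolding geodesic_path_def dt by (auto simp: ray_dist ray_closed)
  from geo_unique [OF this _ _ u] show ?thesis
    using c t by (simp add: dt ray_closed)
qed

lemma ray_proj:
  assumes c: "geodesic_ray c" and s: "0 \<le> s" "s \<le> t"
  shows "proj (c 0) s (c t) = c s"
proof (cases "t = 0")
  case True
  then show ?thesis using c s by (simp add: proj_def ray_closed)
next
  case False
  then have "d (c 0) (c t) = t" using ray_dist [OF c, of 0 t] s by simp
  then show ?thesis
    using ray_geo [OF c, of "s / t" t] s False by (simp add: proj_def)
qed

lemma ray_thales:
  assumes c: "geodesic_ray c" and c': "geodesic_ray c'" and 0: "c 0 = c' 0" and rs: "0 \<le> r" "r \<le> s" "0 < s"
  shows "d (c r) (c' r) \<le> (r / s) * d (c s) (c' s)"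
  using geo_thales [of "c 0" "c s" "c' s" "r / s"] ray_geo [OF c, of "r / s" s] ray_geo [OF c', of "r / s" s]
    rs 0 ray_closed [OF c] ray_closed [OF c'] by simp

section \<open>Asymptotic rays and points of the boundary\<close>

lemma asymptoticD:
  assumes "(c, c') \<in> asymptotic"
  obtains K where "geodesic_ray c" "geodesic_ray c'" "\<And>t. 0 \<le> t \<Longrightarrow> d (c t) (c' t) \<le> K" "0 < K"
proof -
  obtain K where K: "geodesic_ray c" "geodesic_ray c'" "\<And>t. 0 \<le> t \<Longrightarrow> d (c t) (c' t) \<le> K"
    using assms by (auto simp: asymptotic_def)
  show thesis
    by (rule that [of "max K 1"]) (use K in \<open>auto simp: le_max_iff_disj\<close>)
qed

lemma asymptotic_refl: "geodesic_ray c \<Longrightarrow> (c, c) \<in> asymptotic"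
  unfolding asymptotic_def using ray_dist [of c] by (auto intro!: exI [of _ 0])

lemma asymptotic_sym: "(c, c') \<in> asymptotic \<Longrightarrow> (c', c) \<in> asymptotic"
  unfolding asymptotic_def by (auto simp: commute)

lemma asymptotic_trans:
  assumes "(c, c') \<in> asymptotic" "(c', c'') \<in> asymptotic"
  shows "(c, c'') \<in> asymptotic"
proof -
  obtain K where K: "geodesic_ray c" "geodesic_ray c'" "\<And>t. 0 \<le> t \<Longrightarrow> d (c t) (c' t) \<le> K"
    using assms(1) by (rule asymptoticD) blast
  obtain L where L: "geodesic_ray c''" "\<And>t. 0 \<le> t \<Longrightarrow> d (c' t) (c'' t) \<le> L"
    using assms(2) by (rule asymptoticD) blast
  have "d (c t) (c'' t) \<le> K + L" if "0 \<le> t" for t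
    using triangle [of "c t" "c' t" "c'' t"] K L that by (fastforce simp: ray_closed)
  then show ?thesis using K L by (auto simp: asymptotic_def)
qed

text \<open>The distance of two rays is a convex function of time; being bounded, it cannot
  increase. The estimate interpolates between time 0 and a large time \<open>T\<close>.\<close>

lemma asymptotic_dist_le:
  assumes "(c, c') \<in> asymptotic" and t: "0 \<le> t"
  shows "d (c t) (c' t) \<le> d (c 0) (c' 0)"
proof (rule field_le_epsilon)
  fix e :: real assume e: "0 < e"
  obtain K where K: "geodesic_ray c" "geodesic_ray c'" "\<And>t. 0 \<le> t \<Longrightarrow> d (c t) (c' t) \<le> K" "0 < K"
    using assms(1) by (rule asymptoticD) blast
  define T where "T = max (t + 1) (t * K / e)"
  have T: "0 < T" "t \<le> T" using t by (auto simp: T_def)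
  have "t * K / e \<le> T" by (simp add: T_def)
  then have small: "(t / T) * K \<le> e" using e T by (simp add: field_simps)
  have u: "0 \<le> t / T" "t / T \<le> 1" using t T by auto
  have "d (c t) (c' t) = d (geo (c 0) (c T) (t / T)) (geo (c' 0) (c' T) (t / T))"
    using ray_geo [OF K(1) u, of T] ray_geo [OF K(2) u, of T] T by simp
  also have "\<dots> \<le> (1 - t / T) * d (c 0) (c' 0) + (t / T) * d (c T) (c' T)"
    using K u T by (intro geo_convex) (auto simp: ray_closed)
  also have "\<dots> \<le> 1 * d (c 0) (c' 0) + (t / T) * K"
    using K u T by (intro add_mono mult_right_mono mult_left_mono) auto
  finally show "d (c t) (c' t) \<le> d (c 0) (c' 0) + e" using small by simp
qed

text \<open>The new ray is a limit of geodesics from \<open>p\<close> to points far out on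
  \<open>c\<close>.\<close>

lemma asymptotic_ray_exists:
  assumes c: "geodesic_ray c" and p: "p \<in> M"
  obtains c' where "(c, c') \<in> asymptotic" "c' 0 = p"
proof -
  define q where "q = c 0"
  define D where "D = d p q"
  have q: "q \<in> M" using c by (simp add: q_def ray_closed)
  have D: "0 \<le> D" by (simp add: D_def)
  \<comment> \<open>The offset \<open>D\<close> makes \<open>x n\<close> at least \<open>n\<close>
    away from \<open>p\<close>.\<close>
  define T where "T n = real n + D" for n
  define x where "x n = c (T n)" for n
  have T: "0 \<le> T n" for n using D by (simp add: T_def)
  have xM: "x n \<in> M" for n using c T by (simp add: x_def ray_closed)
  have dq: "d q (x n) = T n" for n using ray_dist [OF c, of 0 "T n"] T by (simp add: q_def x_def)
  have dpT: "\<bar>T n - d p (x n)\<bar> \<le> D" for n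
    using triangle [of q p "x n"] triangle [of p q "x n"] p q xM dq commute by (auto simp: D_def abs_le_iff)
  then have "real n \<le> d p (x n)" for n
    using dpT [of n] by (simp add: T_def abs_le_iff)
  then obtain r c' where r: "strict_mono (r :: nat \<Rightarrow> nat)" and c': "geodesic_ray c'" "c' 0 = p"
    and lim: "\<And>s. 0 \<le> s \<Longrightarrow> limitin mtopology (\<lambda>n. proj p s (x (r n))) (c' s) sequentially"
    using proj_limit [OF p, of x] xM by metis
  \<comment> \<open>One \<open>D\<close> pays for the change of base point of the geodesic, one for
    its different parametrisation, and 1 for the approximation of \<open>c'\<close>.\<close>
  have "d (c s) (c' s) \<le> 2 * D + 1" if s: "0 \<le> s" for s
  proof -
    obtain N where N: "\<And>n. n \<ge> N \<Longrightarrow> d (proj p s (x (r n))) (c' s) < 1"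
      using lim [OF s] unfolding limitin_metric eventually_sequentially by (metis zero_less_one)
    define n where "n = r (max N (nat \<lceil>s + 1\<rceil>))"
    have "s + 1 \<le> real (max N (nat \<lceil>s + 1\<rceil>))"
      using real_nat_ceiling_ge [of "s + 1"] by (simp add: le_max_iff_disj)
    also have "\<dots> \<le> real n"
      unfolding n_def using seq_suble [OF r] by simp
    also have "\<dots> \<le> d p (x n)" by fact
    finally have sd: "s + 1 \<le> d p (x n)" .
    have near: "d (proj p s (x n)) (c' s) < 1" using N by (simp add: n_def)
    define u where "u = s / d p (x n)"
    have u: "0 \<le> u" "u \<le> 1" "u * d p (x n) = s" using s sd by (auto simp: u_def)
    have pr: "proj p s (x n) = geo p (x n) u" using u by (simp add: proj_def u_def)
    have "d (geo p (x n) u) (geo q (x n) u) \<le> (1 - u) * d p q"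
      using geo_convex [of p "x n" q "x n" u] u p q xM by simp
    also have "\<dots> \<le> 1 * D" unfolding D_def using u by (intro mult_right_mono) auto
    finally have 1: "d (proj p s (x n)) (geo q (x n) u) \<le> D" by (simp add: pr)
    have gq: "geo q (x n) u = c (u * T n)"
      using ray_geo [OF c u(1,2) T] by (simp add: q_def x_def)
    have "d (c s) (c (u * T n)) = \<bar>s - u * T n\<bar>"
      using ray_dist [OF c] s u T by simp
    also have "\<dots> = u * \<bar>T n - d p (x n)\<bar>"
      using u by (metis abs_minus_commute abs_mult abs_of_nonneg right_diff_distrib')
    also have "\<dots> \<le> 1 * D" using u dpT by (intro mult_mono) auto
    finally have 2: "d (c s) (geo q (x n) u) \<le> D" by (simp add: gq)
    have M: "c s \<in> M" "c' s \<in> M" "geo q (x n) u \<in> M" "proj p s (x n) \<in> M"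
      using c c' s p q u xM by (auto simp: ray_closed)
    show ?thesis
      using triangle [of "c s" "geo q (x n) u" "c' s"] triangle [of "geo q (x n) u" "proj p s (x n)" "c' s"]
        M 1 2 near commute by (smt (verit))
  qed
  then have "(c, c') \<in> asymptotic" using c c' by (auto simp: asymptotic_def)
  with c' show thesis using that by blast
qed

definition endpoint :: "(real \<Rightarrow> 'a) \<Rightarrow> (real \<Rightarrow> 'a) set" where "endpoint c = Image asymptotic {c}"


lemma endpoint_boundary: "geodesic_ray c \<Longrightarrow> endpoint c \<in> boundary_points"
  by (auto simp: endpoint_def boundary_points_def quotient_def)

lemma mem_endpoint: "geodesic_ray c \<Longrightarrow> c \<in> endpoint c"
  by (simp add: endpoint_def asymptotic_refl)

lemma boundary_asymptotic:
  "\<xi> \<in> boundary_points \<Longrightarrow> c \<in> \<xi> \<Longrightarrow> c' \<in> \<xi> \<Longrightarrow> (c, c') \<in> asymptotic"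
  unfolding boundary_points_def quotient_def using asymptotic_sym asymptotic_trans by blast

lemma boundary_ray_exists:
  assumes \<xi>: "\<xi> \<in> boundary_points" and p: "p \<in> M"
  shows "\<exists>c. c \<in> \<xi> \<and> c 0 = p"
proof -
  obtain c where c: "geodesic_ray c" "\<xi> = asymptotic `` {c}"
    using \<xi> by (auto simp: boundary_points_def quotient_def)
  obtain c' where "(c, c') \<in> asymptotic" "c' 0 = p"
    using asymptotic_ray_exists [OF c(1) p] .
  then show ?thesis using c by auto
qed

definition ray :: "'a \<Rightarrow> (real \<Rightarrow> 'a) set \<Rightarrow> real \<Rightarrow> 'a" where
  "ray p \<xi> = (SOME c. c \<in> \<xi> \<and> c 0 = p)"

lemma ray_mem: "\<xi> \<in> boundary_points \<Longrightarrow> p \<in> M \<Longrightarrow> ray p \<xi> \<in> \<xi>"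
  and ray_0 [simp]: "\<xi> \<in> boundary_points \<Longrightarrow> p \<in> M \<Longrightarrow> ray p \<xi> 0 = p"
  using someI_ex [OF boundary_ray_exists] unfolding ray_def by blast+

lemma boundary_geodesic_ray: "\<xi> \<in> boundary_points \<Longrightarrow> c \<in> \<xi> \<Longrightarrow> geodesic_ray c"
  unfolding boundary_points_def quotient_def by (auto simp: asymptotic_def)

lemma geodesic_ray_ray: "\<xi> \<in> boundary_points \<Longrightarrow> p \<in> M \<Longrightarrow> geodesic_ray (ray p \<xi>)"
  using ray_mem boundary_geodesic_ray by blast

lemma ray_in_M [simp]: "\<xi> \<in> boundary_points \<Longrightarrow> p \<in> M \<Longrightarrow> 0 \<le> t \<Longrightarrow> ray p \<xi> t \<in> M"
  using geodesic_ray_ray ray_closed by blast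

text \<open>Asymptotic rays with the same origin never separate, as their distance is bounded by the
  initial one.\<close>

lemma ray_unique:
  assumes \<xi>: "\<xi> \<in> boundary_points" and c: "c \<in> \<xi>" and t: "0 \<le> t"
  shows "ray (c 0) \<xi> t = c t"
proof -
  have c0: "c 0 \<in> M" "c t \<in> M" using boundary_geodesic_ray [OF \<xi> c] ray_closed t by auto
  have "(ray (c 0) \<xi>, c) \<in> asymptotic"
    using \<xi> c c0 ray_mem boundary_asymptotic by blast
  from asymptotic_dist_le [OF this t] have "d (ray (c 0) \<xi> t) (c t) \<le> 0"
    using \<xi> c0 by simp
  then show ?thesis using \<xi> c0 t by (metis antisym nonneg ray_in_M zero)
qed

lemma ray_base_dist:
  assumes "\<xi> \<in> boundary_points" "p \<in> M" "q \<in> M" "0 \<le> t"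
  shows "d (ray p \<xi> t) (ray q \<xi> t) \<le> d p q"
  using asymptotic_dist_le [OF boundary_asymptotic [OF assms(1) ray_mem ray_mem], of p q t] assms by simp

lemma proj_ray: "\<xi> \<in> boundary_points \<Longrightarrow> p \<in> M \<Longrightarrow> 0 \<le> s \<Longrightarrow> s \<le> t \<Longrightarrow> proj p s (ray p \<xi> t) = ray p \<xi> s"
  using ray_proj [OF geodesic_ray_ray, of \<xi> p s t] by simp

lemma dist_ray: "\<xi> \<in> boundary_points \<Longrightarrow> p \<in> M \<Longrightarrow> 0 \<le> t \<Longrightarrow> d p (ray p \<xi> t) = t"
  using ray_dist [OF geodesic_ray_ray, of \<xi> p 0 t] by simp

section \<open>Basic neighbourhoods seen from a fixed base point\<close>

definition cone :: "'a \<Rightarrow> (real \<Rightarrow> 'a) set \<Rightarrow> real \<Rightarrow> real \<Rightarrow> (real \<Rightarrow> 'a) set set" where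
  "cone p \<xi> s e = {\<eta> \<in> boundary_points. d (ray p \<eta> s) (ray p \<xi> s) < e}"

lemma cone_nhd_eq:
  assumes c: "geodesic_ray c" and r: "0 \<le> r"
  shows "cone_nhd c r e = {\<eta> \<in> boundary_points. d (ray (c 0) \<eta> r) (c r) < e}"
  unfolding cone_nhd_def
proof (rule Collect_cong, rule conj_cong [OF refl])
  fix \<eta> assume \<eta>: "\<eta> \<in> boundary_points"
  have c0: "c 0 \<in> M" using c by (simp add: ray_closed)
  show "(\<exists>c'\<in>\<eta>. c' 0 = c 0 \<and> d (c' r) (c r) < e) \<longleftrightarrow> d (ray (c 0) \<eta> r) (c r) < e"
    using ray_unique [OF \<eta> _ r] ray_mem [OF \<eta> c0] \<eta> c0 by (metis ray_0)
qed

lemma cone_eq_cone_nhd: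
  assumes "\<xi> \<in> boundary_points" "p \<in> M" "0 \<le> s"
  shows "cone p \<xi> s e = cone_nhd (ray p \<xi>) s e"
  using assms by (simp add: cone_nhd_eq geodesic_ray_ray cone_def)

lemma topspace_boundary: "topspace boundary = boundary_points"
proof
  show "topspace boundary \<subseteq> boundary_points"
    unfolding boundary_def topology_generated_by_topspace cone_nhd_def by blast
  show "boundary_points \<subseteq> topspace boundary"
  proof
    fix \<xi> assume \<xi>: "\<xi> \<in> boundary_points"
    obtain p where p: "p \<in> M" using nonempty by blast
    have "\<xi> \<in> cone_nhd (ray p \<xi>) 1 1"
      using \<xi> p by (simp add: cone_nhd_eq geodesic_ray_ray)
    then show "\<xi> \<in> topspace boundary"
      unfolding boundary_def topology_generated_by_topspace using geodesic_ray_ray [OF \<xi> p] zero_less_one by blast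
  qed
qed

lemma openin_cone: "\<xi> \<in> boundary_points \<Longrightarrow> p \<in> M \<Longrightarrow> 0 < s \<Longrightarrow> 0 < e \<Longrightarrow> openin boundary (cone p \<xi> s e)"
  unfolding boundary_def by (intro topology_generated_by_Basis) (auto simp: cone_eq_cone_nhd intro: geodesic_ray_ray)

lemma cone_mono:
  assumes \<xi>: "\<xi> \<in> boundary_points" and p: "p \<in> M" and s: "0 < s" "s \<le> s'" and e: "e' \<le> e"
  shows "cone p \<xi> s' e' \<subseteq> cone p \<xi> s e"
proof
  fix \<eta> assume \<eta>: "\<eta> \<in> cone p \<xi> s' e'"
  then have \<eta>b: "\<eta> \<in> boundary_points" by (simp add: cone_def)
  have "d (ray p \<eta> s) (ray p \<xi> s) \<le> (s / s') * d (ray p \<eta> s') (ray p \<xi> s')"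
    using \<xi> \<eta>b p s by (intro ray_thales geodesic_ray_ray) auto
  also have "\<dots> \<le> 1 * d (ray p \<eta> s') (ray p \<xi> s')"
    using s by (intro mult_right_mono) auto
  finally show "\<eta> \<in> cone p \<xi> s e"
    using \<eta> e by (simp add: cone_def)
qed

text \<open>Changing the base point moves a ray by at most \<open>d p q\<close> at every time, and
  Thales' inequality shrinks this error by the factor \<open>r / s\<close>. A neighbourhood taken at
  a late time \<open>s\<close> therefore fits.\<close>

lemma cone_base_change:
  assumes c: "geodesic_ray c" and r: "0 < r" and \<xi>: "\<xi> \<in> cone_nhd c r e" and p: "p \<in> M"
  obtains s e' where "0 < s" "0 < e'" "cone p \<xi> s e' \<subseteq> cone_nhd c r e"
proof -
  define q where "q = c 0"
  have q: "q \<in> M" using c by (simp add: q_def ray_closed)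
  have \<xi>b: "\<xi> \<in> boundary_points" using \<xi> by (simp add: cone_nhd_def)
  define gap where "gap = e - d (ray q \<xi> r) (c r)"
  have gap: "0 < gap" using \<xi> c r by (simp add: cone_nhd_eq gap_def q_def)
  \<comment> \<open>A bound for the distance at time \<open>s\<close> as seen from \<open>q\<close>:
    two changes of base point and the width 1.\<close>
  define L where "L = 2 * d p q + 1"
  have L: "0 < L" by (simp add: L_def add_nonneg_pos)
  define s where "s = max r (r * L / gap + 1)"
  have s: "0 < s" "r \<le> s" using r by (auto simp: s_def)
  have "r * L / gap < s" by (simp add: s_def)
  then have small: "(r / s) * L < gap" using gap s by (simp add: field_simps)
  show thesis
  proof (rule that [OF s(1) zero_less_one])
    show "cone p \<xi> s 1 \<subseteq> cone_nhd c r e"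
    proof
      fix \<eta> assume "\<eta> \<in> cone p \<xi> s 1"
      then have \<eta>: "\<eta> \<in> boundary_points" "d (ray p \<eta> s) (ray p \<xi> s) < 1" by (auto simp: cone_def)
      have M: "ray p \<eta> s \<in> M" "ray p \<xi> s \<in> M" "ray q \<eta> s \<in> M" "ray q \<xi> s \<in> M" "ray q \<eta> r \<in> M"
          "ray q \<xi> r \<in> M" "c r \<in> M"
        using \<eta> \<xi>b p q s r c by (auto intro: ray_closed)
      have "d (ray q \<eta> s) (ray p \<eta> s) \<le> d p q" "d (ray p \<xi> s) (ray q \<xi> s) \<le> d p q"
        using ray_base_dist [of \<eta> q p s] ray_base_dist [of \<xi> p q s] \<eta> \<xi>b p q s commute by auto
      then have "d (ray q \<eta> s) (ray q \<xi> s) \<le> L"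
        using triangle [of "ray q \<eta> s" "ray p \<eta> s" "ray q \<xi> s"] triangle [of "ray p \<eta> s" "ray p \<xi> s" "ray q \<xi> s"]
          \<eta> M by (simp add: L_def)
      then have "(r / s) * d (ray q \<eta> s) (ray q \<xi> s) \<le> (r / s) * L"
        using r s by (intro mult_left_mono) auto
      moreover have "d (ray q \<eta> r) (ray q \<xi> r) \<le> (r / s) * d (ray q \<eta> s) (ray q \<xi> s)"
        using \<eta> \<xi>b q r s by (intro ray_thales geodesic_ray_ray) auto
      ultimately have "d (ray q \<eta> r) (ray q \<xi> r) < gap" using small by linarith
      then have "d (ray q \<eta> r) (c r) < e"
        using triangle [of "ray q \<eta> r" "ray q \<xi> r" "c r"] M by (simp add: gap_def)
      then show "\<eta> \<in> cone_nhd c r e"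
        using \<eta> c r by (simp add: cone_nhd_eq q_def)
    qed
  qed
qed

lemma openin_boundary_cone:
  assumes u: "openin boundary u" and \<xi>: "\<xi> \<in> u" and p: "p \<in> M"
  obtains s e where "0 < s" "0 < e" "cone p \<xi> s e \<subseteq> u"
proof -
  have "generate_topology_on {cone_nhd c r e | c r e. geodesic_ray c \<and> 0 < r \<and> 0 < e} u"
    using u by (simp add: boundary_def openin_topology_generated_by_iff)
  then have "\<xi> \<in> u \<longrightarrow> (\<exists>s>0. \<exists>e>0. cone p \<xi> s e \<subseteq> u)"
  proof induction
    case (Int a b)
    show ?case
    proof
      assume ab: "\<xi> \<in> a \<inter> b"
      then have "\<xi> \<in> topspace boundary"
        using u \<xi> openin_subset by blast
      then have \<xi>b: "\<xi> \<in> boundary_points" by (simp add: topspace_boundary)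
      obtain s e s' e' where *: "0 < s" "0 < e" "cone p \<xi> s e \<subseteq> a" "0 < s'" "0 < e'" "cone p \<xi> s' e' \<subseteq> b"
        using Int ab by blast
      then have "cone p \<xi> (max s s') (min e e') \<subseteq> a \<inter> b"
        using cone_mono [OF \<xi>b p, of s "max s s'" "min e e'" e]
          cone_mono [OF \<xi>b p, of s' "max s s'" "min e e'" e'] by auto
      with * show "\<exists>s>0. \<exists>e>0. cone p \<xi> s e \<subseteq> a \<inter> b"
        by (intro exI [of _ "max s s'"] conjI exI [of _ "min e e'"]) auto
    qed
  next
    case (UN K)
    then show ?case by (meson Union_upper UnionE order_trans)
  next
    case (Basis v)
    then obtain c r e where v: "v = cone_nhd c r e" "geodesic_ray c" "0 < r" by blast
    show ?case
    proof
      assume "\<xi> \<in> v"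
      then obtain s e' where "0 < s" "0 < e'" "cone p \<xi> s e' \<subseteq> cone_nhd c r e"
        using cone_base_change v p by metis
      then show "\<exists>s>0. \<exists>e>0. cone p \<xi> s e \<subseteq> v" using v by auto
    qed
  qed simp
  then show thesis using \<xi> that by blast
qed

text \<open>A Lebesgue number of the cover, in time and in width. If there is none, the rays to the
  centres of bad cones subconverge to a ray whose end point has a basic neighbourhood inside a
  member of the cover; this neighbourhood contains one of the bad cones.\<close>

lemma boundary_Lebesgue:
  assumes U: "U \<in> open_covers boundary" and p: "p \<in> M"
  obtains s e where "0 < s" "0 < e" "\<And>\<xi>. \<xi> \<in> boundary_points \<Longrightarrow> \<exists>u\<in>U. cone p \<xi> s e \<subseteq> u"
proof (rule ccontr)
  assume no: "\<not> thesis"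
  have "\<exists>\<xi>\<in>boundary_points. \<forall>u\<in>U. \<not> cone p \<xi> (real n + 1) (1 / (real n + 1)) \<subseteq> u" for n
  proof (rule ccontr)
    assume "\<not> ?thesis"
    then have "\<exists>u\<in>U. cone p \<xi> (real n + 1) (1 / (real n + 1)) \<subseteq> u" if "\<xi> \<in> boundary_points" for \<xi>
      using that by blast
    moreover have "0 < real n + 1" "0 < 1 / (real n + 1)" by auto
    ultimately have thesis by (intro that [of "real n + 1" "1 / (real n + 1)"]) auto
    then show False using no by blast
  qed
  then obtain \<xi> where \<xi>: "\<And>n. \<xi> n \<in> boundary_points"
    "\<And>n u. u \<in> U \<Longrightarrow> \<not> cone p (\<xi> n) (real n + 1) (1 / (real n + 1)) \<subseteq> u"
    by metis
  define x where "x n = ray p (\<xi> n) (real n + 1)" for n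
  have "x n \<in> M" "real n \<le> d p (x n)" for n
    using \<xi> p by (auto simp: x_def dist_ray)
  then obtain r c where r: "strict_mono (r :: nat \<Rightarrow> nat)" and c: "geodesic_ray c" "c 0 = p"
    and lim: "\<And>s. 0 \<le> s \<Longrightarrow> limitin mtopology (\<lambda>n. proj p s (x (r n))) (c s) sequentially"
    using proj_limit [OF p, of x] by metis
  define \<zeta> where "\<zeta> = endpoint c"
  have \<zeta>: "\<zeta> \<in> boundary_points" "c \<in> \<zeta>"
    using endpoint_boundary mem_endpoint c by (auto simp: \<zeta>_def)
  then obtain u where u: "u \<in> U" "\<zeta> \<in> u" "openin boundary u"
    using U unfolding open_covers_def topspace_boundary by blast
  then obtain s e where se: "0 < s" "0 < e" "cone p \<zeta> s e \<subseteq> u"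
    using openin_boundary_cone p by metis
  obtain N where N: "\<And>n. n \<ge> N \<Longrightarrow> d (proj p s (x (r n))) (c s) < e / 2"
    using lim [of s] se unfolding limitin_metric eventually_sequentially
    by (metis half_gt_zero less_eq_real_def)
  \<comment> \<open>Late enough for the convergence, for the time \<open>s\<close>, and for the
    width \<open>1 / (n + 1)\<close> to be at most \<open>e / 2\<close>.\<close>
  define n where "n = r (max N (nat \<lceil>max s (2 / e)\<rceil>))"
  have "max s (2 / e) \<le> real (max N (nat \<lceil>max s (2 / e)\<rceil>))"
    using real_nat_ceiling_ge [of "max s (2/e)"] by (auto simp: of_nat_max le_max_iff_disj)
  also have "\<dots> \<le> real n"
    unfolding n_def using seq_suble [OF r] by simp
  finally have n: "s \<le> real n" "2 / e \<le> real n" by auto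
  have "1 / (real n + 1) \<le> e / 2" using n se by (simp add: field_simps)
  then have 1: "cone p (\<xi> n) (real n + 1) (1 / (real n + 1)) \<subseteq> cone p (\<xi> n) s (e / 2)"
    using n se \<xi> p by (intro cone_mono) auto
  have "proj p s (x n) = ray p (\<xi> n) s"
    unfolding x_def using \<xi> p n se by (intro proj_ray) auto
  moreover have "d (proj p s (x n)) (c s) < e / 2" using N by (simp add: n_def)
  moreover have "ray p \<zeta> s = c s" using ray_unique [OF \<zeta>, of s] se c by simp
  ultimately have near: "d (ray p (\<xi> n) s) (ray p \<zeta> s) < e / 2" by simp
  have "cone p (\<xi> n) s (e / 2) \<subseteq> cone p \<zeta> s e"
  proof
    fix \<eta> assume \<eta>: "\<eta> \<in> cone p (\<xi> n) s (e / 2)"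
    then show "\<eta> \<in> cone p \<zeta> s e"
      using near triangle [of "ray p \<eta> s" "ray p (\<xi> n) s" "ray p \<zeta> s"] \<xi> \<zeta> p se by (auto simp: cone_def)
  qed
  then show False using 1 se \<xi>(2) [OF u(1), of n] by blast
qed

text \<open>Counterexamples going to infinity would have a subsequence whose geodesics from
  \<open>p\<close> converge to a ray, also at time \<open>s\<close>.\<close>

lemma far_points_near_rays:
  assumes p: "p \<in> M" and s: "0 \<le> s" and e: "0 < e"
  obtains R where "\<And>x. x \<in> M \<Longrightarrow> R \<le> d p x \<Longrightarrow> \<exists>\<xi>\<in>boundary_points. d (proj p s x) (ray p \<xi> s) < e"
proof (rule ccontr)
  assume no: "\<not> thesis"
  have "\<exists>x\<in>M. real n \<le> d p x \<and> (\<forall>\<xi>\<in>boundary_points. \<not> d (proj p s x) (ray p \<xi> s) < e)" for n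
    using no that [of "real n"] by blast
  then obtain x where x: "\<And>n. x n \<in> M" "\<And>n. real n \<le> d p (x n)"
    "\<And>n \<xi>. \<xi> \<in> boundary_points \<Longrightarrow> \<not> d (proj p s (x n)) (ray p \<xi> s) < e"
    by metis
  obtain r c where c: "geodesic_ray c" "c 0 = p"
    and lim: "\<And>s. 0 \<le> s \<Longrightarrow> limitin mtopology (\<lambda>n. proj p s (x (r n))) (c s) sequentially"
    using proj_limit [OF p x(1,2)] by metis
  define \<zeta> where "\<zeta> = endpoint c"
  have \<zeta>: "\<zeta> \<in> boundary_points" "c \<in> \<zeta>"
    using endpoint_boundary mem_endpoint c by (auto simp: \<zeta>_def)
  have "ray p \<zeta> s = c s" using ray_unique [OF \<zeta> s] c by simp
  moreover obtain n where "d (proj p s (x (r n))) (c s) < e"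
    using lim [OF s] e unfolding limitin_metric eventually_sequentially by blast
  ultimately show False using x(3) [OF \<zeta>(1)] by simp
qed

end

section \<open>Simplicial chains on lists\<close>

abbreviation cons_chain :: "'a \<Rightarrow> ('a list \<Rightarrow>\<^sub>0 int) \<Rightarrow> 'a list \<Rightarrow>\<^sub>0 int" where
  "cons_chain a \<equiv> frag_extend (\<lambda>v. frag_of (a # v))"

text \<open>The recursion is the boundary formula for a cone with apex \<open>a\<close>, which turns
  identities such as \<open>lbd_lbd\<close> into inductions. The boundary of a vertex is the empty
  list, so the complex is augmented.\<close>

fun lbd :: "'a list \<Rightarrow> 'a list \<Rightarrow>\<^sub>0 int" where
  "lbd [] = 0"
| "lbd (a # us) = frag_of us - cons_chain a (lbd us)"

lemma lbd_sum: "lbd us = (\<Sum>k<length us. frag_cmul ((-1) ^ k) (frag_of (take k us @ drop (Suc k) us)))"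
proof (induction us)
  case (Cons a us)
  have "cons_chain a (lbd us) = (\<Sum>k<length us. frag_cmul ((-1) ^ k) (frag_of (a # take k us @ drop (Suc k) us)))"
    unfolding Cons by (simp add: frag_extend_sum frag_extend_cmul o_def)
  also have "\<dots> = - (\<Sum>k<length us. frag_cmul ((-1) ^ Suc k) (frag_of (a # take k us @ drop (Suc k) us)))"
    by (simp flip: sum_negf)
  finally show ?case
    by (simp add: sum.lessThan_Suc_shift del: sum.lessThan_Suc)
qed simp

lemma pair_lbd: "pair f (lbd us) = (\<Sum>k<length us. (-1) ^ k * f (take k us @ drop (Suc k) us))"
  unfolding lbd_sum by (simp add: pair_sum pair_cmul)

text \<open>The predicate \<open>P\<close> serves the strictly increasing lists of the Rips complex;
  elsewhere it is taken to be constantly true.\<close>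

lemma supp_lbd:
  "v \<in> supp (lbd us) \<Longrightarrow> length us = Suc (length v) \<and> set v \<subseteq> set us \<and>
     (sorted_wrt P us \<longrightarrow> sorted_wrt P v)"
proof (induction us arbitrary: v)
  case (Cons a us)
  then have "v \<in> supp (frag_of us) \<union> supp (cons_chain a (lbd us))"
    using keys_diff [of "frag_of us" "cons_chain a (lbd us)"] by auto
  then consider "v = us" | w where "w \<in> supp (lbd us)" "v = a # w"
    using keys_frag_extend [of "\<lambda>v. frag_of (a # v)" "lbd us"] by auto
  then show ?case
  proof cases
    case 2
    then show ?thesis using Cons.IH [OF 2(1)] by auto
  qed auto
qed simp

lemma lbd_cons_chain: "frag_extend lbd (cons_chain a c) = c - cons_chain a (frag_extend lbd c)"
  using subset_UNIV [of "supp c"]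
  by (induction c rule: frag_induction) (simp_all add: frag_extend_diff)

lemma lbd_lbd: "frag_extend lbd (lbd us) = 0"
  by (induction us) (simp_all add: frag_extend_diff lbd_cons_chain)

definition list_simplices :: "'a set \<Rightarrow> nat \<Rightarrow> 'a list set" where
  "list_simplices A m = {us. length us = m \<and> set us \<subseteq> A}"

text \<open>\<open>K\<close> is a contracting homotopy. In degree 0 only the empty list can occur,
  and its boundary is zero.\<close>

lemma exact_on_contraction:
  assumes "\<And>m s. s \<in> A m \<Longrightarrow> supp (K s) \<subseteq> A (Suc m)"
    and K: "\<And>m s. s \<in> A m \<Longrightarrow> frag_extend lbd (K s) = frag_of s - frag_extend K (lbd s)"
    and 0: "A 0 \<subseteq> {[]}"
  shows "exact_on (\<lambda>m. lbd) A"
  unfolding exact_on_def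
proof (intro allI impI)
  fix m c assume c: "supp c \<subseteq> A m" and cyc: "is_cycle (\<lambda>m. lbd) m c"
  have c0: "frag_extend lbd c = 0"
  proof (cases m)
    case 0
    then have "frag_extend lbd c = frag_extend (\<lambda>x. 0) c"
      by (intro frag_extend_eq) (use c \<open>A 0 \<subseteq> {[]}\<close> in auto)
    then show ?thesis by simp
  qed (use cyc in simp)
  have "frag_extend lbd (frag_extend K c) = frag_extend (\<lambda>s. frag_of s - frag_extend K (lbd s)) c"
    unfolding frag_extend_frag_extend by (intro frag_extend_eq) (use c K in auto)
  also have "\<dots> = c - frag_extend K (frag_extend lbd c)"
    by (simp add: frag_extend_diff_fun frag_extend_frag_extend)
  finally have "frag_extend lbd (frag_extend K c) = c" using c0 by simp
  moreover have "supp (frag_extend K c) \<subseteq> A (Suc m)"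
    using assms(1) c by (intro frag_extend_closed) auto
  ultimately show "\<exists>c'. supp c' \<subseteq> A (Suc m) \<and> frag_extend lbd c' = c" by blast
qed

text \<open>Repetitions are allowed, so prefixing a fixed vertex is a contracting homotopy without
  case distinction.\<close>

lemma exact_on_list_simplices:
  assumes "A \<noteq> {}"
  shows "exact_on (\<lambda>m. lbd) (list_simplices A)"
proof -
  obtain a where "a \<in> A" using assms by blast
  then show ?thesis
    by (intro exact_on_contraction [of _ "\<lambda>us. frag_of (a # us)"]) (auto simp: list_simplices_def)
qed

text \<open>Strictly increasing lists have no repeated vertices; this is what makes the Rips complex
  finite-dimensional.\<close>

definition sorted_simplices :: "nat set \<Rightarrow> nat \<Rightarrow> nat list set" where
  "sorted_simplices A m = {us. length us = m \<and> set us \<subseteq> A \<and> sorted_wrt (<) us}"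

text \<open>A cone with the least vertex as apex, set to zero on lists that already contain the
  apex, necessarily as first entry.\<close>

lemma exact_on_sorted_simplices:
  assumes "A \<noteq> {}"
  shows "exact_on (\<lambda>m. lbd) (sorted_simplices A)"
proof -
  define a where "a = (LEAST x. x \<in> A)"
  have a: "a \<in> A" "\<And>x. x \<in> A \<Longrightarrow> a \<le> x"
    using assms by (auto simp: a_def intro: LeastI Least_le)
  define K where "K = (\<lambda>us. if a \<in> set us then 0 else frag_of (a # us))"
  have notin: "frag_extend K c = cons_chain a c" if "\<And>v. v \<in> supp c \<Longrightarrow> a \<notin> set v" for c
    by (intro frag_extend_eq) (use that in \<open>auto simp: K_def\<close>)
  have "frag_extend lbd (K us) = frag_of us - frag_extend K (lbd us)" if us: "us \<in> sorted_simplices A m" for m us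
  proof (cases "a \<in> set us")
    case False
    then have "frag_extend K (lbd us) = cons_chain a (lbd us)"
      using supp_lbd [of _ us "\<lambda>x y. True"] by (intro notin) auto
    then show ?thesis using False by (simp add: K_def)
  next
    case True
    then obtain b w where w: "us = b # w" by (cases us) auto
    have "b = a"
      using us True a unfolding w sorted_simplices_def by fastforce
    then have aw: "a \<notin> set w" "us = a # w"
      using us w by (auto simp: sorted_simplices_def)
    have "frag_extend K (cons_chain a (lbd w)) = 0"
      unfolding frag_extend_frag_extend by (simp add: K_def)
    then show ?thesis
      using aw by (simp add: frag_extend_diff) (simp add: K_def)
  qed
  moreover have "supp (K us) \<subseteq> sorted_simplices A (Suc m)" if us: "us \<in> sorted_simplices A m" for m us
  proof (cases "a \<in> set us")
    case False
    have "a < x" if x: "x \<in> set us" for x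
    proof -
      have "a \<le> x" "a \<noteq> x" using a(2) [of x] us x False by (auto simp: sorted_simplices_def)
      then show ?thesis by simp
    qed
    then show ?thesis using us a(1) False by (simp add: K_def sorted_simplices_def)
  qed (simp add: K_def)
  ultimately show ?thesis
    by (intro exact_on_contraction [of _ K]) (auto simp: sorted_simplices_def)
qed

section \<open>Nerves and refinement maps\<close>

definition nerve :: "'a set set \<Rightarrow> nat \<Rightarrow> 'a set list set" where
  "nerve U m = {us. length us = m \<and> set us \<subseteq> U \<and> (us = [] \<or> \<Inter> (set us) \<noteq> {})}"

lemma cpx_lists:
  assumes "\<And>m us v. us \<in> G (Suc m) \<Longrightarrow> v \<in> supp (lbd us) \<Longrightarrow> v \<in> G m"
  shows "cpx G (\<lambda>m. lbd)"
  unfolding cpx_def using assms lbd_lbd by blast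

lemma cpx_nerve: "cpx (nerve U) (\<lambda>m. lbd)"
proof (rule cpx_lists)
  fix m us v assume us: "us \<in> nerve U (Suc m)" and v: "v \<in> supp (lbd us)"
  have "length us = Suc (length v)" "set v \<subseteq> set us"
    using supp_lbd [OF v, of "\<lambda>x y. True"] by auto
  moreover have "\<Inter> (set us) \<noteq> {}" using us by (auto simp: nerve_def)
  then have "\<Inter> (set v) \<noteq> {}" using \<open>set v \<subseteq> set us\<close> by blast
  ultimately show "v \<in> nerve U m"
    using us by (auto simp: nerve_def)
qed

lemma nerve_simplices_eq: "nerve_simplices True U (int m - 1) = nerve U m"
  by (auto simp: nerve_simplices_def nerve_def)

lemma map_chain_lbd: "frag_extend (\<lambda>v. frag_of (map \<tau> v)) (lbd us) = lbd (map \<tau> us)"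
proof (induction us)
  case (Cons a us)
  have "frag_extend (\<lambda>v. frag_of (map \<tau> v)) (cons_chain a (lbd us)) =
      cons_chain (\<tau> a) (frag_extend (\<lambda>v. frag_of (map \<tau> v)) (lbd us))"
    by (simp add: frag_extend_frag_extend)
  then show ?case by (simp add: frag_extend_diff Cons)
qed simp

lemma refinement_nerve:
  assumes "refinement_map V U \<tau>" "vs \<in> nerve V m"
  shows "map \<tau> vs \<in> nerve U m"
  using assms unfolding nerve_def refinement_map_def by fastforce

lemma chmap_refinement:
  assumes "refinement_map V U \<tau>"
  shows "chmap (nerve V) (\<lambda>m. lbd) (nerve U) (\<lambda>m. lbd) (\<lambda>m vs. frag_of (map \<tau> vs))"
  using refinement_nerve [OF assms] by (auto simp: chmap_def map_chain_lbd)

text \<open>The two induced maps are contiguous: a common point of the vertices of a simplex lies in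
  all their images under \<open>\<tau>\<close> and \<open>\<tau>'\<close>, so the full simplex on
  these images is an acyclic carrier inside the nerve of \<open>U\<close>.\<close>

lemma refinement_contiguous:
  assumes \<tau>: "refinement_map V U \<tau>" "refinement_map V U \<tau>'" and f: "cocycle (nerve U) (\<lambda>m. lbd) m f"
  shows "coboundary (nerve V) (\<lambda>m. lbd) m (\<lambda>vs. f (map \<tau> vs) - f (map \<tau>' vs))"
proof -
  define P where "P = (\<lambda>m::nat. \<lambda>vs. list_simplices (\<tau> ` set vs \<union> \<tau>' ` set vs))"
  let ?E = "\<lambda>\<tau>. \<lambda>m::nat. \<lambda>vs. frag_of (map \<tau> vs)"
  have "carrier_ok (nerve V) (\<lambda>m. lbd) (\<lambda>m. lbd) P"
    unfolding carrier_ok_def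
  proof (intro allI ballI conjI)
    fix m vs assume vs: "vs \<in> nerve V (Suc m)"
    show "exact_on (\<lambda>m. lbd) (P (Suc m) vs)"
      unfolding P_def using vs by (intro exact_on_list_simplices) (auto simp: nerve_def)
    show "P m s' n \<subseteq> P (Suc m) vs n" if "s' \<in> supp (lbd vs)" for s' n
      using supp_lbd [OF that, of "\<lambda>x y. True"] unfolding P_def list_simplices_def by blast
  qed
  then obtain h where h: "\<And>m s. s \<in> nerve V m \<Longrightarrow> supp (h m s) \<subseteq> P m s (Suc m)"
    "\<And>m s. s \<in> nerve V (Suc m) \<Longrightarrow> frag_extend lbd (h (Suc m) s) =
       ?E \<tau> (Suc m) s - ?E \<tau>' (Suc m) s - frag_extend (h m) (lbd s)"
    by (rule acyclic_carrier_homotopy [OF cpx_nerve _ chmap_refinement [OF \<tau>(1)] chmap_refinement [OF \<tau>(2)],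
          where P = P and hz = "\<lambda>s. 0"]) (auto simp: P_def list_simplices_def nerve_def)
  have PU: "P m vs (Suc m) \<subseteq> nerve U (Suc m)" if vs: "vs \<in> nerve V m" for m vs
  proof
    fix us assume us: "us \<in> P m vs (Suc m)"
    then have "vs \<noteq> []" by (auto simp: P_def list_simplices_def)
    then obtain x where x: "\<And>v. v \<in> set vs \<Longrightarrow> x \<in> v" using vs by (auto simp: nerve_def)
    have "set vs \<subseteq> V" using vs by (simp add: nerve_def)
    have "x \<in> u \<and> u \<in> U" if "u \<in> set us" for u
    proof -
      obtain v where v: "v \<in> set vs" "u = \<tau> v \<or> u = \<tau>' v"
        using us \<open>u \<in> set us\<close> by (auto simp: P_def list_simplices_def)
      then have "v \<in> V" "x \<in> v" using x \<open>set vs \<subseteq> V\<close> by auto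
      then show ?thesis using v \<tau> unfolding refinement_map_def by blast
    qed
    then have "x \<in> \<Inter> (set us)" "set us \<subseteq> U" by blast+
    then show "us \<in> nerve U (Suc m)"
      using us unfolding nerve_def P_def list_simplices_def by blast
  qed
  have "coboundary (nerve V) (\<lambda>m. lbd) m (\<lambda>s. pull (?E \<tau>) m f s - pull (?E \<tau>') m f s)"
    using h PU by (intro coboundary_diff_homotopy [OF f, where h = h]) (blast, blast, simp add: nerve_def)
  then show ?thesis by (simp add: pull_def)
qed

section \<open>Quotients of groups of functions\<close>

text \<open>Cochains, cocycles and coboundaries all become sets of functions with this addition, and
  classes are handled through representatives.\<close>

definition funs :: "('b \<Rightarrow> int) set \<Rightarrow> ('b \<Rightarrow> int) monoid" where
  "funs A = \<lparr>carrier = A, monoid.mult = (\<lambda>f g x. f x + g x), one = (\<lambda>x. 0)\<rparr>"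

lemma funs_simps [simp]: "carrier (funs A) = A" "monoid.mult (funs A) = (\<lambda>f g x. f x + g x)"
  "one (funs A) = (\<lambda>x. 0)"
  by (simp_all add: funs_def)

definition fun_group :: "('b \<Rightarrow> int) set \<Rightarrow> bool" where
  "fun_group A \<longleftrightarrow> (\<lambda>x. 0) \<in> A \<and> (\<forall>f\<in>A. \<forall>g\<in>A. (\<lambda>x. f x - g x) \<in> A)"

lemma fun_group_diff: "fun_group A \<Longrightarrow> f \<in> A \<Longrightarrow> g \<in> A \<Longrightarrow> (\<lambda>x. f x - g x) \<in> A"
  by (simp add: fun_group_def)

lemma fun_group_0: "fun_group A \<Longrightarrow> (\<lambda>x. 0) \<in> A"
  by (simp add: fun_group_def)

lemma fun_group_minus: "fun_group A \<Longrightarrow> f \<in> A \<Longrightarrow> (\<lambda>x. - f x) \<in> A"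
  using fun_group_diff [of A "\<lambda>x. 0" f] by (simp add: fun_group_0)

lemma fun_group_add: "fun_group A \<Longrightarrow> f \<in> A \<Longrightarrow> g \<in> A \<Longrightarrow> (\<lambda>x. f x + g x) \<in> A"
  using fun_group_diff [of A f "\<lambda>x. - g x"] by (simp add: fun_group_minus)

lemma fun_group_sum:
  "fun_group A \<Longrightarrow> (\<And>i. i \<in> I \<Longrightarrow> f i \<in> A) \<Longrightarrow> (\<lambda>x. \<Sum>i\<in>I. f i x) \<in> A"
  by (induction I rule: infinite_finite_induct) (auto simp: fun_group_0 intro: fun_group_add)

lemma comm_group_funs:
  assumes "fun_group A"
  shows "comm_group (funs A)"
proof (rule comm_groupI)
  show "\<exists>y\<in>carrier (funs A). y \<otimes>\<^bsub>funs A\<^esub> x = \<one>\<^bsub>funs A\<^esub>" if "x \<in> carrier (funs A)" for x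
    using that fun_group_minus [OF assms, of x] by (auto intro!: bexI [of _ "\<lambda>y. - x y"])
qed (use assms in \<open>auto simp: fun_group_0 fun_group_add fun_eq_iff\<close>)

lemma subgroup_funs:
  assumes "fun_group A" "fun_group B" "B \<subseteq> A"
  shows "subgroup B (funs A)"
proof -
  interpret A: comm_group "funs A" by (rule comm_group_funs [OF assms(1)])
  have inv: "inv\<^bsub>funs A\<^esub> f = (\<lambda>x. - f x)" if "f \<in> A" for f
    using that fun_group_minus [OF assms(1) that] by (intro A.inv_equality) auto
  show ?thesis
    using assms inv by unfold_locales (auto simp: fun_group_0 fun_group_add fun_group_minus subset_iff)
qed

definition coset :: "('b \<Rightarrow> int) set \<Rightarrow> ('b \<Rightarrow> int) \<Rightarrow> ('b \<Rightarrow> int) set" where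
  "coset B z = (\<lambda>b x. b x + z x) ` B"

lemma r_coset_funs: "monoid.mult G = (\<lambda>f g x. f x + g x) \<Longrightarrow> B #>\<^bsub>G\<^esub> z = coset B z"
  by (auto simp: r_coset_def coset_def)

lemma coset_eq_iff:
  assumes B: "fun_group B"
  shows "coset B z = coset B w \<longleftrightarrow> (\<lambda>x. z x - w x) \<in> B"
proof
  assume "coset B z = coset B w"
  moreover have "z \<in> coset B z" using fun_group_0 [OF B] by (force simp: coset_def)
  ultimately obtain b where b: "b \<in> B" "z = (\<lambda>x. b x + w x)" by (auto simp: coset_def)
  then show "(\<lambda>x. z x - w x) \<in> B" by simp
next
  have sub: "coset B z \<subseteq> coset B w" if "(\<lambda>x. z x - w x) \<in> B" for z w
  proof
    fix f assume "f \<in> coset B z"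
    then obtain b where b: "b \<in> B" "f = (\<lambda>x. b x + z x)" by (auto simp: coset_def)
    have "f = (\<lambda>x. (b x + (z x - w x)) + w x)" by (simp add: b)
    moreover have "(\<lambda>x. b x + (z x - w x)) \<in> B" by (rule fun_group_add [OF B b(1) that])
    ultimately show "f \<in> coset B w" unfolding coset_def by (rule image_eqI)
  qed
  assume *: "(\<lambda>x. z x - w x) \<in> B"
  then have "(\<lambda>x. w x - z x) \<in> B" using fun_group_minus [OF B *] by simp
  with * sub show "coset B z = coset B w" by blast
qed

lemma coset_0: "coset B (\<lambda>x. 0) = B"
  by (simp add: coset_def)

lemma coset_eq_self_iff: "fun_group B \<Longrightarrow> coset B z = B \<longleftrightarrow> z \<in> B"
  using coset_eq_iff [of B z "\<lambda>x. 0"] by (simp add: coset_0)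

lemma trivial_Mod_iff:
  assumes "comm_group G" "subgroup N G"
  shows "trivial_group (G Mod N) \<longleftrightarrow> carrier G \<subseteq> N"
proof -
  interpret comm_group G by fact
  have N: "N \<lhd> G" using assms(2) by (rule subgroup_imp_normal)
  have grp: "group (G Mod N)" using N by (rule normal.factorgroup_is_group)
  have "carrier (G Mod N) = {N} \<longleftrightarrow> carrier G \<subseteq> N"
  proof
    assume "carrier (G Mod N) = {N}"
    then have "N #>\<^bsub>G\<^esub> x = N" if "x \<in> carrier G" for x
      using that by (auto simp: carrier_FactGroup)
    then show "carrier G \<subseteq> N"
      using rcos_self [OF _ assms(2)] by blast
  next
    assume "carrier G \<subseteq> N"
    then show "carrier (G Mod N) = {N}"
      using coset_join2 [OF _ assms(2)] by (auto simp: carrier_FactGroup)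
  qed
  then show ?thesis using grp by (simp add: trivial_group_def)
qed

text \<open>A system of groups \<open>Z i / B i\<close> whose transition maps are given on
  representatives. Several maps between the same indices are allowed, as one cover can refine
  another in several ways. Here a limit can be shown to be trivial; the converse criterion uses
  directedness.\<close>

locale quotient_system =
  fixes I :: "'i set" and Z B :: "'i \<Rightarrow> ('b \<Rightarrow> int) set"
    and G :: "'i \<Rightarrow> ('b \<Rightarrow> int) set monoid"
    and T :: "('i \<times> 'i \<times> (('b \<Rightarrow> int) \<Rightarrow> 'b \<Rightarrow> int)) set"
  assumes Z: "\<And>i. i \<in> I \<Longrightarrow> fun_group (Z i)" and B: "\<And>i. i \<in> I \<Longrightarrow> fun_group (B i)"
    and BZ: "\<And>i. i \<in> I \<Longrightarrow> B i \<subseteq> Z i"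
    and G: "\<And>i. i \<in> I \<Longrightarrow> G i = funs (Z i) Mod B i"
    and TI: "\<And>i j \<phi>. (i, j, \<phi>) \<in> T \<Longrightarrow> i \<in> I \<and> j \<in> I"
    and TZ: "\<And>i j \<phi> z. (i, j, \<phi>) \<in> T \<Longrightarrow> z \<in> Z i \<Longrightarrow> \<phi> z \<in> Z j"
begin

definition trans :: "(('i \<times> ('b \<Rightarrow> int) set) \<times> ('i \<times> ('b \<Rightarrow> int) set)) set" where
  "trans = {((i, coset (B i) z), (j, coset (B j) (\<phi> z))) | i j \<phi> z. (i, j, \<phi>) \<in> T \<and> z \<in> Z i}"

abbreviation "S \<equiv> sum_group I G"

lemma comm_G: "i \<in> I \<Longrightarrow> comm_group (G i)"
  unfolding G using comm_group_funs [OF Z] comm_group.abelian_FactGroup subgroup_funs [OF Z B BZ] by blast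

lemma group_G: "i \<in> I \<Longrightarrow> group (G i)"
  using comm_G comm_group.axioms(2) by blast

lemma carrier_G: "i \<in> I \<Longrightarrow> carrier (G i) = coset (B i) ` Z i"
  by (simp add: G carrier_FactGroup r_coset_funs)

lemma one_G: "i \<in> I \<Longrightarrow> \<one>\<^bsub>G i\<^esub> = B i"
  by (simp add: G)

lemma mult_G:
  assumes i: "i \<in> I" and zw: "z \<in> Z i" "w \<in> Z i"
  shows "coset (B i) z \<otimes>\<^bsub>G i\<^esub> coset (B i) w = coset (B i) (\<lambda>x. z x + w x)"
proof -
  interpret comm_group "funs (Z i)" by (rule comm_group_funs [OF Z [OF i]])
  have "B i \<lhd> funs (Z i)" by (intro subgroup_imp_normal subgroup_funs Z B BZ i)
  from normal.rcos_sum [OF this, of z w] zw show ?thesis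
    by (simp add: G i r_coset_funs)
qed

lemma inv_G:
  assumes i: "i \<in> I" and z: "z \<in> Z i"
  shows "inv\<^bsub>G i\<^esub> coset (B i) z = coset (B i) (\<lambda>x. - z x)"
proof -
  interpret group "G i" by (rule group_G [OF i])
  have mz: "(\<lambda>x. - z x) \<in> Z i" by (rule fun_group_minus [OF Z [OF i] z])
  have "coset (B i) (\<lambda>x. - z x) \<otimes>\<^bsub>G i\<^esub> coset (B i) z = \<one>\<^bsub>G i\<^esub>"
    using mult_G [OF i mz z] by (simp add: one_G i coset_0)
  then show ?thesis
    using z mz i by (intro inv_equality) (auto simp: carrier_G)
qed

lemma comm_S: "comm_group S"
proof -
  interpret group S by (rule sum_group) (rule group_G)
  show ?thesis
  proof (rule group_comm_groupI)
    fix x y assume "x \<in> carrier S" "y \<in> carrier S"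
    then have xy: "x i \<in> carrier (G i)" "y i \<in> carrier (G i)" if "i \<in> I" for i
      using that by (auto simp: carrier_sum_group group_G)
    have "x i \<otimes>\<^bsub>G i\<^esub> y i = y i \<otimes>\<^bsub>G i\<^esub> x i" if "i \<in> I" for i
      using comm_group.axioms(1) [OF comm_G [OF that]] xy [OF that] by (simp add: comm_monoid.m_comm)
    then show "x \<otimes>\<^bsub>S\<^esub> y = y \<otimes>\<^bsub>S\<^esub> x" by (simp add: restrict_def fun_eq_iff)
  qed
qed

lemma summand_closed: "i \<in> I \<Longrightarrow> x \<in> carrier (G i) \<Longrightarrow> summand I G i x \<in> carrier S"
  using monoid.one_closed [OF group.is_monoid [OF group_G]]
  by (auto simp: carrier_sum_group group_G summand_def intro: finite_subset [of _ "{i}"])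

definition rels :: "('i \<Rightarrow> ('b \<Rightarrow> int) set) set" where
  "rels = {summand I G i x \<otimes>\<^bsub>S\<^esub> inv\<^bsub>S\<^esub> summand I G j y | i x j y. ((i, x), (j, y)) \<in> trans}"

lemma rels_closed: "rels \<subseteq> carrier S"
proof
  fix r assume "r \<in> rels"
  then obtain i j \<phi> z where T: "(i, j, \<phi>) \<in> T" "z \<in> Z i"
    "r = summand I G i (coset (B i) z) \<otimes>\<^bsub>S\<^esub> inv\<^bsub>S\<^esub> summand I G j (coset (B j) (\<phi> z))"
    unfolding rels_def trans_def by blast
  interpret comm_group S by (rule comm_S)
  have "summand I G i (coset (B i) z) \<in> carrier S" "summand I G j (coset (B j) (\<phi> z)) \<in> carrier S"
    using T TI TZ by (auto intro!: summand_closed simp: carrier_G)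
  then show "r \<in> carrier S" unfolding T(3) by (intro m_closed inv_closed)
qed

lemma trivial_direct_limit_iff:
  "trivial_group (direct_limit I G trans) \<longleftrightarrow> carrier S \<subseteq> generate S rels"
proof -
  interpret comm_group S by (rule comm_S)
  have "subgroup (generate S rels) S" by (rule generate_is_subgroup [OF rels_closed])
  from trivial_Mod_iff [OF comm_S this] show ?thesis
    by (simp add: direct_limit_def rels_def)
qed

text \<open>If \<open>z\<close> becomes trivial at \<open>j\<close>, its summand is itself a
  relation, the second term being one. Summands generate the direct sum, by induction on the
  support.\<close>

lemma direct_limit_trivialI:
  assumes dies: "\<And>i z. i \<in> I \<Longrightarrow> z \<in> Z i \<Longrightarrow> \<exists>j \<phi>. (i, j, \<phi>) \<in> T \<and> \<phi> z \<in> B j"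
  shows "trivial_group (direct_limit I G trans)"
  unfolding trivial_direct_limit_iff
proof
  interpret comm_group S by (rule comm_S)
  have sub: "subgroup (generate S rels) S" by (rule generate_is_subgroup [OF rels_closed])
  have one: "summand I G j (B j) = \<one>\<^bsub>S\<^esub>" if "j \<in> I" for j
    using that by (auto simp: summand_def one_G restrict_def fun_eq_iff)
  have gen: "summand I G i x \<in> generate S rels" if i: "i \<in> I" and x: "x \<in> carrier (G i)" for i x
  proof -
    obtain z where z: "z \<in> Z i" "x = coset (B i) z" using x i by (auto simp: carrier_G)
    obtain j \<phi> where j: "(i, j, \<phi>) \<in> T" "\<phi> z \<in> B j" using dies i z by blast
    then have jI: "j \<in> I" using TI by blast
    have "((i, coset (B i) z), (j, coset (B j) (\<phi> z))) \<in> trans"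
      using j z by (auto simp: trans_def)
    then have "summand I G i x \<otimes>\<^bsub>S\<^esub> inv\<^bsub>S\<^esub> summand I G j (B j) \<in> rels"
      unfolding rels_def using coset_eq_self_iff [OF B [OF jI], THEN iffD2, OF j(2)] z(2) by auto
    then show ?thesis
      using generate.incl [of _ rels S] summand_closed [OF i x] by (simp only: one [OF jI] inv_one r_one)
  qed
  fix x assume "x \<in> carrier S"
  then have x: "x \<in> (\<Pi>\<^sub>E i\<in>I. carrier (G i))" "finite {i \<in> I. x i \<noteq> \<one>\<^bsub>G i\<^esub>}"
    by (auto simp: carrier_sum_group group_G)
  have "\<forall>x. x \<in> (\<Pi>\<^sub>E i\<in>I. carrier (G i)) \<longrightarrow> {i \<in> I. x i \<noteq> \<one>\<^bsub>G i\<^esub>} \<subseteq> F \<longrightarrow> x \<in> generate S rels"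
    if "finite F" for F
    using that
  proof (induction F)
    case empty
    show ?case
    proof (intro allI impI)
      fix x assume x: "x \<in> (\<Pi>\<^sub>E i\<in>I. carrier (G i))" "{i \<in> I. x i \<noteq> \<one>\<^bsub>G i\<^esub>} \<subseteq> {}"
      have "x = \<one>\<^bsub>S\<^esub>"
      proof
        fix i show "x i = \<one>\<^bsub>S\<^esub> i"
          using x by (cases "i \<in> I") (auto simp: PiE_def extensional_def)
      qed
      then show "x \<in> generate S rels" using generate.one by metis
    qed
  next
    case (insert i F)
    show ?case
    proof (intro allI impI)
      fix x assume x: "x \<in> (\<Pi>\<^sub>E i\<in>I. carrier (G i))" and supp: "{j \<in> I. x j \<noteq> \<one>\<^bsub>G j\<^esub>} \<subseteq> insert i F"
      show "x \<in> generate S rels"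
      proof (cases "i \<in> I")
        case False
        then show ?thesis using insert.IH x supp by blast
      next
        case True
        define y where "y = x(i := \<one>\<^bsub>G i\<^esub>)"
        have oneG: "\<one>\<^bsub>G j\<^esub> \<in> carrier (G j)" if "j \<in> I" for j
          using group.is_monoid [OF group_G [OF that]] by (rule monoid.one_closed)
        have yP: "y \<in> (\<Pi>\<^sub>E i\<in>I. carrier (G i))"
          using x True oneG by (auto simp: y_def PiE_def extensional_def)
        moreover have "{j \<in> I. y j \<noteq> \<one>\<^bsub>G j\<^esub>} \<subseteq> F" using supp by (auto simp: y_def)
        ultimately have y: "y \<in> generate S rels" using insert.IH by blast
        have xi: "x i \<in> carrier (G i)" using x True by auto
        have "y \<otimes>\<^bsub>S\<^esub> summand I G i (x i) = x"
        proof
          fix j show "(y \<otimes>\<^bsub>S\<^esub> summand I G i (x i)) j = x j"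
          proof (cases "j \<in> I")
            case True
            then have xj: "x j \<in> carrier (G j)" using x by auto
            show ?thesis
              using True xj monoid.l_one [OF group.is_monoid [OF group_G [OF True]] xj]
                monoid.r_one [OF group.is_monoid [OF group_G [OF True]] xj]
              by (cases "j = i") (simp_all add: y_def summand_def)
          next
            case False
            then show ?thesis using x by (simp add: PiE_def extensional_def)
          qed
        qed
        then show ?thesis using generate.eng [OF y gen [OF True xi]] by simp
      qed
    qed
  qed
  then show "x \<in> generate S rels" using x by blast
qed

end

section \<open>Classes that die in a directed limit\<close>

locale directed_quotient_system = quotient_system I Z B G T
  for I :: "'i set" and Z B :: "'i \<Rightarrow> ('b \<Rightarrow> int) set" and G T +
  assumes T_add: "\<And>i j \<phi> z w. (i, j, \<phi>) \<in> T \<Longrightarrow> z \<in> Z i \<Longrightarrow> w \<in> Z i \<Longrightarrow> \<phi> (\<lambda>x. z x + w x) = (\<lambda>x. \<phi> z x + \<phi> w x)"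
    and T_B: "\<And>i j \<phi> z. (i, j, \<phi>) \<in> T \<Longrightarrow> z \<in> B i \<Longrightarrow> \<phi> z \<in> B j"
    and T_upper: "\<And>i j. i \<in> I \<Longrightarrow> j \<in> I \<Longrightarrow> \<exists>k \<phi> \<psi>. (i, k, \<phi>) \<in> T \<and> (j, k, \<psi>) \<in> T"
    and T_unique: "\<And>i j \<phi> \<phi>' z. (i, j, \<phi>) \<in> T \<Longrightarrow> (i, j, \<phi>') \<in> T \<Longrightarrow> z \<in> Z i \<Longrightarrow> (\<lambda>x. \<phi> z x - \<phi>' z x) \<in> B j"
    and T_id: "\<And>i. i \<in> I \<Longrightarrow> \<exists>\<phi>. (i, i, \<phi>) \<in> T \<and> (\<forall>z\<in>Z i. \<phi> z = z)"
    and T_comp: "\<And>i j k \<phi> \<psi>. (i, j, \<phi>) \<in> T \<Longrightarrow> (j, k, \<psi>) \<in> T \<Longrightarrow>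
       \<exists>\<kappa>. (i, k, \<kappa>) \<in> T \<and> (\<forall>z\<in>Z i. \<kappa> z = \<psi> (\<phi> z))"
    and I_nonempty: "I \<noteq> {}"
begin

text \<open>A property of all elements of the subgroup of relations, proved for the generators and
  preserved by products and inverses. The index set \<open>J\<close> may exceed the support of
  \<open>x\<close>, so that two families can be brought to the same \<open>J\<close>.\<close>

definition vanishes :: "('i \<Rightarrow> ('b \<Rightarrow> int) set) \<Rightarrow> bool" where
  "vanishes x \<longleftrightarrow> (\<exists>J k \<phi> \<zeta>. finite J \<and> J \<subseteq> I \<and> {i \<in> I. x i \<noteq> B i} \<subseteq> J \<and> k \<in> I \<and>
     (\<forall>j\<in>J. (j, k, \<phi> j) \<in> T \<and> \<zeta> j \<in> Z j \<and> x j = coset (B j) (\<zeta> j)) \<and>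
     (\<lambda>y. \<Sum>j\<in>J. \<phi> j (\<zeta> j) y) \<in> B k)"

lemma vanishesE:
  assumes "vanishes x"
  obtains J k \<phi> \<zeta> where "finite J" "J \<subseteq> I" "{i \<in> I. x i \<noteq> B i} \<subseteq> J" "k \<in> I"
    "\<And>j. j \<in> J \<Longrightarrow> (j, k, \<phi> j) \<in> T" "\<And>j. j \<in> J \<Longrightarrow> \<zeta> j \<in> Z j" "\<And>j. j \<in> J \<Longrightarrow> x j = coset (B j) (\<zeta> j)"
    "(\<lambda>y. \<Sum>j\<in>J. \<phi> j (\<zeta> j) y) \<in> B k"
proof -
  from assms obtain J k \<phi> \<zeta> where *: "finite J \<and> J \<subseteq> I \<and> {i \<in> I. x i \<noteq> B i} \<subseteq> J \<and> k \<in> I \<and>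
     (\<forall>j\<in>J. (j, k, \<phi> j) \<in> T \<and> \<zeta> j \<in> Z j \<and> x j = coset (B j) (\<zeta> j)) \<and>
     (\<lambda>y. \<Sum>j\<in>J. \<phi> j (\<zeta> j) y) \<in> B k"
    unfolding vanishes_def by (elim exE)
  show thesis
    by (rule that [of J k \<phi> \<zeta>]) (use * in \<open>simp_all\<close>)
qed

lemma T_0:
  assumes T: "(i, j, \<phi>) \<in> T"
  shows "\<phi> (\<lambda>x. 0) = (\<lambda>x. 0)"
proof -
  have "(\<lambda>x. 0) \<in> Z i" using fun_group_0 [OF Z] TI [OF T] by blast
  from T_add [OF T this this] have "\<phi> (\<lambda>x. 0) = (\<lambda>x. \<phi> (\<lambda>x. 0) x + \<phi> (\<lambda>x. 0) x)" by simp
  then have "\<phi> (\<lambda>x. 0) x = 0" for x using fun_cong [of "\<phi> (\<lambda>x. 0)" _ x] by fastforce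
  then show ?thesis by auto
qed

lemma T_minus:
  assumes T: "(i, j, \<phi>) \<in> T" and z: "z \<in> Z i"
  shows "\<phi> (\<lambda>x. - z x) = (\<lambda>x. - \<phi> z x)"
proof
  fix x
  have "(\<lambda>x. - z x) \<in> Z i" using fun_group_minus [OF Z z] TI [OF T] by blast
  from T_add [OF T z this] have "(\<lambda>x. \<phi> z x + \<phi> (\<lambda>x. - z x) x) = (\<lambda>x. 0)" using T_0 [OF T] by simp
  from fun_cong [OF this, of x] show "\<phi> (\<lambda>x. - z x) x = - \<phi> z x" by simp
qed

lemma T_sum:
  assumes T: "(i, j, \<phi>) \<in> T" and "\<And>l. l \<in> J \<Longrightarrow> z l \<in> Z i"
  shows "\<phi> (\<lambda>x. \<Sum>l\<in>J. z l x) = (\<lambda>x. \<Sum>l\<in>J. \<phi> (z l) x)"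
  using assms(2)
proof (induction J rule: infinite_finite_induct)
  case (insert l J)
  have "(\<lambda>x. \<Sum>l\<in>J. z l x) \<in> Z i"
    using insert TI [OF T] by (intro fun_group_sum Z) auto
  then show ?case
    using insert T_add [OF T] by simp
qed (simp_all add: T_0 [OF T])

lemma T_diff_B:
  assumes T: "(i, j, \<phi>) \<in> T" "(i, j, \<phi>') \<in> T" and z: "z \<in> Z i" "w \<in> Z i" and zw: "(\<lambda>x. z x - w x) \<in> B i"
  shows "(\<lambda>x. \<phi> z x - \<phi>' w x) \<in> B j"
proof -
  have j: "i \<in> I" "j \<in> I" using TI [OF T(1)] by auto
  have 1: "(\<lambda>x. \<phi> (\<lambda>x. z x - w x) x) \<in> B j" using T_B [OF T(1) zw] by simp
  have "\<phi> z = \<phi> (\<lambda>x. (z x - w x) + w x)" by simp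
  also have "\<dots> = (\<lambda>x. \<phi> (\<lambda>x. z x - w x) x + \<phi> w x)"
    using zw BZ j z by (intro T_add [OF T(1)]) auto
  finally have "(\<lambda>x. \<phi> z x - \<phi>' w x) = (\<lambda>x. \<phi> (\<lambda>x. z x - w x) x + (\<phi> w x - \<phi>' w x))"
    by (simp add: fun_eq_iff)
  then show ?thesis
    using fun_group_add [OF B [OF j(2)] 1 T_unique [OF T z(2)]] by simp
qed

text \<open>Both families are pushed to a common upper index \<open>l\<close> and extended by zero
  to the union of their index sets.\<close>

lemma vanishes_mult:
  assumes x: "vanishes x" and y: "vanishes y"
  shows "vanishes (x \<otimes>\<^bsub>S\<^esub> y)"
proof -
  obtain J k \<phi> \<zeta> where J: "finite J" "J \<subseteq> I" "{i \<in> I. x i \<noteq> B i} \<subseteq> J" "k \<in> I"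
    "\<And>j. j \<in> J \<Longrightarrow> (j, k, \<phi> j) \<in> T" "\<And>j. j \<in> J \<Longrightarrow> \<zeta> j \<in> Z j" "\<And>j. j \<in> J \<Longrightarrow> x j = coset (B j) (\<zeta> j)"
    "(\<lambda>y. \<Sum>j\<in>J. \<phi> j (\<zeta> j) y) \<in> B k"
    using x by (rule vanishesE) blast
  obtain J' k' \<phi>' \<zeta>' where J': "finite J'" "J' \<subseteq> I" "{i \<in> I. y i \<noteq> B i} \<subseteq> J'" "k' \<in> I"
    "\<And>j. j \<in> J' \<Longrightarrow> (j, k', \<phi>' j) \<in> T" "\<And>j. j \<in> J' \<Longrightarrow> \<zeta>' j \<in> Z j" "\<And>j. j \<in> J' \<Longrightarrow> y j = coset (B j) (\<zeta>' j)"
    "(\<lambda>y. \<Sum>j\<in>J'. \<phi>' j (\<zeta>' j) y) \<in> B k'"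
    using y by (rule vanishesE) blast
  obtain l \<psi> \<psi>' where l: "(k, l, \<psi>) \<in> T" "(k', l, \<psi>') \<in> T" using T_upper J(4) J'(4) by blast
  have lI: "l \<in> I" using TI l by blast
  have "\<forall>j\<in>J. \<exists>\<kappa>. (j, l, \<kappa>) \<in> T \<and> (\<forall>z\<in>Z j. \<kappa> z = \<psi> (\<phi> j z))" using T_comp J(5) l(1) by blast
  then obtain \<kappa> where \<kappa>: "\<And>j. j \<in> J \<Longrightarrow> (j, l, \<kappa> j) \<in> T" "\<And>j z. j \<in> J \<Longrightarrow> z \<in> Z j \<Longrightarrow> \<kappa> j z = \<psi> (\<phi> j z)"
    by metis
  have "\<forall>j\<in>J'. \<exists>\<kappa>. (j, l, \<kappa>) \<in> T \<and> (\<forall>z\<in>Z j. \<kappa> z = \<psi>' (\<phi>' j z))" using T_comp J'(5) l(2) by blast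
  then obtain \<kappa>' where \<kappa>': "\<And>j. j \<in> J' \<Longrightarrow> (j, l, \<kappa>' j) \<in> T" "\<And>j z. j \<in> J' \<Longrightarrow> z \<in> Z j \<Longrightarrow> \<kappa>' j z = \<psi>' (\<phi>' j z)"
    by metis
  define \<omega> where "\<omega> j = (if j \<in> J then \<kappa> j else \<kappa>' j)" for j
  define \<eta> where "\<eta> j = (if j \<in> J then \<zeta> j else (\<lambda>x. 0))" for j
  define \<eta>' where "\<eta>' j = (if j \<in> J' then \<zeta>' j else (\<lambda>x. 0))" for j
  let ?K = "J \<union> J'"
  have \<omega>: "(j, l, \<omega> j) \<in> T" if "j \<in> ?K" for j using that \<kappa> \<kappa>' by (auto simp: \<omega>_def)
  have \<eta>: "\<eta> j \<in> Z j" "\<eta>' j \<in> Z j" if "j \<in> ?K" for j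
    using that J J' fun_group_0 [OF Z] by (auto simp: \<eta>_def \<eta>'_def)
  have xy: "x j = coset (B j) (\<eta> j)" "y j = coset (B j) (\<eta>' j)" if "j \<in> ?K" for j
    using that J J' by (auto simp: \<eta>_def \<eta>'_def coset_0)
  have 1: "(\<lambda>u. \<Sum>j\<in>?K. \<omega> j (\<eta> j) u) \<in> B l"
  proof -
    have "(\<lambda>u. \<Sum>j\<in>?K. \<omega> j (\<eta> j) u) = (\<lambda>u. \<Sum>j\<in>J. \<kappa> j (\<zeta> j) u)"
    proof
      fix u
      have "(\<Sum>j\<in>?K. \<omega> j (\<eta> j) u) = (\<Sum>j\<in>J. \<omega> j (\<eta> j) u)"
        using J(1) J'(1) T_0 [OF \<omega>] by (intro sum.mono_neutral_right) (auto simp: \<eta>_def)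
      then show "(\<Sum>j\<in>?K. \<omega> j (\<eta> j) u) = (\<Sum>j\<in>J. \<kappa> j (\<zeta> j) u)"
        by (simp add: \<omega>_def \<eta>_def)
    qed
    also have "\<dots> = (\<lambda>u. \<Sum>j\<in>J. \<psi> (\<phi> j (\<zeta> j)) u)" using J(6) by (simp add: \<kappa>(2))
    also have "\<dots> = \<psi> (\<lambda>u. \<Sum>j\<in>J. \<phi> j (\<zeta> j) u)"
      using J(5,6) TZ by (intro T_sum [OF l(1), symmetric]) blast
    finally show ?thesis using T_B [OF l(1) J(8)] by simp
  qed
  have 2: "(\<lambda>u. \<Sum>j\<in>?K. \<omega> j (\<eta>' j) u) \<in> B l"
  proof -
    have "(\<lambda>u. \<Sum>j\<in>?K. \<omega> j (\<eta>' j) u) = (\<lambda>u. \<Sum>j\<in>J'. \<omega> j (\<zeta>' j) u)"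
    proof
      fix u
      have "(\<Sum>j\<in>?K. \<omega> j (\<eta>' j) u) = (\<Sum>j\<in>J'. \<omega> j (\<eta>' j) u)"
        using J(1) J'(1) T_0 [OF \<omega>] by (intro sum.mono_neutral_right) (auto simp: \<eta>'_def)
      then show "(\<Sum>j\<in>?K. \<omega> j (\<eta>' j) u) = (\<Sum>j\<in>J'. \<omega> j (\<zeta>' j) u)"
        by (simp add: \<eta>'_def)
    qed
    \<comment> \<open>At an index that also lies in \<open>J\<close>, the map
      \<open>\<omega>\<close> need not be \<open>\<kappa>'\<close>; the difference is split off and
      lies in \<open>B l\<close> by \<open>T_unique\<close>.\<close>
    also have "\<dots> = (\<lambda>u. (\<Sum>j\<in>J'. \<kappa>' j (\<zeta>' j) u) + (\<Sum>j\<in>J'. \<omega> j (\<zeta>' j) u - \<kappa>' j (\<zeta>' j) u))"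
      by (simp add: sum_subtractf)
    finally have eq: "(\<lambda>u. \<Sum>j\<in>?K. \<omega> j (\<eta>' j) u) =
      (\<lambda>u. (\<Sum>j\<in>J'. \<kappa>' j (\<zeta>' j) u) + (\<Sum>j\<in>J'. \<omega> j (\<zeta>' j) u - \<kappa>' j (\<zeta>' j) u))" .
    have "(\<lambda>u. \<Sum>j\<in>J'. \<kappa>' j (\<zeta>' j) u) = (\<lambda>u. \<Sum>j\<in>J'. \<psi>' (\<phi>' j (\<zeta>' j)) u)"
      using J'(6) by (simp add: \<kappa>'(2))
    also have "\<dots> = \<psi>' (\<lambda>u. \<Sum>j\<in>J'. \<phi>' j (\<zeta>' j) u)"
      using J'(5,6) TZ by (intro T_sum [OF l(2), symmetric]) blast
    finally have a: "(\<lambda>u. \<Sum>j\<in>J'. \<kappa>' j (\<zeta>' j) u) \<in> B l" using T_B [OF l(2) J'(8)] by simp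
    have b: "(\<lambda>u. \<Sum>j\<in>J'. \<omega> j (\<zeta>' j) u - \<kappa>' j (\<zeta>' j) u) \<in> B l"
      using J'(6) \<omega> \<kappa>'(1) by (intro fun_group_sum [OF B [OF lI]] T_unique) auto
    show ?thesis unfolding eq by (rule fun_group_add [OF B [OF lI] a b])
  qed
  have "(\<lambda>u. \<Sum>j\<in>?K. \<omega> j (\<lambda>x. \<eta> j x + \<eta>' j x) u) = (\<lambda>u. (\<Sum>j\<in>?K. \<omega> j (\<eta> j) u) + (\<Sum>j\<in>?K. \<omega> j (\<eta>' j) u))"
    using \<eta> T_add [OF \<omega>] by (simp add: sum.distrib [symmetric])
  then have 3: "(\<lambda>u. \<Sum>j\<in>?K. \<omega> j (\<lambda>x. \<eta> j x + \<eta>' j x) u) \<in> B l"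
    using fun_group_add [OF B [OF lI] 1 2] by simp
  have K: "finite ?K" "?K \<subseteq> I" using J J' by auto
  have prod: "(x \<otimes>\<^bsub>S\<^esub> y) j = coset (B j) (\<lambda>x. \<eta> j x + \<eta>' j x)" if "j \<in> ?K" for j
    using that K xy \<eta> mult_G by (auto simp: subset_iff)
  have "{i \<in> I. (x \<otimes>\<^bsub>S\<^esub> y) i \<noteq> B i} \<subseteq> ?K"
  proof clarify
    fix i assume i: "i \<in> I" "(x \<otimes>\<^bsub>S\<^esub> y) i \<noteq> B i" "i \<notin> J'"
    show "i \<in> J"
    proof (rule ccontr)
      assume "i \<notin> J"
      then have "x i = B i" "y i = B i" using i J(3) J'(3) by auto
      then show False
        using i mult_G [of i "\<lambda>x. 0" "\<lambda>x. 0"] fun_group_0 [OF Z] by (simp add: coset_0)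
    qed
  qed
  with K lI \<omega> \<eta> prod 3 show ?thesis
    unfolding vanishes_def
    by (intro exI [of _ ?K] exI [of _ l] exI [of _ \<omega>] exI [of _ "\<lambda>j x. \<eta> j x + \<eta>' j x"])
      (auto intro!: fun_group_add Z)
qed

lemma vanishes_inv:
  assumes x: "vanishes x" and xS: "x \<in> carrier S"
  shows "vanishes (inv\<^bsub>S\<^esub> x)"
proof -
  obtain J k \<phi> \<zeta> where J: "finite J" "J \<subseteq> I" "{i \<in> I. x i \<noteq> B i} \<subseteq> J" "k \<in> I"
    "\<And>j. j \<in> J \<Longrightarrow> (j, k, \<phi> j) \<in> T" "\<And>j. j \<in> J \<Longrightarrow> \<zeta> j \<in> Z j" "\<And>j. j \<in> J \<Longrightarrow> x j = coset (B j) (\<zeta> j)"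
    "(\<lambda>y. \<Sum>j\<in>J. \<phi> j (\<zeta> j) y) \<in> B k"
    using x by (rule vanishesE) blast
  have inv: "(inv\<^bsub>S\<^esub> x) i = inv\<^bsub>G i\<^esub> x i" if "i \<in> I" for i
    using inv_sum_group [OF group_G xS] that by simp
  have "(\<lambda>y. \<Sum>j\<in>J. \<phi> j (\<lambda>x. - \<zeta> j x) y) = (\<lambda>y. - (\<Sum>j\<in>J. \<phi> j (\<zeta> j) y))"
    using T_minus [OF J(5) J(6)] by (simp add: sum_negf)
  then have "(\<lambda>y. \<Sum>j\<in>J. \<phi> j (\<lambda>x. - \<zeta> j x) y) \<in> B k"
    using fun_group_minus [OF B [OF J(4)] J(8)] by simp
  moreover have "{i \<in> I. (inv\<^bsub>S\<^esub> x) i \<noteq> B i} \<subseteq> J"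
  proof clarify
    fix i assume i: "i \<in> I" "(inv\<^bsub>S\<^esub> x) i \<noteq> B i"
    show "i \<in> J"
    proof (rule ccontr)
      assume "i \<notin> J"
      then have "x i = coset (B i) (\<lambda>x. 0)" using i J(3) by (auto simp: coset_0)
      then show False
        using i inv [OF i(1)] inv_G [OF i(1) fun_group_0 [OF Z [OF i(1)]]] by (simp add: coset_0)
    qed
  qed
  moreover have "(inv\<^bsub>S\<^esub> x) j = coset (B j) (\<lambda>x. - \<zeta> j x)" if "j \<in> J" for j
    using that J inv inv_G by auto
  ultimately show ?thesis
    unfolding vanishes_def using J
    by (intro exI [of _ J] exI [of _ k] exI [of _ \<phi>] exI [of _ "\<lambda>j x. - \<zeta> j x"])
      (auto intro!: fun_group_minus Z)
qed

text \<open>Moving both terms of a relation to \<open>j\<close> gives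
  \<open>\<phi> z - \<phi> z\<close>. If \<open>i = j\<close> the two terms merge into one entry,
  and \<open>T_unique\<close> compares \<open>\<phi>\<close> with the identity.\<close>

lemma vanishes_rels:
  assumes "r \<in> rels"
  shows "vanishes r"
proof -
  obtain i j \<phi> z where T: "(i, j, \<phi>) \<in> T" "z \<in> Z i"
    "r = summand I G i (coset (B i) z) \<otimes>\<^bsub>S\<^esub> inv\<^bsub>S\<^esub> summand I G j (coset (B j) (\<phi> z))"
    using assms unfolding rels_def trans_def by blast
  have ij: "i \<in> I" "j \<in> I" using TI [OF T(1)] by auto
  have \<phi>z: "\<phi> z \<in> Z j" using TZ T by blast
  obtain \<iota> where \<iota>: "(j, j, \<iota>) \<in> T" "\<And>z. z \<in> Z j \<Longrightarrow> \<iota> z = z" using T_id ij by blast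
  define m where "m = (\<lambda>x. - \<phi> z x)"
  have m: "m \<in> Z j" unfolding m_def by (rule fun_group_minus [OF Z [OF ij(2)] \<phi>z])
  have yS: "summand I G j (coset (B j) (\<phi> z)) \<in> carrier S"
    using \<phi>z ij by (intro summand_closed) (auto simp: carrier_G)
  have r: "r l = (summand I G i (coset (B i) z) l) \<otimes>\<^bsub>G l\<^esub> inv\<^bsub>G l\<^esub> (summand I G j (coset (B j) (\<phi> z)) l)" if "l \<in> I" for l
    using inv_sum_group [OF group_G yS] that unfolding T(3) by simp
  have mon: "monoid (G l)" if "l \<in> I" for l using group.is_monoid [OF group_G [OF that]] .
  have zc: "coset (B i) z \<in> carrier (G i)" "coset (B j) (\<phi> z) \<in> carrier (G j)" "coset (B j) m \<in> carrier (G j)"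
    using ij T(2) \<phi>z m by (auto simp: carrier_G)
  have rl: "r l = B l" if "l \<in> I" "l \<noteq> i" "l \<noteq> j" for l
    using that r [OF that(1)] mon [OF that(1)] by (simp add: summand_def monoid.inv_one monoid.one_closed one_G flip: one_G)
  show ?thesis
  proof (cases "i = j")
    case False
    have ri: "r i = coset (B i) z"
      using r [OF ij(1)] mon [OF ij(1)] False ij zc by (simp add: summand_def monoid.inv_one)
    have rj: "r j = coset (B j) m"
      using r [OF ij(2)] mon [OF ij(2)] False ij zc inv_G [OF ij(2) \<phi>z] by (simp add: summand_def m_def)
    have "(\<lambda>y. \<Sum>l\<in>{i, j}. (if l = i then \<phi> else \<iota>) (if l = i then z else m) y) = (\<lambda>y. 0)"
      using False \<iota>(2) [OF m] by (simp add: m_def)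
    then show ?thesis
      unfolding vanishes_def
      by (intro exI [of _ "{i, j}"] exI [of _ j] exI [of _ "\<lambda>l. if l = i then \<phi> else \<iota>"] exI [of _ "\<lambda>l. if l = i then z else m"])
        (use ij T \<iota> m ri rj rl fun_group_0 [OF B [OF ij(2)]] False in auto)
  next
    case True
    define w where "w = (\<lambda>x. z x - \<phi> z x)"
    have w: "w = (\<lambda>x. z x + m x)" by (simp add: w_def m_def)
    have wZ: "w \<in> Z j" unfolding w using fun_group_add [OF Z [OF ij(2)] _ m] T(2) True by simp
    have rj: "r j = coset (B j) w"
      using r [OF ij(2)] True ij inv_G [OF ij(2) \<phi>z] mult_G [OF ij(2) _ m, of z] T(2)
      by (simp add: summand_def m_def w)
    have "(\<lambda>x. \<iota> z x - \<phi> z x) \<in> B j"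
      using T_unique [of j j \<iota> \<phi> z] \<iota>(1) T True by simp
    then have "w \<in> B j" using \<iota>(2) T(2) True by (simp add: w_def)
    then show ?thesis
      unfolding vanishes_def
      by (intro exI [of _ "{j}"] exI [of _ j] exI [of _ "\<lambda>l. \<iota>"] exI [of _ "\<lambda>l. w"])
        (use ij \<iota> wZ rj rl True in auto)
  qed
qed

text \<open>Triviality makes the summand of \<open>z\<close> at \<open>i\<close> a product of
  relations, so it vanishes in the above sense. The other entries are represented by elements of
  \<open>B j\<close> and stay trivial at \<open>k\<close>; so the entry at \<open>i\<close> must die
  there.\<close>

lemma direct_limit_trivialD:
  assumes triv: "trivial_group (direct_limit I G trans)" and i: "i \<in> I" and z: "z \<in> Z i"
  shows "\<exists>j \<phi>. (i, j, \<phi>) \<in> T \<and> \<phi> z \<in> B j"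
proof -
  let ?x = "summand I G i (coset (B i) z)"
  interpret comm_group S by (rule comm_S)
  have gS: "generate S rels \<subseteq> carrier S" using generate_incl [OF rels_closed] .
  have "vanishes x" if "x \<in> generate S rels" for x
    using that
  proof induction
    case one
    obtain k where "k \<in> I" using I_nonempty by blast
    then show ?case
      unfolding vanishes_def by (intro exI [of _ "{}"] exI [of _ k]) (auto simp: one_G fun_group_0 B)
  next
    case (incl h)
    then show ?case by (rule vanishes_rels)
  next
    case (inv h)
    then show ?case using vanishes_inv vanishes_rels rels_closed by blast
  next
    case (eng h1 h2)
    then show ?case using vanishes_mult by blast
  qed
  moreover have "?x \<in> carrier S" using i z by (intro summand_closed) (auto simp: carrier_G)
  ultimately have "vanishes ?x"
    using triv unfolding trivial_direct_limit_iff by blast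
  then obtain J k \<phi> \<zeta> where J: "finite J" "J \<subseteq> I" "{l \<in> I. ?x l \<noteq> B l} \<subseteq> J" "k \<in> I"
    "\<And>j. j \<in> J \<Longrightarrow> (j, k, \<phi> j) \<in> T" "\<And>j. j \<in> J \<Longrightarrow> \<zeta> j \<in> Z j" "\<And>j. j \<in> J \<Longrightarrow> ?x j = coset (B j) (\<zeta> j)"
    "(\<lambda>y. \<Sum>j\<in>J. \<phi> j (\<zeta> j) y) \<in> B k"
    by (rule vanishesE) blast
  have xi: "?x i = coset (B i) z" using i by (simp add: summand_def)
  have xj: "?x j = B j" if "j \<in> I" "j \<noteq> i" for j using that by (simp add: summand_def one_G)
  show ?thesis
  proof (cases "i \<in> J")
    case False
    then have "coset (B i) z = B i" using J(3) xi i by auto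
    then have "z \<in> B i" using coset_eq_self_iff [OF B [OF i]] by simp
    then show ?thesis using T_id [OF i] z by metis
  next
    case True
    have "(\<lambda>y. \<Sum>j\<in>J - {i}. \<phi> j (\<zeta> j) y) \<in> B k"
    proof (rule fun_group_sum [OF B [OF J(4)]])
      fix j assume j: "j \<in> J - {i}"
      then have "coset (B j) (\<zeta> j) = B j" using J(2,7) xj by (metis DiffE insertI1 subsetD)
      then have "\<zeta> j \<in> B j" using coset_eq_self_iff [OF B] j J(2) by blast
      then show "\<phi> j (\<zeta> j) \<in> B k" using T_B J(5) j by blast
    qed
    from fun_group_diff [OF B [OF J(4)] J(8) this]
    have 1: "\<phi> i (\<zeta> i) \<in> B k"
      using J(1) True by (simp add: sum.remove)
    have "coset (B i) z = coset (B i) (\<zeta> i)" using J(7) [OF True] xi by simp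
    then have "(\<lambda>x. z x - \<zeta> i x) \<in> B i" using coset_eq_iff [OF B [OF i]] by simp
    from fun_group_add [OF B [OF J(4)] T_diff_B [OF J(5) [OF True] J(5) [OF True] z J(6) [OF True] this] 1]
    have "\<phi> i z \<in> B k" by simp
    then show ?thesis using J(5) True by blast
  qed
qed

end

section \<open>Vanishing of cohomology groups\<close>

lemma subgroup_generated_funs:
  assumes "fun_group A" "fun_group Z" "Z \<subseteq> A"
  shows "subgroup_generated (funs A) Z = funs Z"
proof -
  have "carrier (subgroup_generated (funs A) Z) = Z"
    using subgroup.carrier_subgroup_generated_subgroup [OF subgroup_funs [OF assms]] .
  then show ?thesis
    by (simp add: subgroup_generated_def funs_def)
qed

lemma trivial_funs_Mod_iff:
  assumes "fun_group Z" "fun_group B" "B \<subseteq> Z"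
  shows "trivial_group (funs Z Mod B) \<longleftrightarrow> Z \<subseteq> B"
  using trivial_Mod_iff [OF comm_group_funs [OF assms(1)] subgroup_funs [OF assms]] by simp

lemma cohomology_group_funs:
  assumes C: "C n = funs A" "fun_group A" "\<one>\<^bsub>C (n + 1)\<^esub> = (\<lambda>x. 0)"
    and \<delta>: "\<And>f g. \<delta> n (\<lambda>x. f x - g x) = (\<lambda>x. \<delta> n f x - \<delta> n g x)"
  shows "fun_group (cocycles C \<delta> n)" "cohomology_group C \<delta> n = funs (cocycles C \<delta> n) Mod coboundaries C \<delta> n"
proof -
  have \<delta>0: "\<delta> n (\<lambda>x. 0) = (\<lambda>x. 0)" using \<delta> [of "\<lambda>x. 0" "\<lambda>x. 0"] by simp
  have Z: "cocycles C \<delta> n = {f \<in> A. \<delta> n f = (\<lambda>x. 0)}"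
    using C by (simp add: cocycles_def kernel_def)
  show grp: "fun_group (cocycles C \<delta> n)"
    using C(2) unfolding Z fun_group_def by (simp add: \<delta> \<delta>0)
  show "cohomology_group C \<delta> n = funs (cocycles C \<delta> n) Mod coboundaries C \<delta> n"
    using subgroup_generated_funs [OF C(2) grp] unfolding cohomology_group_def C(1) Z by auto
qed

lemma fun_group_coboundaries:
  assumes C: "C (n - 1) = funs A" "fun_group A"
    and \<delta>: "\<And>f g. \<delta> (n - 1) (\<lambda>x. f x - g x) = (\<lambda>x. \<delta> (n - 1) f x - \<delta> (n - 1) g x)"
  shows "fun_group (coboundaries C \<delta> n)"
proof -
  have \<delta>0: "\<delta> (n - 1) (\<lambda>x. 0) = (\<lambda>x. 0)" using \<delta> [of "\<lambda>x. 0" "\<lambda>x. 0"] by simp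
  show ?thesis
    unfolding fun_group_def coboundaries_def C(1) funs_simps
  proof (intro conjI ballI)
    show "(\<lambda>x. 0) \<in> \<delta> (n - 1) ` A"
      using \<delta>0 fun_group_0 [OF C(2)] by (metis image_eqI)
    fix f g assume "f \<in> \<delta> (n - 1) ` A" "g \<in> \<delta> (n - 1) ` A"
    then obtain u v where uv: "u \<in> A" "v \<in> A" "f = \<delta> (n - 1) u" "g = \<delta> (n - 1) v" by blast
    then have "(\<lambda>x. f x - g x) = \<delta> (n - 1) (\<lambda>x. u x - v x)" by (simp add: \<delta>)
    then show "(\<lambda>x. f x - g x) \<in> \<delta> (n - 1) ` A"
      using fun_group_diff [OF C(2) uv(1,2)] by blast
  qed
qed

subsection \<open>Cech cohomology\<close>

lemma cochain_group_funs: "cochain_group S = funs {f. \<forall>x. x \<notin> S \<longrightarrow> f x = 0}"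
  by (simp add: cochain_group_def funs_def)

lemma fun_group_cochains: "fun_group {f. \<forall>x. x \<notin> S \<longrightarrow> f x = 0}"
  by (auto simp: fun_group_def)

lemma nerve_coboundary_diff:
  "nerve_coboundary a U n (\<lambda>x. f x - g x) = (\<lambda>x. nerve_coboundary a U n f x - nerve_coboundary a U n g x)"
  by (auto simp: nerve_coboundary_def sum_subtractf algebra_simps)

lemma nerve_coboundary_eq:
  "nerve_coboundary True U (int m - 1) f = (\<lambda>us. if us \<in> nerve U (Suc m) then pair f (lbd us) else 0)"
  using nerve_simplices_eq [of U "Suc m"] by (auto simp: nerve_coboundary_def pair_lbd fun_eq_iff)

abbreviation "nerve_Z a U n \<equiv> cocycles (nerve_cochain_group a U) (nerve_coboundary a U) n"
abbreviation "nerve_B a U n \<equiv> coboundaries (nerve_cochain_group a U) (nerve_coboundary a U) n"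

lemma nerve_Z_eq:
  "nerve_Z True U (int m - 1) = {f. (\<forall>us. us \<notin> nerve U m \<longrightarrow> f us = 0) \<and> cocycle (nerve U) (\<lambda>m. lbd) m f}"
  by (auto simp: cocycles_def kernel_def nerve_cochain_group_def cochain_group_funs nerve_coboundary_eq
      nerve_simplices_eq cocycle_def fun_eq_iff)

lemma nerve_B_eq:
  "nerve_B True U (int m - 1) = {f. (\<forall>us. us \<notin> nerve U m \<longrightarrow> f us = 0) \<and> coboundary (nerve U) (\<lambda>m. lbd) m f}"
proof (cases m)
  case 0
  \<comment> \<open>Degree 0 is dimension -1, and even the augmented nerve has nothing in dimension
    -2.\<close>
  have simp1: "nerve_simplices True U (- 2) = {}" by (auto simp: nerve_simplices_def)
  have "nerve_coboundary True U (- 2) f = (\<lambda>us. 0)" for f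
    by (auto simp: nerve_coboundary_def nerve_simplices_def)
  then have "nerve_B True U (int m - 1) = {\<lambda>us. 0}"
    using 0 by (auto simp: coboundaries_def nerve_cochain_group_def cochain_group_funs simp1 intro!: image_eqI [of _ _ "\<lambda>x. 0"])
  also have "\<dots> = {f. (\<forall>us. us \<notin> nerve U m \<longrightarrow> f us = 0) \<and> coboundary (nerve U) (\<lambda>m. lbd) m f}"
    using 0 by (auto simp: coboundary_def fun_eq_iff)
  finally show ?thesis .
next
  case (Suc j)
  have 1: "nerve_B True U (int m - 1) =
      (\<lambda>f us. if us \<in> nerve U (Suc j) then pair f (lbd us) else 0) ` {f. \<forall>us. us \<notin> nerve U j \<longrightarrow> f us = 0}"
    using Suc by (simp add: coboundaries_def nerve_cochain_group_def cochain_group_funs nerve_coboundary_eq nerve_simplices_eq)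
  show ?thesis
  proof (intro equalityI subsetI)
    fix f assume "f \<in> nerve_B True U (int m - 1)"
    then show "f \<in> {f. (\<forall>us. us \<notin> nerve U m \<longrightarrow> f us = 0) \<and> coboundary (nerve U) (\<lambda>m. lbd) m f}"
      unfolding 1 by (auto simp: coboundary_def Suc)
  next
    fix f assume "f \<in> {f. (\<forall>us. us \<notin> nerve U m \<longrightarrow> f us = 0) \<and> coboundary (nerve U) (\<lambda>m. lbd) m f}"
    then obtain g where f: "\<And>us. us \<notin> nerve U (Suc j) \<Longrightarrow> f us = 0"
      "\<And>us. us \<in> nerve U (Suc j) \<Longrightarrow> f us = pair g (lbd us)"
      by (auto simp: coboundary_def Suc)
    define g' where "g' us = (if us \<in> nerve U j then g us else 0)" for us
    have "pair g (lbd us) = pair g' (lbd us)" if "us \<in> nerve U (Suc j)" for us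
      using cpx_supp [OF cpx_nerve that] by (intro pair_cong) (auto simp: g'_def)
    then have "f = (\<lambda>us. if us \<in> nerve U (Suc j) then pair g' (lbd us) else 0)"
      using f by (auto simp: fun_eq_iff)
    then show "f \<in> nerve_B True U (int m - 1)"
      unfolding 1 by (intro image_eqI [of _ _ g']) (auto simp: g'_def)
  qed
qed

text \<open>The transitions as maps of cochains, one for each refinement map; passing to classes
  gives back \<open>refinement_transitions\<close>.\<close>

definition nerve_maps :: "bool \<Rightarrow> 'a topology \<Rightarrow> int \<Rightarrow>
    ('a set set \<times> 'a set set \<times> (('a set list \<Rightarrow> int) \<Rightarrow> 'a set list \<Rightarrow> int)) set" where
  "nerve_maps a X n = {(U, V, nerve_pullback a V n \<tau>) | U V \<tau>. U \<in> open_covers X \<and> V \<in> open_covers X \<and> refinement_map V U \<tau>}"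

lemma nerve_quotient_system:
  assumes BZ: "\<And>U. U \<in> open_covers X \<Longrightarrow> nerve_B a U n \<subseteq> nerve_Z a U n"
    and pull: "\<And>U V \<tau> z. U \<in> open_covers X \<Longrightarrow> V \<in> open_covers X \<Longrightarrow> refinement_map V U \<tau> \<Longrightarrow> z \<in> nerve_Z a U n \<Longrightarrow>
      nerve_pullback a V n \<tau> z \<in> nerve_Z a V n"
  shows "quotient_system (open_covers X) (\<lambda>U. nerve_Z a U n) (\<lambda>U. nerve_B a U n) (\<lambda>U. nerve_cohomology a U n) (nerve_maps a X n)"
proof
  fix U
  show "fun_group (nerve_Z a U n)"
    by (rule cohomology_group_funs) (auto simp: nerve_cochain_group_def cochain_group_funs nerve_coboundary_diff intro: fun_group_cochains)
  show "fun_group (nerve_B a U n)"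
    by (rule fun_group_coboundaries) (auto simp: nerve_cochain_group_def cochain_group_funs nerve_coboundary_diff intro: fun_group_cochains)
  show "nerve_cohomology a U n = funs (nerve_Z a U n) Mod nerve_B a U n"
    unfolding nerve_cohomology_def
    by (rule cohomology_group_funs) (auto simp: nerve_cochain_group_def cochain_group_funs nerve_coboundary_diff intro: fun_group_cochains)
qed (use assms in \<open>auto simp: nerve_maps_def\<close>)

lemma nerve_limit_eq:
  assumes "quotient_system (open_covers X) (\<lambda>U. nerve_Z a U n) (\<lambda>U. nerve_B a U n) (\<lambda>U. nerve_cohomology a U n) (nerve_maps a X n)"
  shows "nerve_limit a X n = direct_limit (open_covers X) (\<lambda>U. nerve_cohomology a U n)
    (quotient_system.trans (\<lambda>U. nerve_Z a U n) (\<lambda>U. nerve_B a U n) (nerve_maps a X n))"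
proof -
  have cl: "nerve_class a U n z = coset (nerve_B a U n) z" for U z
    by (simp add: nerve_class_def r_coset_funs nerve_cochain_group_def cochain_group_funs)
  have "refinement_transitions a X n = quotient_system.trans (\<lambda>U. nerve_Z a U n) (\<lambda>U. nerve_B a U n) (nerve_maps a X n)"
    unfolding quotient_system.trans_def [OF assms] unfolding refinement_transitions_def nerve_maps_def cl by blast
  then show ?thesis
    by (simp add: nerve_limit_def)
qed

lemma open_covers_upper:
  assumes "U \<in> open_covers X" "V \<in> open_covers X"
  obtains W \<tau> \<sigma> where "W \<in> open_covers X" "refinement_map W U \<tau>" "refinement_map W V \<sigma>"
proof -
  define W where "W = {u \<inter> v | u v. u \<in> U \<and> v \<in> V}"
  have "W \<in> open_covers X"
  proof -
    have "\<Union> W = \<Union> U \<inter> \<Union> V" unfolding W_def by blast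
    then show ?thesis
      using assms unfolding open_covers_def by (auto simp: W_def)
  qed
  moreover have "\<forall>w\<in>W. \<exists>u. u \<in> U \<and> w \<subseteq> u" "\<forall>w\<in>W. \<exists>v. v \<in> V \<and> w \<subseteq> v"
    by (auto simp: W_def)
  then obtain \<tau> \<sigma> where "refinement_map W U \<tau>" "refinement_map W V \<sigma>"
    unfolding refinement_map_def by (metis image_subsetI)
  ultimately show thesis using that by blast
qed

lemma cpx_nerve_B_Z: "nerve_B True U (int m - 1) \<subseteq> nerve_Z True U (int m - 1)"
  unfolding nerve_B_eq nerve_Z_eq using cocycle_coboundary [OF cpx_nerve] by blast

lemma nerve_pullback_eq:
  "nerve_pullback True V (int m - 1) \<tau> z = (\<lambda>vs. if vs \<in> nerve V m then z (map \<tau> vs) else 0)"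
  by (simp add: nerve_pullback_def nerve_simplices_eq)

lemma cocycle_cong:
  assumes "cpx G b" "\<And>s. s \<in> G m \<Longrightarrow> f s = g s"
  shows "cocycle G b m f \<longleftrightarrow> cocycle G b m g"
proof -
  have "pair f (b m s) = pair g (b m s)" if "s \<in> G (Suc m)" for s
    using cpx_supp [OF assms(1) that] assms(2) by (intro pair_cong) auto
  then show ?thesis by (simp add: cocycle_def)
qed

lemma nerve_pullback_Z:
  assumes \<tau>: "refinement_map V U \<tau>" and z: "z \<in> nerve_Z True U (int m - 1)"
  shows "nerve_pullback True V (int m - 1) \<tau> z \<in> nerve_Z True V (int m - 1)"
proof -
  have "cocycle (nerve V) (\<lambda>m. lbd) m (\<lambda>vs. z (map \<tau> vs))"
    using cocycle_pull [OF chmap_refinement [OF \<tau>], of m z] z by (simp add: nerve_Z_eq pull_def)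
  then show ?thesis
    unfolding nerve_Z_eq nerve_pullback_eq
    using cocycle_cong [OF cpx_nerve, of V m "\<lambda>vs. if vs \<in> nerve V m then z (map \<tau> vs) else 0" "\<lambda>vs. z (map \<tau> vs)"] by simp
qed

lemma reduced_nerve_system:
  "directed_quotient_system (open_covers X) (\<lambda>U. nerve_Z True U (int m - 1)) (\<lambda>U. nerve_B True U (int m - 1))
     (\<lambda>U. nerve_cohomology True U (int m - 1)) (nerve_maps True X (int m - 1))"
proof -
  interpret quotient_system "open_covers X" "\<lambda>U. nerve_Z True U (int m - 1)" "\<lambda>U. nerve_B True U (int m - 1)"
     "\<lambda>U. nerve_cohomology True U (int m - 1)" "nerve_maps True X (int m - 1)"
    by (rule nerve_quotient_system) (use cpx_nerve_B_Z nerve_pullback_Z in blast)+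
  show ?thesis
  proof
    fix U V \<phi> z w
    assume T: "(U, V, \<phi>) \<in> nerve_maps True X (int m - 1)"
    then obtain \<tau> where \<tau>: "refinement_map V U \<tau>" "\<phi> = nerve_pullback True V (int m - 1) \<tau>"
      by (auto simp: nerve_maps_def)
    show "\<phi> (\<lambda>x. z x + w x) = (\<lambda>x. \<phi> z x + \<phi> w x)"
      by (auto simp: \<tau> nerve_pullback_eq)
    show "\<phi> z \<in> nerve_B True V (int m - 1)" if "z \<in> nerve_B True U (int m - 1)"
    proof -
      have "coboundary (nerve V) (\<lambda>m. lbd) m (\<lambda>vs. z (map \<tau> vs))"
        using coboundary_pull [OF chmap_refinement [OF \<tau>(1)], of m z] that by (simp add: nerve_B_eq pull_def)
      then show ?thesis
        unfolding nerve_B_eq \<tau> nerve_pullback_eq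
        using coboundary_cong [of "nerve V" m "\<lambda>vs. if vs \<in> nerve V m then z (map \<tau> vs) else 0" "\<lambda>vs. z (map \<tau> vs)"]
        by simp
    qed
    show "(\<lambda>x. \<phi> z x - \<phi>' z x) \<in> nerve_B True V (int m - 1)"
      if T': "(U, V, \<phi>') \<in> nerve_maps True X (int m - 1)" and z: "z \<in> nerve_Z True U (int m - 1)" for \<phi>'
    proof -
      obtain \<tau>' where \<tau>': "refinement_map V U \<tau>'" "\<phi>' = nerve_pullback True V (int m - 1) \<tau>'"
        using T' by (auto simp: nerve_maps_def)
      have "coboundary (nerve V) (\<lambda>m. lbd) m (\<lambda>vs. z (map \<tau> vs) - z (map \<tau>' vs))"
        using refinement_contiguous [OF \<tau>(1) \<tau>'(1)] z by (simp add: nerve_Z_eq)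
      then show ?thesis
        unfolding nerve_B_eq \<tau> \<tau>' nerve_pullback_eq
        using coboundary_cong [of "nerve V" m "\<lambda>vs. (if vs \<in> nerve V m then z (map \<tau> vs) else 0) -
            (if vs \<in> nerve V m then z (map \<tau>' vs) else 0)" "\<lambda>vs. z (map \<tau> vs) - z (map \<tau>' vs)"] by simp
    qed
    show "\<exists>\<kappa>. (U, W, \<kappa>) \<in> nerve_maps True X (int m - 1) \<and> (\<forall>z\<in>nerve_Z True U (int m - 1). \<kappa> z = \<psi> (\<phi> z))"
      if T': "(V, W, \<psi>) \<in> nerve_maps True X (int m - 1)" for W \<psi>
    proof -
      obtain \<sigma> where \<sigma>: "refinement_map W V \<sigma>" "\<psi> = nerve_pullback True W (int m - 1) \<sigma>"
        using T' by (auto simp: nerve_maps_def)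
      have "refinement_map W U (\<tau> \<circ> \<sigma>)"
        using \<tau>(1) \<sigma>(1) unfolding refinement_map_def by fastforce
      moreover have "nerve_pullback True W (int m - 1) (\<tau> \<circ> \<sigma>) z = \<psi> (\<phi> z)" for z
        unfolding \<tau> \<sigma> nerve_pullback_eq using refinement_nerve [OF \<sigma>(1)] by (simp add: fun_eq_iff)
      ultimately show ?thesis
        using TI [OF T] TI [OF T'] unfolding nerve_maps_def by blast
    qed
  next
    fix U V assume UV: "U \<in> open_covers X" "V \<in> open_covers X"
    then obtain W \<tau> \<sigma> where "W \<in> open_covers X" "refinement_map W U \<tau>" "refinement_map W V \<sigma>"
      by (rule open_covers_upper)
    with UV show "\<exists>W \<phi> \<psi>. (U, W, \<phi>) \<in> nerve_maps True X (int m - 1) \<and> (V, W, \<psi>) \<in> nerve_maps True X (int m - 1)"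
      unfolding nerve_maps_def by blast
  next
    fix U assume "U \<in> open_covers X"
    moreover have "refinement_map U U id" by (simp add: refinement_map_def)
    moreover have "nerve_pullback True U (int m - 1) id z = z" if "z \<in> nerve_Z True U (int m - 1)" for z
      using that by (auto simp: nerve_pullback_eq nerve_Z_eq fun_eq_iff)
    ultimately show "\<exists>\<phi>. (U, U, \<phi>) \<in> nerve_maps True X (int m - 1) \<and> (\<forall>z\<in>nerve_Z True U (int m - 1). \<phi> z = z)"
      unfolding nerve_maps_def by blast
  next
    have "{topspace X} \<in> open_covers X" by (simp add: open_covers_def)
    then show "open_covers X \<noteq> {}" by blast
  qed
qed

text \<open>Triviality of the reduced limit in dimension \<open>m - 1\<close>, expressed through
  cochains.\<close>

definition dies :: "'a topology \<Rightarrow> nat \<Rightarrow> bool" where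
  "dies X m \<longleftrightarrow> (\<forall>U\<in>open_covers X. \<forall>z. cocycle (nerve U) (\<lambda>m. lbd) m z \<longrightarrow>
     (\<exists>V\<in>open_covers X. \<exists>\<tau>. refinement_map V U \<tau> \<and> coboundary (nerve V) (\<lambda>m. lbd) m (\<lambda>vs. z (map \<tau> vs))))"

lemma reduced_cech_trivial_iff:
  fixes X :: "'a topology"
  shows "trivial_group (reduced_cech_cohomology X (int m - 1)) \<longleftrightarrow> dies X m"
proof -
  interpret directed_quotient_system "open_covers X" "\<lambda>U. nerve_Z True U (int m - 1)" "\<lambda>U. nerve_B True U (int m - 1)"
     "\<lambda>U. nerve_cohomology True U (int m - 1)" "nerve_maps True X (int m - 1)"
    by (rule reduced_nerve_system)
  have lim: "reduced_cech_cohomology X (int m - 1) = direct_limit (open_covers X) (\<lambda>U. nerve_cohomology True U (int m - 1)) trans"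
    unfolding reduced_cech_cohomology_def by (rule nerve_limit_eq) (rule quotient_system_axioms)
  have cob: "nerve_pullback True V (int m - 1) \<tau> z \<in> nerve_B True V (int m - 1) \<longleftrightarrow>
      coboundary (nerve V) (\<lambda>m. lbd) m (\<lambda>vs. z (map \<tau> vs))" for V :: "'a set set" and \<tau> z
    using coboundary_cong [of "nerve V" m "\<lambda>vs. z (map \<tau> vs)" "nerve_pullback True V (int m - 1) \<tau> z"]
    by (auto simp: nerve_B_eq nerve_pullback_eq)
  show ?thesis
  proof
    assume triv: "trivial_group (reduced_cech_cohomology X (int m - 1))"
    show "dies X m"
      unfolding dies_def
    proof (intro ballI allI impI)
      fix U z assume U: "U \<in> open_covers X" and z: "cocycle (nerve U) (\<lambda>m. lbd) m z"
      define z' where "z' us = (if us \<in> nerve U m then z us else 0)" for us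
      have z': "z' \<in> nerve_Z True U (int m - 1)"
        using z cocycle_cong [OF cpx_nerve, of U m z' z] by (simp add: nerve_Z_eq z'_def)
      obtain V \<phi> where V: "(U, V, \<phi>) \<in> nerve_maps True X (int m - 1)" "\<phi> z' \<in> nerve_B True V (int m - 1)"
        using direct_limit_trivialD [OF triv [unfolded lim] U z'] by blast
      then obtain \<tau> where \<tau>: "V \<in> open_covers X" "refinement_map V U \<tau>" "\<phi> = nerve_pullback True V (int m - 1) \<tau>"
        by (auto simp: nerve_maps_def)
      have "coboundary (nerve V) (\<lambda>m. lbd) m (\<lambda>vs. z' (map \<tau> vs))"
        using V(2) cob \<tau>(3) by simp
      then have "coboundary (nerve V) (\<lambda>m. lbd) m (\<lambda>vs. z (map \<tau> vs))"
        using refinement_nerve [OF \<tau>(2)] coboundary_cong [of "nerve V" m "\<lambda>vs. z (map \<tau> vs)" "\<lambda>vs. z' (map \<tau> vs)"]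
        by (simp add: z'_def)
      with \<tau> show "\<exists>V\<in>open_covers X. \<exists>\<tau>. refinement_map V U \<tau> \<and> coboundary (nerve V) (\<lambda>m. lbd) m (\<lambda>vs. z (map \<tau> vs))"
        by blast
    qed
  next
    assume dies: "dies X m"
    show "trivial_group (reduced_cech_cohomology X (int m - 1))"
      unfolding lim
    proof (rule direct_limit_trivialI)
      fix U z assume U: "U \<in> open_covers X" and z: "z \<in> nerve_Z True U (int m - 1)"
      then have "cocycle (nerve U) (\<lambda>m. lbd) m z" by (simp add: nerve_Z_eq)
      then obtain V \<tau> where "V \<in> open_covers X" "refinement_map V U \<tau>"
        "coboundary (nerve V) (\<lambda>m. lbd) m (\<lambda>vs. z (map \<tau> vs))"
        using dies U unfolding dies_def by blast
      then show "\<exists>V \<phi>. (U, V, \<phi>) \<in> nerve_maps True X (int m - 1) \<and> \<phi> z \<in> nerve_B True V (int m - 1)"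
        using U cob unfolding nerve_maps_def by blast
    qed
  qed
qed

text \<open>The augmentation changes the cochains in dimension -1 only, and the groups in dimension
  \<open>n\<close> involve the dimensions \<open>n - 1\<close>, \<open>n\<close> and
  \<open>n + 1\<close>.\<close>

lemma cech_eq_reduced:
  assumes "1 \<le> n"
  shows "cech_cohomology X n = reduced_cech_cohomology X n"
proof -
  have s: "nerve_simplices False U k = nerve_simplices True U k" if "0 \<le> k" for U :: "'a set set" and k
    using that by (auto simp: nerve_simplices_def)
  have C: "nerve_cochain_group False U k = nerve_cochain_group True U k" if "0 \<le> k" for U :: "'a set set" and k
    using s [OF that] by (simp add: nerve_cochain_group_def)
  have D: "nerve_coboundary False U k = nerve_coboundary True U k" if "-1 \<le> k" for U :: "'a set set" and k
    using s [of "k + 1"] that by (simp add: nerve_coboundary_def fun_eq_iff)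
  have Z: "nerve_Z False U n = nerve_Z True U n" and B: "nerve_B False U n = nerve_B True U n" for U :: "'a set set"
    using assms by (simp_all add: cocycles_def coboundaries_def C D)
  have H: "nerve_cohomology False U n = nerve_cohomology True U n" for U :: "'a set set"
    using assms unfolding nerve_cohomology_def cohomology_group_def Z B by (simp add: C)
  have cl: "nerve_class False U n = nerve_class True U n" for U :: "'a set set"
    using assms unfolding nerve_class_def B by (simp add: C)
  have p: "nerve_pullback False V n = nerve_pullback True V n" for V :: "'a set set"
    using assms unfolding nerve_pullback_def by (simp add: s)
  have "refinement_transitions False X n = refinement_transitions True X n"
    unfolding refinement_transitions_def cl p Z ..
  then show ?thesis
    by (simp add: cech_cohomology_def reduced_cech_cohomology_def nerve_limit_def H)
qed

text \<open>The empty set is the only possible member of a cover, so nerves have no simplices and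
  all groups are trivial. This serves the case \<open>d = 0\<close>.\<close>

lemma cech_trivial_empty:
  assumes X: "topspace X = {}"
  shows "trivial_group (cech_cohomology X n)"
proof -
  have s: "nerve_simplices False U k = {}" if "U \<in> open_covers X" for U :: "'a set set" and k
  proof -
    have "u = {}" if "u \<in> U" for u using that \<open>U \<in> open_covers X\<close> X by (auto simp: open_covers_def)
    then have "us = []" if "set us \<subseteq> U" "us = [] \<or> \<Inter> (set us) \<noteq> {}" for us
      using that by (cases us) auto
    then show ?thesis unfolding nerve_simplices_def by auto
  qed
  have C: "nerve_cochain_group False U k = funs {\<lambda>x. 0}" if "U \<in> open_covers X" for U k
    using s [OF that] by (auto simp: nerve_cochain_group_def cochain_group_funs intro!: arg_cong [of _ _ funs])
  have D: "nerve_coboundary False U k f = (\<lambda>x. 0)" if "U \<in> open_covers X" for U k f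
    using s [OF that] by (simp add: nerve_coboundary_def)
  have ZB: "nerve_Z False U n = {\<lambda>x. 0}" "nerve_B False U n = {\<lambda>x. 0}" if "U \<in> open_covers X" for U
    using C [OF that] D [OF that] by (auto simp: cocycles_def coboundaries_def kernel_def)
  interpret quotient_system "open_covers X" "\<lambda>U. nerve_Z False U n" "\<lambda>U. nerve_B False U n"
     "\<lambda>U. nerve_cohomology False U n" "nerve_maps False X n"
    by (rule nerve_quotient_system) (auto simp: ZB nerve_pullback_def)
  have lim: "cech_cohomology X n = direct_limit (open_covers X) (\<lambda>U. nerve_cohomology False U n) trans"
    unfolding cech_cohomology_def by (rule nerve_limit_eq) (rule quotient_system_axioms)
  show ?thesis
    unfolding lim
  proof (rule direct_limit_trivialI)
    fix U z assume U: "U \<in> open_covers X" and z: "z \<in> nerve_Z False U n"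
    have "refinement_map U U id" by (simp add: refinement_map_def)
    then have "(U, U, nerve_pullback False U n id) \<in> nerve_maps False X n"
      using U by (auto simp: nerve_maps_def)
    moreover have "nerve_pullback False U n id z \<in> nerve_B False U n"
      using ZB [OF U] s [OF U] by (auto simp: nerve_pullback_def)
    ultimately show "\<exists>V \<phi>. (U, V, \<phi>) \<in> nerve_maps False X n \<and> \<phi> z \<in> nerve_B False V n" by blast
  qed
qed

text \<open>A vertex of the nerve has the empty list as boundary, so a cocycle is zero on the empty
  list. The contrapositive recognises an empty boundary.\<close>

lemma dies_0_if_nonempty:
  assumes "topspace X \<noteq> {}"
  shows "dies X 0"
  unfolding dies_def
proof (intro ballI allI impI)
  fix U z assume U: "U \<in> open_covers X" and z: "cocycle (nerve U) (\<lambda>m. lbd) 0 z"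
  obtain x where "x \<in> topspace X" using assms by blast
  then have "x \<in> \<Union> U" using U by (simp add: open_covers_def)
  then obtain u where "u \<in> U" "x \<in> u" by blast
  then have "[u] \<in> nerve U (Suc 0)" by (auto simp: nerve_def)
  then have "z [] = 0" using z unfolding cocycle_def by fastforce
  moreover have "refinement_map U U id" by (simp add: refinement_map_def)
  ultimately show "\<exists>V\<in>open_covers X. \<exists>\<tau>. refinement_map V U \<tau> \<and> coboundary (nerve V) (\<lambda>m. lbd) 0 (\<lambda>vs. z (map \<tau> vs))"
    using U by (intro bexI [of _ U] exI [of _ id]) (auto simp: coboundary_def nerve_def)
qed

subsection \<open>Cohomology with compact supports\<close>

definition compact_supp :: "'a topology \<Rightarrow> nat \<Rightarrow> (((nat \<Rightarrow> real) \<Rightarrow> 'a) \<Rightarrow> int) \<Rightarrow> bool" where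
  "compact_supp X m f \<longleftrightarrow> (\<exists>K. compactin X K \<and> (\<forall>s\<in>sing (subtopology X (topspace X - K)) m. f s = 0))"

text \<open>For \<open>i = 0\<close> the primitive has degree 0 and compact support, hence is zero:
  the empty simplex lies off every compact set. So the augmented complex computes the usual groups,
  and \<open>i\<close> is the true dimension.\<close>

definition hc_vanishes :: "'a topology \<Rightarrow> nat \<Rightarrow> bool" where
  "hc_vanishes X i \<longleftrightarrow> (\<forall>f. cocycle (sing X) sbd (Suc i) f \<and> compact_supp X (Suc i) f \<longrightarrow>
     (\<exists>g. compact_supp X i g \<and> (\<forall>s\<in>sing X (Suc i). f s = pair g (sbd i s))))"

lemma compact_supp_diff:
  assumes "compact_supp X m f" "compact_supp X m g"
  shows "compact_supp X m (\<lambda>s. f s - g s)"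
proof -
  obtain K L where K: "compactin X K" "\<And>s. s \<in> sing (subtopology X (topspace X - K)) m \<Longrightarrow> f s = 0"
    and L: "compactin X L" "\<And>s. s \<in> sing (subtopology X (topspace X - L)) m \<Longrightarrow> g s = 0"
    using assms by (auto simp: compact_supp_def)
  have "f s - g s = 0" if "s \<in> sing (subtopology X (topspace X - (K \<union> L))) m" for s
  proof -
    have "f s = 0" "g s = 0" using that by (auto simp: sing_subtopology intro!: K(2) L(2))
    then show ?thesis by simp
  qed
  then show ?thesis
    unfolding compact_supp_def using K(1) L(1) by (intro exI [of _ "K \<union> L"]) (auto simp: compactin_Un)
qed

lemma compact_supp_coboundary:
  assumes "compact_supp X m f"
  shows "compact_supp X (Suc m) (\<lambda>s. pair f (sbd m s))"
proof -
  obtain K where K: "compactin X K" "\<And>s. s \<in> sing (subtopology X (topspace X - K)) m \<Longrightarrow> f s = 0"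
    using assms by (auto simp: compact_supp_def)
  have "pair f (sbd m s) = 0" if "s \<in> sing (subtopology X (topspace X - K)) (Suc m)" for s
    using cpx_supp [OF cpx_sing that] K(2) by (intro pair_eq_0) auto
  then show ?thesis using K(1) by (auto simp: compact_supp_def)
qed

lemma singular_coboundary_diff:
  "singular_coboundary X n (\<lambda>x. f x - g x) = (\<lambda>x. singular_coboundary X n f x - singular_coboundary X n g x)"
  by (auto simp: singular_coboundary_def sum_subtractf algebra_simps)

lemma compact_supp_cong:
  "(\<And>s. s \<in> sing X m \<Longrightarrow> f s = g s) \<Longrightarrow> compact_supp X m f \<longleftrightarrow> compact_supp X m g"
  unfolding compact_supp_def sing_subtopology by (metis (no_types, lifting) mem_Collect_eq)

lemma pair_sbd: "pair f (sbd (Suc i) s) = (\<Sum>k\<le>Suc i. (-1) ^ k * f (singular_face (Suc i) k s))"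
  unfolding sbd_Suc by (simp add: pair_sum pair_cmul del: sum.atMost_Suc)

lemma compact_support_cohomology_trivial_iff:
  fixes X :: "'a topology"
  shows "trivial_group (compact_support_cohomology X (int i)) \<longleftrightarrow> hc_vanishes X i"
proof -
  let ?C = "compact_support_cochain_group X" and ?D = "singular_coboundary X"
  define A where "A = (\<lambda>n. {f :: ((nat \<Rightarrow> real) \<Rightarrow> 'a) \<Rightarrow> int. (\<forall>x. x \<notin> singular_simplices X n \<longrightarrow> f x = 0) \<and>
     (\<exists>K. compactin X K \<and> (\<forall>\<sigma>\<in>singular_simplices (subtopology X (topspace X - K)) n. f \<sigma> = 0))})"
  have C: "?C n = funs (A n)" for n
    by (simp add: compact_support_cochain_group_def cochain_group_funs A_def funs_def)
  have ss: "singular_simplices X (int j) = sing X (Suc j)" for j and X :: "'a topology"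
    by (simp add: singular_simplices_def)
  have A: "A (int j) = {f. (\<forall>x. x \<notin> sing X (Suc j) \<longrightarrow> f x = 0) \<and> compact_supp X (Suc j) f}" for j
    unfolding A_def compact_supp_def ss ..
  have Aneg: "A n = {\<lambda>x. 0}" if "n < 0" for n
    using that by (auto simp: A_def singular_simplices_def intro: exI [of _ "{}"])
  have fgA: "fun_group (A (int j))" for j
    unfolding A fun_group_def by (auto simp: compact_supp_diff) (auto simp: compact_supp_def intro: exI [of _ "{}"])
  have fg: "fun_group (A n)" for n
    using fgA [of "nat n"] Aneg [of n] by (cases "0 \<le> n") (auto simp: fun_group_def)
  have D: "?D (int j) f = (\<lambda>s. if s \<in> sing X (Suc (Suc j)) then pair f (sbd (Suc j) s) else 0)" for j f
  proof -
    have "nat (int j + 1) = Suc j" "int j + 1 = int (Suc j)" by auto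
    then show ?thesis unfolding singular_coboundary_def pair_sbd by (simp only: ss)
  qed
  have Z: "cocycles ?C ?D (int i) = {f \<in> A (int i). cocycle (sing X) sbd (Suc i) f}"
    by (auto simp: cocycles_def kernel_def C D cocycle_def fun_eq_iff)
  have B: "coboundaries ?C ?D (int i) = {f \<in> A (int i). \<exists>g. compact_supp X i g \<and> (\<forall>s\<in>sing X (Suc i). f s = pair g (sbd i s))}"
  proof (cases i)
    case 0
    have "?D (- 1) (\<lambda>x. 0) = (\<lambda>x. 0)" by (auto simp: singular_coboundary_def fun_eq_iff)
    then have "coboundaries ?C ?D (int i) = {\<lambda>x. 0}"
      by (simp add: coboundaries_def C 0 Aneg)
    also have "\<dots> = {f \<in> A (int i). \<exists>g. compact_supp X i g \<and> (\<forall>s\<in>sing X (Suc i). f s = pair g (sbd i s))}"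
    proof -
      have "(\<lambda>x. 0) \<in> A (int i)" using fun_group_0 [OF fg] .
      moreover have "compact_supp X 0 g \<longleftrightarrow> g (\<lambda>_. undefined) = 0" for g
        by (auto simp: compact_supp_def intro: exI [of _ "{}"])
      ultimately show ?thesis
        using 0 A [of 0] by (auto simp: fun_eq_iff intro: exI [of _ "\<lambda>x. 0"]) metis
    qed
    finally show ?thesis .
  next
    case (Suc j)
    then have i1: "int i - 1 = int j" by simp
    have 1: "coboundaries ?C ?D (int i) = (\<lambda>f s. if s \<in> sing X (Suc i) then pair f (sbd i s) else 0) ` A (int j)"
    proof -
      have Dj: "?D (int j) = (\<lambda>f s. if s \<in> sing X (Suc (Suc j)) then pair f (sbd (Suc j) s) else 0)"
        using D by auto
      show ?thesis
        unfolding coboundaries_def C funs_simps i1 Dj by (simp only: Suc)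
    qed
    show ?thesis
    proof (intro equalityI subsetI)
      fix f assume "f \<in> coboundaries ?C ?D (int i)"
      then obtain g where g: "g \<in> A (int j)" "f = (\<lambda>s. if s \<in> sing X (Suc i) then pair g (sbd i s) else 0)"
        unfolding 1 by blast
      have gc: "compact_supp X i g" using g(1) Suc by (simp add: A)
      have "compact_supp X (Suc i) f"
        using compact_supp_coboundary [OF gc] compact_supp_cong [of X "Suc i" f "\<lambda>s. pair g (sbd i s)"] g(2) by simp
      then show "f \<in> {f \<in> A (int i). \<exists>g. compact_supp X i g \<and> (\<forall>s\<in>sing X (Suc i). f s = pair g (sbd i s))}"
        using gc g(2) by (auto simp: A)
    next
      fix f assume "f \<in> {f \<in> A (int i). \<exists>g. compact_supp X i g \<and> (\<forall>s\<in>sing X (Suc i). f s = pair g (sbd i s))}"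
      then obtain g where f: "f \<in> A (int i)" and g: "compact_supp X i g" "\<And>s. s \<in> sing X (Suc i) \<Longrightarrow> f s = pair g (sbd i s)"
        by blast
      define g' where "g' s = (if s \<in> sing X i then g s else 0)" for s
      have "pair g (sbd i s) = pair g' (sbd i s)" if "s \<in> sing X (Suc i)" for s
        using cpx_supp [OF cpx_sing that] by (intro pair_cong) (auto simp: g'_def)
      then have "f = (\<lambda>s. if s \<in> sing X (Suc i) then pair g' (sbd i s) else 0)"
        using f g(2) by (auto simp: A fun_eq_iff)
      moreover have "g' \<in> A (int j)"
        using compact_supp_cong [of X i g' g] g(1) Suc unfolding A by (auto simp: g'_def)
      ultimately show "f \<in> coboundaries ?C ?D (int i)" unfolding 1 by blast
    qed
  qed
  have BZ: "coboundaries ?C ?D (int i) \<subseteq> cocycles ?C ?D (int i)"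
    unfolding B Z
  proof clarify
    fix f g assume "\<forall>s\<in>sing X (Suc i). f s = pair g (sbd i s)"
    then have "coboundary (sing X) sbd (Suc i) f" unfolding coboundary_def nat.case by blast
    then show "cocycle (sing X) sbd (Suc i) f" by (rule cocycle_coboundary [OF cpx_sing])
  qed
  have "compact_support_cohomology X (int i) = funs (cocycles ?C ?D (int i)) Mod coboundaries ?C ?D (int i)"
    unfolding compact_support_cohomology_def
    by (rule cohomology_group_funs [OF C fg]) (simp_all add: C singular_coboundary_diff)
  moreover have "fun_group (cocycles ?C ?D (int i))"
    by (rule cohomology_group_funs [OF C fg]) (simp_all add: C singular_coboundary_diff)
  moreover have "fun_group (coboundaries ?C ?D (int i))"
    by (rule fun_group_coboundaries [OF C fg]) (simp add: singular_coboundary_diff)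
  ultimately have "trivial_group (compact_support_cohomology X (int i)) \<longleftrightarrow>
      cocycles ?C ?D (int i) \<subseteq> coboundaries ?C ?D (int i)"
    using trivial_funs_Mod_iff BZ by metis
  also have "\<dots> \<longleftrightarrow> hc_vanishes X i"
  proof
    assume sub: "cocycles ?C ?D (int i) \<subseteq> coboundaries ?C ?D (int i)"
    show "hc_vanishes X i" unfolding hc_vanishes_def
    proof (intro allI impI, elim conjE)
      fix f assume f: "cocycle (sing X) sbd (Suc i) f" "compact_supp X (Suc i) f"
      define f' where "f' s = (if s \<in> sing X (Suc i) then f s else 0)" for s
      have "f' \<in> cocycles ?C ?D (int i)"
        using f cocycle_cong [OF cpx_sing, of X "Suc i" f' f] compact_supp_cong [of X "Suc i" f' f]
        unfolding Z A by (simp add: f'_def del: sing_simps)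
      then obtain g where "compact_supp X i g" "\<forall>s\<in>sing X (Suc i). f' s = pair g (sbd i s)"
        using sub unfolding B by blast
      then show "\<exists>g. compact_supp X i g \<and> (\<forall>s\<in>sing X (Suc i). f s = pair g (sbd i s))"
        by (auto simp: f'_def simp del: sing_simps)
    qed
  next
    assume "hc_vanishes X i"
    then show "cocycles ?C ?D (int i) \<subseteq> coboundaries ?C ?D (int i)"
      unfolding Z B hc_vanishes_def A by blast
  qed
  finally show ?thesis .
qed

lemma compact_support_cohomology_negative:
  assumes "n < 0"
  shows "trivial_group (compact_support_cohomology X n)"
proof -
  let ?C = "compact_support_cochain_group X" and ?D = "singular_coboundary X"
  have C: "?C k = funs {\<lambda>x. 0}" if "k < 0" for k
    using that by (auto simp: compact_support_cochain_group_def cochain_group_funs funs_def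
        singular_simplices_def intro!: exI [of _ "{}"])
  have fg: "fun_group {\<lambda>x. 0}" by (simp add: fun_group_def)
  have one: "\<one>\<^bsub>?C k\<^esub> = (\<lambda>x. 0)" for k
    by (simp add: compact_support_cochain_group_def cochain_group_funs)
  have D0: "?D k (\<lambda>x. 0) = (\<lambda>x. 0)" for k by (auto simp: singular_coboundary_def fun_eq_iff)
  have Z: "cocycles ?C ?D n = {\<lambda>x. 0}" "coboundaries ?C ?D n = {\<lambda>x. 0}"
    using assms C [of n] C [of "n - 1"] D0 one by (auto simp: cocycles_def coboundaries_def kernel_def)
  have "compact_support_cohomology X n = funs (cocycles ?C ?D n) Mod coboundaries ?C ?D n"
    unfolding compact_support_cohomology_def
    by (rule cohomology_group_funs [where A = "{\<lambda>x. 0}"]) (use assms C fg in \<open>auto simp: one singular_coboundary_diff\<close>)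
  then show ?thesis using trivial_funs_Mod_iff [OF fg fg] by (simp add: Z)
qed

section \<open>Cohomology at infinity and the boundary\<close>

text \<open>Chains are free, so exactness yields a contracting homotopy: take the whole complex as
  carrier of every simplex and compare the identity with zero. The transposed homotopy provides
  primitives.\<close>

lemma exact_cocycle_coboundary:
  assumes G: "cpx G b" and ex: "exact_on b G" and f: "cocycle G b m f"
  shows "coboundary G b m f"
proof -
  have "\<forall>s\<in>G 0. \<exists>c. supp c \<subseteq> G (Suc 0) \<and> frag_extend (b 0) c = frag_of s"
  proof
    fix s assume "s \<in> G 0"
    then show "\<exists>c. supp c \<subseteq> G (Suc 0) \<and> frag_extend (b 0) c = frag_of s"
      using exact_onD [OF ex, of "frag_of s" 0] by simp
  qed
  then obtain hz where hz: "\<And>s. s \<in> G 0 \<Longrightarrow> supp (hz s) \<subseteq> G (Suc 0)" "\<And>s. s \<in> G 0 \<Longrightarrow> frag_extend (b 0) (hz s) = frag_of s"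
    by metis
  let ?P = "\<lambda>m::nat. \<lambda>s. G"
  have ok: "carrier_ok G b b ?P" using ex by (simp add: carrier_ok_def)
  have ch: "chmap G b G b (\<lambda>m s. frag_of s)" "chmap G b G b (\<lambda>m s. 0)"
    by (simp_all add: chmap_def)
  obtain h where h: "\<And>m s. s \<in> G m \<Longrightarrow> supp (h m s) \<subseteq> G (Suc m)"
    "\<And>m s. s \<in> G (Suc m) \<Longrightarrow> frag_extend (b (Suc m)) (h (Suc m) s) = frag_of s - 0 - frag_extend (h m) (b m s)"
    "\<And>s. s \<in> G 0 \<Longrightarrow> h 0 s = hz s"
  proof (rule acyclic_carrier_homotopy [OF G ok ch, where hz = hz], goal_cases)
    case (4 h)
    show ?case by (rule 4(1) [OF 4(2-4)])
  qed (use hz in simp_all)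
  show ?thesis
  proof (cases m)
    case 0
    have "f s = 0" if s: "s \<in> G 0" for s
    proof -
      have "f s = pair f (frag_extend (b 0) (hz s))" using hz s by simp
      also have "\<dots> = 0"
        unfolding pair_extend using hz(1) [OF s] f 0 by (intro pair_eq_0 [where c = "hz s"]) (auto simp: cocycle_def)
      finally show ?thesis .
    qed
    then show ?thesis using 0 by (simp add: coboundary_def)
  next
    case (Suc j)
    have "f s = pair (pull h j f) (b j s)" if s: "s \<in> G (Suc j)" for s
      using homotopy_pull [of G b j f h s "\<lambda>m s. frag_of s" "\<lambda>m s. 0" b] h(1) [OF s] h(2) [OF s] f Suc by (simp add: pull_def)
    then show ?thesis using Suc by (auto simp: coboundary_def)
  qed
qed

lemma coboundary_subset: "coboundary G b m f \<Longrightarrow> (\<And>m. G' m \<subseteq> G m) \<Longrightarrow> coboundary G' b m f"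
proof (cases m)
  case (Suc j)
  moreover assume "coboundary G b m f" "\<And>m. G' m \<subseteq> G m"
  ultimately show ?thesis by (fastforce simp: coboundary_def)
qed (auto simp: coboundary_def)

lemma cocycle_subset: "cocycle G b m f \<Longrightarrow> (\<And>m. G' m \<subseteq> G m) \<Longrightarrow> cocycle G' b m f"
  by (auto simp: cocycle_def subset_iff)

text \<open>\<open>f\<close> differs by a coboundary from its pull-back under \<open>\<rho>\<close>,
  and the pull-back is a coboundary because \<open>\<rho>\<close> takes values in small
  chains.\<close>

lemma coboundary_small_imp:
  assumes W: "\<And>w. w \<in> W \<Longrightarrow> openin X w" "topspace X \<subseteq> \<Union> W"
    and f: "cocycle (sing X) sbd m f" and small: "coboundary (sing_small X W) sbd m f"
  shows "coboundary (sing X) sbd m f"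
proof -
  obtain \<rho> D where \<rho>: "chmap (sing X) sbd (sing_small X W) sbd \<rho>"
    "\<And>m s. s \<in> sing X (Suc m) \<Longrightarrow> frag_extend (sbd (Suc m)) (D (Suc m) s) =
       frag_of s - \<rho> (Suc m) s - frag_extend (D m) (sbd m s)"
    "\<And>s. \<rho> 0 s = frag_of s"
    "\<And>m s. s \<in> sing X m \<Longrightarrow> supp (D m s) \<subseteq> sing (subtopology X (im m s)) (Suc m)"
    using small_simplices [OF W] by metis
  have "coboundary (sing X) sbd m (\<lambda>s. pull (\<lambda>m. frag_of) m f s - pull \<rho> m f s)"
  proof (rule coboundary_diff_homotopy [OF f, where h = D])
    show "supp (D m s) \<subseteq> sing X (Suc m)" if "s \<in> sing X m" for m s
      using \<rho>(4) [OF that] unfolding sing_subtopology by blast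
  qed (use \<rho> in auto)
  from coboundary_add [OF this coboundary_pull [OF \<rho>(1) small]] show ?thesis
    by (simp add: pull_def)
qed

context proper_CAT0_space
begin

section \<open>Cohomology of the complements of balls\<close>

definition far :: "'a \<Rightarrow> real \<Rightarrow> 'a set" where
  "far p r = {x \<in> M. r < d p x}"

abbreviation sing_in :: "'a set \<Rightarrow> nat \<Rightarrow> ((nat \<Rightarrow> real) \<Rightarrow> 'a) set" where
  "sing_in A \<equiv> sing (subtopology mtopology A)"

lemma sing_in_mono: "A \<subseteq> B \<Longrightarrow> sing_in A m \<subseteq> sing_in B m"
  by (auto simp: sing_subtopology)

lemma far_antimono: "r \<le> r' \<Longrightarrow> far p r' \<subseteq> far p r"
  by (auto simp: far_def)

lemma far_eq: "p \<in> M \<Longrightarrow> far p r = topspace mtopology - mcball p r"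
  by (auto simp: far_def)

lemma compact_supp_iff:
  assumes p: "p \<in> M"
  shows "compact_supp mtopology m f \<longleftrightarrow> (\<exists>r. \<forall>s\<in>sing_in (far p r) m. f s = 0)"
proof
  assume "compact_supp mtopology m f"
  then obtain K where K: "compactin mtopology K" "\<forall>s\<in>sing_in (topspace mtopology - K) m. f s = 0"
    unfolding compact_supp_def by blast
  obtain x B where "K \<subseteq> mcball x B"
    using compactin_imp_mbounded [OF K(1)] by (auto simp: mbounded_def)
  then have "K \<subseteq> mcball p (d p x + B)"
    using p triangle [of p x] by fastforce
  then have "far p (d p x + B) \<subseteq> topspace mtopology - K"
    using p by (auto simp: far_def)
  then show "\<exists>r. \<forall>s\<in>sing_in (far p r) m. f s = 0"
    using K(2) sing_in_mono by blast
next
  assume "\<exists>r. \<forall>s\<in>sing_in (far p r) m. f s = 0"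
  then show "compact_supp mtopology m f"
    unfolding compact_supp_def far_eq [OF p] using proper p by (auto simp: proper_space_def)
qed

lemma exact_on_M: "exact_on sbd (sing mtopology)"
  using exact_on_cvx [OF cvx_M nonempty] by (metis subtopology_topspace topspace_mtopology)

lemma cocycle_M_coboundary: "cocycle (sing mtopology) sbd m f \<Longrightarrow> coboundary (sing mtopology) sbd m f"
  by (rule exact_cocycle_coboundary [OF cpx_sing exact_on_M])

text \<open>Triviality of the direct limit, for \<open>r\<close> tending to infinity, of the reduced
  singular cohomology groups of \<open>far p r\<close>.\<close>

definition vanishes_at_infinity :: "'a \<Rightarrow> nat \<Rightarrow> bool" where
  "vanishes_at_infinity p m \<longleftrightarrow> (\<forall>r g. cocycle (sing_in (far p r)) sbd m g \<longrightarrow>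
     (\<exists>r'\<ge>r. coboundary (sing_in (far p r')) sbd m g))"

text \<open>The long exact sequence of \<open>M\<close> and the complements of balls, in which
  \<open>M\<close> is acyclic. From infinity to compact supports one extends by zero and takes the
  coboundary; in the other direction one takes a primitive on \<open>M\<close> and restricts
  it.\<close>

lemma hc_vanishes_iff_infinity:
  assumes p: "p \<in> M"
  shows "hc_vanishes mtopology i \<longleftrightarrow> vanishes_at_infinity p i"
proof
  assume hc: "hc_vanishes mtopology i"
  show "vanishes_at_infinity p i"
    unfolding vanishes_at_infinity_def
  proof (intro allI impI)
    fix r g assume g: "cocycle (sing_in (far p r)) sbd i g"
    define g' where "g' s = (if s \<in> sing_in (far p r) i then g s else 0)" for s
    define f where "f s = pair g' (sbd i s)" for s
    have "coboundary (sing mtopology) sbd (Suc i) f"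
      unfolding coboundary_def nat.case f_def by blast
    then have f: "cocycle (sing mtopology) sbd (Suc i) f"
      by (rule cocycle_coboundary [OF cpx_sing])
    have "f s = 0" if s: "s \<in> sing_in (far p r) (Suc i)" for s
    proof -
      have "f s = pair g (sbd i s)"
        unfolding f_def using cpx_supp [OF cpx_sing s] by (intro pair_cong) (auto simp: g'_def)
      then show ?thesis using g s unfolding cocycle_def by simp
    qed
    then have "compact_supp mtopology (Suc i) f"
      unfolding compact_supp_iff [OF p] by blast
    then obtain b where b: "compact_supp mtopology i b" "\<And>s. s \<in> sing mtopology (Suc i) \<Longrightarrow> f s = pair b (sbd i s)"
      using hc f unfolding hc_vanishes_def by blast
    obtain r'' where r'': "\<And>s. s \<in> sing_in (far p r'') i \<Longrightarrow> b s = 0"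
      using b(1) unfolding compact_supp_iff [OF p] by blast
    \<comment> \<open>Both terms have the coboundary \<open>f\<close>. Far out the difference equals
      \<open>g\<close>, so a primitive of it on all of \<open>M\<close> serves there.\<close>
    have "cocycle (sing mtopology) sbd i (\<lambda>s. g' s - b s)"
      unfolding cocycle_def pair_diff_fun using b(2) by (simp add: f_def del: sing_simps)
    then have cob: "coboundary (sing mtopology) sbd i (\<lambda>s. g' s - b s)"
      by (rule cocycle_M_coboundary)
    define r' where "r' = max r r''"
    have "coboundary (sing_in (far p r')) sbd i (\<lambda>s. g' s - b s)"
      by (rule coboundary_subset [OF cob]) (auto simp: sing_subtopology)
    moreover have "g' s - b s = g s" if "s \<in> sing_in (far p r') i" for s
    proof -
      have "s \<in> sing_in (far p r) i" "s \<in> sing_in (far p r'') i"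
        using that sing_in_mono [OF far_antimono] unfolding r'_def by (meson max.cobounded1 max.cobounded2 subsetD)+
      then show ?thesis using r'' by (simp add: g'_def)
    qed
    ultimately have "coboundary (sing_in (far p r')) sbd i g"
      using coboundary_cong [of "sing_in (far p r')" i "\<lambda>s. g' s - b s" g] by simp
    then show "\<exists>r'\<ge>r. coboundary (sing_in (far p r')) sbd i g"
      by (intro exI [of _ r']) (simp add: r'_def)
  qed
next
  assume inf: "vanishes_at_infinity p i"
  show "hc_vanishes mtopology i"
    unfolding hc_vanishes_def
  proof (intro allI impI, elim conjE)
    fix f assume f: "cocycle (sing mtopology) sbd (Suc i) f" "compact_supp mtopology (Suc i) f"
    obtain r where r: "\<And>s. s \<in> sing_in (far p r) (Suc i) \<Longrightarrow> f s = 0"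
      using f(2) unfolding compact_supp_iff [OF p] by blast
    obtain g where g: "\<And>s. s \<in> sing mtopology (Suc i) \<Longrightarrow> f s = pair g (sbd i s)"
      using cocycle_M_coboundary [OF f(1)] unfolding coboundary_def nat.case by blast
    have sub: "sing_in A m \<subseteq> sing mtopology m" for A m by (auto simp: sing_subtopology)
    have "cocycle (sing_in (far p r)) sbd i g"
      unfolding cocycle_def using r g sub by (metis subsetD)
    then obtain r' where r': "r \<le> r'" "coboundary (sing_in (far p r')) sbd i g"
      using inf unfolding vanishes_at_infinity_def by blast
    show "\<exists>g. compact_supp mtopology i g \<and> (\<forall>s\<in>sing mtopology (Suc i). f s = pair g (sbd i s))"
    proof (cases i)
      case 0
      then have "compact_supp mtopology i g"
        using r' unfolding compact_supp_iff [OF p] by (auto simp: coboundary_def)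
      then show ?thesis using g by blast
    next
      case (Suc j)
      obtain b where b: "\<And>s. s \<in> sing_in (far p r') i \<Longrightarrow> g s = pair b (sbd j s)"
        using r'(2) unfolding coboundary_def Suc nat.case by blast
      define b' where "b' s = (if s \<in> sing_in (far p r') j then b s else 0)" for s
      \<comment> \<open>Subtracting the coboundary of \<open>b\<close>, extended by zero, makes the
        primitive vanish far out and leaves its coboundary unchanged.\<close>
      define g' where "g' s = g s - pair b' (sbd j s)" for s
      have "g' s = 0" if s: "s \<in> sing_in (far p r') i" for s
      proof -
        have "pair b' (sbd j s) = pair b (sbd j s)"
          using cpx_supp [OF cpx_sing] s unfolding Suc by (intro pair_cong) (auto simp: b'_def subset_iff simp del: sing_simps)
        then show ?thesis using b [OF s] by (simp add: g'_def)
      qed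
      then have "compact_supp mtopology i g'"
        unfolding compact_supp_iff [OF p] by blast
      moreover have "f s = pair g' (sbd i s)" if s: "s \<in> sing mtopology (Suc i)" for s
      proof -
        have "coboundary (sing mtopology) sbd i (\<lambda>s. pair b' (sbd j s))"
          unfolding coboundary_def Suc nat.case by blast
        from cocycle_coboundary [OF cpx_sing this] have "pair (\<lambda>s. pair b' (sbd j s)) (sbd i s) = 0"
          using s unfolding cocycle_def by blast
        then show ?thesis
          using g [OF s] by (simp add: g'_def [abs_def] pair_diff_fun)
      qed
      ultimately show ?thesis by blast
    qed
  qed
qed

section \<open>Passing between complements of balls and nerves\<close>

text \<open>
  The vertex map of a cover \<open>U\<close> of the boundary assigns to a point \<open>x\<close> far from \<open>p\<close> a member of \<open>U\<close>
  that contains the end points of all rays from \<open>p\<close> that pass near the geodesic from \<open>p\<close> to \<open>x\<close>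
  at time \<open>s\<close>.
\<close>

lemma vertex_map_exists:
  assumes U: "U \<in> open_covers boundary" and p: "p \<in> M" and s0: "0 < s0" "0 < e0"
  obtains s e R u where "s0 \<le> s" "0 < e" "e \<le> e0" "s \<le> R"
    "\<And>x. x \<in> far p R \<Longrightarrow> u x \<in> U"
    "\<And>x. x \<in> far p R \<Longrightarrow> \<exists>\<eta>\<in>boundary_points. d (ray p \<eta> s) (proj p s x) < e / 2"
    "\<And>x \<eta>. x \<in> far p R \<Longrightarrow> \<eta> \<in> boundary_points \<Longrightarrow> d (ray p \<eta> s) (proj p s x) < e \<Longrightarrow> \<eta> \<in> u x"
proof -
  obtain s1 e1 where se1: "0 < s1" "0 < e1" "\<And>\<xi>. \<xi> \<in> boundary_points \<Longrightarrow> \<exists>u\<in>U. cone p \<xi> s1 e1 \<subseteq> u"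
    using boundary_Lebesgue [OF U p] by metis
  define s where "s = max s0 s1"
  define e where "e = min e0 (e1 / 2)"
  have se: "s0 \<le> s" "0 < s" "0 < e" "e \<le> e0" "s1 \<le> s" "2 * e \<le> e1" using s0 se1 by (auto simp: s_def e_def)
  obtain R0 where R0: "\<And>x. x \<in> M \<Longrightarrow> R0 \<le> d p x \<Longrightarrow> \<exists>\<xi>\<in>boundary_points. d (proj p s x) (ray p \<xi> s) < e / 2"
    using far_points_near_rays [OF p, of s "e / 2"] se by auto
  define R where "R = max s R0"
  have "\<exists>\<xi>\<in>boundary_points. d (proj p s x) (ray p \<xi> s) < e / 2" if "x \<in> far p R" for x
    using R0 [of x] that by (auto simp: far_def R_def)
  then obtain \<xi> where \<xi>: "\<And>x. x \<in> far p R \<Longrightarrow> \<xi> x \<in> boundary_points"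
    "\<And>x. x \<in> far p R \<Longrightarrow> d (proj p s x) (ray p (\<xi> x) s) < e / 2"
    by metis
  obtain u where u: "\<And>\<xi>. \<xi> \<in> boundary_points \<Longrightarrow> u \<xi> \<in> U \<and> cone p \<xi> s1 e1 \<subseteq> u \<xi>"
    using se1(3) by metis
  show thesis
  proof (rule that [of s e R "\<lambda>x. u (\<xi> x)"])
    show "\<exists>\<eta>\<in>boundary_points. d (ray p \<eta> s) (proj p s x) < e / 2" if "x \<in> far p R" for x
      using \<xi> [OF that] by (auto simp: commute)
    fix x \<eta> assume x: "x \<in> far p R" and \<eta>: "\<eta> \<in> boundary_points" "d (ray p \<eta> s) (proj p s x) < e"
    have xM: "x \<in> M" using x by (simp add: far_def)
    have "d (ray p \<eta> s) (ray p (\<xi> x) s) \<le> d (ray p \<eta> s) (proj p s x) + d (proj p s x) (ray p (\<xi> x) s)"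
      using \<eta> \<xi>(1) [OF x] p se xM by (intro triangle) auto
    then have "d (ray p \<eta> s) (ray p (\<xi> x) s) < 2 * e"
      using \<eta>(2) \<xi>(2) [OF x] se by linarith
    then have "\<eta> \<in> cone p (\<xi> x) s (2 * e)" using \<eta> by (simp add: cone_def)
    also have "\<dots> \<subseteq> cone p (\<xi> x) s1 e1" using se \<xi>(1) [OF x] p se1 by (intro cone_mono)
    also have "\<dots> \<subseteq> u (\<xi> x)" using u \<xi>(1) [OF x] by blast
    finally show "\<eta> \<in> u (\<xi> x)" .
  qed (use se \<xi> u in \<open>auto simp: R_def\<close>)
qed

text \<open>The sets are small only after projection to radius \<open>s\<close>, which is all that
  the defining property of the vertex map refers to; they may be unbounded.\<close>

definition thin_cover :: "'a \<Rightarrow> real \<Rightarrow> real \<Rightarrow> real \<Rightarrow> 'a set set" where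
  "thin_cover p R s e = {{x \<in> far p R. proj p s x \<in> mball y e} | y. y \<in> M}"

lemma openin_thin_cover:
  assumes p: "p \<in> M" and s: "0 \<le> s" and w: "w \<in> thin_cover p R s e"
  shows "openin (subtopology mtopology (far p R)) w"
proof -
  obtain y where w: "w = {x \<in> far p R. proj p s x \<in> mball y e}" using w by (auto simp: thin_cover_def)
  have "openin mtopology {x \<in> topspace mtopology. proj p s x \<in> mball y e}"
    using p s by (intro openin_continuous_map_preimage [OF continuous_map_proj]) auto
  moreover have "w = {x \<in> topspace mtopology. proj p s x \<in> mball y e} \<inter> far p R"
    using w by (auto simp: far_def)
  ultimately show ?thesis by (auto simp: openin_subtopology)
qed

lemma thin_cover_covers:
  assumes "p \<in> M" "0 \<le> s" "0 < e"
  shows "topspace (subtopology mtopology (far p R)) \<subseteq> \<Union> (thin_cover p R s e)"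
proof
  fix x assume "x \<in> topspace (subtopology mtopology (far p R))"
  then have x: "x \<in> far p R" "x \<in> M" by auto
  then have "x \<in> {z \<in> far p R. proj p s z \<in> mball (proj p s x) e}"
    using assms by auto
  then show "x \<in> \<Union> (thin_cover p R s e)"
    unfolding thin_cover_def using x assms by blast
qed

lemma thin_cover_dist:
  assumes p: "p \<in> M" "0 \<le> s" and "w \<in> thin_cover p R s e" "x \<in> w" "x' \<in> w"
  shows "d (proj p s x) (proj p s x') < 2 * e"
proof -
  obtain y where y: "y \<in> M" "x \<in> M" "x' \<in> M" "d y (proj p s x) < e" "d y (proj p s x') < e"
    using assms by (auto simp: thin_cover_def far_def)
  then show ?thesis
    using triangle [of "proj p s x" y "proj p s x'"] p by (simp add: commute)
qed

text \<open>The carrier of a small simplex is the full simplex on the labels of its points.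
  Projections of its points differ by less than \<open>e / 2\<close>, so a ray within
  \<open>e / 2\<close> of one of them is within \<open>e\<close> of all; its end point belongs to
  all labels.\<close>

lemma far_to_nerve:
  assumes p: "p \<in> M" and s: "0 \<le> s" and e: "0 < e"
    and u: "\<And>x. x \<in> far p R \<Longrightarrow> u x \<in> U"
    "\<And>x. x \<in> far p R \<Longrightarrow> \<exists>\<eta>\<in>boundary_points. d (ray p \<eta> s) (proj p s x) < e / 2"
    "\<And>x \<eta>. x \<in> far p R \<Longrightarrow> \<eta> \<in> boundary_points \<Longrightarrow> d (ray p \<eta> s) (proj p s x) < e \<Longrightarrow> \<eta> \<in> u x"
  obtains \<phi> where
    "chmap (sing_small (subtopology mtopology (far p R)) (thin_cover p R s (e / 4))) sbd (nerve U) (\<lambda>m. lbd) \<phi>"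
    "\<And>m \<sigma>. \<sigma> \<in> sing_small (subtopology mtopology (far p R)) (thin_cover p R s (e / 4)) m \<Longrightarrow>
        supp (\<phi> m \<sigma>) \<subseteq> list_simplices (u ` im m \<sigma>) m"
    "\<phi> 0 (\<lambda>_. undefined) = frag_of []"
proof -
  let ?Y = "subtopology mtopology (far p R)" and ?W = "thin_cover p R s (e / 4)"
  let ?G = "sing_small ?Y ?W"
  define P where "P = (\<lambda>m \<sigma>. list_simplices (u ` im m \<sigma>))"
  have ok: "carrier_ok ?G sbd (\<lambda>m. lbd) P"
    unfolding carrier_ok_def
  proof (intro allI ballI conjI)
    fix m \<sigma> assume "\<sigma> \<in> ?G (Suc m)"
    show "exact_on (\<lambda>m. lbd) (P (Suc m) \<sigma>)"
      unfolding P_def using im_nonempty [of m \<sigma>] by (intro exact_on_list_simplices) blast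
    show "P m \<sigma>' n \<subseteq> P (Suc m) \<sigma> n" if "\<sigma>' \<in> supp (sbd m \<sigma>)" for \<sigma>' n
      using im_face [OF that] unfolding P_def list_simplices_def by blast
  qed
  have PU: "P m \<sigma> n \<subseteq> nerve U n" if \<sigma>: "\<sigma> \<in> ?G m" for m \<sigma> n
  proof
    fix us assume us: "us \<in> P m \<sigma> n"
    show "us \<in> nerve U n"
    proof (cases "us = []")
      case False
      then obtain x0 where x0: "x0 \<in> im m \<sigma>" using us by (cases us) (auto simp: P_def list_simplices_def)
      then have "m \<noteq> 0" by (cases m) auto
      then obtain w where w: "w \<in> ?W" "im m \<sigma> \<subseteq> w" using \<sigma> by (auto simp: sing_small_def)
      have wf: "w \<subseteq> far p R" using w by (auto simp: thin_cover_def)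
      obtain \<eta> where \<eta>: "\<eta> \<in> boundary_points" "d (ray p \<eta> s) (proj p s x0) < e / 2"
        using u(2) x0 w wf by blast
      have "\<eta> \<in> u x" if x: "x \<in> im m \<sigma>" for x
      proof (rule u(3) [OF _ \<eta>(1)])
        show xf: "x \<in> far p R" using x w wf by blast
        have M: "x \<in> M" "x0 \<in> M" using xf x0 w wf by (auto simp: far_def)
        have "d (proj p s x0) (proj p s x) < e / 2"
          using thin_cover_dist [OF p s w(1), of x0 x] x x0 w by auto
        moreover have "d (ray p \<eta> s) (proj p s x) \<le> d (ray p \<eta> s) (proj p s x0) + d (proj p s x0) (proj p s x)"
          using M \<eta> p s by (intro triangle) auto
        ultimately show "d (ray p \<eta> s) (proj p s x) < e" using \<eta> by linarith
      qed
      then have "\<eta> \<in> \<Inter> (set us)" "set us \<subseteq> U"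
        using us u(1) w wf unfolding P_def list_simplices_def by blast+
      then show ?thesis using us by (auto simp: nerve_def P_def list_simplices_def)
    qed (use us in \<open>auto simp: nerve_def P_def list_simplices_def\<close>)
  qed
  obtain \<phi> where "chmap ?G sbd (nerve U) (\<lambda>m. lbd) \<phi>" "\<And>m \<sigma>. \<sigma> \<in> ?G m \<Longrightarrow> supp (\<phi> m \<sigma>) \<subseteq> P m \<sigma> m"
    "\<And>\<sigma>. \<sigma> \<in> ?G 0 \<Longrightarrow> \<phi> 0 \<sigma> = frag_of []"
    by (rule acyclic_carrier_chmap [OF cpx_sing_small ok PU, where Fz = "\<lambda>\<sigma>. frag_of []"])
      (auto simp: P_def list_simplices_def)
  then show thesis
    by (intro that [of \<phi>]) (auto simp: P_def sing_small_def)
qed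

text \<open>A member of the cover is sent to the point at time \<open>S\<close> on the ray to its
  centre. If several members share a boundary point, these points lie within \<open>e\<close> of the
  ray to it at time \<open>S\<close>, and so does their convex hull, which is therefore more than
  \<open>S - e\<close> away from \<open>p\<close>.\<close>

lemma nerve_to_far:
  assumes p: "p \<in> M" and S: "0 < S" "r + e \<le> S" and e: "0 < e"
    and V: "\<And>v. v \<in> V \<Longrightarrow> c v \<in> boundary_points \<and> v \<subseteq> cone p (c v) S e"
  defines "z \<equiv> \<lambda>v. ray p (c v) S"
  obtains \<psi> where "chmap (nerve V) (\<lambda>m. lbd) (sing_in (far p r)) sbd \<psi>"
    "\<And>m vs. vs \<in> nerve V m \<Longrightarrow> supp (\<psi> m vs) \<subseteq> sing_in (chull (z ` set vs)) m"
    "\<psi> 0 [] = frag_of (\<lambda>_. undefined)"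
proof -
  define P where "P = (\<lambda>m::nat. \<lambda>vs. sing_in (chull (z ` set vs)))"
  have zM: "z v \<in> M" if "v \<in> V" for v using V [OF that] p S by (simp add: z_def)
  have ok: "carrier_ok (nerve V) (\<lambda>m. lbd) sbd P"
    unfolding carrier_ok_def
  proof (intro allI ballI conjI)
    fix m vs assume vs: "vs \<in> nerve V (Suc m)"
    then have "set vs \<noteq> {}" "z ` set vs \<subseteq> M" using zM by (auto simp: nerve_def)
    then show "exact_on sbd (P (Suc m) vs)"
      unfolding P_def using chull_superset [of "z ` set vs"] by (intro exact_on_cvx cvx_chull) auto
    show "P m vs' n \<subseteq> P (Suc m) vs n" if "vs' \<in> supp (lbd vs)" for vs' n
      unfolding P_def using supp_lbd [OF that, of "\<lambda>x y. True"] by (intro sing_in_mono chull_mono) auto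
  qed
  have hull: "chull (z ` set vs) \<subseteq> far p r" if vs: "vs \<in> nerve V m" for vs m
  proof (cases "vs = []")
    case True
    have "cvx {}" by (simp add: cvx_def)
    then show ?thesis using True chull_minimal [of "{}"] by auto
  next
    case False
    then obtain \<eta> where \<eta>: "\<And>v. v \<in> set vs \<Longrightarrow> \<eta> \<in> v" using vs by (auto simp: nerve_def)
    have sV: "set vs \<subseteq> V" using vs by (simp add: nerve_def)
    then have \<eta>b: "\<eta> \<in> boundary_points" using \<eta> V False unfolding cone_def by (cases vs) auto
    have "z ` set vs \<subseteq> mball (ray p \<eta> S) e"
    proof
      fix x assume "x \<in> z ` set vs"
      then obtain v where v: "v \<in> set vs" "x = z v" by blast
      then have "\<eta> \<in> cone p (c v) S e" using \<eta> V sV by blast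
      then show "x \<in> mball (ray p \<eta> S) e"
        using v sV zM \<eta>b p S by (auto simp: cone_def z_def)
    qed
    then have "chull (z ` set vs) \<subseteq> mball (ray p \<eta> S) e"
      by (intro chull_minimal cvx_mball)
    also have "\<dots> \<subseteq> far p r"
    proof
      fix x assume x: "x \<in> mball (ray p \<eta> S) e"
      have "S \<le> d p x + d x (ray p \<eta> S)"
        using triangle [of p x "ray p \<eta> S"] dist_ray [OF \<eta>b p, of S] x p S by simp
      then show "x \<in> far p r" using x S by (simp add: far_def commute)
    qed
    finally show ?thesis .
  qed
  obtain \<psi> where "chmap (nerve V) (\<lambda>m. lbd) (sing_in (far p r)) sbd \<psi>"
    "\<And>m vs. vs \<in> nerve V m \<Longrightarrow> supp (\<psi> m vs) \<subseteq> P m vs m"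
    "\<And>vs. vs \<in> nerve V 0 \<Longrightarrow> \<psi> 0 vs = frag_of (\<lambda>_. undefined)"
  proof (rule acyclic_carrier_chmap [OF cpx_nerve ok, where Fz = "\<lambda>vs. frag_of (\<lambda>_. undefined)"])
    show "P m vs n \<subseteq> sing_in (far p r) n" if "vs \<in> nerve V m" for m vs n
      unfolding P_def by (intro sing_in_mono hull [OF that])
  qed (auto simp: P_def)
  then show thesis
    by (intro that [of \<psi>]) (auto simp: P_def nerve_def)
qed

lemma cone_cover:
  assumes "p \<in> M" "0 < S" "0 < e"
  shows "{cone p \<zeta> S e | \<zeta>. \<zeta> \<in> boundary_points} \<in> open_covers boundary"
proof -
  have "\<zeta> \<in> cone p \<zeta> S e" if "\<zeta> \<in> boundary_points" for \<zeta>
    using that assms by (simp add: cone_def)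
  moreover have "cone p \<zeta> S e \<subseteq> boundary_points" for \<zeta> by (auto simp: cone_def)
  ultimately have "\<Union> {cone p \<zeta> S e | \<zeta>. \<zeta> \<in> boundary_points} = boundary_points" by blast
  then show ?thesis
    using openin_cone [OF _ assms] unfolding open_covers_def topspace_boundary by blast
qed

text \<open>On small simplices far out, the identity is homotopic within \<open>far p r0\<close> to
  the passage through the nerves, under which the cocycle becomes a coboundary. The points of a
  small simplex are close only after projection, so hulls of the simplices themselves are not
  controlled; radial preimages of hulls at radius \<open>S\<close> are.\<close>

lemma dies_imp_vanishes_at_infinity:
  assumes p: "p \<in> M" and dies: "dies boundary m"
  shows "vanishes_at_infinity p m"
  unfolding vanishes_at_infinity_def
proof (intro allI impI)
  fix r g assume g: "cocycle (sing_in (far p r)) sbd m g"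
  define r0 where "r0 = max r 0"
  \<comment> \<open>The hulls used below lie in balls of radius 2 about points at distance
    \<open>S\<close>, hence beyond \<open>r0\<close>.\<close>
  define S where "S = r0 + 2"
  have S: "0 < S" "r0 + 1 \<le> S" by (auto simp: S_def r0_def)
  define U where "U = {cone p \<zeta> S 1 | \<zeta>. \<zeta> \<in> boundary_points}"
  have U: "U \<in> open_covers boundary" unfolding U_def using p S by (intro cone_cover) auto
  have "\<forall>v\<in>U. \<exists>\<zeta>. \<zeta> \<in> boundary_points \<and> v \<subseteq> cone p \<zeta> S 1" by (auto simp: U_def)
  then obtain c where c: "\<And>v. v \<in> U \<Longrightarrow> c v \<in> boundary_points \<and> v \<subseteq> cone p (c v) S 1" by metis
  define z where "z = (\<lambda>v. ray p (c v) S)"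
  obtain \<psi> where \<psi>: "chmap (nerve U) (\<lambda>m. lbd) (sing_in (far p r0)) sbd \<psi>"
    "\<And>m vs. vs \<in> nerve U m \<Longrightarrow> supp (\<psi> m vs) \<subseteq> sing_in (chull (z ` set vs)) m"
    "\<psi> 0 [] = frag_of (\<lambda>_. undefined)"
    unfolding z_def
  proof (rule nerve_to_far [OF p S zero_less_one, where V = U and c = c], goal_cases)
    case (2 \<psi>)
    show ?case by (rule 2(1) [OF 2(2-4)])
  qed (simp add: c)
  have g0: "cocycle (sing_in (far p r0)) sbd m g"
    by (rule cocycle_subset [OF g]) (intro sing_in_mono far_antimono, simp add: r0_def)
  \<comment> \<open>The refinement on which the cocycle dies is fixed before the vertex map is
    chosen, as the latter has to take values in \<open>V\<close>.\<close>
  obtain V \<tau> where V: "V \<in> open_covers boundary" "refinement_map V U \<tau>"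
    "coboundary (nerve V) (\<lambda>m. lbd) m (\<lambda>vs. pull \<psi> m g (map \<tau> vs))"
    using dies U cocycle_pull [OF \<psi>(1) g0] unfolding dies_def by blast
  obtain s e R u where u: "S \<le> s" "0 < e" "e \<le> 1/4" "s \<le> R"
    "\<And>x. x \<in> far p R \<Longrightarrow> u x \<in> V"
    "\<And>x. x \<in> far p R \<Longrightarrow> \<exists>\<eta>\<in>boundary_points. d (ray p \<eta> s) (proj p s x) < e / 2"
    "\<And>x \<eta>. x \<in> far p R \<Longrightarrow> \<eta> \<in> boundary_points \<Longrightarrow> d (ray p \<eta> s) (proj p s x) < e \<Longrightarrow> \<eta> \<in> u x"
  proof (rule vertex_map_exists [OF V(1) p S(1), of "1/4"], goal_cases)
    case (2 s e R u)
    show ?case by (rule 2(1) [OF 2(2-8)])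
  qed simp
  have s: "0 \<le> s" using u S by linarith
  let ?Y = "subtopology mtopology (far p R)" and ?W = "thin_cover p R s (e / 4)"
  let ?G = "sing_small ?Y ?W"
  obtain \<phi> where \<phi>: "chmap ?G sbd (nerve V) (\<lambda>m. lbd) \<phi>"
    "\<And>m \<sigma>. \<sigma> \<in> ?G m \<Longrightarrow> supp (\<phi> m \<sigma>) \<subseteq> list_simplices (u ` im m \<sigma>) m"
    "\<phi> 0 (\<lambda>_. undefined) = frag_of []"
  proof (rule far_to_nerve [OF p s u(2), where u = u and U = V and R = R], goal_cases)
    case (4 \<phi>)
    show ?case by (rule 4(1) [OF 4(2-4)])
  next
    case (2 x)
    then show ?case using u(6) by blast
  qed (simp_all add: u(5-7))
  define E' where "E' = comp_ch \<psi> (comp_ch (\<lambda>m vs. frag_of (map \<tau> vs)) \<phi>)"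
  have E': "chmap ?G sbd (sing_in (far p r0)) sbd E'"
    unfolding E'_def by (intro chmap_comp [OF chmap_comp [OF \<phi>(1) chmap_refinement [OF V(2)]] \<psi>(1)])
  have r0R: "r0 \<le> R" using u S by linarith
  have GE: "?G m \<subseteq> sing_in (far p r0) m" for m
    using sing_small_subset [of ?Y ?W m] sing_in_mono [OF far_antimono [OF r0R]] by blast
  have E: "chmap ?G sbd (sing_in (far p r0)) sbd (\<lambda>m. frag_of)"
    by (rule chmap_of [OF GE])
  \<comment> \<open>The hull, at radius \<open>S\<close>, of the projected simplex together with the
    points that represent its labels; \<open>A\<close> is its radial preimage and contains both the
    simplex and its image under \<open>E'\<close>.\<close>
  define H where "H m \<sigma> = chull (proj p S ` im m \<sigma> \<union> (\<lambda>x. z (\<tau> (u x))) ` im m \<sigma>)" for m :: nat and \<sigma>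
  define A where "A m \<sigma> = {x \<in> M. proj p S x \<in> H m \<sigma>}" for m \<sigma>
  define P where "P = (\<lambda>m \<sigma>. sing_in (A m \<sigma>))"
  have \<tau>u: "\<tau> (u x) \<in> U" "u x \<subseteq> \<tau> (u x)" if "x \<in> far p R" for x
    using u(5) [OF that] V(2) unfolding refinement_map_def by auto
  have imf: "im m \<sigma> \<subseteq> far p R" if "\<sigma> \<in> ?G m" for m \<sigma>
    using that im_subset_topspace [of \<sigma> ?Y m] by (auto simp: sing_small_def)
  \<comment> \<open>The width of the cones contributes 1. The ray to \<open>\<eta>\<close> is within
    \<open>e / 2\<close> of the projection at time \<open>s\<close>, and projecting further to
    radius \<open>S\<close> at most doubles this.\<close>
  have zu: "z (\<tau> (u x)) \<in> M" "d p (z (\<tau> (u x))) = S" "d (proj p S x) (z (\<tau> (u x))) < 1 + e" if x: "x \<in> far p R" for x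
  proof -
    have xM: "x \<in> M" using x by (simp add: far_def)
    have cb: "c (\<tau> (u x)) \<in> boundary_points" using c \<tau>u(1) [OF x] by blast
    then show zM: "z (\<tau> (u x)) \<in> M" "d p (z (\<tau> (u x))) = S" using p S by (auto simp: z_def dist_ray)
    obtain \<eta> where \<eta>: "\<eta> \<in> boundary_points" "d (ray p \<eta> s) (proj p s x) < e / 2" using u(6) [OF x] by blast
    then have "\<eta> \<in> u x" using u(2,7) x by force
    then have "\<eta> \<in> cone p (c (\<tau> (u x))) S 1" using \<tau>u [OF x] c by blast
    then have 1: "d (ray p \<eta> S) (z (\<tau> (u x))) < 1" by (simp add: cone_def z_def)
    have "d (proj p S (ray p \<eta> s)) (proj p S (proj p s x)) \<le> 2 * d (ray p \<eta> s) (proj p s x)"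
      using p S xM \<eta> s by (intro proj_lipschitz) auto
    moreover have "proj p S (ray p \<eta> s) = ray p \<eta> S" using \<eta> p S u by (intro proj_ray) auto
    moreover have "proj p S (proj p s x) = proj p S x" using p S u xM by (intro proj_proj) auto
    ultimately have 2: "d (ray p \<eta> S) (proj p S x) < e" using \<eta>(2) by simp
    have "d (proj p S x) (z (\<tau> (u x))) \<le> d (proj p S x) (ray p \<eta> S) + d (ray p \<eta> S) (z (\<tau> (u x)))"
      using p S xM \<eta> zM by (intro triangle) auto
    then show "d (proj p S x) (z (\<tau> (u x))) < 1 + e" using 1 2 by (simp add: commute)
  qed
  have near: "d (proj p S x) (proj p S x') < 1/4" if \<sigma>: "\<sigma> \<in> ?G m" and x: "x \<in> im m \<sigma>" "x' \<in> im m \<sigma>" for m \<sigma> x x'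
  proof -
    have "m \<noteq> 0" using x by (cases m) auto
    then obtain w where w: "w \<in> ?W" "im m \<sigma> \<subseteq> w" using \<sigma> by (auto simp: sing_small_def)
    have M: "x \<in> M" "x' \<in> M" using imf [OF \<sigma>] x by (auto simp: far_def)
    have "d (proj p s x) (proj p s x') < 2 * (e / 4)"
      using thin_cover_dist [OF p s w(1), of x x'] x w by blast
    moreover have "d (proj p S (proj p s x)) (proj p S (proj p s x')) \<le> 2 * d (proj p s x) (proj p s x')"
      using p S M s by (intro proj_lipschitz) auto
    moreover have "proj p S (proj p s x) = proj p S x" "proj p S (proj p s x') = proj p S x'"
      using p S u M by (auto intro: proj_proj)
    ultimately show ?thesis using u(3) by simp
  qed
  have gens: "proj p S ` im m \<sigma> \<union> (\<lambda>x. z (\<tau> (u x))) ` im m \<sigma> \<subseteq> mcball p S" if \<sigma>: "\<sigma> \<in> ?G m" for m \<sigma>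
  proof -
    have "proj p S x \<in> mcball p S \<and> z (\<tau> (u x)) \<in> mcball p S" if "x \<in> im m \<sigma>" for x
    proof -
      have "x \<in> far p R" "x \<in> M" using imf [OF \<sigma>] that by (auto simp: far_def)
      then show ?thesis using zu p S by (auto simp: dist_proj)
    qed
    then show ?thesis by blast
  qed
  have HS: "H m \<sigma> \<subseteq> mcball p S" "cvx (H m \<sigma>)" if \<sigma>: "\<sigma> \<in> ?G m" for m \<sigma>
    unfolding H_def using gens [OF \<sigma>] mcball_subset_mspace [of p S]
    by (meson chull_minimal cvx_mcball cvx_chull order_trans)+
  have HA: "H m \<sigma> \<subseteq> A m \<sigma>" if \<sigma>: "\<sigma> \<in> ?G m" for m \<sigma>
  proof
    fix x assume "x \<in> H m \<sigma>"
    moreover from this have "x \<in> mcball p S" using HS [OF \<sigma>] by blast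
    ultimately show "x \<in> A m \<sigma>" using p S proj_eq [of p S x] by (simp add: A_def)
  qed
  have imA: "im m \<sigma> \<subseteq> A m \<sigma>" if \<sigma>: "\<sigma> \<in> ?G m" for m \<sigma>
  proof
    fix x assume x: "x \<in> im m \<sigma>"
    then have "proj p S x \<in> H m \<sigma>"
      unfolding H_def by (intro subsetD [OF chull_superset] UnI1 imageI)
    then show "x \<in> A m \<sigma>" using imf [OF \<sigma>] x by (auto simp: A_def far_def)
  qed
  have Afar: "A m \<sigma> \<subseteq> far p r0" if \<sigma>: "\<sigma> \<in> ?G m" for m \<sigma>
  proof (cases "im m \<sigma> = {}")
    case True
    have "cvx {}" by (simp add: cvx_def)
    then have "H m \<sigma> = {}" using True chull_minimal [of "{}"] by (simp add: H_def)
    then show ?thesis by (simp add: A_def)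
  next
    case False
    then obtain x0 where x0: "x0 \<in> im m \<sigma>" by blast
    then have x0f: "x0 \<in> far p R" "x0 \<in> M" using imf [OF \<sigma>] by (auto simp: far_def)
    define y where "y = proj p S x0"
    have y: "y \<in> M" "d p y = S" using p S x0f u by (auto simp: y_def dist_proj far_def)
    \<comment> \<open>The bounds add up to \<open>1/4 + 1 + e\<close>, which is at most
      \<open>3/2\<close>.\<close>
    have "proj p S x \<in> mball y 2 \<and> z (\<tau> (u x)) \<in> mball y 2" if x: "x \<in> im m \<sigma>" for x
    proof -
      have xf: "x \<in> far p R" "x \<in> M" using imf [OF \<sigma>] x by (auto simp: far_def)
      have 1: "d y (proj p S x) < 1/4" unfolding y_def by (rule near [OF \<sigma> x0 x])
      have "d y (z (\<tau> (u x))) \<le> d y (proj p S x) + d (proj p S x) (z (\<tau> (u x)))"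
        using y xf p S zu by (intro triangle) auto
      then show ?thesis using 1 zu [OF xf(1)] u(3) y xf p S by auto
    qed
    then have "H m \<sigma> \<subseteq> mball y 2"
      unfolding H_def by (intro chull_minimal cvx_mball) blast
    show ?thesis
    proof
      fix x assume x: "x \<in> A m \<sigma>"
      then have xM: "x \<in> M" "proj p S x \<in> mball y 2" using \<open>H m \<sigma> \<subseteq> mball y 2\<close> by (auto simp: A_def)
      have "S \<le> d p (proj p S x) + d (proj p S x) y"
        using triangle [of p "proj p S x" y] y xM p S by simp
      then have "r0 < d p (proj p S x)" using xM by (simp add: S_def commute)
      also have "\<dots> \<le> d p x" using p S xM by (simp add: dist_proj)
      finally show "x \<in> far p r0" using xM by (simp add: far_def)
    qed
  qed
  have ok: "carrier_ok ?G sbd sbd P"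
    unfolding carrier_ok_def
  proof (intro allI ballI conjI)
    fix m \<sigma> assume \<sigma>: "\<sigma> \<in> ?G (Suc m)"
    have "im (Suc m) \<sigma> \<noteq> {}" by (rule im_nonempty)
    then obtain x where "x \<in> im (Suc m) \<sigma>" by blast
    then have "proj p S x \<in> H (Suc m) \<sigma>"
      unfolding H_def by (intro subsetD [OF chull_superset] UnI1 imageI)
    then have "H (Suc m) \<sigma> \<noteq> {}" by blast
    then have "contractible_space (subtopology mtopology (A (Suc m) \<sigma>))"
      unfolding A_def using p S HS [OF \<sigma>] by (intro contractible_proj_vimage) auto
    moreover have "topspace (subtopology mtopology (A (Suc m) \<sigma>)) \<noteq> {}"
      using \<open>H (Suc m) \<sigma> \<noteq> {}\<close> HA [OF \<sigma>] by (auto simp: A_def simp del: subtopology_eq_discrete_topology_empty)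
    ultimately show "exact_on sbd (P (Suc m) \<sigma>)"
      unfolding P_def by (rule exact_on_contractible)
    show "P m \<sigma>' n \<subseteq> P (Suc m) \<sigma> n" if "\<sigma>' \<in> supp (sbd m \<sigma>)" for \<sigma>' n
    proof -
      have "H m \<sigma>' \<subseteq> H (Suc m) \<sigma>"
        unfolding H_def using im_face [OF that] by (intro chull_mono) blast
      then show ?thesis unfolding P_def A_def by (intro sing_in_mono) blast
    qed
  qed
  have EP: "supp (frag_of \<sigma>) \<subseteq> P m \<sigma> m" if \<sigma>: "\<sigma> \<in> ?G m" for m \<sigma>
    using \<sigma> imA [OF \<sigma>] unfolding P_def sing_subtopology by (auto simp: sing_small_def sing_subtopology)
  have EP': "supp (E' m \<sigma>) \<subseteq> P m \<sigma> m" if \<sigma>: "\<sigma> \<in> ?G m" for m \<sigma>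
    unfolding E'_def comp_ch_def
  proof (intro frag_extend_closed)
    fix us assume "us \<in> supp (frag_extend (\<lambda>vs. frag_of (map \<tau> vs)) (\<phi> m \<sigma>))"
    then obtain vs where vs: "vs \<in> supp (\<phi> m \<sigma>)" "us = map \<tau> vs"
      using keys_frag_extend [of "\<lambda>vs. frag_of (map \<tau> vs)" "\<phi> m \<sigma>"] by auto
    have "set vs \<subseteq> u ` im m \<sigma>" using \<phi>(2) [OF \<sigma>] vs by (auto simp: list_simplices_def)
    then have "z ` set us \<subseteq> (\<lambda>x. z (\<tau> (u x))) ` im m \<sigma>" unfolding vs(2) by auto
    then have "chull (z ` set us) \<subseteq> H m \<sigma>" unfolding H_def by (intro chull_mono) blast
    then have "chull (z ` set us) \<subseteq> A m \<sigma>" using HA [OF \<sigma>] by blast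
    moreover have "us \<in> nerve U m"
      using refinement_nerve [OF V(2)] chmap_supp [OF \<phi>(1) \<sigma>] vs by blast
    ultimately show "supp (\<psi> m us) \<subseteq> P m \<sigma> m"
      using \<psi>(2) sing_in_mono unfolding P_def by blast
  qed
  have E0: "E' 0 \<sigma> = frag_of \<sigma>" if "\<sigma> \<in> ?G 0" for \<sigma>
    using that \<phi>(3) \<psi>(3) by (simp add: E'_def comp_ch_def sing_small_def)
  obtain h where h: "\<And>m s. s \<in> ?G m \<Longrightarrow> supp (h m s) \<subseteq> P m s (Suc m)"
    "\<And>m s. s \<in> ?G (Suc m) \<Longrightarrow> frag_extend (sbd (Suc m)) (h (Suc m) s) =
       frag_of s - E' (Suc m) s - frag_extend (h m) (sbd m s)"
    by (rule acyclic_carrier_homotopy [OF cpx_sing_small ok E E' EP EP', where hz = "\<lambda>s. 0"])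
      (auto simp: E0)
  have "coboundary ?G sbd m (\<lambda>s. pull (\<lambda>m. frag_of) m g s - pull E' m g s)"
  proof (rule coboundary_diff_homotopy [OF g0, where h = h])
    show "supp (h m s) \<subseteq> sing_in (far p r0) (Suc m)" if "s \<in> ?G m" for m s
      using h(1) [OF that] sing_in_mono [OF Afar [OF that]] unfolding P_def by blast
  qed (use h E0 in auto)
  moreover have "coboundary ?G sbd m (pull E' m g)"
    using coboundary_pull [OF \<phi>(1) V(3)] by (simp add: E'_def pull_comp) (simp add: pull_def)
  ultimately have "coboundary ?G sbd m (\<lambda>s. (pull (\<lambda>m. frag_of) m g s - pull E' m g s) + pull E' m g s)"
    by (rule coboundary_add)
  then have "coboundary ?G sbd m g" by (simp add: pull_def)
  moreover have "cocycle (sing ?Y) sbd m g"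
    by (rule cocycle_subset [OF g0]) (intro sing_in_mono far_antimono r0R)
  ultimately have "coboundary (sing ?Y) sbd m g"
    using openin_thin_cover [OF p s] thin_cover_covers [OF p s, of "e / 4" R] u(2)
    by (intro coboundary_small_imp [where W = ?W]) auto
  then show "\<exists>r'\<ge>r. coboundary (sing_in (far p r')) sbd m g"
    using r0R by (intro exI [of _ R]) (auto simp: r0_def)
qed

text \<open>Going from the nerve of a fine cover \<open>V\<close> to the far region and on to the
  nerve of \<open>U\<close> is compared with a refinement map. Both send a simplex into the full
  simplex on those members of \<open>U\<close> that contain its intersection.\<close>

lemma vanishes_at_infinity_imp_dies:
  assumes p: "p \<in> M" and inf: "vanishes_at_infinity p m"
  shows "dies boundary m"
  unfolding dies_def
proof (intro ballI allI impI)
  fix U \<zeta> assume U: "U \<in> open_covers boundary" and \<zeta>: "cocycle (nerve U) (\<lambda>m. lbd) m \<zeta>"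
  obtain s e R u where u: "1 \<le> s" "0 < e" "e \<le> 1" "s \<le> R"
    "\<And>x. x \<in> far p R \<Longrightarrow> u x \<in> U"
    "\<And>x. x \<in> far p R \<Longrightarrow> \<exists>\<eta>\<in>boundary_points. d (ray p \<eta> s) (proj p s x) < e / 2"
    "\<And>x \<eta>. x \<in> far p R \<Longrightarrow> \<eta> \<in> boundary_points \<Longrightarrow> d (ray p \<eta> s) (proj p s x) < e \<Longrightarrow> \<eta> \<in> u x"
    by (rule vertex_map_exists [OF U p zero_less_one zero_less_one]) (rule that)
  have s: "0 \<le> s" using u by linarith
  let ?Y = "subtopology mtopology (far p R)" and ?W = "thin_cover p R s (e / 4)"
  let ?G = "sing_small ?Y ?W"
  obtain \<phi> where \<phi>: "chmap ?G sbd (nerve U) (\<lambda>m. lbd) \<phi>"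
    "\<And>m \<sigma>. \<sigma> \<in> ?G m \<Longrightarrow> supp (\<phi> m \<sigma>) \<subseteq> list_simplices (u ` im m \<sigma>) m"
    "\<phi> 0 (\<lambda>_. undefined) = frag_of []"
  proof (rule far_to_nerve [OF p s u(2), where u = u and U = U and R = R], goal_cases)
    case (4 \<phi>)
    show ?case by (rule 4(1) [OF 4(2-4)])
  next
    case (2 x)
    then show ?case using u(6) by blast
  qed (simp_all add: u(5-7))
  obtain \<rho> where \<rho>: "chmap (sing ?Y) sbd ?G sbd \<rho>" "\<And>s. \<rho> 0 s = frag_of s"
    "\<And>m s. s \<in> sing ?Y m \<Longrightarrow> supp (\<rho> m s) \<subseteq> sing (subtopology ?Y (im m s)) m"
    using small_simplices [of ?W ?Y] openin_thin_cover [OF p s] thin_cover_covers [OF p s, of "e / 4" R] u(2)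
    by (smt (verit) divide_pos_pos zero_less_numeral)
  \<comment> \<open>\<open>\<phi>\<close> is defined on small simplices, whereas
    \<open>\<psi>\<close> may produce large ones; \<open>\<rho>\<close> subdivides them without
    enlarging their images.\<close>
  define F where "F = comp_ch \<phi> \<rho>"
  have F: "chmap (sing ?Y) sbd (nerve U) (\<lambda>m. lbd) F"
    unfolding F_def by (rule chmap_comp [OF \<rho>(1) \<phi>(1)])
  have Fsupp: "supp (F m \<sigma>) \<subseteq> list_simplices (u ` im m \<sigma>) m" if \<sigma>: "\<sigma> \<in> sing ?Y m" for m \<sigma>
    unfolding F_def comp_ch_def
  proof (intro frag_extend_closed)
    fix \<sigma>' assume "\<sigma>' \<in> supp (\<rho> m \<sigma>)"
    then have "\<sigma>' \<in> ?G m" "im m \<sigma>' \<subseteq> im m \<sigma>"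
      using \<rho>(3) [OF \<sigma>] chmap_supp [OF \<rho>(1) \<sigma>] unfolding sing_subtopology by blast+
    then show "supp (\<phi> m \<sigma>') \<subseteq> list_simplices (u ` im m \<sigma>) m"
      using \<phi>(2) unfolding list_simplices_def by fast
  qed
  have F0: "F 0 (\<lambda>_. undefined) = frag_of []" by (simp add: F_def comp_ch_def \<rho> \<phi>)
  have "cocycle (sing ?Y) sbd m (pull F m \<zeta>)" by (rule cocycle_pull [OF F \<zeta>])
  then obtain r' where r': "R \<le> r'" "coboundary (sing_in (far p r')) sbd m (pull F m \<zeta>)"
    using inf unfolding vanishes_at_infinity_def by blast
  \<comment> \<open>Projection to radius \<open>s\<close> at most doubles distances, so a point
    within \<open>e'\<close> of a ray at time \<open>S\<close> projects to within
    \<open>e / 2\<close> of the ray at time \<open>s\<close>.\<close>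
  define e' where "e' = e / 4"
  define S where "S = r' + e'"
  have S: "0 < S" "r' + e' \<le> S" "0 < e'" "s \<le> S" "R < S" using u r' by (auto simp: S_def e'_def)
  define V where "V = {cone p \<zeta> S e' | \<zeta>. \<zeta> \<in> boundary_points}"
  have V: "V \<in> open_covers boundary" unfolding V_def using p S by (intro cone_cover) auto
  have "\<forall>v\<in>V. \<exists>\<zeta>. \<zeta> \<in> boundary_points \<and> v \<subseteq> cone p \<zeta> S e'" by (auto simp: V_def)
  then obtain c where c: "\<And>v. v \<in> V \<Longrightarrow> c v \<in> boundary_points \<and> v \<subseteq> cone p (c v) S e'" by metis
  define z where "z = (\<lambda>v. ray p (c v) S)"
  obtain \<psi> where \<psi>: "chmap (nerve V) (\<lambda>m. lbd) (sing_in (far p r')) sbd \<psi>"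
    "\<And>m vs. vs \<in> nerve V m \<Longrightarrow> supp (\<psi> m vs) \<subseteq> sing_in (chull (z ` set vs)) m"
    "\<psi> 0 [] = frag_of (\<lambda>_. undefined)"
    unfolding z_def
  proof (rule nerve_to_far [OF p S(1-3), where V = V and c = c], goal_cases)
    case (2 \<psi>)
    show ?case by (rule 2(1) [OF 2(2-4)])
  qed (simp add: c)
  have near: "\<eta> \<in> u x" if \<eta>: "\<eta> \<in> boundary_points" and x: "x \<in> far p R" "d (ray p \<eta> S) x < e'" for \<eta> x
  proof (rule u(7) [OF x(1) \<eta>])
    have "d (proj p s (ray p \<eta> S)) (proj p s x) \<le> 2 * d (ray p \<eta> S) x"
      using p s \<eta> x S by (intro proj_lipschitz) (auto simp: far_def)
    moreover have "proj p s (ray p \<eta> S) = ray p \<eta> s" using \<eta> p s S by (intro proj_ray)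
    ultimately show "d (ray p \<eta> s) (proj p s x) < e" using x u(2) by (simp add: e'_def)
  qed
  define \<tau> where "\<tau> v = u (z v)" for v
  have zfar: "z v \<in> far p R" if "v \<in> V" for v
    using c [OF that] p S by (simp add: z_def far_def dist_ray)
  have vz: "d (ray p \<eta> S) (z v) < e'" "\<eta> \<in> boundary_points" if "v \<in> V" "\<eta> \<in> v" for v \<eta>
    using c [OF that(1)] that(2) by (auto simp: cone_def z_def)
  have \<tau>: "refinement_map V U \<tau>"
    unfolding refinement_map_def \<tau>_def using zfar u(5) near vz by blast
  define E where "E = comp_ch F \<psi>"
  have \<psi>R: "chmap (nerve V) (\<lambda>m. lbd) (sing ?Y) sbd \<psi>"
    using \<psi>(1) unfolding chmap_def using sing_in_mono [OF far_antimono [OF r'(1)]] by blast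
  have E: "chmap (nerve V) (\<lambda>m. lbd) (nerve U) (\<lambda>m. lbd) E"
    unfolding E_def by (rule chmap_comp [OF \<psi>R F])
  define P where "P = (\<lambda>m::nat. \<lambda>vs. list_simplices {w \<in> U. \<Inter> (set vs) \<subseteq> w})"
  have hull: "\<Inter> (set vs) \<subseteq> u x" "x \<in> far p R" if vs: "vs \<in> nerve V m" "vs \<noteq> []" and x: "x \<in> chull (z ` set vs)" "x \<in> far p R" for vs m x
  proof -
    have sV: "set vs \<subseteq> V" using vs by (simp add: nerve_def)
    show "\<Inter> (set vs) \<subseteq> u x"
    proof
      fix \<eta> assume \<eta>: "\<eta> \<in> \<Inter> (set vs)"
      have \<eta>b: "\<eta> \<in> boundary_points" using \<eta> vs(2) sV vz(2) by (cases vs) auto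
      have "z ` set vs \<subseteq> mball (ray p \<eta> S) e'"
      proof
        fix y assume "y \<in> z ` set vs"
        then obtain v where v: "v \<in> set vs" "y = z v" by blast
        then show "y \<in> mball (ray p \<eta> S) e'"
          using vz(1) [of v \<eta>] \<eta> sV zfar [of v] \<eta>b p S by (auto simp: far_def)
      qed
      then have "x \<in> mball (ray p \<eta> S) e'" using chull_minimal [OF cvx_mball] x by blast
      then show "\<eta> \<in> u x" using near \<eta>b x by auto
    qed
  qed (use x in auto)
  have ok: "carrier_ok (nerve V) (\<lambda>m. lbd) (\<lambda>m. lbd) P"
    unfolding carrier_ok_def
  proof (intro allI ballI conjI)
    fix m vs assume vs: "vs \<in> nerve V (Suc m)"
    then obtain v where v: "v \<in> set vs" "v \<in> V" by (cases vs) (auto simp: nerve_def)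
    have "\<tau> v \<in> {w \<in> U. \<Inter> (set vs) \<subseteq> w}"
      using v \<tau> unfolding refinement_map_def by blast
    then show "exact_on (\<lambda>m. lbd) (P (Suc m) vs)"
      unfolding P_def by (intro exact_on_list_simplices) blast
    show "P m vs' n \<subseteq> P (Suc m) vs n" if "vs' \<in> supp (lbd vs)" for vs' n
    proof -
      have "set vs' \<subseteq> set vs" using supp_lbd [OF that, of "\<lambda>x y. True"] by simp
      then have "\<Inter> (set vs) \<subseteq> \<Inter> (set vs')" by blast
      then show ?thesis unfolding P_def list_simplices_def by blast
    qed
  qed
  have EP: "supp (E m vs) \<subseteq> P m vs m" if vs: "vs \<in> nerve V m" for m vs
    unfolding E_def comp_ch_def
  proof (intro frag_extend_closed)
    fix \<sigma> assume \<sigma>: "\<sigma> \<in> supp (\<psi> m vs)"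
    have \<sigma>Y: "\<sigma> \<in> sing ?Y m" using chmap_supp [OF \<psi>R vs] \<sigma> by blast
    have im: "im m \<sigma> \<subseteq> chull (z ` set vs)" "im m \<sigma> \<subseteq> far p R"
      using \<psi>(2) [OF vs] \<sigma> \<sigma>Y unfolding sing_subtopology by auto
    have "u ` im m \<sigma> \<subseteq> {w \<in> U. \<Inter> (set vs) \<subseteq> w}"
    proof (cases "vs = []")
      case True
      then have "m = 0" using vs by (simp add: nerve_def)
      then show ?thesis by simp
    next
      case False
      then show ?thesis using hull(1) [OF vs False] im u(5) by blast
    qed
    then show "supp (F m \<sigma>) \<subseteq> P m vs m"
      using Fsupp [OF \<sigma>Y] unfolding P_def list_simplices_def by blast
  qed
  have TP: "supp (frag_of (map \<tau> vs)) \<subseteq> P m vs m" if vs: "vs \<in> nerve V m" for m vs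
    using vs \<tau> unfolding P_def list_simplices_def nerve_def refinement_map_def by (auto simp: subset_iff)
  have E0: "E 0 vs = frag_of (map \<tau> vs)" if "vs \<in> nerve V 0" for vs
    using that by (simp add: nerve_def E_def comp_ch_def \<psi> F0)
  obtain h where h: "\<And>m s. s \<in> nerve V m \<Longrightarrow> supp (h m s) \<subseteq> P m s (Suc m)"
    "\<And>m s. s \<in> nerve V (Suc m) \<Longrightarrow> frag_extend lbd (h (Suc m) s) =
       frag_of (map \<tau> s) - E (Suc m) s - frag_extend (h m) (lbd s)"
    "\<And>s. s \<in> nerve V 0 \<Longrightarrow> h 0 s = 0"
    by (rule acyclic_carrier_homotopy [OF cpx_nerve ok chmap_refinement [OF \<tau>] E TP EP, where hz = "\<lambda>s. 0"])
      (auto simp: E0)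
  \<comment> \<open>Members of \<open>U\<close> containing a common non-empty intersection span a
    simplex of the nerve. The empty list is treated apart: its intersection is the universal set,
    but \<open>h\<close> is zero on it.\<close>
  have PU: "supp (h m vs) \<subseteq> nerve U (Suc m)" if vs: "vs \<in> nerve V m" for m vs
  proof (cases "vs = []")
    case True
    then show ?thesis using h(3) vs by (simp add: nerve_def)
  next
    case False
    have "us \<in> nerve U (Suc m)" if us: "us \<in> supp (h m vs)" for us
    proof -
      have us: "length us = Suc m" "set us \<subseteq> {w \<in> U. \<Inter> (set vs) \<subseteq> w}"
        using h(1) [OF vs] us by (auto simp: P_def list_simplices_def)
      have "\<Inter> (set vs) \<noteq> {}" using vs False by (simp add: nerve_def)
      moreover have "\<Inter> (set vs) \<subseteq> \<Inter> (set us)" using us(2) by blast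
      ultimately have "\<Inter> (set us) \<noteq> {}" by blast
      then show ?thesis using us by (auto simp: nerve_def)
    qed
    then show ?thesis by blast
  qed
  have "coboundary (nerve V) (\<lambda>m. lbd) m (\<lambda>vs. pull (\<lambda>m vs. frag_of (map \<tau> vs)) m \<zeta> vs - pull E m \<zeta> vs)"
    by (rule coboundary_diff_homotopy [OF \<zeta>, where h = h]) (use PU h E0 in auto)
  moreover have "coboundary (nerve V) (\<lambda>m. lbd) m (pull E m \<zeta>)"
    unfolding E_def pull_comp by (rule coboundary_pull [OF \<psi>(1) r'(2)])
  ultimately have "coboundary (nerve V) (\<lambda>m. lbd) m
      (\<lambda>vs. (pull (\<lambda>m vs. frag_of (map \<tau> vs)) m \<zeta> vs - pull E m \<zeta> vs) + pull E m \<zeta> vs)"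
    by (rule coboundary_add)
  then have "coboundary (nerve V) (\<lambda>m. lbd) m (\<lambda>vs. \<zeta> (map \<tau> vs))"
    by (simp add: pull_def)
  then show "\<exists>V\<in>open_covers boundary. \<exists>\<tau>. refinement_map V U \<tau> \<and> coboundary (nerve V) (\<lambda>m. lbd) m (\<lambda>vs. \<zeta> (map \<tau> vs))"
    using V \<tau> by blast
qed

theorem hc_vanishes_iff_dies: "hc_vanishes mtopology i \<longleftrightarrow> dies boundary i"
proof -
  obtain p where "p \<in> M" using nonempty by blast
  then show ?thesis
    using hc_vanishes_iff_infinity dies_imp_vanishes_at_infinity vanishes_at_infinity_imp_dies by blast
qed

end

section \<open>A finite-dimensional model\<close>

locale cocompact_CAT0_space = proper_CAT0_space +
  assumes cocompact: cocompact_space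
begin

section \<open>Nets and uniform local finiteness\<close>

definition separated :: "'a set \<Rightarrow> bool" where
  "separated S \<longleftrightarrow> S \<subseteq> M \<and> (\<forall>x\<in>S. \<forall>y\<in>S. x \<noteq> y \<longrightarrow> 1/2 \<le> d x y)"

lemma maximal_separated:
  obtains S where "separated S" "\<And>x. x \<in> M \<Longrightarrow> \<exists>y\<in>S. d x y < 1/2"
proof -
  have "\<exists>S\<in>Collect separated. \<forall>T\<in>Collect separated. S \<subseteq> T \<longrightarrow> T = S"
  proof (rule subset_Zorn')
    fix C assume C: "subset.chain (Collect separated) C"
    have CS: "separated A" if "A \<in> C" for A using C that by (auto simp: subset_chain_def)
    show "\<Union> C \<in> Collect separated"
      unfolding separated_def mem_Collect_eq
    proof (intro conjI ballI impI)
      show "\<Union> C \<subseteq> M" using CS unfolding separated_def by blast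
      fix x y assume "x \<in> \<Union> C" "y \<in> \<Union> C" "x \<noteq> y"
      then obtain A B where AB: "A \<in> C" "B \<in> C" "x \<in> A" "y \<in> B" by blast
      then have "A \<subseteq> B \<or> B \<subseteq> A" using C by (auto simp: subset_chain_def)
      then obtain D where "D \<in> C" "x \<in> D" "y \<in> D" using AB by blast
      then show "1/2 \<le> d x y" using CS \<open>x \<noteq> y\<close> unfolding separated_def by blast
    qed
  qed
  then obtain S where S: "separated S" "\<And>T. separated T \<Longrightarrow> S \<subseteq> T \<Longrightarrow> T = S" by auto
  have "\<exists>y\<in>S. d x y < 1/2" if x: "x \<in> M" for x
  proof (rule ccontr)
    assume "\<not> ?thesis"
    then have far: "\<And>y. y \<in> S \<Longrightarrow> 1/2 \<le> d x y" by force
    have "separated (insert x S)"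
      using S(1) x far by (auto simp: separated_def commute)
    then have "insert x S = S" by (rule S(2)) blast
    then have "x \<in> S" by blast
    then show False using far [of x] x by simp
  qed
  with S(1) show thesis using that by blast
qed

lemma cocompact_ball:
  assumes q: "q \<in> M"
  obtains B where "0 \<le> B" "\<And>x. x \<in> M \<Longrightarrow> \<exists>k c. self_isometry k \<and> c \<in> M \<and> d q c \<le> B \<and> k c = x"
proof -
  obtain C where C: "compactin mtopology C" "M \<subseteq> (\<Union>h\<in>Collect self_isometry. h ` C)"
    using cocompact by (auto simp: cocompact_space_def)
  obtain y b where "C \<subseteq> mcball y b"
    using compactin_imp_mbounded [OF C(1)] by (auto simp: mbounded_def)
  then have Cb: "c \<in> M \<and> d q c \<le> max 0 (d q y + b)" if "c \<in> C" for c
    using that triangle [of q y c] q by fastforce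
  have "\<exists>k c. self_isometry k \<and> c \<in> M \<and> d q c \<le> max 0 (d q y + b) \<and> k c = x" if x: "x \<in> M" for x
  proof -
    obtain k c where "self_isometry k" "c \<in> C" "x = k c" using C(2) x by blast
    then show ?thesis using Cb by blast
  qed
  then show thesis by (intro that [of "max 0 (d q y + b)"]) auto
qed

text \<open>An isometry moves the set into a fixed compact ball, which is covered by finitely many
  balls of radius \<open>1/4\<close>; each of these contains at most one point of the set. The bound
  \<open>D\<close> thus depends on \<open>r\<close> alone.\<close>

lemma separated_card_bound:
  obtains D where "\<And>x S. x \<in> M \<Longrightarrow> separated S \<Longrightarrow> S \<subseteq> mcball x r \<Longrightarrow> finite S \<and> card S \<le> D"
proof -
  obtain q where q: "q \<in> M" using nonempty by blast
  obtain B where B: "0 \<le> B" "\<And>x. x \<in> M \<Longrightarrow> \<exists>k c. self_isometry k \<and> c \<in> M \<and> d q c \<le> B \<and> k c = x"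
    using cocompact_ball [OF q] by metis
  have "compactin mtopology (mcball q (B + r))"
    using proper q by (simp add: proper_space_def)
  then have "mtotally_bounded (mcball q (B + r))" by (rule compactin_imp_mtotally_bounded)
  then obtain K where K: "finite K" "mcball q (B + r) \<subseteq> (\<Union>x\<in>K. mball x (1/4))"
    unfolding mtotally_bounded_def by (metis zero_less_divide_1_iff zero_less_numeral)
  have "finite S \<and> card S \<le> card K" if x: "x \<in> M" and S: "separated S" "S \<subseteq> mcball x r" for x S
  proof -
    obtain k c where k: "self_isometry k" "c \<in> M" "d q c \<le> B" "k c = x" using B x by blast
    have "\<exists>z w. w \<in> M \<and> k w = y \<and> z \<in> K \<and> z \<in> M \<and> d z w < 1/4" if y: "y \<in> S" for y
    proof -
      have "y \<in> M" using y S by (auto simp: separated_def)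
      then have "y \<in> k ` M" using k(1) by (simp add: self_isometry_def)
      then obtain w where w: "w \<in> M" "k w = y" by blast
      then have "d c w = d x y" using k by (auto simp: self_isometry_def)
      then have "d c w \<le> r" using S(2) y by auto
      then have "w \<in> mcball q (B + r)" using q k w triangle [of q c w] by simp
      then obtain z where "z \<in> K" "w \<in> mball z (1/4)" using K(2) by blast
      then show ?thesis using w by (intro exI [of _ z] exI [of _ w]) auto
    qed
    then obtain z w where zw: "\<And>y. y \<in> S \<Longrightarrow> w y \<in> M \<and> k (w y) = y \<and> z y \<in> K \<and> z y \<in> M \<and> d (z y) (w y) < 1/4" by metis
    have "inj_on z S"
    proof (rule inj_onI, rule ccontr)
      fix y y' assume y: "y \<in> S" "y' \<in> S" "z y = z y'" "y \<noteq> y'"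
      have zM: "z y \<in> M" using zw [OF y(1)] by blast
      have "d (w y) (w y') \<le> d (w y) (z y) + d (z y) (w y')"
        using zw y zM by (intro triangle) auto
      then have "d (w y) (w y') < 1/2" using zw [OF y(1)] zw [OF y(2)] y(3) by (simp add: commute)
      moreover have "d (w y) (w y') = d y y'" using zw y k(1) by (metis self_isometry_def)
      ultimately show False using S(1) y by (force simp: separated_def)
    qed
    moreover have "z ` S \<subseteq> K" using zw by blast
    ultimately show ?thesis using K(1) by (meson card_inj_on_le inj_on_finite)
  qed
  then show thesis using that by blast
qed

end

text \<open>
  The points \<open>pt j\<close> with \<open>j \<in> J\<close> form a net in \<open>M\<close>, and \<open>Rips m\<close> are the ordered simplices of its
  Rips complex at scale 2. The chain maps \<open>\<alpha>\<close> and \<open>\<beta>\<close> exhibit the singular complex as a homotopy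
  retract of the chains of this locally finite and finite-dimensional complex.
\<close>

locale finite_model = cocompact_CAT0_space M d
  for M :: "'a set" and d :: "'a \<Rightarrow> 'a \<Rightarrow> real" +
  fixes J :: "nat set" and pt :: "nat \<Rightarrow> 'a" and dim :: nat
    and \<alpha> :: "nat \<Rightarrow> ((nat \<Rightarrow> real) \<Rightarrow> 'a) \<Rightarrow> nat list \<Rightarrow>\<^sub>0 int"
    and \<beta> :: "nat \<Rightarrow> nat list \<Rightarrow> 'a chain"
    and h :: "nat \<Rightarrow> ((nat \<Rightarrow> real) \<Rightarrow> 'a) \<Rightarrow> 'a chain"
    and Rips :: "nat \<Rightarrow> nat list set"
  assumes Rips_def: "Rips = (\<lambda>m. {js. length js = m \<and> set js \<subseteq> J \<and> sorted_wrt (<) js \<and>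
      (\<forall>i\<in>set js. \<forall>j\<in>set js. d (pt i) (pt j) \<le> 2)})"
    and pt: "\<And>j. j \<in> J \<Longrightarrow> pt j \<in> M" and J: "J \<noteq> {}"
    and locally_finite: "\<And>x r. x \<in> M \<Longrightarrow> finite {j \<in> J. d x (pt j) \<le> r}"
    and dim: "\<And>m. dim < m \<Longrightarrow> Rips m = {}"
    and \<alpha>: "chmap (sing mtopology) sbd Rips (\<lambda>m. lbd) \<alpha>" "\<alpha> 0 (\<lambda>_. undefined) = frag_of []"
    and \<alpha>_near: "\<And>m \<sigma> js j. \<sigma> \<in> sing mtopology m \<Longrightarrow> js \<in> supp (\<alpha> m \<sigma>) \<Longrightarrow> j \<in> set js \<Longrightarrow>
      \<exists>x\<in>im m \<sigma>. d x (pt j) \<le> 1/2"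
    and \<beta>: "chmap Rips (\<lambda>m. lbd) (sing mtopology) sbd \<beta>" "\<beta> 0 [] = frag_of (\<lambda>_. undefined)"
    and \<beta>_near: "\<And>m \<sigma> js j x. js \<in> Rips m \<Longrightarrow> \<sigma> \<in> supp (\<beta> m js) \<Longrightarrow> j \<in> set js \<Longrightarrow> x \<in> im m \<sigma> \<Longrightarrow>
      d (pt j) x \<le> 2"
    and h: "\<And>m s. s \<in> sing mtopology m \<Longrightarrow> supp (h m s) \<subseteq> sing mtopology (Suc m)"
      "\<And>m s. s \<in> sing mtopology (Suc m) \<Longrightarrow> frag_extend (sbd (Suc m)) (h (Suc m) s) =
       frag_of s - comp_ch \<beta> \<alpha> (Suc m) s - frag_extend (h m) (sbd m s)"
    and h_near: "\<And>m \<sigma> \<tau> y. \<sigma> \<in> sing mtopology m \<Longrightarrow> \<tau> \<in> supp (h m \<sigma>) \<Longrightarrow> y \<in> im (Suc m) \<tau> \<Longrightarrow>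
      \<exists>x\<in>im m \<sigma>. d x y \<le> 1"

context cocompact_CAT0_space
begin

text \<open>Every point is labelled by a net point within \<open>1/2\<close>. Small simplices are
  sent to chains on their labels, Rips simplices to singular chains in the hull of their vertices,
  and hulls of images and labels carry the homotopy.\<close>

lemma finite_model_exists: "\<exists>J pt dim \<alpha> \<beta> h Rips. finite_model M d J pt dim \<alpha> \<beta> h Rips"
proof -
  obtain N where N: "separated N" "\<And>x. x \<in> M \<Longrightarrow> \<exists>y\<in>N. d x y < 1/2"
    using maximal_separated by blast
  have NM: "N \<subseteq> M" using N(1) by (simp add: separated_def)
  have sub: "separated (N \<inter> A)" for A using N(1) by (auto simp: separated_def)
  have lf: "finite (N \<inter> mcball x r)" if x: "x \<in> M" for x r
  proof -
    obtain D where "\<And>x S. x \<in> M \<Longrightarrow> separated S \<Longrightarrow> S \<subseteq> mcball x r \<Longrightarrow> finite S \<and> card S \<le> D"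
      using separated_card_bound by blast
    then show ?thesis using x sub [of "mcball x r"] by blast
  qed
  \<comment> \<open>This becomes the bound on the dimension: the vertices of a Rips simplex are
    separated and lie within 2 of any one of them.\<close>
  obtain D where D: "\<And>x S. x \<in> M \<Longrightarrow> separated S \<Longrightarrow> S \<subseteq> mcball x 2 \<Longrightarrow> finite S \<and> card S \<le> D"
    using separated_card_bound by blast
  obtain q where q: "q \<in> M" using nonempty by blast
  have "N = (\<Union>n::nat. N \<inter> mcball q (real n))"
    using NM q real_arch_simple by fastforce
  moreover have "countable (\<Union>n::nat. N \<inter> mcball q (real n))"
    using lf [OF q] by (intro countable_UN) (auto intro: countable_finite)
  ultimately have cN: "countable N" by simp
  \<comment> \<open>Enumerating the net by natural numbers orders its points, as needed for
    increasing lists.\<close>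
  define J where "J = to_nat_on N ` N"
  define pt where "pt = from_nat_into N"
  have ptN: "pt j \<in> N" if "j \<in> J" for j
    using that cN by (auto simp: J_def pt_def)
  have inj: "inj_on pt J"
    using cN by (auto simp: J_def pt_def inj_on_def)
  have ptJ: "\<exists>j\<in>J. pt j = y" if "y \<in> N" for y
    using that cN by (auto simp: J_def pt_def)
  have ptM: "pt j \<in> M" if "j \<in> J" for j using ptN [OF that] NM by blast
  define Rips where "Rips = (\<lambda>m. {js. length js = m \<and> set js \<subseteq> J \<and> sorted_wrt (<) js \<and>
      (\<forall>i\<in>set js. \<forall>j\<in>set js. d (pt i) (pt j) \<le> 2)})"
  have cR: "cpx Rips (\<lambda>m. lbd)"
  proof (rule cpx_lists)
    fix m us v assume us: "us \<in> Rips (Suc m)" and v: "v \<in> supp (lbd us)"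
    show "v \<in> Rips m"
      using supp_lbd [OF v, of "(<)"] us by (auto simp: Rips_def subset_iff)
  qed
  have "\<forall>x\<in>M. \<exists>j\<in>J. d x (pt j) < 1/2" using N(2) ptJ by fastforce
  then obtain v where v: "\<And>x. x \<in> M \<Longrightarrow> v x \<in> J" "\<And>x. x \<in> M \<Longrightarrow> d x (pt (v x)) < 1/2" by metis
  \<comment> \<open>Small simplices have diameter at most \<open>1/2\<close>; with the distances of
    two points to their labels, labels are at most \<open>3/2\<close> apart, within the scale
    2.\<close>
  define W where "W = {mball y (1/4) | y. y \<in> M}"
  have W: "\<And>w. w \<in> W \<Longrightarrow> openin mtopology w" "topspace mtopology \<subseteq> \<Union> W"
    by (auto simp: W_def)
  let ?G = "sing_small mtopology W"
  obtain \<rho> E where \<rho>: "chmap (sing mtopology) sbd ?G sbd \<rho>"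
    "\<And>m s. s \<in> sing mtopology (Suc m) \<Longrightarrow> frag_extend (sbd (Suc m)) (E (Suc m) s) =
       frag_of s - \<rho> (Suc m) s - frag_extend (E m) (sbd m s)"
    "\<And>s. \<rho> 0 s = frag_of s"
    "\<And>m s. s \<in> sing mtopology m \<Longrightarrow> supp (\<rho> m s) \<subseteq> sing (subtopology mtopology (im m s)) m"
    "\<And>m s. s \<in> sing mtopology m \<Longrightarrow> supp (E m s) \<subseteq> sing (subtopology mtopology (im m s)) (Suc m)"
    using small_simplices [OF W] by metis
  have imM: "im m \<sigma> \<subseteq> M" if "\<sigma> \<in> sing mtopology m" for m \<sigma>
    using im_subset_topspace [OF that] by simp
  have GX: "?G m \<subseteq> sing mtopology m" for m by (rule sing_small_subset)
  have near: "d x x' < 1/2" if \<sigma>: "\<sigma> \<in> ?G m" and x: "x \<in> im m \<sigma>" "x' \<in> im m \<sigma>" for m \<sigma> x x'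
  proof -
    have "m \<noteq> 0" using x by (cases m) auto
    then obtain w where "w \<in> W" "im m \<sigma> \<subseteq> w" using \<sigma> by (auto simp: sing_small_def)
    then obtain y where "y \<in> M" "im m \<sigma> \<subseteq> mball y (1/4)" unfolding W_def by blast
    then have "y \<in> M" "x \<in> mball y (1/4)" "x' \<in> mball y (1/4)" using x by blast+
    then show ?thesis using triangle [of x y x'] by (simp add: commute)
  qed
  define Pa where "Pa = (\<lambda>m \<sigma>. sorted_simplices (v ` im m \<sigma>))"
  have oka: "carrier_ok ?G sbd (\<lambda>m. lbd) Pa"
    unfolding carrier_ok_def
  proof (intro allI ballI conjI)
    fix m \<sigma>
    show "exact_on (\<lambda>m. lbd) (Pa (Suc m) \<sigma>)"
      unfolding Pa_def using im_nonempty [of m \<sigma>] by (intro exact_on_sorted_simplices) blast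
    show "Pa m \<sigma>' n \<subseteq> Pa (Suc m) \<sigma> n" if "\<sigma>' \<in> supp (sbd m \<sigma>)" for \<sigma>' n
      using im_face [OF that] unfolding Pa_def sorted_simplices_def by blast
  qed
  have PaR: "Pa m \<sigma> n \<subseteq> Rips n" if \<sigma>: "\<sigma> \<in> ?G m" for m \<sigma> n
  proof
    fix js assume js: "js \<in> Pa m \<sigma> n"
    have "d (pt i) (pt j) \<le> 2" if ij: "i \<in> set js" "j \<in> set js" for i j
    proof -
      obtain x y where xy: "x \<in> im m \<sigma>" "y \<in> im m \<sigma>" "i = v x" "j = v y"
        using js ij unfolding Pa_def sorted_simplices_def by blast
      have xyM: "x \<in> M" "y \<in> M" using imM GX \<sigma> xy by blast+
      have "d (pt i) (pt j) \<le> d (pt i) x + d x (pt j)"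
        using xy xyM v ptM by (intro triangle) auto
      moreover have "d x (pt j) \<le> d x y + d y (pt j)"
        using xy xyM v ptM by (intro triangle) auto
      moreover have "d (pt i) x < 1/2" "d y (pt j) < 1/2" using v(2) xy xyM by (auto simp: commute)
      ultimately show ?thesis using near [OF \<sigma> xy(1,2)] by linarith
    qed
    moreover have "set js \<subseteq> J"
      using js v(1) imM GX \<sigma> unfolding Pa_def sorted_simplices_def by blast
    ultimately show "js \<in> Rips n"
      using js by (auto simp: Pa_def sorted_simplices_def Rips_def)
  qed
  obtain a where a: "chmap ?G sbd Rips (\<lambda>m. lbd) a" "\<And>m \<sigma>. \<sigma> \<in> ?G m \<Longrightarrow> supp (a m \<sigma>) \<subseteq> Pa m \<sigma> m"
    "\<And>\<sigma>. \<sigma> \<in> ?G 0 \<Longrightarrow> a 0 \<sigma> = frag_of []"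
  proof (rule acyclic_carrier_chmap [OF cpx_sing_small oka PaR, where Fz = "\<lambda>\<sigma>. frag_of []"], goal_cases)
    case (3 a)
    show ?case by (rule 3(1) [OF 3(2-4)])
  qed (auto simp: Pa_def sorted_simplices_def)
  define Pb where "Pb = (\<lambda>m::nat. \<lambda>js. sing_in (chull (pt ` set js)))"
  have hullM: "chull A \<subseteq> M" if "A \<subseteq> M" for A using chull_minimal [OF cvx_M that] .
  have okb: "carrier_ok Rips (\<lambda>m. lbd) sbd Pb"
    unfolding carrier_ok_def
  proof (intro allI ballI conjI)
    fix m js assume js: "js \<in> Rips (Suc m)"
    then have "set js \<noteq> {}" "pt ` set js \<subseteq> M" using ptM by (auto simp: Rips_def)
    then show "exact_on sbd (Pb (Suc m) js)"
      unfolding Pb_def using chull_superset [of "pt ` set js"] by (intro exact_on_cvx cvx_chull) auto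
    show "Pb m js' n \<subseteq> Pb (Suc m) js n" if "js' \<in> supp (lbd js)" for js' n
      unfolding Pb_def using supp_lbd [OF that, of "(<)"] by (intro sing_in_mono chull_mono) auto
  qed
  have PbX: "Pb m js n \<subseteq> sing mtopology n" for m js n
    by (auto simp: Pb_def sing_subtopology)
  obtain b where b: "chmap Rips (\<lambda>m. lbd) (sing mtopology) sbd b" "\<And>m js. js \<in> Rips m \<Longrightarrow> supp (b m js) \<subseteq> Pb m js m"
    "\<And>js. js \<in> Rips 0 \<Longrightarrow> b 0 js = frag_of (\<lambda>_. undefined)"
  proof (rule acyclic_carrier_chmap [OF cR okb PbX, where Fz = "\<lambda>js. frag_of (\<lambda>_. undefined)"], goal_cases)
    case (2 b)
    show ?case by (rule 2(1) [OF 2(2-4)])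
  qed (auto simp: Pb_def)
  define Ph where "Ph = (\<lambda>m \<sigma>. sing_in (chull (im m \<sigma> \<union> (\<lambda>x. pt (v x)) ` im m \<sigma>)))"
  have gensM: "im m \<sigma> \<union> (\<lambda>x. pt (v x)) ` im m \<sigma> \<subseteq> M" if "\<sigma> \<in> ?G m" for m \<sigma>
    using imM [of \<sigma> m] GX that v(1) ptM by blast
  have okh: "carrier_ok ?G sbd sbd Ph"
    unfolding carrier_ok_def
  proof (intro allI ballI conjI)
    fix m \<sigma> assume \<sigma>: "\<sigma> \<in> ?G (Suc m)"
    show "exact_on sbd (Ph (Suc m) \<sigma>)"
      unfolding Ph_def using im_nonempty [of m \<sigma>] chull_superset gensM [OF \<sigma>]
      by (intro exact_on_cvx cvx_chull) blast+
    show "Ph m \<sigma>' n \<subseteq> Ph (Suc m) \<sigma> n" if "\<sigma>' \<in> supp (sbd m \<sigma>)" for \<sigma>' n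
      unfolding Ph_def using im_face [OF that] by (intro sing_in_mono chull_mono) blast
  qed
  have E: "chmap ?G sbd (sing mtopology) sbd (\<lambda>m. frag_of)"
    by (rule chmap_of [OF GX])
  have E': "chmap ?G sbd (sing mtopology) sbd (comp_ch b a)"
    by (rule chmap_comp [OF a(1) b(1)])
  have EP: "supp (frag_of \<sigma>) \<subseteq> Ph m \<sigma> m" if \<sigma>: "\<sigma> \<in> ?G m" for m \<sigma>
  proof -
    have "im m \<sigma> \<subseteq> chull (im m \<sigma> \<union> (\<lambda>x. pt (v x)) ` im m \<sigma>)" using chull_superset by blast
    then show ?thesis using \<sigma> GX unfolding Ph_def sing_subtopology by auto
  qed
  have EP': "supp (comp_ch b a m \<sigma>) \<subseteq> Ph m \<sigma> m" if \<sigma>: "\<sigma> \<in> ?G m" for m \<sigma>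
    unfolding comp_ch_def
  proof (intro frag_extend_closed)
    fix js assume js: "js \<in> supp (a m \<sigma>)"
    then have "set js \<subseteq> v ` im m \<sigma>" using a(2) [OF \<sigma>] by (auto simp: Pa_def sorted_simplices_def)
    then have "pt ` set js \<subseteq> im m \<sigma> \<union> (\<lambda>x. pt (v x)) ` im m \<sigma>" by blast
    then have "Pb m js m \<subseteq> Ph m \<sigma> m" unfolding Pb_def Ph_def by (intro sing_in_mono chull_mono)
    moreover have "js \<in> Rips m" using chmap_supp [OF a(1) \<sigma>] js by blast
    ultimately show "supp (b m js) \<subseteq> Ph m \<sigma> m" using b(2) by blast
  qed
  have R0: "[] \<in> Rips 0" by (simp add: Rips_def)
  have E0: "comp_ch b a 0 \<sigma> = frag_of \<sigma>" if "\<sigma> \<in> ?G 0" for \<sigma>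
    using that a(3) [OF that] b(3) [OF R0] by (simp add: comp_ch_def sing_small_def)
  obtain k where k: "\<And>m s. s \<in> ?G m \<Longrightarrow> supp (k m s) \<subseteq> Ph m s (Suc m)"
    "\<And>m s. s \<in> ?G (Suc m) \<Longrightarrow> frag_extend (sbd (Suc m)) (k (Suc m) s) =
       frag_of s - comp_ch b a (Suc m) s - frag_extend (k m) (sbd m s)"
    "\<And>s. s \<in> ?G 0 \<Longrightarrow> k 0 s = 0"
  proof (rule acyclic_carrier_homotopy [OF cpx_sing_small okh E E' EP EP', where hz = "\<lambda>s. 0"], goal_cases)
    case (4 k)
    show ?case by (rule 4(1) [OF 4(2-4)])
  qed (use E0 in auto)
  \<comment> \<open>Two homotopies in succession: from the identity to \<open>\<rho>\<close>, then
    the one for small simplices applied to \<open>\<rho>\<close>.\<close>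
  define h where "h = (\<lambda>m s. E m s + frag_extend (k m) (\<rho> m s))"
  define \<alpha> where "\<alpha> = comp_ch a \<rho>"
  have hS: "supp (h m s) \<subseteq> supp (E m s) \<union> (\<Union>t\<in>supp (\<rho> m s). supp (k m t))" for m s
    unfolding h_def using keys_add [of "E m s" "frag_extend (k m) (\<rho> m s)"] keys_frag_extend [of "k m" "\<rho> m s"]
    by auto
  have "finite_model M d J pt D \<alpha> b h Rips"
  proof
    show "Rips = (\<lambda>m. {js. length js = m \<and> set js \<subseteq> J \<and> sorted_wrt (<) js \<and>
      (\<forall>i\<in>set js. \<forall>j\<in>set js. d (pt i) (pt j) \<le> 2)})" by (rule Rips_def)
    show "J \<noteq> {}" using v(1) q by blast
    show "finite {j \<in> J. d x (pt j) \<le> r}" if x: "x \<in> M" for x r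
    proof (rule inj_on_finite)
      show "inj_on pt {j \<in> J. d x (pt j) \<le> r}" using inj by (rule inj_on_subset) blast
      show "pt ` {j \<in> J. d x (pt j) \<le> r} \<subseteq> N \<inter> mcball x r" using x ptN ptM by auto
    qed (rule lf [OF x])
    show "Rips m = {}" if m: "D < m" for m
    proof (rule ccontr)
      assume "Rips m \<noteq> {}"
      then obtain js where js: "js \<in> Rips m" by blast
      then obtain j where j: "j \<in> set js" using m by (cases js) (auto simp: Rips_def)
      have sJ: "set js \<subseteq> J" using js by (simp add: Rips_def)
      have "pt ` set js \<subseteq> mcball (pt j) 2"
      proof -
        have "pt i \<in> M" if "i \<in> set js" for i using ptM sJ that by blast
        then show ?thesis using js j by (auto simp: Rips_def)
      qed
      moreover have "separated (pt ` set js)"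
        using sub [of "pt ` set js"] ptN sJ by (metis Int_absorb1 image_subset_iff subset_iff)
      ultimately have "card (pt ` set js) \<le> D" using D ptM j sJ by blast
      moreover have "card (pt ` set js) = card (set js)"
        using inj sJ by (intro card_image) (rule inj_on_subset)
      moreover have "card (set js) = m"
        using js by (auto simp: Rips_def distinct_card strict_sorted_iff)
      ultimately show False using m by simp
    qed
    show \<alpha>: "chmap (sing mtopology) sbd Rips (\<lambda>m. lbd) \<alpha>"
      unfolding \<alpha>_def by (rule chmap_comp [OF \<rho>(1) a(1)])
    show "\<alpha> 0 (\<lambda>_. undefined) = frag_of []"
      using a(3) [of "\<lambda>_. undefined"] by (simp add: \<alpha>_def comp_ch_def \<rho>(3) sing_small_def)
    show "\<exists>x\<in>im m \<sigma>. d x (pt j) \<le> 1/2" if \<sigma>: "\<sigma> \<in> sing mtopology m" and js: "js \<in> supp (\<alpha> m \<sigma>)" "j \<in> set js" for m \<sigma> js j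
    proof -
      obtain \<sigma>' where \<sigma>': "\<sigma>' \<in> supp (\<rho> m \<sigma>)" "js \<in> supp (a m \<sigma>')"
        using js keys_frag_extend [of "a m" "\<rho> m \<sigma>"] by (auto simp: \<alpha>_def comp_ch_def)
      then have "\<sigma>' \<in> ?G m" "im m \<sigma>' \<subseteq> im m \<sigma>"
        using \<rho>(4) [OF \<sigma>] chmap_supp [OF \<rho>(1) \<sigma>] unfolding sing_subtopology by blast+
      then obtain x where "x \<in> im m \<sigma>" "j = v x"
        using a(2) \<sigma>' js(2) unfolding Pa_def sorted_simplices_def by blast
      then show ?thesis using v(2) [of x] imM [OF \<sigma>] by (intro bexI [of _ x]) auto
    qed
    show "chmap Rips (\<lambda>m. lbd) (sing mtopology) sbd b" by (rule b)
    show "b 0 [] = frag_of (\<lambda>_. undefined)" by (rule b(3) [OF R0])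
    show "d (pt j) x \<le> 2" if js: "js \<in> Rips m" "\<sigma> \<in> supp (b m js)" "j \<in> set js" "x \<in> im m \<sigma>" for m \<sigma> js j x
    proof -
      have sJ: "set js \<subseteq> J" using js by (simp add: Rips_def)
      have "pt ` set js \<subseteq> mcball (pt j) 2"
      proof -
        have "pt i \<in> M" if "i \<in> set js" for i using ptM sJ that by blast
        then show ?thesis using js(1,3) by (auto simp: Rips_def)
      qed
      then have "chull (pt ` set js) \<subseteq> mcball (pt j) 2" by (intro chull_minimal cvx_mcball)
      moreover have "x \<in> chull (pt ` set js)"
        using b(2) [OF js(1)] js unfolding Pb_def sing_subtopology by blast
      ultimately show ?thesis by auto
    qed
    show "supp (h m s) \<subseteq> sing mtopology (Suc m)" if s: "s \<in> sing mtopology m" for m s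
    proof -
      have "supp (E m s) \<subseteq> sing mtopology (Suc m)" using \<rho>(5) [OF s] unfolding sing_subtopology by blast
      moreover have "supp (k m t) \<subseteq> sing mtopology (Suc m)" if "t \<in> supp (\<rho> m s)" for t
        using k(1) [of t m] chmap_supp [OF \<rho>(1) s] that unfolding Ph_def sing_subtopology by blast
      ultimately show ?thesis using hS by blast
    qed
    show "frag_extend (sbd (Suc m)) (h (Suc m) s) =
       frag_of s - comp_ch b \<alpha> (Suc m) s - frag_extend (h m) (sbd m s)" if s: "s \<in> sing mtopology (Suc m)" for m s
    proof -
      have "frag_extend (sbd (Suc m)) (frag_extend (k (Suc m)) (\<rho> (Suc m) s)) =
          frag_extend (\<lambda>t. frag_of t - comp_ch b a (Suc m) t - frag_extend (k m) (sbd m t)) (\<rho> (Suc m) s)"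
        unfolding frag_extend_frag_extend
        by (intro frag_extend_eq) (use k(2) chmap_supp [OF \<rho>(1) s] in auto)
      also have "\<dots> = \<rho> (Suc m) s - comp_ch b \<alpha> (Suc m) s - frag_extend (k m) (frag_extend (sbd m) (\<rho> (Suc m) s))"
        by (simp add: frag_extend_diff_fun \<alpha>_def comp_ch_def frag_extend_frag_extend)
      also have "frag_extend (sbd m) (\<rho> (Suc m) s) = frag_extend (\<rho> m) (sbd m s)"
        by (rule chmap_b [OF \<rho>(1) s])
      finally show ?thesis
        unfolding h_def frag_extend_add \<rho>(2) [OF s] frag_extend_add_fun
        by (simp add: frag_extend_frag_extend)
    qed
    show "\<exists>x\<in>im m \<sigma>. d x y \<le> 1" if \<sigma>: "\<sigma> \<in> sing mtopology m" and \<tau>: "\<tau> \<in> supp (h m \<sigma>)" "y \<in> im (Suc m) \<tau>" for m \<sigma> \<tau> y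
    proof -
      consider "\<tau> \<in> supp (E m \<sigma>)" | t where "t \<in> supp (\<rho> m \<sigma>)" "\<tau> \<in> supp (k m t)"
        using \<tau>(1) hS by blast
      then show ?thesis
      proof cases
        case 1
        then have "y \<in> im m \<sigma>" using \<rho>(5) [OF \<sigma>] \<tau>(2) unfolding sing_subtopology by blast
        then show ?thesis using imM [OF \<sigma>] by (intro bexI [of _ y]) auto
      next
        case 2
        then have t: "t \<in> ?G m" "im m t \<subseteq> im m \<sigma>"
          using \<rho>(4) [OF \<sigma>] chmap_supp [OF \<rho>(1) \<sigma>] unfolding sing_subtopology by blast+
        have y: "y \<in> chull (im m t \<union> (\<lambda>x. pt (v x)) ` im m t)"
          using k(1) [OF t(1)] 2(2) \<tau>(2) unfolding Ph_def sing_subtopology by blast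
        have "im m t \<noteq> {}"
        proof
          assume "im m t = {}"
          moreover have "cvx {}" by (simp add: cvx_def)
          ultimately show False using y chull_minimal [of "{}" "{}"] by auto
        qed
        then obtain x where x: "x \<in> im m t" by blast
        have xM: "x \<in> M" using x t imM [OF \<sigma>] by blast
        have "x' \<in> mball x 1 \<and> pt (v x') \<in> mball x 1" if x': "x' \<in> im m t" for x'
        proof -
          have x'M: "x' \<in> M" using x' t imM [OF \<sigma>] by blast
          have "d x x' < 1/2" by (rule near [OF t(1) x x'])
          moreover have "d x (pt (v x')) \<le> d x x' + d x' (pt (v x'))"
            using xM x'M v(1) ptM by (intro triangle) auto
          moreover have "d x' (pt (v x')) < 1/2" using v(2) x'M by blast
          ultimately show ?thesis using xM x'M v(1) ptM by auto
        qed
        then have "chull (im m t \<union> (\<lambda>x. pt (v x)) ` im m t) \<subseteq> mball x 1"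
          by (intro chull_minimal cvx_mball) blast
        then have "d x y \<le> 1" using y by auto
        then show ?thesis using x t by blast
      qed
    qed
  qed (use ptM in auto)
  then show ?thesis by blast
qed

end

section \<open>Supports, and vanishing in high dimensions\<close>

context finite_model
begin

text \<open>The simplices on which \<open>f\<close> may be non-zero meet the closed ball of radius
  \<open>r\<close>, but may reach far beyond it. In degree 0 the condition forces the value on the
  empty simplex to be zero.\<close>

definition offX :: "'a \<Rightarrow> real \<Rightarrow> nat \<Rightarrow> (((nat \<Rightarrow> real) \<Rightarrow> 'a) \<Rightarrow> int) \<Rightarrow> bool" where
  "offX x r m f \<longleftrightarrow> (\<forall>s\<in>sing_in (far x r) m. f s = 0)"

definition offR :: "'a \<Rightarrow> real \<Rightarrow> nat \<Rightarrow> (nat list \<Rightarrow> int) \<Rightarrow> bool" where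
  "offR x r m c \<longleftrightarrow> (\<forall>js\<in>Rips m. (\<forall>j\<in>set js. r < d x (pt j)) \<longrightarrow> c js = 0)"

lemma cpx_Rips: "cpx Rips (\<lambda>m. lbd)"
proof (rule cpx_lists)
  fix m us v assume us: "us \<in> Rips (Suc m)" and v: "v \<in> supp (lbd us)"
  show "v \<in> Rips m"
    using supp_lbd [OF v, of "(<)"] us by (auto simp: Rips_def subset_iff)
qed

lemma RipsD: "js \<in> Rips m \<Longrightarrow> length js = m \<and> set js \<subseteq> J"
  "js \<in> Rips m \<Longrightarrow> i \<in> set js \<Longrightarrow> j \<in> set js \<Longrightarrow> d (pt i) (pt j) \<le> 2"
  "js \<in> Rips m \<Longrightarrow> j \<in> set js \<Longrightarrow> pt j \<in> M"
  using pt by (auto simp: Rips_def)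

lemma sing_in_far: "\<sigma> \<in> sing_in (far x r) m \<longleftrightarrow> \<sigma> \<in> sing mtopology m \<and> (\<forall>y\<in>im m \<sigma>. r < d x y)"
  using im_subset_topspace [of \<sigma> mtopology m] by (auto simp: sing_subtopology far_def)

lemma im_M: "\<sigma> \<in> sing mtopology m \<Longrightarrow> im m \<sigma> \<subseteq> M"
  using im_subset_topspace [of \<sigma> mtopology m] by simp

lemma offX_mono: "offX x r m f \<Longrightarrow> r \<le> r' \<Longrightarrow> offX x r' m f"
  unfolding offX_def using sing_in_mono [OF far_antimono] by blast

lemma offX_center:
  assumes "offX x r m f" "x \<in> M" "y \<in> M" "r + d x y \<le> r'"
  shows "offX y r' m f"
  unfolding offX_def
proof
  fix \<sigma> assume "\<sigma> \<in> sing_in (far y r') m"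
  then have \<sigma>: "\<sigma> \<in> sing mtopology m" "\<And>z. z \<in> im m \<sigma> \<Longrightarrow> r' < d y z" by (auto simp: sing_in_far)
  have "r < d x z" if z: "z \<in> im m \<sigma>" for z
    using \<sigma>(2) [OF z] triangle [of y x z] assms im_M [OF \<sigma>(1)] z by (auto simp: commute)
  then show "f \<sigma> = 0" using assms(1) \<sigma>(1) by (auto simp: offX_def sing_in_far)
qed

lemma offX_pull_\<alpha>:
  assumes c: "offR x r m c" and x: "x \<in> M"
  shows "offX x (r + 1) m (pull \<alpha> m c)"
  unfolding offX_def pull_def
proof (intro ballI pair_eq_0)
  fix \<sigma> js assume "\<sigma> \<in> sing_in (far x (r + 1)) m" and js: "js \<in> supp (\<alpha> m \<sigma>)"
  then have \<sigma>: "\<sigma> \<in> sing mtopology m" "\<And>z. z \<in> im m \<sigma> \<Longrightarrow> r + 1 < d x z" by (auto simp: sing_in_far)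
  have jsR: "js \<in> Rips m" using chmap_supp [OF \<alpha>(1) \<sigma>(1)] js by blast
  have "r < d x (pt j)" if j: "j \<in> set js" for j
  proof -
    obtain y where y: "y \<in> im m \<sigma>" "d y (pt j) \<le> 1/2" using \<alpha>_near [OF \<sigma>(1) js j] by blast
    then show ?thesis
      using \<sigma>(2) [OF y(1)] triangle [of x "pt j" y] x RipsD(3) [OF jsR j] im_M [OF \<sigma>(1)] by (auto simp: commute)
  qed
  then show "c js = 0" using c jsR by (simp add: offR_def)
qed

lemma offR_pull_\<beta>:
  assumes f: "offX x r m f" and x: "x \<in> M"
  shows "offR x (r + 2) m (pull \<beta> m f)"
  unfolding offR_def pull_def
proof (intro ballI impI pair_eq_0)
  fix js \<sigma> assume js: "js \<in> Rips m" and far: "\<forall>j\<in>set js. r + 2 < d x (pt j)" and \<sigma>: "\<sigma> \<in> supp (\<beta> m js)"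
  have \<sigma>X: "\<sigma> \<in> sing mtopology m" using chmap_supp [OF \<beta>(1) js] \<sigma> by blast
  have "r < d x y" if y: "y \<in> im m \<sigma>" for y
  proof -
    have "m \<noteq> 0" using y by (cases m) auto
    then obtain j where j: "j \<in> set js" using RipsD(1) [OF js] by (cases js) auto
    have "d (pt j) y \<le> 2" by (rule \<beta>_near [OF js \<sigma> j y])
    then show ?thesis
      using far j triangle [of x y "pt j"] x RipsD(3) [OF js j] im_M [OF \<sigma>X] y by (fastforce simp: commute)
  qed
  then show "f \<sigma> = 0" using f \<sigma>X by (auto simp: offX_def sing_in_far)
qed

lemma offX_pull_h:
  assumes f: "offX x r (Suc m) f" and x: "x \<in> M"
  shows "offX x (r + 1) m (pull h m f)"
  unfolding offX_def pull_def
proof (intro ballI pair_eq_0)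
  fix \<sigma> \<tau> assume "\<sigma> \<in> sing_in (far x (r + 1)) m" and \<tau>: "\<tau> \<in> supp (h m \<sigma>)"
  then have \<sigma>: "\<sigma> \<in> sing mtopology m" "\<And>z. z \<in> im m \<sigma> \<Longrightarrow> r + 1 < d x z" by (auto simp: sing_in_far)
  have \<tau>X: "\<tau> \<in> sing mtopology (Suc m)" using h(1) [OF \<sigma>(1)] \<tau> by blast
  have "r < d x y" if y: "y \<in> im (Suc m) \<tau>" for y
  proof -
    obtain z where z: "z \<in> im m \<sigma>" "d z y \<le> 1" using h_near [OF \<sigma>(1) \<tau> y] by blast
    have "y \<in> M" using im_M [OF \<tau>X] y by blast
    then show ?thesis
      using \<sigma>(2) [OF z(1)] z(2) triangle [of x y z] x im_M [OF \<sigma>(1)] z(1) by (auto simp: commute)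
  qed
  then have "\<tau> \<in> sing_in (far x r) (Suc m)" using \<tau>X sing_in_far by blast
  then show "f \<tau> = 0" using f unfolding offX_def by blast
qed

text \<open>A cocycle is an explicit coboundary plus a part that factors through the Rips complex,
  and the supports of both are under control.\<close>

lemma cocycle_eq_homotopy:
  assumes f: "cocycle (sing mtopology) sbd (Suc m) f" and s: "s \<in> sing mtopology (Suc m)"
  shows "f s = pair (pull h m f) (sbd m s) + pull \<alpha> (Suc m) (pull \<beta> (Suc m) f) s"
proof -
  have "pull (\<lambda>m. frag_of) (Suc m) f s - pull (comp_ch \<beta> \<alpha>) (Suc m) f s = pair (pull h m f) (sbd m s)"
    by (rule homotopy_pull [OF f]) (use h s in blast)+
  then show ?thesis unfolding pull_comp by (simp add: pull_def)
qed

text \<open>Above the dimension of the Rips complex the part that factors through it is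
  zero.\<close>

lemma hc_vanishes_high:
  assumes "dim \<le> i"
  shows "hc_vanishes mtopology i"
  unfolding hc_vanishes_def
proof (intro allI impI, elim conjE)
  fix f assume f: "cocycle (sing mtopology) sbd (Suc i) f" and c: "compact_supp mtopology (Suc i) f"
  obtain q where q: "q \<in> M" using nonempty by blast
  obtain r where "offX q r (Suc i) f" using c unfolding compact_supp_iff [OF q] offX_def by blast
  then have "offX q (r + 1) i (pull h i f)" using q by (rule offX_pull_h)
  then have "compact_supp mtopology i (pull h i f)" unfolding compact_supp_iff [OF q] offX_def by blast
  moreover have "f s = pair (pull h i f) (sbd i s)" if s: "s \<in> sing mtopology (Suc i)" for s
  proof -
    have "supp (\<alpha> (Suc i) s) = {}" using chmap_supp [OF \<alpha>(1) s] dim [of "Suc i"] assms by simp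
    then have "pull \<alpha> (Suc i) (pull \<beta> (Suc i) f) s = 0" by (simp add: pull_def pair_def)
    then show ?thesis using cocycle_eq_homotopy [OF f s] by simp
  qed
  ultimately show "\<exists>g. compact_supp mtopology i g \<and> (\<forall>s\<in>sing mtopology (Suc i). f s = pair g (sbd i s))"
    by blast
qed

end

section \<open>Non-vanishing\<close>

lemma fun_group_int_mult:
  fixes n :: int
  assumes A: "fun_group A" and f: "f \<in> A"
  shows "(\<lambda>x. n * f x) \<in> A"
proof -
  have nat: "(\<lambda>x. int k * f x) \<in> A" for k
  proof (induction k)
    case (Suc k)
    then show ?case using fun_group_add [OF A Suc f] by (simp add: algebra_simps)
  qed (simp add: fun_group_0 [OF A])
  show ?thesis
  proof (cases "0 \<le> n")
    case True
    then show ?thesis using nat [of "nat n"] by simp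
  next
    case False
    then show ?thesis using fun_group_minus [OF A nat [of "nat (- n)"]] by simp
  qed
qed

text \<open>Induction on \<open>F\<close>: the subgroups of elements vanishing at the new point
  \<open>x\<close> become stationary, and the values at \<open>x\<close> form ideals of the
  integers. Once the least positive value is attained, every element is reduced to one vanishing at
  \<open>x\<close>.\<close>

lemma fun_group_chain_stabilizes:
  fixes L :: "nat \<Rightarrow> ('b \<Rightarrow> int) set"
  assumes "finite F" and "\<And>n. fun_group (L n)" and "\<And>m n. m \<le> n \<Longrightarrow> L m \<subseteq> L n"
    and "\<And>n a x. a \<in> L n \<Longrightarrow> x \<notin> F \<Longrightarrow> a x = 0"
  shows "\<exists>n. \<forall>k. L k \<subseteq> L n"
  using assms
proof (induction F arbitrary: L)
  case empty
  have "L k \<subseteq> L 0" for k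
  proof
    fix a assume "a \<in> L k"
    then have "a = (\<lambda>x. 0)" using empty(3) by auto
    then show "a \<in> L 0" using fun_group_0 [OF empty(1)] by simp
  qed
  then show ?case by blast
next
  case (insert x F)
  note grp = insert.prems(1) and mono = insert.prems(2) and supp = insert.prems(3)
  define L' where "L' n = {a \<in> L n. a x = 0}" for n
  have "\<exists>n. \<forall>k. L' k \<subseteq> L' n"
  proof (rule insert.IH)
    show "fun_group (L' n)" for n using grp [of n] by (auto simp: L'_def fun_group_def)
    show "L' m \<subseteq> L' n" if "m \<le> n" for m n using mono [OF that] by (auto simp: L'_def)
    show "a y = 0" if "a \<in> L' n" "y \<notin> F" for n a y
      using that supp by (cases "y = x") (auto simp: L'_def)
  qed
  then obtain n1 where n1: "\<And>k. L' k \<subseteq> L' n1" by blast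
  show ?case
  proof (cases "\<exists>k a. a \<in> L k \<and> a x \<noteq> 0")
    case False
    then have "L k = L' k" for k by (auto simp: L'_def)
    then show ?thesis using n1 by auto
  next
    case True
    define V where "V = {v::nat. 0 < v \<and> (\<exists>k a. a \<in> L k \<and> a x = int v)}"
    obtain k a where a: "a \<in> L k" "a x \<noteq> 0" using True by blast
    have "nat \<bar>a x\<bar> \<in> V"
    proof (cases "0 \<le> a x")
      case True
      then show ?thesis using a by (auto simp: V_def)
    next
      case False
      then show ?thesis
        using a fun_group_minus [OF grp a(1)] by (auto simp: V_def intro!: exI [of _ k] bexI [of _ "\<lambda>x. - a x"])
    qed
    define v where "v = (LEAST v. v \<in> V)"
    have v: "v \<in> V" "\<And>w. w \<in> V \<Longrightarrow> v \<le> w"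
      using \<open>nat \<bar>a x\<bar> \<in> V\<close> by (auto simp: v_def intro: LeastI Least_le)
    obtain n0 b where b: "b \<in> L n0" "b x = int v" "0 < v" using v(1) by (auto simp: V_def)
    define n where "n = max n0 n1"
    have "L k \<subseteq> L n" for k
    proof
      fix a assume a: "a \<in> L k"
      define N where "N = max k n"
      define z where "z = a x div int v"
      have aN: "a \<in> L N" using mono [of k N] a by (auto simp: N_def)
      have bN: "b \<in> L N" using mono [of n0 N] b by (auto simp: N_def n_def le_max_iff_disj)
      define c where "c y = a y - z * b y" for y
      have c: "c \<in> L N"
        unfolding c_def using fun_group_diff [OF grp aN fun_group_int_mult [OF grp bN]] .
      have cx: "c x = a x mod int v"
        by (simp add: c_def z_def b(2) minus_div_mult_eq_mod)
      \<comment> \<open>A non-zero remainder would be a positive value below the least one.\<close>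
      have "c x = 0"
      proof (rule ccontr)
        assume "c x \<noteq> 0"
        moreover have "0 \<le> c x" "c x < int v" using b(3) by (auto simp: cx)
        ultimately have "nat (c x) \<in> V" using c by (auto simp: V_def)
        then have "v \<le> nat (c x)" by (rule v(2))
        then show False using \<open>c x < int v\<close> \<open>0 \<le> c x\<close> by linarith
      qed
      then have "c \<in> L' n1" using n1 [of N] c by (auto simp: L'_def)
      then have cn: "c \<in> L n" using mono [of n1 n] by (auto simp: L'_def n_def le_max_iff_disj)
      have bn: "b \<in> L n" using mono [of n0 n] b by (auto simp: n_def le_max_iff_disj)
      have "a = (\<lambda>y. c y + z * b y)" by (simp add: c_def)
      then show "a \<in> L n" using fun_group_add [OF grp cn fun_group_int_mult [OF grp bn]] by simp
    qed
    then show ?thesis by blast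
  qed
qed

section \<open>Isometries acting on singular chains\<close>

definition kmap :: "('a \<Rightarrow> 'b) \<Rightarrow> nat \<Rightarrow> ((nat \<Rightarrow> real) \<Rightarrow> 'a) \<Rightarrow> (nat \<Rightarrow> real) \<Rightarrow> 'b" where
  "kmap k m \<sigma> = (case m of 0 \<Rightarrow> (\<lambda>_. undefined) | Suc p \<Rightarrow> simplex_map p k \<sigma>)"

lemma chmap_kmap:
  assumes k: "continuous_map X Y k"
  shows "chmap (sing X) sbd (sing Y) sbd (\<lambda>m \<sigma>. frag_of (kmap k m \<sigma>))"
  unfolding chmap_def
proof (intro conjI allI ballI)
  show "supp (frag_of (kmap k m \<sigma>)) \<subseteq> sing Y m" if "\<sigma> \<in> sing X m" for m \<sigma>
    using that k by (cases m) (auto simp: kmap_def intro: singular_simplex_simplex_map)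
  show "frag_extend (sbd m) (frag_of (kmap k (Suc m) \<sigma>)) = frag_extend (\<lambda>\<sigma>. frag_of (kmap k m \<sigma>)) (sbd m \<sigma>)"
    if "\<sigma> \<in> sing X (Suc m)" for m \<sigma>
  proof (cases m)
    case 0
    then show ?thesis by (simp add: kmap_def)
  next
    case (Suc p)
    have "singular_chain (Suc p) X (frag_of \<sigma>)" using that Suc by (simp add: singular_chain_of)
    from chain_boundary_chain_map [OF this, of k]
    have "chain_boundary (Suc p) (frag_of (simplex_map (Suc p) k \<sigma>)) = chain_map p k (chain_boundary (Suc p) (frag_of \<sigma>))"
      by simp
    then show ?thesis
      unfolding Suc frag_extend_sbd by (simp add: kmap_def sbd_def chain_map_def o_def)
  qed
qed

lemma im_kmap: "im m (kmap k m \<sigma>) = k ` im m \<sigma>"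
  by (cases m) (auto simp: kmap_def simplex_map_def image_image)

lemma kmap_kmap:
  assumes \<sigma>: "\<sigma> \<in> sing X m" and k: "\<And>x. x \<in> topspace X \<Longrightarrow> k' (k x) = x"
  shows "kmap k' m (kmap k m \<sigma>) = \<sigma>"
proof (cases m)
  case 0
  then show ?thesis using \<sigma> by (simp add: kmap_def)
next
  case (Suc p)
  have st: "\<sigma> \<in> extensional (standard_simplex p)" "\<And>x. x \<in> standard_simplex p \<Longrightarrow> \<sigma> x \<in> topspace X"
    using \<sigma> im_subset_topspace [OF \<sigma>] Suc by (auto simp: singular_simplex_def)
  then show ?thesis
  proof -
    have "simplex_map p k' (simplex_map p k \<sigma>) = restrict (\<lambda>x. k' (k (\<sigma> x))) (standard_simplex p)"
      by (auto simp: simplex_map_def restrict_def)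
    also have "\<dots> = restrict \<sigma> (standard_simplex p)"
      by (intro restrict_ext) (use k st in auto)
    also have "\<dots> = \<sigma>" using st by (simp add: extensional_restrict)
    finally show ?thesis by (simp add: Suc kmap_def)
  qed
qed

context cocompact_CAT0_space
begin

lemma self_isometry_continuous:
  assumes "self_isometry k"
  shows "continuous_map mtopology mtopology k"
  unfolding continuous_map_to_metric
proof (intro ballI allI impI)
  fix x and e :: real assume x: "x \<in> topspace mtopology" and e: "0 < e"
  have "k y \<in> mball (k x) e" if "y \<in> mball x e" for y
    using assms that by (auto simp: self_isometry_def)
  then show "\<exists>U. openin mtopology U \<and> x \<in> U \<and> (\<forall>y\<in>U. k y \<in> mball (k x) e)"
    using x e by (intro exI [of _ "mball x e"]) auto
qed

lemma self_isometry_inverse: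
  assumes k: "self_isometry k"
  obtains k' where "self_isometry k'" "\<And>x. x \<in> M \<Longrightarrow> k' (k x) = x" "\<And>x. x \<in> M \<Longrightarrow> k (k' x) = x"
proof -
  have kM: "k ` M = M" and kd: "\<And>x y. x \<in> M \<Longrightarrow> y \<in> M \<Longrightarrow> d (k x) (k y) = d x y"
    using k by (auto simp: self_isometry_def)
  have inj: "inj_on k M"
  proof (rule inj_onI)
    fix x y assume "x \<in> M" "y \<in> M" "k x = k y"
    then have "k x \<in> M" using kM by blast
    then have "d x y = 0" using kd [of x y] \<open>x \<in> M\<close> \<open>y \<in> M\<close> \<open>k x = k y\<close> by simp
    then show "x = y" using \<open>x \<in> M\<close> \<open>y \<in> M\<close> by simp
  qed
  let ?k' = "inv_into M k"
  have 1: "?k' (k x) = x" if "x \<in> M" for x using inj that by simp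
  have 2: "k (?k' x) = x" if "x \<in> M" for x using kM that by (simp add: f_inv_into_f)
  have 3: "?k' x \<in> M" if "x \<in> M" for x using kM that by (metis inv_into_into)
  have "?k' ` M = M"
  proof
    show "?k' ` M \<subseteq> M" using 3 by blast
    show "M \<subseteq> ?k' ` M"
    proof
      fix x assume "x \<in> M"
      then have "k x \<in> M" "?k' (k x) = x" using 1 kM by auto
      then show "x \<in> ?k' ` M" by force
    qed
  qed
  moreover have "d (?k' x) (?k' y) = d x y" if "x \<in> M" "y \<in> M" for x y
    using kd [OF 3 [OF that(1)] 3 [OF that(2)]] 2 that by simp
  ultimately have "self_isometry ?k'" by (simp add: self_isometry_def)
  then show thesis using 1 2 that by blast
qed

end

lemma pull_diff: "pull F m (\<lambda>x. f x - g x) = (\<lambda>s. pull F m f s - pull F m g s)"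
  by (simp add: pull_def pair_diff_fun)

lemma pull_frag_of: "pull (\<lambda>m s. frag_of (F m s)) m f = (\<lambda>s. f (F m s))"
  by (simp add: pull_def)

definition ind :: "'b \<Rightarrow> 'b \<Rightarrow> int" where
  "ind t = (\<lambda>x. if x = t then 1 else 0)"

lemma pair_ind: "pair (ind t) c = Poly_Mapping.lookup c t"
proof -
  have "pair (ind t) c = (\<Sum>x\<in>supp c. if x = t then Poly_Mapping.lookup c x else 0)"
    unfolding pair_def by (intro sum.cong) (auto simp: ind_def)
  then show ?thesis by (simp add: in_keys_iff)
qed

lemma sum_pair_ind:
  assumes "finite A" "supp c \<subseteq> A"
  shows "(\<Sum>t\<in>A. a t * pair (ind t) c) = pair a c"
  unfolding pair_ind by (simp add: pair_superset [OF assms] mult.commute)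

section \<open>Bounds for the supports of primitives\<close>

context finite_model
begin

text \<open>\<open>L n\<close> consists of the pull-backs to the Rips complex of those cocycles that
  bound within radius \<open>n\<close>. It lies in the functions on a finite set, so the sequence
  stops. A cocycle then differs from one that bounds within the final radius by a cocycle with zero
  pull-back, and for the latter \<open>h\<close> gives a primitive within
  \<open>r + 1\<close>.\<close>

lemma uniform_bound_center:
  assumes hc: "hc_vanishes mtopology i" and q: "q \<in> M"
  shows "\<exists>R. \<forall>f. cocycle (sing mtopology) sbd (Suc i) f \<longrightarrow> offX q r (Suc i) f \<longrightarrow>
     (\<exists>g. offX q R i g \<and> (\<forall>s\<in>sing mtopology (Suc i). f s = pair g (sbd i s)))"
proof -
  define bounds where "bounds R f \<longleftrightarrow> (\<exists>g. offX q R i g \<and> (\<forall>s\<in>sing mtopology (Suc i). f s = pair g (sbd i s)))" for R f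
  define ok where "ok f \<longleftrightarrow> cocycle (sing mtopology) sbd (Suc i) f \<and> offX q r (Suc i) f" for f
  \<comment> \<open>Off \<open>F\<close> all pull-backs vanish, as \<open>\<beta>\<close> enlarges
    supports by 2. With the diameter 2 of a simplex, all its vertices lie within
    \<open>r + 4\<close>.\<close>
  define F where "F = {js \<in> Rips (Suc i). \<exists>j\<in>set js. d q (pt j) \<le> r + 2}"
  have "F \<subseteq> {js. set js \<subseteq> {j \<in> J. d q (pt j) \<le> r + 4} \<and> length js = Suc i}"
  proof
    fix js assume "js \<in> F"
    then obtain j where js: "js \<in> Rips (Suc i)" and j: "j \<in> set js" "d q (pt j) \<le> r + 2" by (auto simp: F_def)
    have "d q (pt l) \<le> r + 4" if l: "l \<in> set js" for l
      using triangle [of q "pt j" "pt l"] q RipsD(2,3) [OF js] j l by fastforce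
    then show "js \<in> {js. set js \<subseteq> {j \<in> J. d q (pt j) \<le> r + 4} \<and> length js = Suc i}"
      using RipsD(1) [OF js] by auto
  qed
  moreover have "finite {js. set js \<subseteq> {j \<in> J. d q (pt j) \<le> r + 4} \<and> length js = Suc i}"
    by (rule finite_lists_length_eq [OF locally_finite [OF q]])
  ultimately have finF: "finite F" by (rule finite_subset)
  define bf where "bf f = (\<lambda>js. if js \<in> F then pull \<beta> (Suc i) f js else 0)" for f
  have bf_diff: "bf (\<lambda>s. f s - f' s) = (\<lambda>js. bf f js - bf f' js)" for f f'
    by (auto simp: bf_def pull_diff)
  have ok_diff: "ok (\<lambda>s. f s - f' s)" if "ok f" "ok f'" for f f'
    using that by (auto simp: ok_def cocycle_def offX_def pair_diff_fun)
  have bounds_diff: "bounds R (\<lambda>s. f s - f' s)" if bb: "bounds R f" "bounds R f'" for f f' R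
  proof -
    obtain g g' where "offX q R i g" "\<forall>s\<in>sing mtopology (Suc i). f s = pair g (sbd i s)"
      "offX q R i g'" "\<forall>s\<in>sing mtopology (Suc i). f' s = pair g' (sbd i s)"
      using bb by (auto simp: bounds_def simp del: sing_simps)
    then show ?thesis
      unfolding bounds_def by (intro exI [of _ "\<lambda>s. g s - g' s"]) (simp add: offX_def pair_diff_fun del: sing_simps)
  qed
  have bounds_mono: "bounds R' f" if "bounds R f" "R \<le> R'" for R R' f
    using that offX_mono unfolding bounds_def by blast
  define L where "L n = {bf f | f. ok f \<and> bounds (real n) f}" for n :: nat
  have "\<exists>n. \<forall>k. L k \<subseteq> L n"
  proof (rule fun_group_chain_stabilizes [OF finF])
    fix n
    have "ok (\<lambda>s. 0)" "bounds (real n) (\<lambda>s. 0)" "bf (\<lambda>s. 0) = (\<lambda>s. 0)"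
      by (auto simp: ok_def cocycle_def offX_def bounds_def bf_def pull_def intro!: exI [of _ "\<lambda>s. 0"])
    then have "(\<lambda>s. 0) \<in> L n" unfolding L_def by (metis (mono_tags, lifting) mem_Collect_eq)
    moreover have "(\<lambda>s. a s - b s) \<in> L n" if "a \<in> L n" "b \<in> L n" for a b
    proof -
      obtain f f' where ff: "ok f" "bounds (real n) f" "a = bf f" "ok f'" "bounds (real n) f'" "b = bf f'"
        using \<open>a \<in> L n\<close> \<open>b \<in> L n\<close> unfolding L_def by blast
      have "(\<lambda>s. a s - b s) = bf (\<lambda>s. f s - f' s)" by (simp add: bf_diff ff)
      then show ?thesis unfolding L_def using ok_diff bounds_diff ff by blast
    qed
    ultimately show "fun_group (L n)" by (simp add: fun_group_def)
  next
    fix m n :: nat assume "m \<le> n"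
    then show "L m \<subseteq> L n" unfolding L_def using bounds_mono [of "real m" _ "real n"] by auto
  next
    fix n a js assume "a \<in> L n" "js \<notin> F"
    then show "a js = 0" by (auto simp: L_def bf_def)
  qed
  then obtain n where n: "\<And>k. L k \<subseteq> L n" by blast
  define R where "R = max (real n) (r + 1)"
  have "bounds R f" if f: "ok f" for f
  proof -
    have "compact_supp mtopology (Suc i) f"
      using f unfolding compact_supp_iff [OF q] ok_def offX_def by blast
    then obtain g where g: "compact_supp mtopology i g" "\<forall>s\<in>sing mtopology (Suc i). f s = pair g (sbd i s)"
      using hc f unfolding hc_vanishes_def ok_def by blast
    obtain R0 where R0: "offX q R0 i g" using g(1) unfolding compact_supp_iff [OF q] offX_def by blast
    obtain k :: nat where "R0 \<le> real k" using real_arch_simple by blast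
    then have "bounds (real k) f" using R0 g(2) offX_mono unfolding bounds_def by blast
    then have "bf f \<in> L n" using n [of k] f unfolding L_def by blast
    then obtain f' where f': "ok f'" "bounds (real n) f'" "bf f = bf f'" unfolding L_def by blast
    define e where "e s = f s - f' s" for s
    have e: "ok e" unfolding e_def using ok_diff f f' by blast
    have \<beta>e: "pull \<beta> (Suc i) e js = 0" if js: "js \<in> Rips (Suc i)" for js
    proof (cases "js \<in> F")
      case True
      then show ?thesis using fun_cong [OF f'(3), of js] by (simp add: e_def [abs_def] pull_diff bf_def)
    next
      case False
      then have "\<forall>j\<in>set js. r + 2 < d q (pt j)" using js by (auto simp: F_def)
      then show ?thesis using offR_pull_\<beta> [OF _ q, of r "Suc i" e] e js by (simp add: ok_def offR_def)
    qed
    have "e s = pair (pull h i e) (sbd i s)" if s: "s \<in> sing mtopology (Suc i)" for s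
    proof -
      have "pull \<alpha> (Suc i) (pull \<beta> (Suc i) e) s = 0"
        unfolding pull_def [of \<alpha>] using \<beta>e chmap_supp [OF \<alpha>(1) s] by (intro pair_eq_0) blast
      then show ?thesis using cocycle_eq_homotopy [of i e s] e s by (simp add: ok_def del: sing_simps)
    qed
    moreover have "offX q R i (pull h i e)"
      using offX_mono [OF offX_pull_h [OF _ q, of r i e], of R] e by (simp add: ok_def R_def)
    ultimately have "bounds R e" unfolding bounds_def by blast
    moreover have "bounds R (\<lambda>s. - f' s)"
    proof -
      have "bounds R (\<lambda>s. 0)" by (auto simp: bounds_def offX_def intro!: exI [of _ "\<lambda>s. 0"])
      from bounds_diff [OF this bounds_mono [OF f'(2)]] show ?thesis by (simp add: R_def)
    qed
    ultimately have "bounds R (\<lambda>s. e s - - f' s)" by (rule bounds_diff)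
    then show ?thesis by (simp add: e_def)
  qed
  then show ?thesis unfolding bounds_def ok_def by blast
qed

text \<open>Isometries act on singular cochains but not on the net, so the bound at \<open>q\<close>
  is transported on the singular side. Every \<open>x\<close> is the image of some \<open>c\<close>
  within \<open>B\<close> of \<open>q\<close>; recentring from \<open>c\<close> to \<open>q\<close>
  and back costs \<open>B\<close> each time.\<close>

lemma uniform_bound:
  assumes hc: "hc_vanishes mtopology i"
  shows "\<exists>R. \<forall>x\<in>M. \<forall>f. cocycle (sing mtopology) sbd (Suc i) f \<longrightarrow> offX x r (Suc i) f \<longrightarrow>
     (\<exists>g. offX x R i g \<and> (\<forall>s\<in>sing mtopology (Suc i). f s = pair g (sbd i s)))"
proof -
  obtain q where q: "q \<in> M" using nonempty by blast
  obtain B where B: "0 \<le> B" "\<And>x. x \<in> M \<Longrightarrow> \<exists>k c. self_isometry k \<and> c \<in> M \<and> d q c \<le> B \<and> k c = x"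
    using cocompact_ball [OF q] by metis
  obtain R where R: "\<And>f. cocycle (sing mtopology) sbd (Suc i) f \<Longrightarrow> offX q (r + B) (Suc i) f \<Longrightarrow>
     (\<exists>g. offX q R i g \<and> (\<forall>s\<in>sing mtopology (Suc i). f s = pair g (sbd i s)))"
    using uniform_bound_center [OF hc q, of "r + B"] by blast
  have "\<exists>g. offX x (R + B) i g \<and> (\<forall>s\<in>sing mtopology (Suc i). f s = pair g (sbd i s))"
    if x: "x \<in> M" and f: "cocycle (sing mtopology) sbd (Suc i) f" "offX x r (Suc i) f" for x f
  proof -
    obtain k c where k: "self_isometry k" and c: "c \<in> M" "d q c \<le> B" "k c = x" using B(2) [OF x] by blast
    obtain k' where k': "self_isometry k'" "\<And>x. x \<in> M \<Longrightarrow> k' (k x) = x" "\<And>x. x \<in> M \<Longrightarrow> k (k' x) = x"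
      using self_isometry_inverse [OF k] by blast
    note ch = chmap_kmap [OF self_isometry_continuous]
    define f' where "f' = pull (\<lambda>m \<sigma>. frag_of (kmap k m \<sigma>)) (Suc i) f"
    have f'c: "cocycle (sing mtopology) sbd (Suc i) f'"
      unfolding f'_def by (rule cocycle_pull [OF ch [OF k] f(1)])
    have km: "kmap k m \<sigma> \<in> sing mtopology m" if "\<sigma> \<in> sing mtopology m" for m \<sigma>
      using chmap_supp [OF ch [OF k] that] by simp
    have km': "kmap k' m \<sigma> \<in> sing mtopology m" if "\<sigma> \<in> sing mtopology m" for m \<sigma>
      using chmap_supp [OF ch [OF k'(1)] that] by simp
    have dk: "d (k y) (k z) = d y z" if "y \<in> M" "z \<in> M" for y z using k that by (simp add: self_isometry_def)
    have "offX c r (Suc i) f'"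
      unfolding offX_def
    proof
      fix \<sigma> assume "\<sigma> \<in> sing_in (far c r) (Suc i)"
      then have \<sigma>: "\<sigma> \<in> sing mtopology (Suc i)" "\<And>y. y \<in> im (Suc i) \<sigma> \<Longrightarrow> r < d c y" unfolding sing_in_far by auto
      have "\<forall>y\<in>im (Suc i) (kmap k (Suc i) \<sigma>). r < d x y"
        unfolding im_kmap using \<sigma>(2) im_M [OF \<sigma>(1)] dk [OF c(1)] c(3) by (metis imageE subsetD)
      then have "kmap k (Suc i) \<sigma> \<in> sing_in (far x r) (Suc i)"
        using km [OF \<sigma>(1)] sing_in_far by blast
      then show "f' \<sigma> = 0"
        using f(2) unfolding f'_def pull_frag_of offX_def by blast
    qed
    then have "offX q (r + B) (Suc i) f'"
      by (rule offX_center) (use c q in \<open>auto simp: commute\<close>)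
    then obtain g where g: "offX q R i g" "\<And>s. s \<in> sing mtopology (Suc i) \<Longrightarrow> f' s = pair g (sbd i s)"
      using R f'c by blast
    define g' where "g' = pull (\<lambda>m \<sigma>. frag_of (kmap k' m \<sigma>)) i g"
    have gc: "offX c (R + B) i g" by (rule offX_center [OF g(1)]) (use c q in auto)
    have "offX x (R + B) i g'"
      unfolding offX_def
    proof
      fix \<sigma> assume "\<sigma> \<in> sing_in (far x (R + B)) i"
      then have \<sigma>: "\<sigma> \<in> sing mtopology i" "\<And>y. y \<in> im i \<sigma> \<Longrightarrow> R + B < d x y" unfolding sing_in_far by auto
      have "R + B < d c y" if y: "y \<in> im i (kmap k' i \<sigma>)" for y
      proof -
        obtain z where z: "z \<in> im i \<sigma>" "y = k' z" using y unfolding im_kmap by blast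
        have "z \<in> M" "y \<in> M" using z im_M [OF \<sigma>(1)] im_M [OF km' [OF \<sigma>(1)]] y by blast+
        then show ?thesis using \<sigma>(2) [OF z(1)] dk [OF c(1), of y] c(3) k'(3) z by simp
      qed
      then have "kmap k' i \<sigma> \<in> sing_in (far c (R + B)) i"
        using km' [OF \<sigma>(1)] sing_in_far by blast
      then show "g' \<sigma> = 0"
        using gc unfolding g'_def pull_frag_of offX_def by blast
    qed
    moreover have "f s = pair g' (sbd i s)" if s: "s \<in> sing mtopology (Suc i)" for s
    proof -
      have "kmap k (Suc i) (kmap k' (Suc i) s) = s"
        by (rule kmap_kmap [OF s]) (use k' in simp)
      then have "f s = pull (\<lambda>m \<sigma>. frag_of (kmap k' m \<sigma>)) (Suc i) f' s"
        by (simp add: f'_def pull_frag_of)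
      also have "\<dots> = pair g' (sbd i s)"
        unfolding g'_def by (rule pull_coboundary_eq [OF ch [OF k'(1)] g(2) s])
      finally show ?thesis .
    qed
    ultimately show ?thesis by blast
  qed
  then show ?thesis by blast
qed

abbreviation "e \<equiv> comp_ch \<alpha> \<beta>"

lemma chmap_e: "chmap Rips (\<lambda>m. lbd) Rips (\<lambda>m. lbd) e"
  by (rule chmap_comp [OF \<beta>(1) \<alpha>(1)])

text \<open>The cocycle is pulled back along \<open>\<alpha>\<close> and bounded there, and the
  primitive is pulled back along \<open>\<beta>\<close>. The result bounds the pull-back under
  \<open>e\<close> instead of the cocycle itself.\<close>

lemma uniform_bound_Rips:
  assumes hc: "hc_vanishes mtopology i"
  shows "\<exists>R. \<forall>x\<in>M. \<forall>c. cocycle Rips (\<lambda>m. lbd) (Suc i) c \<longrightarrow> offR x r (Suc i) c \<longrightarrow>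
     (\<exists>b. offR x R i b \<and> (\<forall>js\<in>Rips (Suc i). pull e (Suc i) c js = pair b (lbd js)))"
proof -
  obtain R where R: "\<And>x f. x \<in> M \<Longrightarrow> cocycle (sing mtopology) sbd (Suc i) f \<Longrightarrow> offX x (r + 1) (Suc i) f \<Longrightarrow>
     (\<exists>g. offX x R i g \<and> (\<forall>s\<in>sing mtopology (Suc i). f s = pair g (sbd i s)))"
    using uniform_bound [OF hc, of "r + 1"] by blast
  have "\<exists>b. offR x (R + 2) i b \<and> (\<forall>js\<in>Rips (Suc i). pull e (Suc i) c js = pair b (lbd js))"
    if x: "x \<in> M" and c: "cocycle Rips (\<lambda>m. lbd) (Suc i) c" "offR x r (Suc i) c" for x c
  proof -
    obtain g where g: "offX x R i g" "\<And>s. s \<in> sing mtopology (Suc i) \<Longrightarrow> pull \<alpha> (Suc i) c s = pair g (sbd i s)"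
      using R [OF x cocycle_pull [OF \<alpha>(1) c(1)] offX_pull_\<alpha> [OF c(2) x]] by blast
    have "pull e (Suc i) c js = pair (pull \<beta> i g) (lbd js)" if "js \<in> Rips (Suc i)" for js
      unfolding pull_comp by (rule pull_coboundary_eq [OF \<beta>(1) g(2) that])
    then show ?thesis using offR_pull_\<beta> [OF g(1) x] by blast
  qed
  then show ?thesis by blast
qed

section \<open>Powers of \<open>e\<close> and local operators on Rips cochains\<close>

primrec epow :: "nat \<Rightarrow> nat \<Rightarrow> nat list \<Rightarrow> nat list \<Rightarrow>\<^sub>0 int" where
  "epow 0 = (\<lambda>m. frag_of)"
| "epow (Suc k) = comp_ch (epow k) e"

lemma chmap_epow: "chmap Rips (\<lambda>m. lbd) Rips (\<lambda>m. lbd) (epow k)"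
proof (induction k)
  case 0
  then show ?case by (simp add: chmap_of)
next
  case (Suc k)
  then show ?case using chmap_comp [OF chmap_e Suc] by simp
qed

lemma e_near:
  assumes js: "js \<in> Rips m" "js' \<in> supp (e m js)" and i: "i \<in> set js" "j \<in> set js'"
  shows "d (pt i) (pt j) \<le> 3"
proof -
  obtain \<sigma> where \<sigma>: "\<sigma> \<in> supp (\<beta> m js)" "js' \<in> supp (\<alpha> m \<sigma>)"
    using js keys_frag_extend [of "\<alpha> m" "\<beta> m js"] by (auto simp: comp_ch_def)
  have \<sigma>X: "\<sigma> \<in> sing mtopology m" using chmap_supp [OF \<beta>(1) js(1)] \<sigma> by blast
  have js'R: "js' \<in> Rips m" using chmap_supp [OF chmap_e js(1)] js(2) by blast
  obtain x where x: "x \<in> im m \<sigma>" "d x (pt j) \<le> 1/2" using \<alpha>_near [OF \<sigma>X \<sigma>(2) i(2)] by blast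
  have "d (pt i) x \<le> 2" by (rule \<beta>_near [OF js(1) \<sigma>(1) i(1) x(1)])
  then show ?thesis
    using triangle [of "pt i" x "pt j"] x RipsD(3) [OF js(1) i(1)] RipsD(3) [OF js'R i(2)] im_M [OF \<sigma>X] by auto
qed

text \<open>Each factor \<open>e\<close> moves vertices by at most 3; the remaining 2 is the
  diameter of a simplex.\<close>

lemma epow_near:
  assumes "js \<in> Rips m" "js' \<in> supp (epow k m js)" "i \<in> set js" "j \<in> set js'"
  shows "d (pt i) (pt j) \<le> 3 * real k + 2"
  using assms
proof (induction k arbitrary: js i)
  case 0
  then show ?case using RipsD(2) [OF 0(1)] by auto
next
  case (Suc k)
  then obtain ls where ls: "ls \<in> supp (e m js)" "js' \<in> supp (epow k m ls)"
    using keys_frag_extend [of "epow k m" "e m js"] by (auto simp: comp_ch_def [of "epow k"])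
  have lsR: "ls \<in> Rips m" using chmap_supp [OF chmap_e Suc.prems(1)] ls by blast
  have "length ls = length js" using RipsD(1) lsR Suc.prems(1) by metis
  then obtain l where l: "l \<in> set ls" using Suc.prems(3) by (cases ls) auto
  have "js' \<in> Rips m" using chmap_supp [OF chmap_epow lsR] ls by blast
  then have M: "pt i \<in> M" "pt l \<in> M" "pt j \<in> M" using RipsD(3) Suc.prems lsR l by blast+
  have "d (pt i) (pt l) \<le> 3" by (rule e_near [OF Suc.prems(1) ls(1) Suc.prems(3) l])
  moreover have "d (pt l) (pt j) \<le> 3 * real k + 2" by (rule Suc.IH [OF lsR ls(2) l Suc.prems(4)])
  ultimately show ?case using triangle [OF M] by simp
qed

text \<open>\<open>S\<close> is the matrix of an operator that lowers degrees by one: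
  \<open>S t\<close> is the image of the indicator of \<open>t\<close>, supported near a vertex of
  \<open>t\<close>. For \<open>i = 0\<close> locality forces the matrix to be zero.\<close>

definition local_kernel :: "nat \<Rightarrow> real \<Rightarrow> (nat list \<Rightarrow> nat list \<Rightarrow> int) \<Rightarrow> bool" where
  "local_kernel i \<rho> S \<longleftrightarrow> (\<forall>t\<in>Rips (Suc i). offR (pt (hd t)) \<rho> i (S t))"

text \<open>The simplices that contribute to the value at \<open>u\<close>. Locality makes them
  finite in number, so that the operator applies to cochains with arbitrary support.\<close>

definition kernel_set :: "nat \<Rightarrow> (nat list \<Rightarrow> nat list \<Rightarrow> int) \<Rightarrow> nat list \<Rightarrow> nat list set" where
  "kernel_set i S u = {t \<in> Rips (Suc i). S t u \<noteq> 0}"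

lemma hd_Rips: "t \<in> Rips (Suc i) \<Longrightarrow> hd t \<in> set t"
  using RipsD(1) [of t "Suc i"] by (cases t) auto

lemma local_kernelD:
  assumes "local_kernel i \<rho> S" "u \<in> Rips i" "t \<in> kernel_set i S u"
  obtains j where "j \<in> set u" "d (pt (hd t)) (pt j) \<le> \<rho>"
  using assms unfolding local_kernel_def kernel_set_def offR_def by force

lemma finite_kernel_set:
  assumes S: "local_kernel i \<rho> S" and u: "u \<in> Rips i"
  shows "finite (kernel_set i S u)"
proof (rule finite_subset)
  let ?A = "\<Union>j\<in>set u. {l \<in> J. d (pt j) (pt l) \<le> \<rho> + 2}"
  show "kernel_set i S u \<subseteq> {t. set t \<subseteq> ?A \<and> length t = Suc i}"
  proof
    fix t assume t: "t \<in> kernel_set i S u"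
    then have tR: "t \<in> Rips (Suc i)" by (simp add: kernel_set_def)
    obtain j where j: "j \<in> set u" "d (pt (hd t)) (pt j) \<le> \<rho>" using local_kernelD [OF S u t] .
    have "d (pt j) (pt l) \<le> \<rho> + 2" if l: "l \<in> set t" for l
      using triangle [of "pt j" "pt (hd t)" "pt l"] RipsD(3) [OF u j(1)] RipsD(2,3) [OF tR hd_Rips [OF tR]]
        RipsD(3) [OF tR l] l j(2) commute by (smt (verit))
    then have "set t \<subseteq> ?A" using RipsD(1) [OF tR] j(1) by blast
    then show "t \<in> {t. set t \<subseteq> ?A \<and> length t = Suc i}" using RipsD(1) [OF tR] by simp
  qed
  have "finite ?A" using locally_finite RipsD(3) [OF u] by blast
  then show "finite {t. set t \<subseteq> ?A \<and> length t = Suc i}" by (rule finite_lists_length_eq)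
qed

text \<open>
  Only \<open>\<beta>\<close> after \<open>\<alpha>\<close>, but not \<open>e\<close>, is known to be homotopic to the identity; hence the power of \<open>e\<close>.
  The cocycle \<open>c\<close> need not have compact support, and the sums are finite because \<open>S\<close> is local.
\<close>

definition contraction :: "nat \<Rightarrow> bool" where
  "contraction i \<longleftrightarrow> (\<exists>k \<rho> S. local_kernel i \<rho> S \<and>
     (\<forall>c. cocycle Rips (\<lambda>m. lbd) (Suc i) c \<longrightarrow> (\<forall>w\<in>Rips (Suc i).
        pull (epow k) (Suc i) c w = pair (\<lambda>u. \<Sum>t\<in>kernel_set i S u. c t * S t u) (lbd w))))"

text \<open>Given \<open>S\<close> one degree higher, take the pull-back under the
  \<open>k\<close>-th power of \<open>e\<close> minus \<open>S\<close> applied to the coboundary. It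
  sends the indicator of \<open>t\<close> to a cocycle \<open>cc t\<close> supported near
  \<open>t\<close>, and after one more \<open>e\<close> the uniform bound yields a primitive
  \<open>T t\<close> within a radius independent of \<open>t\<close>. On a cocycle the term with
  \<open>S\<close> drops out, so \<open>T\<close> is the contraction sought.\<close>

lemma contraction_step:
  assumes hc: "hc_vanishes mtopology i" and con: "contraction (Suc i)"
  shows "contraction i"
proof -
  obtain k \<rho> S where S: "local_kernel (Suc i) \<rho> S"
    and contr: "\<And>c w. cocycle Rips (\<lambda>m. lbd) (Suc (Suc i)) c \<Longrightarrow> w \<in> Rips (Suc (Suc i)) \<Longrightarrow>
      pull (epow k) (Suc (Suc i)) c w = pair (\<lambda>u. \<Sum>t\<in>kernel_set (Suc i) S u. c t * S t u) (lbd w)"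
    using con unfolding contraction_def by blast
  define cc where "cc t u = pull (epow k) (Suc i) (ind t) u -
      (\<Sum>v\<in>kernel_set (Suc i) S u. pair (ind t) (lbd v) * S v u)" for t u
  have cc_cocycle: "cocycle Rips (\<lambda>m. lbd) (Suc i) (cc t)" for t
    unfolding cocycle_def
  proof
    fix w assume w: "w \<in> Rips (Suc (Suc i))"
    have "coboundary Rips (\<lambda>m. lbd) (Suc (Suc i)) (\<lambda>v. pair (ind t) (lbd v))"
      unfolding coboundary_def nat.case by blast
    then have "cocycle Rips (\<lambda>m. lbd) (Suc (Suc i)) (\<lambda>v. pair (ind t) (lbd v))"
      by (rule cocycle_coboundary [OF cpx_Rips])
    from contr [OF this w]
    have "pair (pull (epow k) (Suc i) (ind t)) (lbd w) =
        pair (\<lambda>u. \<Sum>v\<in>kernel_set (Suc i) S u. pair (ind t) (lbd v) * S v u) (lbd w)"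
      using pair_pull [OF chmap_epow w, of k "ind t"] by (simp add: pull_def)
    then show "pair (cc t) (lbd w) = 0"
      unfolding cc_def [abs_def] pair_diff_fun by simp
  qed
  \<comment> \<open>The first entry covers the power of \<open>e\<close>. In the second, 2 is the
    way from \<open>t\<close> to the first vertex of a simplex that has \<open>t\<close> as a
    face.\<close>
  define r where "r = max (3 * real k + 2) (\<rho> + 2)"
  have cc_off: "offR (pt (hd t)) r (Suc i) (cc t)" if t: "t \<in> Rips (Suc i)" for t
    unfolding offR_def
  proof (intro ballI impI)
    fix u assume u: "u \<in> Rips (Suc i)" and far: "\<forall>j\<in>set u. r < d (pt (hd t)) (pt j)"
    have "t \<notin> supp (epow k (Suc i) u)"
    proof
      assume "t \<in> supp (epow k (Suc i) u)"
      then have "d (pt (hd u)) (pt (hd t)) \<le> 3 * real k + 2"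
        using epow_near [OF u _ hd_Rips [OF u] hd_Rips [OF t]] by blast
      then show False using far hd_Rips [OF u] by (fastforce simp: r_def commute)
    qed
    then have 1: "pull (epow k) (Suc i) (ind t) u = 0" by (simp add: pull_def pair_ind in_keys_iff)
    have "pair (ind t) (lbd v) = 0" if v: "v \<in> kernel_set (Suc i) S u" for v
    proof (rule ccontr)
      assume "pair (ind t) (lbd v) \<noteq> 0"
      then have tv: "t \<in> supp (lbd v)" by (simp add: pair_ind in_keys_iff)
      have vR: "v \<in> Rips (Suc (Suc i))" using v by (simp add: kernel_set_def)
      have ht: "hd t \<in> set v" using supp_lbd [OF tv, of "(<)"] hd_Rips [OF t] by blast
      obtain j where j: "j \<in> set u" "d (pt (hd v)) (pt j) \<le> \<rho>" using local_kernelD [OF S u v] .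
      have "d (pt (hd t)) (pt (hd v)) \<le> 2" by (rule RipsD(2) [OF vR ht hd_Rips [OF vR]])
      then have "d (pt (hd t)) (pt j) \<le> \<rho> + 2"
        using triangle [of "pt (hd t)" "pt (hd v)" "pt j"] j RipsD(3) [OF vR ht]
          RipsD(3) [OF vR hd_Rips [OF vR]] RipsD(3) [OF u j(1)] by simp
      then show False using far j(1) by (fastforce simp: r_def)
    qed
    then have "(\<Sum>v\<in>kernel_set (Suc i) S u. pair (ind t) (lbd v) * S v u) = 0" by simp
    then show "cc t u = 0" using 1 by (simp add: cc_def)
  qed
  obtain R where R: "\<And>x c. x \<in> M \<Longrightarrow> cocycle Rips (\<lambda>m. lbd) (Suc i) c \<Longrightarrow> offR x r (Suc i) c \<Longrightarrow>
     (\<exists>b. offR x R i b \<and> (\<forall>js\<in>Rips (Suc i). pull e (Suc i) c js = pair b (lbd js)))"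
    using uniform_bound_Rips [OF hc, of r] by blast
  have "\<exists>b. offR (pt (hd t)) R i b \<and> (\<forall>js\<in>Rips (Suc i). pull e (Suc i) (cc t) js = pair b (lbd js))"
    if t: "t \<in> Rips (Suc i)" for t
    using R [OF RipsD(3) [OF t hd_Rips [OF t]] cc_cocycle cc_off [OF t]] .
  then obtain T where T: "\<And>t. t \<in> Rips (Suc i) \<Longrightarrow> offR (pt (hd t)) R i (T t)"
    "\<And>t js. t \<in> Rips (Suc i) \<Longrightarrow> js \<in> Rips (Suc i) \<Longrightarrow> pull e (Suc i) (cc t) js = pair (T t) (lbd js)"
    by metis
  have TL: "local_kernel i R T" using T(1) by (simp add: local_kernel_def)
  have "pull (epow (Suc k)) (Suc i) c w = pair (\<lambda>u. \<Sum>t\<in>kernel_set i T u. c t * T t u) (lbd w)"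
    if c: "cocycle Rips (\<lambda>m. lbd) (Suc i) c" and w: "w \<in> Rips (Suc i)" for c w
  proof -
    \<comment> \<open>All \<open>t\<close> that enter the formula at \<open>w\<close> on either
      side. Summing over one finite set allows the sums to be interchanged.\<close>
    define A where "A = (\<Union>u\<in>supp (lbd w). kernel_set i T u) \<union>
      (\<Union>u\<in>supp (e (Suc i) w). supp (epow k (Suc i) u) \<union> (\<Union>v\<in>kernel_set (Suc i) S u. supp (lbd v)))"
    have lw: "supp (lbd w) \<subseteq> Rips i" using cpx_supp [OF cpx_Rips w] .
    have ew: "supp (e (Suc i) w) \<subseteq> Rips (Suc i)" using chmap_supp [OF chmap_e w] .
    have finA: "finite A"
      unfolding A_def using lw ew finite_kernel_set [OF TL] finite_kernel_set [OF S]
      by (intro finite_UnI finite_UN_I finite_keys) blast+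
    have kR: "kernel_set (Suc i) S u \<subseteq> Rips (Suc (Suc i))" for u by (auto simp: kernel_set_def)
    have AR: "A \<subseteq> Rips (Suc i)"
    proof -
      have "supp (lbd v) \<subseteq> Rips (Suc i)" if "v \<in> kernel_set (Suc i) S u" for v u
        using cpx_supp [OF cpx_Rips] kR that by blast
      moreover have "supp (epow k (Suc i) u) \<subseteq> Rips (Suc i)" if "u \<in> supp (e (Suc i) w)" for u
        using chmap_supp [OF chmap_epow] ew that by blast
      moreover have "kernel_set i T u \<subseteq> Rips (Suc i)" for u by (auto simp: kernel_set_def)
      ultimately show ?thesis unfolding A_def by blast
    qed
    have "pair (\<lambda>u. \<Sum>t\<in>kernel_set i T u. c t * T t u) (lbd w) = pair (\<lambda>u. \<Sum>t\<in>A. c t * T t u) (lbd w)"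
    proof (rule pair_cong)
      fix u assume u: "u \<in> supp (lbd w)"
      show "(\<Sum>t\<in>kernel_set i T u. c t * T t u) = (\<Sum>t\<in>A. c t * T t u)"
      proof (rule sum.mono_neutral_left [OF finA])
        show "kernel_set i T u \<subseteq> A" unfolding A_def using u by blast
        show "\<forall>t\<in>A - kernel_set i T u. c t * T t u = 0"
          using AR by (auto simp: kernel_set_def)
      qed
    qed
    also have "\<dots> = (\<Sum>t\<in>A. c t * pair (T t) (lbd w))"
      by (simp add: pair_sum_fun pair_cmul_fun)
    also have "\<dots> = (\<Sum>t\<in>A. c t * pair (cc t) (e (Suc i) w))"
      by (intro sum.cong refl arg_cong2 [where f = times]) (use T(2) w AR in \<open>auto simp: pull_def\<close>)
    also have "\<dots> = pair (\<lambda>u. \<Sum>t\<in>A. c t * cc t u) (e (Suc i) w)"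
      by (simp add: pair_sum_fun pair_cmul_fun)
    also have "\<dots> = pair (pull (epow k) (Suc i) c) (e (Suc i) w)"
    proof (rule pair_cong)
      fix u assume u: "u \<in> supp (e (Suc i) w)"
      have "(\<Sum>t\<in>A. c t * cc t u) = (\<Sum>t\<in>A. c t * pair (ind t) (epow k (Suc i) u)) -
          (\<Sum>t\<in>A. \<Sum>v\<in>kernel_set (Suc i) S u. c t * (pair (ind t) (lbd v) * S v u))"
        by (simp only: cc_def pull_def right_diff_distrib sum_subtractf sum_distrib_left)
      also have "(\<Sum>t\<in>A. c t * pair (ind t) (epow k (Suc i) u)) = pair c (epow k (Suc i) u)"
        by (rule sum_pair_ind [OF finA]) (use u in \<open>auto simp: A_def\<close>)
      also have "(\<Sum>t\<in>A. \<Sum>v\<in>kernel_set (Suc i) S u. c t * (pair (ind t) (lbd v) * S v u)) =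
          (\<Sum>v\<in>kernel_set (Suc i) S u. \<Sum>t\<in>A. c t * (pair (ind t) (lbd v) * S v u))"
        by (rule sum.swap)
      also have "\<dots> = (\<Sum>v\<in>kernel_set (Suc i) S u. (\<Sum>t\<in>A. c t * pair (ind t) (lbd v)) * S v u)"
        by (simp only: sum_distrib_right mult.assoc)
      \<comment> \<open>The cocycle condition on \<open>c\<close> enters here and removes the term
        with \<open>S\<close>.\<close>
      also have "\<dots> = 0"
      proof (rule sum.neutral, rule ballI)
        fix v assume v: "v \<in> kernel_set (Suc i) S u"
        have "(\<Sum>t\<in>A. c t * pair (ind t) (lbd v)) = pair c (lbd v)"
          by (rule sum_pair_ind [OF finA]) (use u v in \<open>auto simp: A_def\<close>)
        also have "\<dots> = 0" using c v kR unfolding cocycle_def by blast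
        finally show "(\<Sum>t\<in>A. c t * pair (ind t) (lbd v)) * S v u = 0" by simp
      qed
      finally show "(\<Sum>t\<in>A. c t * cc t u) = pull (epow k) (Suc i) c u" by (simp add: pull_def)
    qed
    also have "\<dots> = pull (epow (Suc k)) (Suc i) c w"
      by (simp only: epow.simps pull_comp [of "epow k"] pull_def [of e])
    finally show ?thesis by simp
  qed
  then show ?thesis unfolding contraction_def using TL by blast
qed

lemma hc_not_all_vanish: "\<exists>i. \<not> hc_vanishes mtopology i"
proof (rule ccontr)
  assume "\<not> ?thesis"
  then have hc: "hc_vanishes mtopology i" for i by blast
  have down: "contraction n \<Longrightarrow> contraction 0" for n
    using contraction_step [OF hc] by (induction n) auto
  \<comment> \<open>There are no simplices of degree \<open>Suc dim\<close>, so the zero kernel will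
    do.\<close>
  have "contraction dim"
    unfolding contraction_def using dim [of "Suc dim"]
    by (intro exI [of _ 0] exI [of _ "\<lambda>t u. 0"]) (auto simp: local_kernel_def)
  then have "contraction 0" by (rule down)
  then obtain k \<rho> S where S: "local_kernel 0 \<rho> S"
    and contr: "\<And>c w. cocycle Rips (\<lambda>m. lbd) (Suc 0) c \<Longrightarrow> w \<in> Rips (Suc 0) \<Longrightarrow>
      pull (epow k) (Suc 0) c w = pair (\<lambda>u. \<Sum>t\<in>kernel_set 0 S u. c t * S t u) (lbd w)"
    unfolding contraction_def by blast
  define one :: "nat list \<Rightarrow> int" where "one = (\<lambda>u. 1)"
  have aug: "pair one (lbd v) = 1" if v: "v \<in> Rips (Suc 0)" for v
  proof -
    obtain j where "v = [j]" using RipsD(1) [OF v] by (cases v) auto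
    then show ?thesis by (simp add: one_def)
  qed
  have "cocycle Rips (\<lambda>m. lbd) (Suc 0) one"
    unfolding cocycle_def
  proof
    fix v assume "v \<in> Rips (Suc (Suc 0))"
    then obtain a b where "v = [a, b]" using RipsD(1) [of v "Suc (Suc 0)"] by (auto simp: length_Suc_conv)
    then show "pair one (lbd v) = 0" by (simp add: pair_diff one_def)
  qed
  moreover obtain j where j: "j \<in> J" using J by blast
  have w: "[j] \<in> Rips (Suc 0)" using j pt [OF j] by (simp add: Rips_def)
  ultimately have "pull (epow k) (Suc 0) one [j] = pair (\<lambda>u. \<Sum>t\<in>kernel_set 0 S u. one t * S t u) (lbd [j])"
    using contr by blast
  also have "\<dots> = 0"
  proof -
    have R0: "[] \<in> Rips 0" by (simp add: Rips_def)
    \<comment> \<open>The empty simplex has no vertex near \<open>hd t\<close>, so a local kernel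
      vanishes there.\<close>
    have "t \<notin> kernel_set 0 S []" for t
    proof
      assume "t \<in> kernel_set 0 S []"
      then obtain j where "j \<in> set ([] :: nat list)" by (rule local_kernelD [OF S R0])
      then show False by simp
    qed
    then have "kernel_set 0 S [] = {}" by blast
    then show ?thesis by simp
  qed
  finally have 0: "pair one (epow k (Suc 0) [j]) = 0" by (simp add: pull_def)
  \<comment> \<open>Since powers of \<open>e\<close> preserve the augmentation, the pull-back of the
    constant 1 still has the value 1 at a vertex.\<close>
  have e0: "epow k 0 [] = frag_of []" for k
    by (induction k) (simp_all add: comp_ch_def \<alpha>(2) \<beta>(2))
  have sup: "supp (epow k (Suc 0) [j]) \<subseteq> Rips (Suc 0)" by (rule chmap_supp [OF chmap_epow w])
  have "pair one (epow k (Suc 0) [j]) = pair (\<lambda>v. pair one (lbd v)) (epow k (Suc 0) [j])"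
    by (rule pair_cong) (use sup aug in \<open>auto simp: one_def\<close>)
  also have "\<dots> = pair one (frag_extend lbd (epow k (Suc 0) [j]))"
    by (simp add: pair_extend)
  also have "frag_extend lbd (epow k (Suc 0) [j]) = frag_extend (epow k 0) (lbd [j])"
    by (rule chmap_b [OF chmap_epow w])
  also have "\<dots> = frag_of []" by (simp add: e0)
  finally show False using 0 by (simp add: one_def)
qed

end

theorem corollary2:
  fixes X :: "'a set" and \<rho> :: "'a \<Rightarrow> 'a \<Rightarrow> real"
  assumes "CAT0_space X \<rho>"
    and "Metric_space.proper_space X \<rho>"
    and "Metric_space.cocompact_space X \<rho>"
  shows "(\<exists>!d. \<not> trivial_group (compact_support_cohomology (Metric_space.mtopology X \<rho>) d) \<and>
               (\<forall>i>d. trivial_group (compact_support_cohomology (Metric_space.mtopology X \<rho>) i))) \<and>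
         (\<forall>d. \<not> trivial_group (compact_support_cohomology (Metric_space.mtopology X \<rho>) d) \<and>
              (\<forall>i>d. trivial_group (compact_support_cohomology (Metric_space.mtopology X \<rho>) i)) \<longrightarrow>
              \<not> trivial_group (reduced_cech_cohomology (Metric_space.boundary X \<rho>) (d - 1)) \<and>
              (\<forall>i>d - 1. trivial_group (cech_cohomology (Metric_space.boundary X \<rho>) i)))"
proof -
  interpret CAT0_space X \<rho> by fact
  interpret cocompact_CAT0_space X \<rho>
    by unfold_locales (use assms in auto)
  obtain J pt dim \<alpha> \<beta> h Rips where "finite_model X \<rho> J pt dim \<alpha> \<beta> h Rips"
    using finite_model_exists by blast
  then interpret F: finite_model X \<rho> J pt dim \<alpha> \<beta> h Rips .
  let ?H = "compact_support_cohomology mtopology"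
  let ?top = "\<lambda>d. \<not> trivial_group (?H d) \<and> (\<forall>i>d. trivial_group (?H i))"
  have hc: "trivial_group (?H (int n)) \<longleftrightarrow> dies boundary n" for n
    by (simp add: compact_support_cohomology_trivial_iff hc_vanishes_iff_dies)
  have nonneg: "0 \<le> d" if "\<not> trivial_group (?H d)" for d
    using compact_support_cohomology_negative that by force
  define A where "A = {n. \<not> trivial_group (?H (int n))}"
  have "A \<subseteq> {..<dim}"
    using F.hc_vanishes_high by (auto simp: A_def compact_support_cohomology_trivial_iff not_le [symmetric])
  then have finA: "finite A" by (rule finite_subset) simp
  have neA: "A \<noteq> {}"
    using F.hc_not_all_vanish by (auto simp: A_def compact_support_cohomology_trivial_iff)
  have "?top (int (Max A))"
  proof (intro conjI allI impI)
    show "\<not> trivial_group (?H (int (Max A)))" using Max_in [OF finA neA] by (simp add: A_def)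
    fix i assume i: "int (Max A) < i"
    then have "nat i \<notin> A" using Max_ge [OF finA, of "nat i"] by linarith
    then show "trivial_group (?H i)" using i by (simp add: A_def)
  qed
  moreover have "d = d'" if "?top d" "?top d'" for d d'
    using that by (metis linorder_neqE)
  ultimately have "\<exists>!d. ?top d" by (intro ex1I [of _ "int (Max A)"])
  moreover have "\<not> trivial_group (reduced_cech_cohomology boundary (d - 1)) \<and>
      (\<forall>i>d - 1. trivial_group (cech_cohomology boundary i))" if d: "?top d" for d
  proof (intro conjI allI impI)
    define n where "n = nat d"
    have n: "d = int n" using nonneg d by (simp add: n_def)
    have nd: "\<not> dies boundary n" using d hc unfolding n by blast
    then show "\<not> trivial_group (reduced_cech_cohomology boundary (d - 1))"
      unfolding n reduced_cech_trivial_iff .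
    fix i assume i: "d - 1 < i"
    show "trivial_group (cech_cohomology boundary i)"
    proof (cases "1 \<le> i")
      case True
      \<comment> \<open>Dimension \<open>i\<close> of the boundary belongs to dimension
        \<open>i + 1\<close> with compact supports, which exceeds \<open>d\<close>.\<close>
      define m where "m = nat (i + 1)"
      have m: "i = int m - 1" using True by (simp add: m_def)
      have "trivial_group (?H (int m))" using d i m by simp
      then have "trivial_group (reduced_cech_cohomology boundary i)"
        unfolding m reduced_cech_trivial_iff hc .
      then show ?thesis by (simp add: cech_eq_reduced [OF True])
    next
      case False
      \<comment> \<open>Below dimension 1 ordinary and reduced groups may differ, but only
        \<open>i = 0 = d\<close> is left, and then the boundary turns out to be empty.\<close>
      then have "n = 0" using i n by linarith
      then have "topspace boundary = {}" using nd dies_0_if_nonempty by metis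
      then show ?thesis by (rule cech_trivial_empty)
    qed
  qed
  ultimately show ?thesis by blast
qed

end
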